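(* If $\mathsf k$ is an algebraically closed field of characteristic zero and $q\in\mathsf k^\times$ is not a root of unity, then $U_q(\mathfrak{gl}_n)$ is LD-stable and has Gelfand--Kirillov dimension $n^2$.
   Context: $U_q(\mathfrak{gl}_n)$ is the standard Drinfeld--Jimbo quantized enveloping algebra over $\mathsf k$: generators $e_i,f_i$ ($1\le i\le n-1$), $K_j^{\pm1}$ ($1\le j\le n$), with the $K_j$ commuting and invertible, $K_je_iK_j^{-1}=q^{\delta_{ij}-\delta_{i+1,j}}e_i$, $K_jf_iK_j^{-1}=q^{-\delta_{ij}+\delta_{i+1,j}}f_i$, $[e_i,f_j]=\delta_{ij}\frac{K_iK_{i+1}^{-1}-K_i^{-1}K_{i+1}}{q-q^{-1}}$, and the quantum Serre relations: $[e_i,e_j]=[f_i,f_j]=0$ for $|i-j|>1$; $e_i^2e_j-(q+q^{-1})e_ie_je_i+e_je_i^2=0$ and likewise for the $f$'s, for $|i-j|=1$. Let $A$ be an affine (finitely generated) $\mathsf k$-algebra. A frame is a finite-dimensional subspace $V\ni1$ generating $A$. The Gelfand--Kirillov dimension is $\operatorname{GK}A=\limsup_{n}\log_n\dim V^n$ (independent of the frame $V$). The Gelfand--Kirillov transcendence degree is $\operatorname{Tdeg}A=\sup_V\inf_b\limsup_{n}\log_n\dim(\mathsf k+bV)^n$, with $V$ over frames and $b$ over regular elements of $A$. The lower transcendence degree $\operatorname{LD}A$: if for every frame $V$ there is a nonzero finite-dimensional subspace $W\subseteq A$ with $\dim VW=\dim W$, then $\operatorname{LD}A=0$. Otherwise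 $\operatorname{LD}A$ is the supremum, over frames $V$, of all $d\in(0,\infty]$ for which there is a constant $c>0$ such that $\dim VW\ge\dim W+c(\dim W)^{(d-1)/d}$ for every nonzero finite-dimensional subspace $W\subseteq A$ (for $d=\infty$ the exponent is $1$). One always has $\operatorname{LD}A\le\operatorname{Tdeg}A\le\operatorname{GK}A$; $A$ is LD-stable if $\operatorname{LD}A=\operatorname{Tdeg}A=\operatorname{GK}A$. *)

theory Defs
  imports
    "HOL-Algebra.Algebra"
    "HOL-Algebra.Algebraic_Closure_Type"
    "HOL-Library.Poly_Mapping"
    "HOL-Library.Liminf_Limsup"
    "HOL-Library.Extended_Real"
begin

section \<open>Growth invariants of a noncommutative algebra\<close>

text \<open>
  As in \<^theory>\<open>HOL-Algebra.Embedded_Algebras\<close>, an algebra over a field is a ring \<open>R\<close> together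
  with the subfield \<open>K\<close> of its scalars; for an associative unital algebra \<open>K\<close> is central.
  Vector space dimensions are \<^const>\<open>ring.dim\<close> and \<^const>\<open>ring.finite_dimension\<close>. Every \<open>E\<close> with
  \<open>finite_dimension K E\<close> is a \<open>K\<close>-subspace of \<open>carrier R\<close>.
\<close>

context ring
begin

text \<open>
  The product \<open>VW\<close> of subspaces is the linear span of all \<open>v \<otimes> w\<close>. The set of these products is
  already closed under scalars because \<open>V\<close> is, so the additive subgroup it generates is the span.
\<close>

definition subspace_mult :: "'a set \<Rightarrow> 'a set \<Rightarrow> 'a set"
  where "subspace_mult V W = generate (add_monoid R) (V <#> W)"

primrec subspace_power :: "'a set \<Rightarrow> 'a set \<Rightarrow> nat \<Rightarrow> 'a set"
  where
    "subspace_power K V 0 = K"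
  | "subspace_power K V (Suc m) = subspace_mult V (subspace_power K V m)"

text \<open>
  A subspace containing \<open>\<one>\<close> contains \<open>K\<close>, so the subring generated by it is the \<open>K\<close>-subalgebra
  generated by it.
\<close>

definition frame :: "'a set \<Rightarrow> 'a set \<Rightarrow> bool"
  where "frame K V \<longleftrightarrow>
    finite_dimension K V \<and> \<one> \<in> V \<and> generate_ring R V = carrier R"

definition regular :: "'a \<Rightarrow> bool"
  where "regular b \<longleftrightarrow> b \<in> carrier R \<and>
    (\<forall>x \<in> carrier R. b \<otimes> x = \<zero> \<longrightarrow> x = \<zero>) \<and>
    (\<forall>x \<in> carrier R. x \<otimes> b = \<zero> \<longrightarrow> x = \<zero>)"

definition growth_exponent :: "'a set \<Rightarrow> 'a set \<Rightarrow> ereal"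
  where "growth_exponent K V =
    limsup (\<lambda>m. ereal (log (real m) (real (dim K (subspace_power K V m)))))"

text \<open>
  All frames of an affine algebra have the same growth exponent, so this supremum is that common
  value. It is \<open>-\<infinity>\<close> if there is no frame, that is, if the algebra is not affine.
\<close>

definition GK :: "'a set \<Rightarrow> ereal"
  where "GK K = (SUP V \<in> {V. frame K V}. growth_exponent K V)"

definition Tdeg :: "'a set \<Rightarrow> ereal"
  where "Tdeg K =
    (SUP V \<in> {V. frame K V}. INF b \<in> {b. regular b}. growth_exponent K (K <+> (b <# V)))"

definition isoperimetric_exponent :: "ereal \<Rightarrow> real"
  where "isoperimetric_exponent d =
    (if d = \<infinity> then 1 else (real_of_ereal d - 1) / real_of_ereal d)"

definition isoperimetric :: "'a set \<Rightarrow> 'a set \<Rightarrow> ereal \<Rightarrow> bool"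
  where "isoperimetric K V d \<longleftrightarrow> (\<exists>c > 0. \<forall>W. finite_dimension K W \<and> W \<noteq> {\<zero>} \<longrightarrow>
    real (dim K (subspace_mult V W)) \<ge>
      real (dim K W) + c * real (dim K W) powr isoperimetric_exponent d)"

definition LD :: "'a set \<Rightarrow> ereal"
  where "LD K =
    (if \<forall>V. frame K V \<longrightarrow>
          (\<exists>W. finite_dimension K W \<and> W \<noteq> {\<zero>} \<and> dim K (subspace_mult V W) = dim K W)
     then 0
     else Sup {d. 0 < d \<and> (\<exists>V. frame K V \<and> isoperimetric K V d)})"

definition LD_stable :: "'a set \<Rightarrow> bool"
  where "LD_stable K \<longleftrightarrow> LD K = Tdeg K \<and> Tdeg K = GK K"

end


section \<open>Free associative algebras and presentations\<close>

datatype 'g free_monoid = Free_Monoid (letters: "'g list")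

instantiation free_monoid :: (type) monoid_add
begin

definition zero_free_monoid :: "'a free_monoid"
  where "zero_free_monoid = Free_Monoid []"

definition plus_free_monoid :: "'a free_monoid \<Rightarrow> 'a free_monoid \<Rightarrow> 'a free_monoid"
  where "plus_free_monoid u v = Free_Monoid (letters u @ letters v)"

instance
  by standard (simp_all add: zero_free_monoid_def plus_free_monoid_def)

end

text \<open>
  The monoid ring \<open>'g free_monoid \<Rightarrow>\<^sub>0 'k\<close> is the free associative algebra on the type \<open>'g\<close>;
  \<open>free_algebra G\<close> is its subalgebra of polynomials in the noncommuting variables from \<open>G\<close>.
\<close>

definition fa_const :: "'k::field \<Rightarrow> ('g free_monoid \<Rightarrow>\<^sub>0 'k)"
  where "fa_const c = Poly_Mapping.single 0 c"

definition fa_var :: "'g \<Rightarrow> ('g free_monoid \<Rightarrow>\<^sub>0 'k::field)"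
  where "fa_var x = Poly_Mapping.single (Free_Monoid [x]) 1"

definition free_algebra_set :: "'g set \<Rightarrow> ('g free_monoid \<Rightarrow>\<^sub>0 'k::field) set"
  where "free_algebra_set G = {p. \<forall>w \<in> Poly_Mapping.keys p. set (letters w) \<subseteq> G}"

definition free_algebra :: "'g set \<Rightarrow> ('g free_monoid \<Rightarrow>\<^sub>0 'k::field) ring"
  where "free_algebra G = ring_of_type_algebra \<lparr>carrier := free_algebra_set G\<rparr>"

text \<open>The relator \<open>r\<close> stands for the relation \<open>r = 0\<close>.\<close>

definition relator_ideal ::
    "'g set \<Rightarrow> ('g free_monoid \<Rightarrow>\<^sub>0 'k::field) set \<Rightarrow> ('g free_monoid \<Rightarrow>\<^sub>0 'k) set"
  where "relator_ideal G S = genideal (free_algebra G) S"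

definition presented_algebra ::
    "'g set \<Rightarrow> ('g free_monoid \<Rightarrow>\<^sub>0 'k::field) set \<Rightarrow> ('g free_monoid \<Rightarrow>\<^sub>0 'k) set ring"
  where "presented_algebra G S = free_algebra G Quot relator_ideal G S"

definition presented_scalars ::
    "'g set \<Rightarrow> ('g free_monoid \<Rightarrow>\<^sub>0 'k::field) set \<Rightarrow> ('g free_monoid \<Rightarrow>\<^sub>0 'k) set set"
  where "presented_scalars G S =
    range (\<lambda>c. relator_ideal G S +>\<^bsub>free_algebra G\<^esub> fa_const c)"


section \<open>The quantized enveloping algebra of \<open>gl\<^sub>n\<close>\<close>

datatype uq_gen = Gen_e nat | Gen_f nat | Gen_K nat | Gen_Kinv nat

definition uq_gens :: "nat \<Rightarrow> uq_gen set"
  where "uq_gens n =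
    Gen_e ` {1..<n} \<union> Gen_f ` {1..<n} \<union> Gen_K ` {1..n} \<union> Gen_Kinv ` {1..n}"

type_synonym 'k uq_free = "uq_gen free_monoid \<Rightarrow>\<^sub>0 'k"

abbreviation uq_e :: "nat \<Rightarrow> 'k::field uq_free" where "uq_e i \<equiv> fa_var (Gen_e i)"
abbreviation uq_f :: "nat \<Rightarrow> 'k::field uq_free" where "uq_f i \<equiv> fa_var (Gen_f i)"
abbreviation uq_K :: "nat \<Rightarrow> 'k::field uq_free" where "uq_K j \<equiv> fa_var (Gen_K j)"
abbreviation uq_Kinv :: "nat \<Rightarrow> 'k::field uq_free" where "uq_Kinv j \<equiv> fa_var (Gen_Kinv j)"

definition uq_weight :: "nat \<Rightarrow> nat \<Rightarrow> int"
  where "uq_weight j i = of_bool (i = j) - of_bool (i + 1 = j)"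

definition uq_torus_relators :: "nat \<Rightarrow> 'k::field uq_free set"
  where "uq_torus_relators n =
    {uq_K i * uq_K j - uq_K j * uq_K i | i j. i \<in> {1..n} \<and> j \<in> {1..n}} \<union>
    {uq_K j * uq_Kinv j - 1 | j. j \<in> {1..n}} \<union>
    {uq_Kinv j * uq_K j - 1 | j. j \<in> {1..n}}"

definition uq_weight_relators :: "nat \<Rightarrow> 'k::field \<Rightarrow> 'k uq_free set"
  where "uq_weight_relators n q =
    {uq_K j * uq_e i * uq_Kinv j - fa_const (q powi uq_weight j i) * uq_e i | i j.
       i \<in> {1..<n} \<and> j \<in> {1..n}} \<union>
    {uq_K j * uq_f i * uq_Kinv j - fa_const (q powi (- uq_weight j i)) * uq_f i | i j.
       i \<in> {1..<n} \<and> j \<in> {1..n}}"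

definition uq_commutator_relators :: "nat \<Rightarrow> 'k::field \<Rightarrow> 'k uq_free set"
  where "uq_commutator_relators n q =
    {uq_e i * uq_f j - uq_f j * uq_e i -
       (if i = j
        then fa_const (inverse (q - inverse q)) *
               (uq_K i * uq_Kinv (i + 1) - uq_Kinv i * uq_K (i + 1))
        else 0) | i j. i \<in> {1..<n} \<and> j \<in> {1..<n}}"

definition serre_relators ::
    "nat \<Rightarrow> 'k::field \<Rightarrow> (nat \<Rightarrow> 'k uq_free) \<Rightarrow> 'k uq_free set"
  where "serre_relators n q x =
    {x i * x j - x j * x i | i j.
       i \<in> {1..<n} \<and> j \<in> {1..<n} \<and> \<bar>int i - int j\<bar> > 1} \<union>
    {(x i)\<^sup>2 * x j - fa_const (q + inverse q) * x i * x j * x i + x j * (x i)\<^sup>2 | i j.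
       i \<in> {1..<n} \<and> j \<in> {1..<n} \<and> \<bar>int i - int j\<bar> = 1}"

definition uq_relators :: "nat \<Rightarrow> 'k::field \<Rightarrow> 'k uq_free set"
  where "uq_relators n q =
    uq_torus_relators n \<union> uq_weight_relators n q \<union> uq_commutator_relators n q \<union>
    serre_relators n q uq_e \<union> serre_relators n q uq_f"

definition Uq_gl :: "nat \<Rightarrow> 'k::field \<Rightarrow> 'k uq_free set ring"
  where "Uq_gl n q = presented_algebra (uq_gens n) (uq_relators n q)"

definition Uq_gl_scalars :: "nat \<Rightarrow> 'k::field \<Rightarrow> 'k uq_free set set"
  where "Uq_gl_scalars n q = presented_scalars (uq_gens n) (uq_relators n q)"


section \<open>Well-formedness\<close>

lemma fa_closed:
  "fa_const c \<in> free_algebra_set G"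
  "0 \<in> free_algebra_set G" "1 \<in> free_algebra_set G"
  "x \<in> G \<Longrightarrow> fa_var x \<in> free_algebra_set G"
  by (auto simp: free_algebra_set_def fa_const_def fa_var_def zero_free_monoid_def
        simp flip: single_one)

lemma fa_plus_closed:
  assumes "p \<in> free_algebra_set G" "r \<in> free_algebra_set G"
  shows "p + r \<in> free_algebra_set G"
  using assms Poly_Mapping.keys_add[of p r] by (fastforce simp: free_algebra_set_def)

lemma fa_minus_closed:
  assumes "p \<in> free_algebra_set G" "r \<in> free_algebra_set G"
  shows "p - r \<in> free_algebra_set G"
  using assms Poly_Mapping.keys_diff[of p r] by (fastforce simp: free_algebra_set_def)

lemma fa_times_closed:
  assumes "p \<in> free_algebra_set G" "r \<in> free_algebra_set G"
  shows "p * r \<in> free_algebra_set G"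
  using assms Poly_Mapping.keys_mult[of p r]
  by (fastforce simp: free_algebra_set_def plus_free_monoid_def)

lemma ring_free_algebra: "ring (free_algebra G :: ('g free_monoid \<Rightarrow>\<^sub>0 'k::field) ring)"
proof -
  have "\<exists>y \<in> free_algebra_set G. y + x = 0 \<and> x + y = 0"
    if "x \<in> free_algebra_set G" for x :: "'g free_monoid \<Rightarrow>\<^sub>0 'k"
    using fa_minus_closed[OF fa_closed(2) that] by (intro bexI[of _ "- x"]) auto
  then show ?thesis
    unfolding free_algebra_def ring_of_type_algebra_def
    by unfold_locales
       (auto simp: Units_def algebra_simps fa_closed fa_plus_closed fa_times_closed)
qed

lemma uq_relators_closed:
  "uq_relators n (q :: 'k::field) \<subseteq> carrier (free_algebra (uq_gens n))"
proof -
  have "uq_relators n q \<subseteq> free_algebra_set (uq_gens n)"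
    unfolding uq_relators_def uq_torus_relators_def uq_weight_relators_def
      uq_commutator_relators_def serre_relators_def power2_eq_square
    by (auto simp: uq_gens_def intro!: fa_closed fa_plus_closed fa_minus_closed fa_times_closed)
  then show ?thesis
    by (simp add: free_algebra_def)
qed

lemma ring_Uq_gl: "ring (Uq_gl n (q :: 'k::field))"
  unfolding Uq_gl_def presented_algebra_def relator_ideal_def
  by (intro ideal.quotient_is_ring ring.genideal_ideal ring_free_algebra uq_relators_closed)

end

theory Submission
  imports Defs "HOL-Real_Asymp.Real_Asymp" "HOL-Library.Product_Lexorder"
begin

text \<open>
  The algebra is mapped to a quantum torus by tensoring representations in which the Serre generators
  act through quantum oscillators; the leading exponents of the images of the root vectors and of the
  \<open>K\<^sub>j\<close> are linearly independent. Hence ordered monomials in the root vectors, which span, have pairwise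
  different leading exponents. So the homomorphism is injective, and the leading exponent is a
  valuation \<open>\<nu>\<close> with one-dimensional leaves and values in a lattice of rank \<open>n\<^sup>2\<close>, for which
  \<open>dim W = card (\<nu> W)\<close> and \<open>\<nu> (VW)\<close> contains \<open>\<nu> V + \<nu> W\<close>. If \<open>V\<close> contains the root vectors and the
  \<open>K\<^sub>j\<close>, then \<open>\<nu> V\<close> contains a basis of the lattice, and the discrete isoperimetric inequality gives
  \<open>LD \<ge> n\<^sup>2\<close>. Words of length at most \<open>m\<close> have values in a box of side \<open>2m + 1\<close>, so \<open>GK \<le> n\<^sup>2\<close>. Finally
  an isoperimetric inequality bounds the growth of \<open>k + bV\<close> from below for all regular \<open>b\<close>, hence
  \<open>LD \<le> Tdeg\<close>.
\<close>

section \<open>A discrete isoperimetric inequality\<close>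

text \<open>Working with ordered monomials alone would require the PBW theorem and the commutation
  rules between arbitrary root vectors. The quantum torus supplies independence and multiplicativity
  of leading terms, so only spanning has to be shown by rewriting. There word lengths must never
  grow, because the box that bounds GK comes from them. The target is designed so that leading terms
  can be read off. Copy \<open>c\<close> of the oscillators involves only the indices
  \<open>k\<close> with \<open>c \<le> k\<close>, so a root vector starting at \<open>i\<close> has
  its leading term in copy \<open>i\<close>, where it is a product of monomials and at most one
  binomial. Switching off one coefficient at \<open>k = c\<close> makes consecutive copies match in
  the coproduct, but the resulting representation satisfies a contracted relation between
  \<open>e\<close> and \<open>f\<close>, with one of the two torus terms missing. A second, mirrored
  family restores that term, and a degree dominating the order lets one family decide the
  \<open>e\<close> root vectors and the other the \<open>f\<close> root vectors.\<close>

lemma card_fibres_proj: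
  fixes S :: "('i \<Rightarrow> 'b) set"
  assumes "finite S" "i \<noteq> j"
  shows "card ((\<lambda>s. s(i := z)) ` S) =
    (\<Sum>t \<in> (\<lambda>s. s j) ` S. card ((\<lambda>s. s(i := z)) ` {s \<in> S. s j = t}))"
proof -
  define f where "f = (\<lambda>s :: 'i \<Rightarrow> 'b. s(i := z))"
  have f: "f s j = s j" for s using assms(2) by (simp add: f_def)
  have "f ` S = (\<Union>t \<in> (\<lambda>s. s j) ` S. f ` {s \<in> S. s j = t})"
    by auto
  moreover have "card (\<Union>t \<in> (\<lambda>s. s j) ` S. f ` {s \<in> S. s j = t}) =
      (\<Sum>t \<in> (\<lambda>s. s j) ` S. card (f ` {s \<in> S. s j = t}))"
  proof (rule card_UN_disjoint)
    show "finite ((\<lambda>s. s j) ` S)" using assms(1) by simp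
    show "\<forall>t \<in> (\<lambda>s. s j) ` S. finite (f ` {s \<in> S. s j = t})" using assms(1) by simp
    have *: "x j = t" if "x \<in> f ` {s \<in> S. s j = t}" for x t
      using that by (auto simp: f)
    show "\<forall>t \<in> (\<lambda>s. s j) ` S. \<forall>u \<in> (\<lambda>s. s j) ` S. t \<noteq> u \<longrightarrow>
        f ` {s \<in> S. s j = t} \<inter> f ` {s \<in> S. s j = u} = {}"
    proof (intro ballI impI Int_emptyI)
      fix t u x assume "t \<noteq> u" "x \<in> f ` {s \<in> S. s j = t}" "x \<in> f ` {s \<in> S. s j = u}"
      with *[of x t] *[of x u] show False by simp
    qed
  qed
  ultimately show ?thesis unfolding f_def by presburger
qed

text \<open>
  A weak form of the Loomis--Whitney inequality. The slices of \<open>S\<close> in the direction \<open>j\<close> embed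
  into the projection along \<open>j\<close>, which bounds the factor that is missing from the exponent.
\<close>

lemma card_powr_le_sum_proj:
  fixes S :: "('i \<Rightarrow> 'b) set"
  assumes "finite I" "I \<noteq> {}" "finite S" "\<And>s i. s \<in> S \<Longrightarrow> i \<notin> I \<Longrightarrow> s i = z"
  shows "real (card S) powr ((real (card I) - 1) / real (card I))
    \<le> (\<Sum>i\<in>I. real (card ((\<lambda>s. s(i := z)) ` S)))"
  using assms
proof (induction I arbitrary: S rule: finite_ne_induct)
  case (singleton i)
  show ?case
  proof (cases "S = {}")
    case False
    then have "card ((\<lambda>s. s(i := z)) ` S) \<ge> 1"
      using singleton by (simp add: Suc_leI card_gt_0_iff)
    then have "1 \<le> real (card ((\<lambda>s. s(i := z)) ` S))" by linarith
    moreover have "real (card S) powr ((real (card {i}) - 1) / real (card {i})) \<le> 1"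
      by (simp add: powr_def)
    moreover have "(\<Sum>i\<in>{i}. real (card ((\<lambda>s. s(i := z)) ` S))) = real (card ((\<lambda>s. s(i := z)) ` S))"
      by (simp only: sum.insert finite.emptyI empty_iff not_False_eq_True sum.empty add_0_right)
    ultimately show ?thesis by linarith
  qed simp
next
  case (insert j I)
  define N where "N = real (card I)"
  have N: "N \<ge> 1"
    using insert.hyps unfolding N_def by (simp add: Suc_leI card_gt_0_iff)
  have cardI: "real (card (insert j I)) = N + 1"
    using insert.hyps by (simp add: N_def)
  define pr where "pr i T = (\<lambda>s. s(i := z)) ` T" for i and T :: "('i \<Rightarrow> 'b) set"
  define P where "P = real (card (pr j S))"
  define Q where "Q = P + (\<Sum>i\<in>I. real (card (pr i S)))"
  define T where "T = (\<lambda>s. s j) ` S"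
  define fib where "fib t = {s \<in> S. s j = t}" for t
  have finS: "finite S" by fact
  have fin: "finite (fib t)" "finite T" for t
    using finS by (auto simp: fib_def T_def)
  have inj: "inj_on (\<lambda>s. s(j := z)) (fib t)" for t
  proof (rule inj_onI)
    fix x y assume "x \<in> fib t" "y \<in> fib t" "x(j := z) = y(j := z)"
    then have "(x(j := z))(j := t) = (y(j := z))(j := t)" "x j = t" "y j = t"
      by (simp_all add: fib_def)
    then show "x = y" by (metis fun_upd_triv fun_upd_upd)
  qed
  have slice: "real (card (fib t)) \<le> P powr (1 / N) * (\<Sum>i\<in>I. real (card (pr i (fib t))))" for t
  proof (cases "fib t = {}")
    case False
    have c: "card (pr j (fib t)) = card (fib t)"
      unfolding pr_def by (rule card_image[OF inj])
    have "card (pr j (fib t)) \<le> card (pr j S)"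
      using finS by (intro card_mono) (auto simp: pr_def fib_def)
    then have le: "real (card (fib t)) \<le> P" by (simp add: c P_def)
    have pos: "real (card (fib t)) > 0" using False fin by (simp add: card_gt_0_iff)
    \<comment> \<open>The induction hypothesis wants all coordinates outside \<open>I\<close> equal
      to \<open>z\<close>, so it is applied to the slice after coordinate \<open>j\<close> has been
      reset.\<close>
    have "real (card (pr j (fib t))) powr ((real (card I) - 1) / real (card I))
        \<le> (\<Sum>i\<in>I. real (card (pr i (pr j (fib t)))))"
      unfolding pr_def
    proof (rule insert.IH)
      show "finite ((\<lambda>s. s(j := z)) ` fib t)" using fin by simp
      show "s i = z" if "s \<in> (\<lambda>s. s(j := z)) ` fib t" "i \<notin> I" for s i
        using that insert.prems(2) by (auto simp: fib_def)
    qed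
    also have "\<dots> \<le> (\<Sum>i\<in>I. real (card (pr i (fib t))))"
    proof (rule sum_mono)
      fix i assume "i \<in> I"
      with insert.hyps have ij: "i \<noteq> j" by auto
      have "pr i (pr j (fib t)) = (\<lambda>s. s(j := z)) ` pr i (fib t)"
        using ij by (auto simp: pr_def image_image fun_upd_twist)
      then show "real (card (pr i (pr j (fib t)))) \<le> real (card (pr i (fib t)))"
        using fin by (simp add: card_image_le pr_def)
    qed
    finally have IH: "real (card (fib t)) powr ((N - 1) / N) \<le> (\<Sum>i\<in>I. real (card (pr i (fib t))))"
      by (simp add: c N_def)
    have "1 = 1 / N + (N - 1) / N" using N by (simp add: field_simps)
    then have "real (card (fib t)) = real (card (fib t)) powr (1 / N + (N - 1) / N)"
      using pos by (metis powr_one less_imp_le)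
    also have "\<dots> = real (card (fib t)) powr (1 / N) * real (card (fib t)) powr ((N - 1) / N)"
      by (rule powr_add)
    also have "\<dots> \<le> P powr (1 / N) * (\<Sum>i\<in>I. real (card (pr i (fib t))))"
      using le pos N IH by (intro mult_mono powr_mono2) auto
    finally show ?thesis .
  qed (auto intro!: mult_nonneg_nonneg sum_nonneg)
  have "S = (\<Union>t\<in>T. fib t)" by (auto simp: T_def fib_def)
  moreover have "card (\<Union>t\<in>T. fib t) = (\<Sum>t\<in>T. card (fib t))"
    using fin by (intro card_UN_disjoint) (auto simp: fib_def)
  ultimately have "card S = (\<Sum>t\<in>T. card (fib t))" by presburger
  then have "real (card S) \<le> (\<Sum>t\<in>T. P powr (1 / N) * (\<Sum>i\<in>I. real (card (pr i (fib t)))))"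
    using slice by (auto intro: sum_mono)
  also have "\<dots> = P powr (1 / N) * (\<Sum>i\<in>I. \<Sum>t\<in>T. real (card (pr i (fib t))))"
    by (subst sum.swap) (simp add: sum_distrib_left)
  also have "(\<Sum>i\<in>I. \<Sum>t\<in>T. real (card (pr i (fib t)))) = (\<Sum>i\<in>I. real (card (pr i S)))"
  proof (rule sum.cong)
    fix i assume "i \<in> I"
    then have "i \<noteq> j" using insert.hyps by auto
    from card_fibres_proj[OF finS this, of z]
    show "(\<Sum>t\<in>T. real (card (pr i (fib t)))) = real (card (pr i S))"
      by (simp add: pr_def fib_def T_def)
  qed simp
  also have "P powr (1 / N) * (\<Sum>i\<in>I. real (card (pr i S))) \<le> Q powr (1 / N) * Q"
    using N by (intro mult_mono powr_mono2) (auto simp: Q_def P_def intro!: sum_nonneg add_nonneg_nonneg)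
  finally have *: "real (card S) \<le> Q powr (1 / N) * Q" .
  have Q0: "Q \<ge> 0" by (auto simp: Q_def P_def intro!: sum_nonneg add_nonneg_nonneg)
  \<comment> \<open>\<open>N / (N + 1)\<close> is the exponent belonging to
    \<open>insert j I\<close>. It undoes the power \<open>(N + 1) / N\<close> of \<open>Q\<close> on
    the right.\<close>
  have "real (card S) powr (N / (N + 1)) \<le> (Q powr (1 / N) * Q) powr (N / (N + 1))"
    using * N by (intro powr_mono2) auto
  also have "\<dots> = Q"
  proof (cases "Q = 0")
    case False
    with Q0 have Qp: "Q > 0" by simp
    then have "Q powr (1 / N) * Q = Q powr (1 / N + 1)" by (simp add: powr_add)
    also have "\<dots> powr (N / (N + 1)) = Q powr ((1 / N + 1) * (N / (N + 1)))" by (rule powr_powr)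
    also have "1 / N + 1 = (N + 1) / N"
      using N by (simp add: add_divide_distrib)
    also have "(N + 1) / N * (N / (N + 1)) = 1"
      using N by simp
    finally show ?thesis using Qp by simp
  qed simp
  finally have "real (card S) powr (N / (N + 1)) \<le> Q" .
  then show ?case
    using sum.insert[OF insert.hyps(1,3), of "\<lambda>i. real (card (pr i S))"]
    unfolding cardI by (simp only: Q_def P_def pr_def add_diff_cancel_right')
qed

text \<open>Each line in direction \<open>i\<close> that meets \<open>S\<close> has a topmost point
  of \<open>S\<close>; the shift of that point lies outside \<open>S\<close> and projects to the
  same line. So the new points map onto the set of lines.\<close>

lemma card_proj_le_shift_diff:
  fixes S :: "('i \<Rightarrow> int) set"
  assumes "finite S"
  shows "card ((\<lambda>s. s(i := 0)) ` S) \<le> card ((\<lambda>s. s(i := s i + 1)) ` S - S)"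
proof (rule surj_card_le[of _ _ "\<lambda>s. s(i := 0)"])
  show "finite ((\<lambda>s. s(i := s i + 1)) ` S - S)" using assms by simp
  show "(\<lambda>s. s(i := 0)) ` S \<subseteq> (\<lambda>s. s(i := 0)) ` ((\<lambda>s. s(i := s i + 1)) ` S - S)"
  proof
    fix r assume "r \<in> (\<lambda>s. s(i := 0)) ` S"
    then obtain s0 where s0: "s0 \<in> S" "r = s0(i := 0)" by auto
    define L where "L = {s \<in> S. s(i := 0) = r}"
    have "finite L" "s0 \<in> L" using assms s0 by (auto simp: L_def)
    then obtain s where s: "s \<in> L" "\<And>u. u \<in> L \<Longrightarrow> u i \<le> s i"
      using obtains_MAX[of L "\<lambda>s. s i"] Max_ge[of "(\<lambda>s. s i) ` L"]
      by (metis (no_types, lifting) empty_iff finite_imageI imageI)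
    have "s(i := s i + 1) \<notin> S"
    proof
      assume "s(i := s i + 1) \<in> S"
      then have "s(i := s i + 1) \<in> L" using s(1) by (simp add: L_def)
      from s(2)[OF this] show False by simp
    qed
    then show "r \<in> (\<lambda>s. s(i := 0)) ` ((\<lambda>s. s(i := s i + 1)) ` S - S)"
      using s(1) by (intro image_eqI[of _ _ "s(i := s i + 1)"]) (auto simp: L_def)
  qed
qed

text \<open>Every direction forces at least as many new points as there are lines of that direction.
  Averaging over the directions produces the constant \<open>1 / card I\<close>.\<close>

lemma isoperimetric_shifts:
  fixes S T :: "('i \<Rightarrow> int) set"
  assumes I: "finite I" "I \<noteq> {}" and S: "finite S" "\<And>s i. s \<in> S \<Longrightarrow> i \<notin> I \<Longrightarrow> s i = 0"
    and T: "finite T" "S \<subseteq> T" "\<And>s i. s \<in> S \<Longrightarrow> i \<in> I \<Longrightarrow> s(i := s i + 1) \<in> T"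
  shows "real (card T) \<ge> real (card S) +
    1 / real (card I) * real (card S) powr ((real (card I) - 1) / real (card I))"
proof -
  have *: "real (card ((\<lambda>s. s(i := 0)) ` S)) \<le> real (card T) - real (card S)" if "i \<in> I" for i
  proof -
    have "card ((\<lambda>s. s(i := 0)) ` S) \<le> card ((\<lambda>s. s(i := s i + 1)) ` S - S)"
      by (rule card_proj_le_shift_diff[OF S(1)])
    also have "\<dots> \<le> card (T - S)"
      using T that by (intro card_mono) auto
    also have "\<dots> = card T - card S"
      using T S by (simp add: card_Diff_subset)
    finally show ?thesis using card_mono[OF T(1,2)] by linarith
  qed
  have "real (card S) powr ((real (card I) - 1) / real (card I))
      \<le> (\<Sum>i\<in>I. real (card ((\<lambda>s. s(i := 0)) ` S)))"
    using card_powr_le_sum_proj[OF I S(1)] S(2) by blast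
  also have "\<dots> \<le> (\<Sum>i\<in>I. real (card T) - real (card S))"
    by (rule sum_mono) (rule *)
  also have "\<dots> = real (card I) * (real (card T) - real (card S))" by simp
  finally have "real (card S) powr ((real (card I) - 1) / real (card I)) / real (card I)
      \<le> real (card T) - real (card S)"
    using I by (subst pos_divide_le_eq) (auto simp: card_gt_0_iff mult.commute)
  then show ?thesis by simp
qed

section \<open>Growth of sequences\<close>

text \<open>Discrete form of the differential equation a' = c a^((d-1)/d), under which the
  \<open>d\<close>-th root of \<open>a\<close> grows linearly. The root gains at least a fixed
  amount \<open>e\<close> in each step, so \<open>a\<close> is at least of the order of the
  \<open>d\<close>-th power of \<open>m\<close>.\<close>

lemma log_growth_lower:
  fixes a :: "nat \<Rightarrow> nat" and c d :: real
  assumes d: "d > 0" and c: "c > 0" and a0: "a 0 \<ge> 1"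
    and step: "\<And>m. real (a (Suc m)) \<ge> real (a m) + c * real (a m) powr ((d - 1) / d)"
  shows "limsup (\<lambda>m. ereal (log (real m) (real (a m)))) \<ge> ereal d"
proof -
  \<comment> \<open>The \<open>min\<close> keeps \<open>d * (e / s)\<close> at most 1/2, where exp x
    is at most 1 + 2x; the 2 in the denominator absorbs the factor 2 of this estimate.\<close>
  define e where "e = min 1 c / (2 * d)"
  have e: "e > 0" using c d by (simp add: e_def)
  have a1: "real (a m) \<ge> 1" for m
  proof (induction m)
    case (Suc m)
    have "c * real (a m) powr ((d - 1) / d) \<ge> 0" using c by simp
    then show ?case using step[of m] Suc by linarith
  qed (use a0 in simp)
  have grow: "real (a m) powr (1 / d) \<ge> 1 + e * real m" for m
  proof (induction m)
    case 0
    show ?case using powr_mono2[of "1 / d" 1 "real (a 0)"] a0 d by simp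
  next
    case (Suc m)
    define s where "s = real (a m) powr (1 / d)"
    have s1: "s \<ge> 1"
      using powr_mono2[of "1 / d" 1 "real (a m)"] a1[of m] d by (simp add: s_def)
    have am: "real (a m) = s powr d"
      using a1[of m] d by (simp add: s_def powr_powr)
    have "(d - 1) / d = 1 - 1 / d" using d by (simp add: field_simps)
    then have am': "real (a m) powr ((d - 1) / d) = s powr d / s"
      using a1[of m] d by (simp add: s_def powr_powr powr_diff)
    have "(1 + e / s) powr d \<le> exp (d * (e / s))"
    proof -
      have "(1 + e / s) powr d \<le> exp (e / s) powr d"
        using e s1 d by (intro powr_mono2 exp_ge_add_one_self) auto
      then show ?thesis by (simp add: powr_def mult.commute)
    qed
    also have "exp (d * (e / s)) \<le> 1 + 2 * (d * (e / s))"
    proof -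
      have "d * (e / s) = min 1 c / 2 / s" using d s1 by (simp add: e_def)
      also have "\<dots> \<le> min 1 c / 2 / 1" using s1 c by (intro divide_left_mono) auto
      finally have "d * (e / s) \<le> 1 / 2" by simp
      moreover have "d * (e / s) \<ge> 0" using d e s1 by simp
      ultimately show ?thesis using exp_bound_lemma[of "d * (e / s)"]
        by (metis abs_of_nonneg exp_ge_zero real_norm_def)
    qed
    also have "\<dots> = 1 + min 1 c / s" using d s1 by (simp add: e_def)
    also have "\<dots> \<le> 1 + c / s" using s1 by (simp add: divide_right_mono)
    finally have key: "(1 + e / s) powr d \<le> 1 + c / s" .
    have "(s + e) powr d = s powr d * (1 + e / s) powr d"
    proof -
      have "s + e = s * (1 + e / s)" using s1 by (simp add: field_simps)
      then show ?thesis using s1 e by (simp add: powr_mult)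
    qed
    also have "\<dots> \<le> s powr d * (1 + c / s)" using key by (simp add: mult_left_mono)
    also have "\<dots> = real (a m) + c * real (a m) powr ((d - 1) / d)"
      unfolding am' unfolding am by (simp add: field_simps)
    also have "\<dots> \<le> real (a (Suc m))" by (rule step)
    finally have "((s + e) powr d) powr (1 / d) \<le> real (a (Suc m)) powr (1 / d)"
      using d by (intro powr_mono2) auto
    then have "s + e \<le> real (a (Suc m)) powr (1 / d)"
      using s1 e d by (simp add: powr_powr)
    then show ?case using Suc by (simp add: s_def algebra_simps)
  qed
  have lower: "d * log (real m) (e * real m) \<le> log (real m) (real (a m))" if "m \<ge> 2" for m
  proof -
    have "(e * real m) powr d \<le> (real (a m) powr (1 / d)) powr d"
      using grow[of m] e d by (intro powr_mono2) auto
    also have "\<dots> = real (a m)" using a1[of m] d by (simp add: powr_powr)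
    finally have le: "(e * real m) powr d \<le> real (a m)" .
    have "log (real m) ((e * real m) powr d) \<le> log (real m) (real (a m))"
      using le that e by (intro log_mono) auto
    then show ?thesis using that e by (simp add: log_powr)
  qed
  have "((\<lambda>m. d * log (real m) (e * real m)) \<longlongrightarrow> d) sequentially"
    using e by real_asymp
  then have "limsup (\<lambda>m. ereal (d * log (real m) (e * real m))) = ereal d"
    by (intro lim_imp_Limsup) auto
  moreover have "limsup (\<lambda>m. ereal (d * log (real m) (e * real m)))
      \<le> limsup (\<lambda>m. ereal (log (real m) (real (a m))))"
    by (intro Limsup_mono) (auto intro!: eventually_sequentiallyI[of 2] lower)
  ultimately show ?thesis by simp
qed

text \<open>Constant factors disappear in logarithms to base \<open>m\<close>, so a box of side
  linear in \<open>m\<close> has its dimension \<open>N\<close> as growth exponent.\<close>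

lemma log_growth_upper:
  fixes a :: "nat \<Rightarrow> nat"
  assumes a: "\<And>m. a m \<ge> 1" and up: "\<And>m. a m \<le> (2 * r * m + 1) ^ N"
  shows "limsup (\<lambda>m. ereal (log (real m) (real (a m)))) \<le> ereal (real N)"
proof -
  have upper: "log (real m) (real (a m)) \<le> real N * log (real m) (real (2 * r + 1) * real m)"
    if "m \<ge> 2" for m
  proof -
    have "2 * r * m + 1 \<le> (2 * r + 1) * m" using that by simp
    then have "a m \<le> ((2 * r + 1) * m) ^ N"
      using up[of m] power_mono[of "2 * r * m + 1" "(2 * r + 1) * m" N] by linarith
    then have "real (a m) \<le> (real (2 * r + 1) * real m) ^ N"
      by (metis of_nat_le_iff of_nat_mult of_nat_power)
    then have "log (real m) (real (a m)) \<le> log (real m) ((real (2 * r + 1) * real m) ^ N)"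
      using that a[of m] by (intro log_mono) auto
    then show ?thesis using that by (simp add: log_nat_power)
  qed
  have "((\<lambda>m. real N * log (real m) (real (2 * r + 1) * real m)) \<longlongrightarrow> real N) sequentially"
  proof -
    have "real (2 * r + 1) > 0" by simp
    then show ?thesis by real_asymp
  qed
  then have "limsup (\<lambda>m. ereal (real N * log (real m) (real (2 * r + 1) * real m))) = ereal (real N)"
    by (intro lim_imp_Limsup) auto
  moreover have "limsup (\<lambda>m. ereal (log (real m) (real (a m))))
      \<le> limsup (\<lambda>m. ereal (real N * log (real m) (real (2 * r + 1) * real m)))"
    by (intro Limsup_mono, rule eventually_sequentiallyI[of 2]) (simp only: ereal_less_eq(3) upper)
  ultimately show ?thesis by simp
qed

section \<open>Algebras with a valuation whose leaves are one-dimensional\<close>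

text \<open>Values are leading exponents, so a sum has at most the larger value, opposite to the
  usual sign convention. On zero \<open>\<nu>\<close> is arbitrary, whence the repeated exclusion of
  zero. \<open>val_leaf\<close> expresses one-dimensional leaves: a scalar multiple of
  \<open>y\<close> cancels the top term of any \<open>x\<close> of the same value.\<close>

locale valuation_algebra = ring R for R (structure) +
  fixes K :: "'a set" and \<nu> :: "'a \<Rightarrow> 'g::linordered_ab_group_add"
  assumes subfield: "subfield K R"
    and central: "\<lbrakk>k \<in> K; x \<in> carrier R\<rbrakk> \<Longrightarrow> k \<otimes> x = x \<otimes> k"
    and no_zero_div: "\<lbrakk>x \<in> carrier R - {\<zero>}; y \<in> carrier R - {\<zero>}\<rbrakk> \<Longrightarrow> x \<otimes> y \<noteq> \<zero>"
    and val_mult: "\<lbrakk>x \<in> carrier R - {\<zero>}; y \<in> carrier R - {\<zero>}\<rbrakk> \<Longrightarrow> \<nu> (x \<otimes> y) = \<nu> x + \<nu> y"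
    and val_add: "\<lbrakk>x \<in> carrier R - {\<zero>}; y \<in> carrier R - {\<zero>}; x \<oplus> y \<noteq> \<zero>\<rbrakk>
      \<Longrightarrow> \<nu> (x \<oplus> y) \<le> max (\<nu> x) (\<nu> y)"
    and val_scalar: "\<lbrakk>k \<in> K - {\<zero>}; x \<in> carrier R - {\<zero>}\<rbrakk> \<Longrightarrow> \<nu> (k \<otimes> x) = \<nu> x"
    and val_leaf: "\<lbrakk>x \<in> carrier R - {\<zero>}; y \<in> carrier R - {\<zero>}; \<nu> x = \<nu> y\<rbrakk>
      \<Longrightarrow> \<exists>k\<in>K. x \<ominus> k \<otimes> y = \<zero> \<or> \<nu> (x \<ominus> k \<otimes> y) < \<nu> y"
begin

definition vals :: "'a set \<Rightarrow> 'g set"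
  where "vals E = \<nu> ` (E - {\<zero>})"

lemma K_carrier: "K \<subseteq> carrier R"
  using subfieldE(3)[OF subfield] .

lemma scalar_carrier [intro]: "k \<in> K \<Longrightarrow> k \<in> carrier R"
  using K_carrier by blast

lemma K_zero_one: "\<zero> \<in> K" "\<one> \<in> K" "\<one> \<noteq> \<zero>"
  using subringE(2,3)[OF subfieldE(1)[OF subfield]] subfieldE(6)[OF subfield] by auto

lemma K_minus: "k \<in> K \<Longrightarrow> \<ominus> k \<in> K"
  using subringE(5)[OF subfieldE(1)[OF subfield]] by auto

lemma subalgebraD:
  assumes "subalgebra K E R"
  shows "E \<subseteq> carrier R" "\<zero> \<in> E" "\<And>x y. x \<in> E \<Longrightarrow> y \<in> E \<Longrightarrow> x \<oplus> y \<in> E"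
    "\<And>x. x \<in> E \<Longrightarrow> \<ominus> x \<in> E" "\<And>x y. x \<in> E \<Longrightarrow> y \<in> E \<Longrightarrow> x \<ominus> y \<in> E"
    "\<And>k x. k \<in> K \<Longrightarrow> x \<in> E \<Longrightarrow> k \<otimes> x \<in> E"
proof -
  have sg: "subgroup E (add_monoid R)" using assms by (rule subalgebra.axioms)
  show "E \<subseteq> carrier R" using subalgebra_in_carrier[OF assms] .
  show "\<zero> \<in> E" using subgroup.one_closed[OF sg] by simp
  show add: "x \<oplus> y \<in> E" if "x \<in> E" "y \<in> E" for x y
    using subgroup.m_closed[OF sg that] by simp
  show inv: "\<ominus> x \<in> E" if "x \<in> E" for x
    using subgroup.m_inv_closed[OF sg that] by (simp add: a_inv_def)
  show "x \<ominus> y \<in> E" if "x \<in> E" "y \<in> E" for x y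
    using add[OF that(1) inv[OF that(2)]] by (simp add: a_minus_def)
  show "k \<otimes> x \<in> E" if "k \<in> K" "x \<in> E" for k x
    using subalgebra.smult_closed[OF assms that] .
qed

lemma subalgebraI:
  assumes "E \<subseteq> carrier R" "\<zero> \<in> E" "\<And>x y. x \<in> E \<Longrightarrow> y \<in> E \<Longrightarrow> x \<oplus> y \<in> E"
    "\<And>k x. k \<in> K \<Longrightarrow> x \<in> E \<Longrightarrow> k \<otimes> x \<in> E"
  shows "subalgebra K E R"
proof -
  have "\<ominus> x \<in> E" if "x \<in> E" for x
  proof -
    have "(\<ominus> \<one>) \<otimes> x \<in> E" using assms(4)[OF K_minus[OF K_zero_one(2)] that] .
    then show ?thesis using assms(1) that by (simp add: l_minus subset_eq)
  qed
  then have "subgroup E (add_monoid R)"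
    using assms(1-3) by (intro subgroup.intro) (auto simp flip: a_inv_def)
  then show ?thesis using assms(4) by (simp add: subalgebra_def subalgebra_axioms_def)
qed

lemma vals_mono: "E \<subseteq> F \<Longrightarrow> vals E \<subseteq> vals F"
  by (auto simp: vals_def)

lemma val_uminus:
  assumes "x \<in> carrier R - {\<zero>}"
  shows "\<nu> (\<ominus> x) = \<nu> x"
proof -
  have "\<ominus> \<one> \<in> K - {\<zero>}" using K_minus[OF K_zero_one(2)] K_zero_one(3)
    by (metis Diff_iff add.inv_eq_1_iff one_closed singletonD)
  from val_scalar[OF this assms] show ?thesis using assms by (simp add: l_minus)
qed

text \<open>If the sum had a value below that of \<open>y\<close>, then \<open>y\<close>, which is
  the sum minus \<open>x\<close>, would have too small a value itself.\<close>

lemma val_diff_less: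
  assumes "x \<in> carrier R - {\<zero>}" "y \<in> carrier R - {\<zero>}" "\<nu> x < \<nu> y"
  shows "x \<oplus> y \<noteq> \<zero>" "\<nu> (x \<oplus> y) = \<nu> y"
proof -
  have xy: "x \<in> carrier R" "y \<in> carrier R" "x \<noteq> \<zero>" "y \<noteq> \<zero>" using assms by auto
  show ne: "x \<oplus> y \<noteq> \<zero>"
  proof
    assume "x \<oplus> y = \<zero>"
    then have "y = \<ominus> x" using xy by (metis minus_equality a_comm)
    then show False using val_uminus[OF assms(1)] assms(3) by simp
  qed
  have "y = (x \<oplus> y) \<oplus> (\<ominus> x)" using xy by algebra
  moreover have "\<nu> ((x \<oplus> y) \<oplus> (\<ominus> x)) \<le> max (\<nu> (x \<oplus> y)) (\<nu> (\<ominus> x))"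
    using xy ne calculation by (intro val_add) auto
  ultimately have "\<nu> y \<le> max (\<nu> (x \<oplus> y)) (\<nu> x)" using val_uminus[OF assms(1)] by simp
  with assms(3) have "\<nu> y \<le> \<nu> (x \<oplus> y)" by (auto simp: max_def split: if_splits)
  moreover have "\<nu> (x \<oplus> y) \<le> max (\<nu> x) (\<nu> y)" using assms(1,2) ne by (rule val_add)
  ultimately show "\<nu> (x \<oplus> y) = \<nu> y" using assms(3) by (simp add: max.absorb2)
qed

text \<open>Gaussian elimination: remove the element of largest value.\<close>

lemma dimension_card_vals:
  assumes "subalgebra K E R" "finite (vals E)"
  shows "dimension (card (vals E)) K E"
  using assms
proof (induction "card (vals E)" arbitrary: E)
  case 0
  then have "E - {\<zero>} = {}" by (simp add: vals_def)
  then have "E = {\<zero>}" using subalgebraD(2)[OF 0(2)] by auto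
  then show ?case using 0 by (metis zero_dim)
next
  case (Suc n)
  note E = subalgebraD[OF Suc(3)]
  have ne: "vals E \<noteq> {}" using Suc(2) by auto
  define m where "m = Max (vals E)"
  have "m \<in> vals E" using Suc(4) ne by (simp add: m_def)
  then obtain u where u: "u \<in> E" "u \<noteq> \<zero>" "\<nu> u = m" by (auto simp: vals_def)
  have uc: "u \<in> carrier R" using u E by auto
  define F where "F = {x \<in> E. x \<noteq> \<zero> \<longrightarrow> \<nu> x < m}"
  have le_m: "\<nu> x \<le> m" if "x \<in> E" "x \<noteq> \<zero>" for x
    using that Suc(4) by (auto simp: m_def vals_def)
  have F: "subalgebra K F R"
  proof (rule subalgebraI)
    show "F \<subseteq> carrier R" "\<zero> \<in> F" using E by (auto simp: F_def)
    fix x y assume xy: "x \<in> F" "y \<in> F"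
    then have c: "x \<in> E" "y \<in> E" "x \<in> carrier R" "y \<in> carrier R" using E(1) by (auto simp: F_def)
    show "x \<oplus> y \<in> F"
    proof (cases "x = \<zero> \<or> y = \<zero> \<or> x \<oplus> y = \<zero>")
      case True
      then show ?thesis using xy c E by (auto simp: F_def)
    next
      case False
      then have "\<nu> (x \<oplus> y) \<le> max (\<nu> x) (\<nu> y)" using c by (intro val_add) auto
      also have "\<dots> < m" using False xy by (auto simp: F_def)
      finally show ?thesis using c E by (auto simp: F_def)
    qed
  next
    fix k x assume kx: "k \<in> K" "x \<in> F"
    then have c: "x \<in> E" "x \<in> carrier R" "k \<in> carrier R" using E(1) by (auto simp: F_def)
    show "k \<otimes> x \<in> F"
    proof (cases "k = \<zero> \<or> x = \<zero>")
      case True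
      then show ?thesis using c E(2) by (auto simp: F_def)
    next
      case False
      then have "\<nu> (k \<otimes> x) = \<nu> x" using kx c by (intro val_scalar) auto
      then show ?thesis using kx c E(6) False by (auto simp: F_def)
    qed
  qed
  have vF: "vals F = vals E - {m}"
    using le_m by (fastforce simp: vals_def F_def)
  have cF: "card (vals F) = n"
    using Suc(2,4) \<open>m \<in> vals E\<close> by (simp add: vF)
  have dF: "dimension n K F"
    using Suc(1)[of F] cF F Suc(4) by (simp add: vF)
  have uF: "u \<notin> F" using u by (simp add: F_def)
  have "E = line_extension K u F"
  proof (rule Set.set_eqI, unfold line_extension_mem_iff, rule iffI)
    fix x assume x: "x \<in> E"
    then have xc: "x \<in> carrier R" using E by auto
    show "\<exists>k\<in>K. \<exists>v\<in>F. x = k \<otimes> u \<oplus> v"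
    proof (cases "x \<in> F")
      case True
      have "x = \<zero> \<otimes> u \<oplus> x" using uc xc by simp
      with True K_zero_one show ?thesis by blast
    next
      case False
      then have xm: "x \<noteq> \<zero>" "\<nu> x = m" using x le_m by (auto simp: F_def less_le)
      have "\<exists>k\<in>K. x \<ominus> k \<otimes> u = \<zero> \<or> \<nu> (x \<ominus> k \<otimes> u) < \<nu> u"
        using xm xc u uc by (intro val_leaf) auto
      then obtain k where k: "k \<in> K" "x \<ominus> k \<otimes> u = \<zero> \<or> \<nu> (x \<ominus> k \<otimes> u) < m"
        using u by auto
      have kc: "k \<in> carrier R" using k by auto
      have "x \<ominus> k \<otimes> u \<in> F"
        using k E(5)[OF x E(6)[OF k(1) u(1)]] by (auto simp: F_def)
      moreover have "x = k \<otimes> u \<oplus> (x \<ominus> k \<otimes> u)" using xc uc kc by algebra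
      ultimately show ?thesis using k(1) by blast
    qed
  next
    fix x assume "\<exists>k\<in>K. \<exists>v\<in>F. x = k \<otimes> u \<oplus> v"
    then show "x \<in> E" using E(3,6) u(1) by (auto simp: F_def)
  qed
  then show ?case using Suc_dim[OF uc uF dF] Suc(2) by metis
qed

text \<open>Adding one vector \<open>v\<close> creates at most one new value. If \<open>x\<close>
  and \<open>y\<close> had two different new values, the combination of them that eliminates
  \<open>v\<close> would lie in \<open>E\<close> and still have the larger of the two values. With
  \<open>dimension_card_vals\<close> this makes finite dimension equivalent to having finitely many
  values.\<close>

lemma finite_vals_dimension:
  assumes "dimension n K E"
  shows "finite (vals E)"
  using assms
proof (induction n K\<equiv>K E rule: dimension.induct)
  case zero_dim
  then show ?case by (simp add: vals_def)
next
  case (Suc_dim v E n)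
  have sE: "subalgebra K E R"
    using finite_dimension_imp_subalgebra[OF subfield finite_dimensionI[OF Suc_dim(3)]] .
  note E = subalgebraD[OF sE]
  have "\<nu> x = \<nu> y" if x: "x \<in> line_extension K v E" "x \<noteq> \<zero>" "\<nu> x \<notin> vals E"
    and y: "y \<in> line_extension K v E" "y \<noteq> \<zero>" "\<nu> y \<notin> vals E" for x y
  proof -
    have key: False if "\<nu> x < \<nu> y" "x \<in> line_extension K v E" "x \<noteq> \<zero>" "\<nu> x \<notin> vals E"
      "y \<in> line_extension K v E" "y \<noteq> \<zero>" "\<nu> y \<notin> vals E" for x y
    proof -
      from that(2) obtain k e where k: "k \<in> K" "e \<in> E" "x = k \<otimes> v \<oplus> e"
        by (auto simp: line_extension_mem_iff)
      from that(5) obtain l f where l: "l \<in> K" "f \<in> E" "y = l \<otimes> v \<oplus> f"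
        by (auto simp: line_extension_mem_iff)
      have c: "k \<in> carrier R" "l \<in> carrier R" "e \<in> carrier R" "f \<in> carrier R" "v \<in> carrier R"
        using k l E(1) Suc_dim by auto
      then have xyc: "x \<in> carrier R" "y \<in> carrier R" using k l by auto
      have k0: "k \<noteq> \<zero>"
      proof
        assume "k = \<zero>"
        then have "x \<in> E" using k c by simp
        then show False using that by (auto simp: vals_def)
      qed
      have l0: "l \<noteq> \<zero>"
      proof
        assume "l = \<zero>"
        then have "y \<in> E" using l c by simp
        then show False using that by (auto simp: vals_def)
      qed
      have lx: "l \<otimes> x \<in> carrier R - {\<zero>}" "\<nu> (l \<otimes> x) = \<nu> x"
        using no_zero_div[of l x] val_scalar[of l x] l0 l(1) that xyc c by auto
      have mk: "\<ominus> k \<in> K - {\<zero>}"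
        using K_minus[OF k(1)] k0 c by (metis Diff_iff add.inv_eq_1_iff singletonD)
      have ky: "\<ominus> k \<otimes> y \<in> carrier R - {\<zero>}" "\<nu> (\<ominus> k \<otimes> y) = \<nu> y"
        using no_zero_div[of "\<ominus> k" y] val_scalar[of "\<ominus> k" y] mk that xyc c by auto
      have lk: "l \<otimes> k = k \<otimes> l" using central[OF l(1) c(1)] .
      have "l \<otimes> x \<oplus> \<ominus> k \<otimes> y = (l \<otimes> k) \<otimes> v \<oplus> l \<otimes> e \<oplus> \<ominus> (k \<otimes> l) \<otimes> v \<oplus> \<ominus> k \<otimes> f"
        unfolding k(3) l(3) using c by (simp add: r_distr m_assoc l_minus a_assoc minus_add)
      also have "\<dots> = l \<otimes> e \<oplus> \<ominus> k \<otimes> f"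
      proof -
        have "\<ominus> (k \<otimes> l) \<otimes> v = \<ominus> ((k \<otimes> l) \<otimes> v)" using c by (simp add: l_minus)
        then show ?thesis using c lk
          by (metis (no_types, lifting) a_assoc a_comm a_inv_closed add.inv_closed add.m_closed
              l_neg m_closed r_neg1 r_neg2)
      qed
      also have "\<dots> \<in> E" using E k l mk by auto
      finally have in_E: "l \<otimes> x \<oplus> \<ominus> k \<otimes> y \<in> E" .
      from val_diff_less[OF lx(1) ky(1)] lx ky that(1)
      have "l \<otimes> x \<oplus> \<ominus> k \<otimes> y \<noteq> \<zero>" "\<nu> (l \<otimes> x \<oplus> \<ominus> k \<otimes> y) = \<nu> y" by auto
      with in_E have "\<nu> y \<in> vals E" unfolding vals_def by (metis Diff_iff image_eqI singletonD)
      with that show False by simp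
    qed
    show ?thesis using key[of x y] key[of y x] x y by (meson linorder_cases)
  qed
  then have uniq: "a = b" if "a \<in> vals (line_extension K v E) - vals E"
    "b \<in> vals (line_extension K v E) - vals E" for a b
    using that unfolding vals_def[of "line_extension K v E"] by auto
  have "\<exists>a. vals (line_extension K v E) \<subseteq> insert a (vals E)"
  proof (cases "vals (line_extension K v E) - vals E = {}")
    case False
    then obtain a where "a \<in> vals (line_extension K v E) - vals E" by blast
    with uniq have "vals (line_extension K v E) \<subseteq> insert a (vals E)" by blast
    then show ?thesis ..
  qed blast
  then show ?case using Suc_dim.hyps(4) by (meson finite.insertI finite_subset)
qed

lemma finite_dimension_iff_vals:
  "finite_dimension K E \<longleftrightarrow> subalgebra K E R \<and> finite (vals E)"
  using finite_dimension_imp_subalgebra[OF subfield] finite_vals_dimension dimension_card_vals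
    finite_dimensionI by (metis finite_dimensionE')

lemma dim_eq_card_vals:
  assumes "finite_dimension K E"
  shows "dim K E = card (vals E)"
  using assms dimension_card_vals dimI[OF subfield] unfolding finite_dimension_iff_vals over_def
  by blast

text \<open>Multiplication by a nonzero \<open>b\<close> merely translates the values; this is why
  it preserves dimensions.\<close>

lemma vals_l_coset:
  assumes "b \<in> carrier R - {\<zero>}" "E \<subseteq> carrier R"
  shows "vals (b <# E) = (+) (\<nu> b) ` vals E"
proof -
  have "(b <# E) - {\<zero>} = (\<otimes>) b ` (E - {\<zero>})"
    using assms no_zero_div[of b] by (fastforce simp: l_coset_def)
  then show ?thesis
    unfolding vals_def using assms val_mult[of b] by (auto simp: image_image intro!: image_cong)
qed

section \<open>Products of subspaces\<close>

lemma subspace_mult_closed: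
  assumes "subalgebra K V R" "subalgebra K W R"
  shows "subalgebra K (subspace_mult V W) R"
proof -
  note V = subalgebraD[OF assms(1)] and W = subalgebraD[OF assms(2)]
  have sub: "V <#> W \<subseteq> carrier R"
    using V(1) W(1) by (auto simp: set_mult_def)
  have sg: "subgroup (subspace_mult V W) (add_monoid R)"
    unfolding subspace_mult_def by (rule add.generate_is_subgroup) (use sub in simp)
  show ?thesis
  proof (intro subalgebra.intro sg subalgebra_axioms.intro)
    fix k x assume k: "k \<in> K" and x: "x \<in> subspace_mult V W"
    have kc: "k \<in> carrier R" using k by auto
    have gen: "generate (add_monoid R) (V <#> W) \<subseteq> carrier R"
      using add.generate_incl[of "V <#> W"] sub by simp
    show "k \<otimes> x \<in> subspace_mult V W"
      using x unfolding subspace_mult_def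
    proof (induction rule: generate.induct)
      case one
      show ?case using kc generate.one[of "add_monoid R" "V <#> W"] by simp
    next
      case (incl h)
      then obtain v w where h: "v \<in> V" "w \<in> W" "h = v \<otimes> w" by (auto simp: set_mult_def)
      then have "k \<otimes> h = (k \<otimes> v) \<otimes> w" using kc V(1) W(1) by (auto simp: m_assoc subset_iff)
      then have "k \<otimes> h \<in> V <#> W" using V(6)[OF k h(1)] h(2) by (auto simp: set_mult_def)
      then show ?case by (rule generate.incl)
    next
      case (inv h)
      then obtain v w where h: "v \<in> V" "w \<in> W" "h = v \<otimes> w" by (auto simp: set_mult_def)
      then have "k \<otimes> (\<ominus> h) = (k \<otimes> (\<ominus> v)) \<otimes> w" using kc V(1) W(1)
        by (auto simp: m_assoc l_minus r_minus subset_iff)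
      then have "k \<otimes> (\<ominus> h) \<in> V <#> W" using V(6)[OF k V(4)[OF h(1)]] h(2)
        by (auto simp: set_mult_def)
      then show ?case using generate.incl[of _ "V <#> W" "add_monoid R"] by (simp add: a_inv_def)
    next
      case (eng h1 h2)
      have "h1 \<in> carrier R" "h2 \<in> carrier R" using eng gen by auto
      then show ?case using generate.eng[OF eng(3,4)] kc by (simp add: r_distr)
    qed
  qed
qed

lemma subspace_mult_incl: "v \<in> V \<Longrightarrow> w \<in> W \<Longrightarrow> v \<otimes> w \<in> subspace_mult V W"
  unfolding subspace_mult_def by (rule generate.incl) (auto simp: set_mult_def)

lemma subspace_mult_least:
  assumes "subalgebra K E R" "\<And>v w. v \<in> V \<Longrightarrow> w \<in> W \<Longrightarrow> v \<otimes> w \<in> E"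
  shows "subspace_mult V W \<subseteq> E"
proof
  fix x assume "x \<in> subspace_mult V W"
  then show "x \<in> E"
    unfolding subspace_mult_def
  proof (induction rule: generate.induct)
    case one
    then show ?case using subalgebraD(2)[OF assms(1)] by simp
  next
    case (incl h)
    then show ?case using assms(2) by (auto simp: set_mult_def)
  next
    case (inv h)
    then have "h \<in> E" using assms(2) by (auto simp: set_mult_def)
    then show ?case using subalgebraD(4)[OF assms(1)] by (simp add: a_inv_def)
  next
    case (eng h1 h2)
    then show ?case using subalgebraD(3)[OF assms(1)] by simp
  qed
qed

end

section \<open>Filtrations whose values lie in boxes of a lattice\<close>

lemma card_box_le:
  assumes "finite I"
  shows "finite {s :: 'i \<Rightarrow> int. (\<forall>i\<in>I. \<bar>s i\<bar> \<le> int m) \<and> (\<forall>i. i \<notin> I \<longrightarrow> s i = 0)}"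
    "card {s :: 'i \<Rightarrow> int. (\<forall>i\<in>I. \<bar>s i\<bar> \<le> int m) \<and> (\<forall>i. i \<notin> I \<longrightarrow> s i = 0)} \<le> (2 * m + 1) ^ card I"
proof -
  define B where "B = {s :: 'i \<Rightarrow> int. (\<forall>i\<in>I. \<bar>s i\<bar> \<le> int m) \<and> (\<forall>i. i \<notin> I \<longrightarrow> s i = 0)}"
  have inj: "inj_on (\<lambda>s. restrict s I) B"
  proof (rule inj_onI)
    fix s t assume st: "s \<in> B" "t \<in> B" "restrict s I = restrict t I"
    show "s = t"
    proof
      fix i show "s i = t i" using st by (cases "i \<in> I") (auto simp: B_def dest: fun_cong[of _ _ i])
    qed
  qed
  have sub: "(\<lambda>s. restrict s I) ` B \<subseteq> PiE I (\<lambda>_. {- int m..int m})"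
    by (auto simp: B_def abs_le_iff)
  have fin: "finite (PiE I (\<lambda>_. {- int m..int m}))" using assms by (intro finite_PiE) auto
  show "finite {s :: 'i \<Rightarrow> int. (\<forall>i\<in>I. \<bar>s i\<bar> \<le> int m) \<and> (\<forall>i. i \<notin> I \<longrightarrow> s i = 0)}"
    using inj_on_finite[OF inj sub fin] by (simp add: B_def)
  have "card B \<le> card (PiE I (\<lambda>_. {- int m..int m}))"
    by (rule card_inj_on_le[OF inj sub fin])
  also have "\<dots> = (2 * m + 1) ^ card I"
    using assms by (simp add: card_PiE nat_add_distrib nat_mult_distrib)
  finally show "card {s :: 'i \<Rightarrow> int. (\<forall>i\<in>I. \<bar>s i\<bar> \<le> int m) \<and> (\<forall>i. i \<notin> I \<longrightarrow> s i = 0)} \<le> (2 * m + 1) ^ card I"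
    by (simp add: B_def)
qed

text \<open>In the application \<open>F\<close> is the filtration by word length, and
  \<open>coord\<close> expresses a value in the basis formed by the values of the
  \<open>y i\<close>. Not every lattice point has to be a value, so injectivity is asked on values
  only, and instead of additivity only the effect of adding the value of one \<open>y i\<close>. The
  bound on coordinates by the filtration degree gives the upper estimate of growth, the shifts give
  the lower one.\<close>

locale filtered_valuation_algebra =
  valuation_algebra R K \<nu>
  for R (structure) and K and \<nu> :: "'a \<Rightarrow> 'g::linordered_ab_group_add" +
  fixes F :: "nat \<Rightarrow> 'a set" and I :: "'i set" and coord :: "'g \<Rightarrow> 'i \<Rightarrow> int"
    and y :: "'i \<Rightarrow> 'a" and gens :: "'a set"
  assumes filt_subspace: "subalgebra K (F m) R"
    and filt_mult: "\<lbrakk>a \<in> F l; b \<in> F m\<rbrakk> \<Longrightarrow> a \<otimes> b \<in> F (l + m)"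
    and filt_mono: "l \<le> m \<Longrightarrow> F l \<subseteq> F m"
    and filt_exhaust: "a \<in> carrier R \<Longrightarrow> \<exists>m. a \<in> F m"
    and filt_scalars: "K \<subseteq> F 0"
    and finite_I: "finite I" "I \<noteq> {}"
    and y_nonzero: "i \<in> I \<Longrightarrow> y i \<in> carrier R - {\<zero>}"
    and coord_inj: "inj_on coord (vals (carrier R))"
    and coord_bound: "\<lbrakk>g \<in> vals (F m); i \<in> I\<rbrakk> \<Longrightarrow> \<bar>coord g i\<bar> \<le> int m"
    and coord_outside: "\<lbrakk>g \<in> vals (carrier R); i \<notin> I\<rbrakk> \<Longrightarrow> coord g i = 0"
    and coord_shift: "\<lbrakk>g \<in> vals (carrier R); i \<in> I\<rbrakk>
      \<Longrightarrow> coord (\<nu> (y i) + g) = (coord g)(i := coord g i + 1)"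
    and finite_gens: "finite gens" "gens \<subseteq> carrier R"
    and generating: "generate_ring R (K \<union> gens) = carrier R"
begin

lemma card_coord:
  assumes "E \<subseteq> carrier R"
  shows "card (coord ` vals E) = card (vals E)"
  using assms by (intro card_image inj_on_subset[OF coord_inj] vals_mono)

lemma finite_vals_filt: "finite (vals (F m))"
  and card_vals_filt: "card (vals (F m)) \<le> (2 * m + 1) ^ card I"
proof -
  let ?B = "{s :: 'i \<Rightarrow> int. (\<forall>i\<in>I. \<bar>s i\<bar> \<le> int m) \<and> (\<forall>i. i \<notin> I \<longrightarrow> s i = 0)}"
  have Fc: "F m \<subseteq> carrier R" using subalgebraD(1)[OF filt_subspace] .
  have sub: "coord ` vals (F m) \<subseteq> ?B"
    using coord_bound coord_outside vals_mono[OF Fc] by blast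
  have inj: "inj_on coord (vals (F m))"
    using inj_on_subset[OF coord_inj vals_mono[OF Fc]] .
  show "finite (vals (F m))"
    using inj_on_finite[OF inj sub card_box_le(1)[OF finite_I(1)]] .
  have "card (vals (F m)) \<le> card ?B"
    using card_inj_on_le[OF inj sub card_box_le(1)[OF finite_I(1)]] .
  then show "card (vals (F m)) \<le> (2 * m + 1) ^ card I"
    using card_box_le(2)[OF finite_I(1), of m] by linarith
qed

text \<open>A finite spanning list lies in a single piece because the pieces are nested and exhaust
  the algebra; conversely a piece has only finitely many values. In this form finite dimension is
  visibly stable under products.\<close>

lemma finite_dimension_iff_filt:
  "finite_dimension K E \<longleftrightarrow> subalgebra K E R \<and> (\<exists>m. E \<subseteq> F m)"
proof
  assume fd: "finite_dimension K E"
  then have sE: "subalgebra K E R" by (simp add: finite_dimension_iff_vals)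
  obtain Us where Us: "set Us \<subseteq> carrier R" "Span K Us = E"
    using exists_base[OF subfield] fd by (metis finite_dimensionE')
  have "\<exists>m. set Us \<subseteq> F m" if "set Us \<subseteq> carrier R" for Us
    using that
  proof (induction Us)
    case (Cons u Us)
    then obtain m where m: "set Us \<subseteq> F m" by auto
    from Cons(2) obtain l where "u \<in> F l" using filt_exhaust by auto
    with m have "set (u # Us) \<subseteq> F (max l m)"
      using filt_mono[of l "max l m"] filt_mono[of m "max l m"] by auto
    then show ?case ..
  qed simp
  then obtain m where "set Us \<subseteq> F m" using Us by blast
  then have "Span K Us \<subseteq> F m" using subalgebra_Span_incl[OF subfield filt_subspace] by blast
  then show "subalgebra K E R \<and> (\<exists>m. E \<subseteq> F m)" using sE Us by auto
next
  assume *: "subalgebra K E R \<and> (\<exists>m. E \<subseteq> F m)"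
  then obtain m where "E \<subseteq> F m" by blast
  then have "finite (vals E)" using finite_subset[OF vals_mono finite_vals_filt] by blast
  then show "finite_dimension K E" using * by (simp add: finite_dimension_iff_vals)
qed

lemma finite_dimension_mult:
  assumes "finite_dimension K V" "finite_dimension K W"
  shows "finite_dimension K (subspace_mult V W)"
proof -
  obtain l m where "V \<subseteq> F l" "W \<subseteq> F m" "subalgebra K V R" "subalgebra K W R"
    using assms by (auto simp: finite_dimension_iff_filt)
  then have "subspace_mult V W \<subseteq> F (l + m)"
    by (intro subspace_mult_least filt_subspace filt_mult) auto
  then show ?thesis
    using \<open>subalgebra K V R\<close> \<open>subalgebra K W R\<close>
    by (auto simp: finite_dimension_iff_filt intro: subspace_mult_closed)
qed

lemma finite_dimension_K: "finite_dimension K K"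
  using dimension_one[OF subfield] finite_dimensionI by blast

lemma dim_K: "dim K K = 1"
  using dimI[OF subfield dimension_one[OF subfield]] by (simp add: over_def)

lemma power_filt:
  assumes "V \<subseteq> F r"
  shows "subspace_power K V m \<subseteq> F (r * m)"
proof (induction m)
  case (Suc m)
  have "subspace_mult V (subspace_power K V m) \<subseteq> F (r + r * m)"
    using Suc assms by (intro subspace_mult_least filt_subspace filt_mult) blast+
  then show ?case by simp
qed (use filt_scalars in simp)

lemma finite_dimension_power:
  assumes "finite_dimension K V"
  shows "finite_dimension K (subspace_power K V m)"
  by (induction m) (simp_all add: finite_dimension_K finite_dimension_mult assms)

lemma power_one:
  assumes "subalgebra K V R" "\<one> \<in> V"
  shows "\<one> \<in> subspace_power K V m"
proof (induction m)
  case (Suc m)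
  then show ?case using subspace_mult_incl[OF assms(2) Suc] by simp
qed (simp add: K_zero_one)

text \<open>If \<open>V\<close> lies in \<open>F r\<close>, its \<open>m\<close>-th power lies in
  \<open>F (r * m)\<close>, whose values fit into a box of side
  \<open>2 * r * m + 1\<close>.\<close>

lemma growth_exponent_le:
  assumes "finite_dimension K V" "\<one> \<in> V"
  shows "growth_exponent K V \<le> ereal (real (card I))"
proof -
  obtain r where V: "subalgebra K V R" "V \<subseteq> F r"
    using assms by (auto simp: finite_dimension_iff_filt)
  have fd: "finite_dimension K (subspace_power K V m)" for m
    using finite_dimension_power[OF assms(1)] .
  show ?thesis
    unfolding growth_exponent_def
  proof (rule log_growth_upper)
    fix m
    have "\<nu> \<one> \<in> vals (subspace_power K V m)"
      using power_one[OF V(1) assms(2), of m] K_zero_one by (auto simp: vals_def)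
    then show "dim K (subspace_power K V m) \<ge> 1"
      using fd[of m] by (auto simp: dim_eq_card_vals finite_dimension_iff_vals Suc_le_eq card_gt_0_iff)
    have "card (vals (subspace_power K V m)) \<le> card (vals (F (r * m)))"
      by (intro card_mono finite_vals_filt vals_mono power_filt V)
    then show "dim K (subspace_power K V m) \<le> (2 * r * m + 1) ^ card I"
      using card_vals_filt[of "r * m"] fd by (simp add: dim_eq_card_vals mult.assoc)
  qed
qed

text \<open>Multiplying \<open>W\<close> by \<open>\<one>\<close> keeps its values, and multiplying
  by \<open>y i\<close> shifts them by one unit in direction \<open>i\<close>. So the values of the
  product contain a set to which the discrete inequality applies.\<close>

lemma isoperimetric_frame:
  assumes V: "finite_dimension K V" "\<one> \<in> V" "\<And>i. i \<in> I \<Longrightarrow> y i \<in> V"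
  shows "isoperimetric K V (ereal (real (card I)))"
  unfolding isoperimetric_def
proof (intro exI conjI allI impI)
  show "1 / real (card I) > 0" using finite_I by (simp add: card_gt_0_iff)
  fix W assume "finite_dimension K W \<and> W \<noteq> {\<zero>}"
  then have W: "finite_dimension K W" by simp
  have fd: "finite_dimension K (subspace_mult V W)" using finite_dimension_mult[OF V(1) W] .
  have Wc: "W \<subseteq> carrier R" and VWc: "subspace_mult V W \<subseteq> carrier R"
    using W fd by (auto simp: finite_dimension_iff_vals dest: subalgebraD(1))
  let ?S = "coord ` vals W" and ?T = "coord ` vals (subspace_mult V W)"
  have "real (card ?T) \<ge> real (card ?S) +
      1 / real (card I) * real (card ?S) powr ((real (card I) - 1) / real (card I))"
  proof (rule isoperimetric_shifts[OF finite_I])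
    show "finite ?S" "finite ?T" using W fd by (auto simp: finite_dimension_iff_vals)
    show "s i = 0" if "s \<in> ?S" "i \<notin> I" for s i
      using that vals_mono[OF Wc] coord_outside by auto
    have "W \<subseteq> subspace_mult V W"
      using subspace_mult_incl[OF V(2)] Wc by (metis l_one subset_iff)
    then show "?S \<subseteq> ?T" by (intro image_mono vals_mono)
    show "s(i := s i + 1) \<in> ?T" if "s \<in> ?S" "i \<in> I" for s i
    proof -
      from that(1) obtain w where w: "w \<in> W" "w \<noteq> \<zero>" "s = coord (\<nu> w)" by (auto simp: vals_def)
      have wc: "w \<in> carrier R - {\<zero>}" using w Wc by auto
      have "\<nu> (y i \<otimes> w) \<in> vals (subspace_mult V W)"
        using subspace_mult_incl[OF V(3)[OF that(2)] w(1)] no_zero_div[OF y_nonzero[OF that(2)] wc]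
        by (auto simp: vals_def)
      moreover have "coord (\<nu> (y i \<otimes> w)) = s(i := s i + 1)"
        using coord_shift[of "\<nu> w" i] val_mult[OF y_nonzero[OF that(2)] wc] wc that w(3)
        by (auto simp: vals_def)
      ultimately show ?thesis by (metis image_eqI)
    qed
  qed
  then show "real (dim K (subspace_mult V W)) \<ge> real (dim K W) + 1 / real (card I) *
      real (dim K W) powr isoperimetric_exponent (ereal (real (card I)))"
    by (simp add: card_coord[OF Wc] card_coord[OF VWc] dim_eq_card_vals[OF W] dim_eq_card_vals[OF fd]
        isoperimetric_exponent_def)
qed

text \<open>It contains \<open>gens\<close> in order to generate the algebra and the
  \<open>y i\<close> in order to realize all unit shifts. The list is chosen because
  \<open>Span\<close> acts on lists.\<close>

definition big_frame :: "'a set"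
  where "big_frame = Span K (\<one> # (SOME xs. set xs = gens \<union> y ` I))"

lemma big_frame_props:
  shows "frame K big_frame" "i \<in> I \<Longrightarrow> y i \<in> big_frame"
proof -
  define xs where "xs = (SOME xs. set xs = gens \<union> y ` I)"
  have xs: "set xs = gens \<union> y ` I"
    unfolding xs_def by (rule someI_ex) (use finite_gens finite_I in \<open>auto intro: finite_list\<close>)
  have c: "set (\<one> # xs) \<subseteq> carrier R" using xs finite_gens y_nonzero by auto
  have bf: "big_frame = Span K (\<one> # xs)" by (simp add: big_frame_def xs_def)
  have incl: "set (\<one> # xs) \<subseteq> big_frame" unfolding bf by (rule Span_base_incl[OF subfield c])
  show "y i \<in> big_frame" if "i \<in> I" using incl xs that by auto
  have fd: "finite_dimension K big_frame" unfolding bf by (rule Span_finite_dimension[OF subfield c])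
  then have sub: "subalgebra K big_frame R" by (simp add: finite_dimension_iff_vals)
  have "k \<in> big_frame" if "k \<in> K" for k
    using subalgebraD(6)[OF sub that, of \<one>] incl that scalar_carrier by simp
  then have KX: "K \<union> gens \<subseteq> big_frame" using incl xs by auto
  have "generate_ring R (K \<union> gens) \<subseteq> generate_ring R big_frame"
  proof (intro subsetI)
    fix h assume "h \<in> generate_ring R (K \<union> gens)"
    then show "h \<in> generate_ring R big_frame"
      by (induction rule: generate_ring.induct)
        (use KX in \<open>auto intro: generate_ring.intros\<close>)
  qed
  moreover have "generate_ring R big_frame \<subseteq> carrier R"
    using generate_ring_incl subalgebraD(1)[OF sub] .
  ultimately show "frame K big_frame" using fd incl generating by (auto simp: frame_def)
qed

text \<open>
  For \<open>W = (k + bV)\<^sup>m\<close> the next power contains \<open>b(VW)\<close>, which has the dimension of \<open>VW\<close>. So an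
  isoperimetric inequality for \<open>V\<close> bounds the growth of \<open>k + bV\<close> from below for every \<open>b\<close>.
\<close>

lemma growth_exponent_ge:
  assumes V: "finite_dimension K V" and d: "isoperimetric K V (ereal d)" "d > 0"
    and b: "b \<in> carrier R - {\<zero>}"
  shows "growth_exponent K (K <+>\<^bsub>R\<^esub> (b <# V)) \<ge> ereal d"
proof -
  note sV = subalgebraD[OF V[THEN finite_dimension_iff_vals[THEN iffD1, THEN conjunct1]]]
  have bc: "b \<in> carrier R" using b by simp
  define Y where "Y = K <+>\<^bsub>R\<^esub> (b <# V)"
  have memY: "x \<in> Y \<longleftrightarrow> (\<exists>k\<in>K. \<exists>v\<in>V. x = k \<oplus> b \<otimes> v)" for x
    by (auto simp: Y_def set_add_def' l_coset_def)
  have Y: "subalgebra K Y R"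
  proof (rule subalgebraI)
    show "Y \<subseteq> carrier R"
    proof
      fix x assume "x \<in> Y"
      then obtain k v where "k \<in> K" "v \<in> V" "x = k \<oplus> b \<otimes> v" by (auto simp: memY)
      then show "x \<in> carrier R" using sV(1) bc scalar_carrier by (metis add.m_closed m_closed subsetD)
    qed
    have "\<zero> = \<zero> \<oplus> b \<otimes> \<zero>" using bc by simp
    then show "\<zero> \<in> Y" using memY sV(2) K_zero_one by blast
  next
    fix x x' assume "x \<in> Y" "x' \<in> Y"
    then obtain k v k' v' where *: "k \<in> K" "v \<in> V" "x = k \<oplus> b \<otimes> v" "k' \<in> K" "v' \<in> V" "x' = k' \<oplus> b \<otimes> v'"
      by (auto simp: memY)
    then have c: "k \<in> carrier R" "k' \<in> carrier R" "v \<in> carrier R" "v' \<in> carrier R" using sV(1) by auto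
    have "x \<oplus> x' = (k \<oplus> k') \<oplus> b \<otimes> (v \<oplus> v')"
      using * c bc by (simp add: r_distr a_ac)
    moreover have "k \<oplus> k' \<in> K" using subringE(7)[OF subfieldE(1)[OF subfield]] * by simp
    ultimately show "x \<oplus> x' \<in> Y" using memY sV(3)[OF *(2,5)] by blast
  next
    fix l x assume l: "l \<in> K" and "x \<in> Y"
    then obtain k v where *: "k \<in> K" "v \<in> V" "x = k \<oplus> b \<otimes> v" by (auto simp: memY)
    then have c: "k \<in> carrier R" "v \<in> carrier R" "l \<in> carrier R" using sV(1) l by auto
    have "l \<otimes> x = l \<otimes> k \<oplus> b \<otimes> (l \<otimes> v)"
      using * c bc central[OF l bc] by (simp add: r_distr m_assoc[symmetric])
    moreover have "l \<otimes> k \<in> K" using subringE(6)[OF subfieldE(1)[OF subfield]] * l by simp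
    ultimately show "l \<otimes> x \<in> Y" using memY sV(6)[OF l *(2)] by blast
  qed
  obtain r where r: "V \<subseteq> F r" using V by (auto simp: finite_dimension_iff_filt)
  obtain s where s: "b \<in> F s" using filt_exhaust bc by blast
  have "Y \<subseteq> F (s + r)"
  proof
    fix x assume "x \<in> Y"
    then obtain k v where *: "k \<in> K" "v \<in> V" "x = k \<oplus> b \<otimes> v" by (auto simp: memY)
    have "k \<in> F (s + r)" using * filt_scalars filt_mono[of 0 "s + r"] by auto
    moreover have "b \<otimes> v \<in> F (s + r)" using filt_mult[OF s] r * by auto
    ultimately show "x \<in> F (s + r)" using subalgebraD(3)[OF filt_subspace] * by simp
  qed
  then have fdY: "finite_dimension K Y" using Y by (auto simp: finite_dimension_iff_filt)
  define W where "W m = subspace_power K Y m" for m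
  have fdW: "finite_dimension K (W m)" for m
    unfolding W_def by (rule finite_dimension_power[OF fdY])
  then have Wc: "W m \<subseteq> carrier R" for m
    by (metis finite_dimension_iff_vals subalgebraD(1))
  have "K \<subseteq> Y"
  proof
    fix k assume k: "k \<in> K"
    then have "k = k \<oplus> b \<otimes> \<zero>" using bc scalar_carrier by simp
    then show "k \<in> Y" using memY k sV(2) by blast
  qed
  then have oneY: "\<one> \<in> Y" using K_zero_one by auto
  have ne: "W m \<noteq> {\<zero>}" for m
    using power_one[OF Y oneY, of m] K_zero_one by (auto simp: W_def)
  obtain c where c: "c > 0" and iso: "\<And>W. finite_dimension K W \<Longrightarrow> W \<noteq> {\<zero>} \<Longrightarrow>
      real (dim K (subspace_mult V W)) \<ge> real (dim K W) + c * real (dim K W) powr ((d - 1) / d)"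
    using d(1) unfolding isoperimetric_def isoperimetric_exponent_def by auto
  have "ereal d \<le> limsup (\<lambda>m. ereal (log (real m) (real (dim K (W m)))))"
  proof (rule log_growth_lower[OF d(2) c])
    show "1 \<le> dim K (W 0)" by (simp add: W_def dim_K)
    fix m
    let ?VW = "subspace_mult V (W m)"
    have fdVW: "finite_dimension K ?VW" by (rule finite_dimension_mult[OF V fdW])
    have VWc: "?VW \<subseteq> carrier R" using fdVW by (metis finite_dimension_iff_vals subalgebraD(1))
    have sW: "subalgebra K (W (Suc m)) R" using fdW by (simp add: finite_dimension_iff_vals)
    have "b \<otimes> x \<in> W (Suc m)" if "x \<in> ?VW" for x
    proof -
      \<comment> \<open>The elements that \<open>b\<close> multiplies into the next power form a
        subspace, so products \<open>v \<otimes> w\<close> suffice. For these,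
        \<open>b \<otimes> v\<close> lies in \<open>Y\<close> with scalar part zero.\<close>
      have "subalgebra K {x \<in> carrier R. b \<otimes> x \<in> W (Suc m)} R"
      proof (rule subalgebraI)
        fix k x assume kx: "k \<in> K" "x \<in> {x \<in> carrier R. b \<otimes> x \<in> W (Suc m)}"
        then have "k \<in> carrier R" by auto
        then have "b \<otimes> (k \<otimes> x) = k \<otimes> (b \<otimes> x)"
          using kx central[OF kx(1) bc] bc by (simp add: m_assoc[symmetric])
        then show "k \<otimes> x \<in> {x \<in> carrier R. b \<otimes> x \<in> W (Suc m)}"
          using kx subalgebraD(6)[OF sW] \<open>k \<in> carrier R\<close> by auto
      qed (use bc subalgebraD(2,3)[OF sW] in \<open>auto simp: r_distr\<close>)
      moreover have "v \<otimes> w \<in> {x \<in> carrier R. b \<otimes> x \<in> W (Suc m)}" if "v \<in> V" "w \<in> W m" for v w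
      proof -
        have vw: "v \<in> carrier R" "w \<in> carrier R" using that sV(1) Wc by auto
        have "b \<otimes> v = \<zero> \<oplus> b \<otimes> v" using bc vw by simp
        then have "b \<otimes> v \<in> Y" using memY K_zero_one that by blast
        then have "(b \<otimes> v) \<otimes> w \<in> W (Suc m)"
          using subspace_mult_incl[of _ Y w "W m"] that by (simp add: W_def)
        then show ?thesis using vw bc by (simp add: m_assoc)
      qed
      ultimately have "?VW \<subseteq> {x \<in> carrier R. b \<otimes> x \<in> W (Suc m)}"
        by (rule subspace_mult_least)
      with that show ?thesis by blast
    qed
    then have "b <# ?VW \<subseteq> W (Suc m)" by (auto simp: l_coset_def)
    then have "card (vals (b <# ?VW)) \<le> card (vals (W (Suc m)))"
      using fdW by (intro card_mono vals_mono) (auto simp: finite_dimension_iff_vals)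
    also have "card (vals (b <# ?VW)) = card (vals ?VW)"
      unfolding vals_l_coset[OF b VWc] by (rule card_image) simp
    finally have "dim K ?VW \<le> dim K (W (Suc m))"
      using fdVW fdW by (simp add: dim_eq_card_vals)
    then show "real (dim K (W m)) + c * real (dim K (W m)) powr ((d - 1) / d) \<le> real (dim K (W (Suc m)))"
      using iso[OF fdW ne, of m] by linarith
  qed
  then show ?thesis by (simp add: growth_exponent_def W_def Y_def)
qed

text \<open>A nonzero subspace has dimension at least one, so the linear gain belonging to
  \<open>\<infinity>\<close> dominates every power with exponent below one.\<close>

lemma isoperimetric_real_less:
  assumes "isoperimetric K V \<infinity>" "d > 0"
  shows "isoperimetric K V (ereal d)"
proof -
  obtain c where c: "c > 0" and iso: "\<And>W. finite_dimension K W \<Longrightarrow> W \<noteq> {\<zero>} \<Longrightarrow>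
      real (dim K (subspace_mult V W)) \<ge> real (dim K W) + c * real (dim K W) powr 1"
    using assms(1) unfolding isoperimetric_def isoperimetric_exponent_def by auto
  have "real (dim K W) + c * real (dim K W) powr ((d - 1) / d) \<le> real (dim K (subspace_mult V W))"
    if W: "finite_dimension K W" "W \<noteq> {\<zero>}" for W
  proof -
    have "vals W \<noteq> {}"
      using W subalgebraD(2)[of W] by (auto simp: vals_def finite_dimension_iff_vals)
    then have "real (dim K W) \<ge> 1"
      using W(1) by (simp add: dim_eq_card_vals finite_dimension_iff_vals Suc_le_eq card_gt_0_iff)
    then have "real (dim K W) powr ((d - 1) / d) \<le> real (dim K W) powr 1"
      using assms(2) by (intro powr_mono) (auto simp: field_simps)
    then show ?thesis using iso[OF W] c by (smt (verit) mult_left_mono)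
  qed
  then show ?thesis using c unfolding isoperimetric_def isoperimetric_exponent_def by auto
qed

section \<open>Comparison of the three growth invariants\<close>

lemma GK_le: "GK K \<le> ereal (real (card I))"
  unfolding GK_def by (rule SUP_least) (auto simp: frame_def intro: growth_exponent_le)

text \<open>The infimum is bounded by its term for \<open>b = 1\<close>, which is the growth of
  \<open>V\<close> itself since a frame contains the scalars.\<close>

lemma Tdeg_le_GK: "Tdeg K \<le> GK K"
  unfolding Tdeg_def
proof (rule SUP_least)
  fix V assume "V \<in> {V. frame K V}"
  then have V: "frame K V" by simp
  then have sV: "subalgebra K V R" and one: "\<one> \<in> V"
    by (auto simp: frame_def finite_dimension_iff_vals)
  note sV = subalgebraD[OF sV]
  have "\<one> \<otimes> x = x" if "x \<in> V" for x using that sV(1) by auto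
  then have "\<one> <# V = V" by (force simp: l_coset_def)
  moreover have "K <+>\<^bsub>R\<^esub> V = V"
  proof (intro equalityI subsetI)
    fix x assume "x \<in> K <+>\<^bsub>R\<^esub> V"
    then obtain k v where *: "k \<in> K" "v \<in> V" "x = k \<oplus> v" by (auto simp: set_add_def')
    have "k = k \<otimes> \<one>" using * scalar_carrier by simp
    then have "k \<in> V" using sV(6)[OF *(1) one] by simp
    then show "x \<in> V" using sV(3) * by simp
  next
    fix x assume x: "x \<in> V"
    then have "x = \<zero> \<oplus> x" using sV(1) by auto
    then show "x \<in> K <+>\<^bsub>R\<^esub> V" using x K_zero_one by (auto simp: set_add_def')
  qed
  moreover have "regular \<one>" by (simp add: regular_def)
  ultimately have "(INF b \<in> {b. regular b}. growth_exponent K (K <+>\<^bsub>R\<^esub> (b <# V))) \<le> growth_exponent K V"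
    using INF_lower[of \<one> "{b. regular b}" "\<lambda>b. growth_exponent K (K <+>\<^bsub>R\<^esub> (b <# V))"] by simp
  also have "\<dots> \<le> GK K" unfolding GK_def using V by (intro SUP_upper) simp
  finally show "(INF b \<in> {b. regular b}. growth_exponent K (K <+>\<^bsub>R\<^esub> (b <# V))) \<le> GK K" .
qed

lemma isoperimetric_le_Tdeg:
  assumes V: "frame K V" and d: "isoperimetric K V d" "d > 0"
  shows "d \<le> Tdeg K"
proof -
  have fd: "finite_dimension K V" using V by (simp add: frame_def)
  have *: "ereal e \<le> Tdeg K" if "isoperimetric K V (ereal e)" "e > 0" for e
  proof -
    have "b \<in> carrier R - {\<zero>}" if b: "regular b" for b
    proof -
      have "b \<noteq> \<zero>"
      proof
        assume "b = \<zero>"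
        then have "b \<otimes> \<one> = \<zero>" by simp
        then have "\<one> = \<zero>" using b one_closed unfolding regular_def by blast
        then show False using K_zero_one by simp
      qed
      then show ?thesis using b unfolding regular_def by blast
    qed
    then have "ereal e \<le> (INF b \<in> {b. regular b}. growth_exponent K (K <+>\<^bsub>R\<^esub> (b <# V)))"
      using growth_exponent_ge[OF fd that] by (intro INF_greatest) auto
    also have "\<dots> \<le> Tdeg K" unfolding Tdeg_def using V by (intro SUP_upper) simp
    finally show ?thesis .
  qed
  show ?thesis
  proof (cases d)
    case (real e)
    then show ?thesis using * d by simp
  next
    case PInf
    \<comment> \<open>An infinite exponent would yield all finite ones; \<open>card I + 1\<close>
      already contradicts the upper bound on GK.\<close>
    have "ereal (real (card I) + 1) \<le> Tdeg K"
      using isoperimetric_real_less[of V "real (card I) + 1"] d PInf by (intro *) auto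
    also have "\<dots> \<le> ereal (real (card I))" using Tdeg_le_GK GK_le by (rule order_trans)
    finally show ?thesis by simp
  next
    case MInf
    then show ?thesis using d by simp
  qed
qed

theorem LD_stable_GK: "LD_stable K" "GK K = ereal (real (card I))"
proof -
  have N: "real (card I) > 0" using finite_I by (simp add: card_gt_0_iff)
  note bf = big_frame_props(1)
  have fd: "finite_dimension K big_frame" and one: "\<one> \<in> big_frame" using bf by (auto simp: frame_def)
  have iso: "isoperimetric K big_frame (ereal (real (card I)))"
    using isoperimetric_frame[OF fd one big_frame_props(2)] .
  \<comment> \<open>\<open>LD\<close> is defined by cases, and the supremum is taken only if some
    frame enlarges every nonzero subspace.\<close>
  have "dim K (subspace_mult big_frame W) \<noteq> dim K W" if W: "finite_dimension K W" "W \<noteq> {\<zero>}" for W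
  proof -
    obtain c where c: "c > 0" "real (dim K (subspace_mult big_frame W)) \<ge> real (dim K W) +
        c * real (dim K W) powr isoperimetric_exponent (ereal (real (card I)))"
      using iso W unfolding isoperimetric_def by blast
    have "vals W \<noteq> {}"
      using W subalgebraD(2)[of W] by (auto simp: vals_def finite_dimension_iff_vals)
    then have "real (dim K W) > 0"
      using W(1) by (simp add: dim_eq_card_vals finite_dimension_iff_vals card_gt_0_iff)
    then have "c * real (dim K W) powr isoperimetric_exponent (ereal (real (card I))) > 0"
      using c(1) by simp
    then show ?thesis using c(2) by linarith
  qed
  then have LD: "LD K = Sup {d. 0 < d \<and> (\<exists>V. frame K V \<and> isoperimetric K V d)}"
    using bf unfolding LD_def by auto
  have "ereal (real (card I)) \<le> LD K"
    unfolding LD using bf iso N by (intro Sup_upper) auto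
  moreover have "LD K \<le> Tdeg K"
    unfolding LD by (rule Sup_least) (auto intro: isoperimetric_le_Tdeg)
  ultimately show "LD_stable K" "GK K = ereal (real (card I))"
    unfolding LD_stable_def using Tdeg_le_GK GK_le by (meson order_antisym order_trans)+
qed

end

section \<open>Twisted group algebras as algebras of operators\<close>

definition smul :: "'k::field \<Rightarrow> ('g \<Rightarrow>\<^sub>0 'k) \<Rightarrow> ('g \<Rightarrow>\<^sub>0 'k)"
  where "smul c p = Abs_poly_mapping (\<lambda>g. c * Poly_Mapping.lookup p g)"

lemma lookup_smul [simp]: "Poly_Mapping.lookup (smul c p) g = c * Poly_Mapping.lookup p g"
proof -
  have "finite {g. c * Poly_Mapping.lookup p g \<noteq> 0}"
    by (rule finite_subset[OF _ finite_lookup[of p]]) auto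
  then show ?thesis by (simp add: smul_def lookup_Abs_poly_mapping)
qed

lemma smul_simps:
  "smul c (p + r) = smul c p + smul c r" "smul c (smul d p) = smul (c * d) p"
  "smul (c + d) p = smul c p + smul d p" "smul 1 p = p" "smul c 0 = 0" "smul c (- p) = - smul c p"
  "smul c (p - r) = smul c p - smul c r"
  by (rule poly_mapping_eqI; simp add: lookup_add lookup_minus algebra_simps)+

text \<open>
  Realizing the quantum torus inside the ring of all linear operators makes it a subset of a type
  of class \<open>ring_1\<close>, although its multiplication depends on \<open>q\<close>.
\<close>

typedef (overloaded) ('g, 'k) linop =
  "{f :: ('g \<Rightarrow>\<^sub>0 'k::field) \<Rightarrow> ('g \<Rightarrow>\<^sub>0 'k).
     (\<forall>x y. f (x + y) = f x + f y) \<and> (\<forall>c x. f (smul c x) = smul c (f x))}"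
  by (rule exI[of _ id]) simp

setup_lifting type_definition_linop

instantiation linop :: (type, field) ring_1
begin

lift_definition zero_linop :: "('a, 'b) linop" is "\<lambda>_. 0" by (simp add: smul_simps)
lift_definition one_linop :: "('a, 'b) linop" is id by simp
lift_definition plus_linop :: "('a, 'b) linop \<Rightarrow> ('a, 'b) linop \<Rightarrow> ('a, 'b) linop"
  is "\<lambda>f g x. f x + g x" by (simp add: smul_simps)
lift_definition uminus_linop :: "('a, 'b) linop \<Rightarrow> ('a, 'b) linop"
  is "\<lambda>f x. - f x" by (simp add: smul_simps)
lift_definition minus_linop :: "('a, 'b) linop \<Rightarrow> ('a, 'b) linop \<Rightarrow> ('a, 'b) linop"
  is "\<lambda>f g x. f x - g x" by (simp add: smul_simps)
lift_definition times_linop :: "('a, 'b) linop \<Rightarrow> ('a, 'b) linop \<Rightarrow> ('a, 'b) linop"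
  is "\<lambda>f g x. f (g x)" by simp

instance
proof
  show "(0 :: ('a, 'b) linop) \<noteq> 1"
  proof
    assume "(0 :: ('a, 'b) linop) = 1"
    then have "Rep_linop (0 :: ('a, 'b) linop) (Poly_Mapping.single undefined 1) =
        Rep_linop 1 (Poly_Mapping.single undefined 1)"
      by simp
    then have "Poly_Mapping.single (undefined :: 'a) (1 :: 'b) = 0"
      by (simp add: zero_linop.rep_eq one_linop.rep_eq)
    then have "Poly_Mapping.lookup (Poly_Mapping.single (undefined :: 'a) (1 :: 'b)) undefined = 0"
      by (metis lookup_zero)
    then show False by simp
  qed
qed (transfer; simp add: fun_eq_iff algebra_simps)+

end

abbreviation ap :: "('g, 'k::field) linop \<Rightarrow> ('g \<Rightarrow>\<^sub>0 'k) \<Rightarrow> ('g \<Rightarrow>\<^sub>0 'k)"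
  where "ap \<equiv> Rep_linop"

lift_definition sc :: "'k::field \<Rightarrow> ('g, 'k) linop" is smul
  by (simp add: smul_simps mult.commute)

lemma linop_eqI: "(\<And>p g. Poly_Mapping.lookup (ap A p) g = Poly_Mapping.lookup (ap B p) g) \<Longrightarrow> A = B"
  by (simp add: Rep_linop_inject[symmetric]) (auto intro!: ext poly_mapping_eqI)

lemma ap_simps [simp]:
  "ap (A + B) p = ap A p + ap B p" "ap (A * B) p = ap A (ap B p)" "ap 1 p = p" "ap 0 p = 0"
  "ap (- A) p = - ap A p" "ap (A - B) p = ap A p - ap B p" "ap (sc c) p = smul c p"
  "ap A (p + r) = ap A p + ap A r" "ap A (smul c p) = smul c (ap A p)"
  using Rep_linop[of A]
  by (simp_all add: plus_linop.rep_eq times_linop.rep_eq one_linop.rep_eq zero_linop.rep_eq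
      uminus_linop.rep_eq minus_linop.rep_eq sc.rep_eq)

lemma sc_simps:
  "sc (a + b) = sc a + sc b" "sc (a * b) = sc a * sc b" "sc 1 = 1" "sc 0 = 0" "sc (- a) = - sc a"
  "sc (a - b) = sc a - sc b"
  by (rule linop_eqI; simp add: lookup_add lookup_minus algebra_simps)+

lemma sc_comm: "A * sc c = sc c * A"
  by (rule linop_eqI) simp

text \<open>An element of the quantum torus sends the basis vector at 0 to its own expansion in
  monomials, so one value of the operator reveals all coefficients.\<close>

definition coef :: "('g::zero, 'k::field) linop \<Rightarrow> 'g \<Rightarrow> 'k"
  where "coef A = Poly_Mapping.lookup (ap A (Poly_Mapping.single 0 1))"

definition supp :: "('g::zero, 'k::field) linop \<Rightarrow> 'g set"
  where "supp A = {g. coef A g \<noteq> 0}"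

lemma finite_supp [simp]: "finite (supp A)"
  by (simp add: supp_def coef_def)

lemma coef_simps [simp]:
  "coef (A + B) g = coef A g + coef B g" "coef 0 g = 0" "coef (sc c * A) g = c * coef A g"
  "coef (- A) g = - coef A g" "coef (A - B) g = coef A g - coef B g"
  by (simp_all add: coef_def lookup_add lookup_minus)

text \<open>The form \<open>bf\<close> need not be alternating. Putting the whole power of
  \<open>q\<close> on one of the two orders of a product avoids square roots of
  \<open>q\<close>.\<close>

locale twisted_torus =
  fixes q :: "'k::field" and bf :: "'g::linordered_ab_group_add \<Rightarrow> 'g \<Rightarrow> int"
  assumes q_nonzero: "q \<noteq> 0"
    and bf_add_left: "bf (g + g') h = bf g h + bf g' h"
    and bf_add_right: "bf g (h + h') = bf g h + bf g h'"
begin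

lemma bf_zero [simp]: "bf 0 h = 0" "bf g 0 = 0"
  using bf_add_left[of 0 0 h] bf_add_right[of g 0 0] by simp_all

lemma bf_minus: "bf (- g) h = - bf g h" "bf g (- h) = - bf g h"
  using bf_add_left[of g "- g" h] bf_add_right[of g h "- h"] by simp_all

text \<open>On basis vectors this is the translation of \<open>h\<close> to \<open>g + h\<close>
  with factor \<open>q powi bf g h\<close>; the formula is its effect on coefficient
  functions.\<close>

lift_definition mon :: "'g \<Rightarrow> ('g, 'k) linop"
  is "\<lambda>g p. Abs_poly_mapping (\<lambda>h. q powi bf g (h - g) * Poly_Mapping.lookup p (h - g))"
proof -
  fix g :: 'g
  have *: "Poly_Mapping.lookup (Abs_poly_mapping (\<lambda>h. q powi bf g (h - g) * Poly_Mapping.lookup p (h - g))) h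
      = q powi bf g (h - g) * Poly_Mapping.lookup p (h - g)" for p :: "'g \<Rightarrow>\<^sub>0 'k" and h
  proof -
    have "{h. q powi bf g (h - g) * Poly_Mapping.lookup p (h - g) \<noteq> 0} \<subseteq> (+) g ` Poly_Mapping.keys p"
    proof
      fix h assume "h \<in> {h. q powi bf g (h - g) * Poly_Mapping.lookup p (h - g) \<noteq> 0}"
      then have "h - g \<in> Poly_Mapping.keys p" by (simp add: in_keys_iff)
      then show "h \<in> (+) g ` Poly_Mapping.keys p" by (intro image_eqI[of _ _ "h - g"]) auto
    qed
    then have "finite {h. q powi bf g (h - g) * Poly_Mapping.lookup p (h - g) \<noteq> 0}"
      by (rule finite_subset) simp
    then show ?thesis by (simp add: lookup_Abs_poly_mapping)
  qed
  show "(\<forall>x y. Abs_poly_mapping (\<lambda>h. q powi bf g (h - g) * Poly_Mapping.lookup (x + y) (h - g)) =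
      Abs_poly_mapping (\<lambda>h. q powi bf g (h - g) * Poly_Mapping.lookup x (h - g)) +
      Abs_poly_mapping (\<lambda>h. q powi bf g (h - g) * Poly_Mapping.lookup y (h - g))) \<and>
    (\<forall>c x. Abs_poly_mapping (\<lambda>h. q powi bf g (h - g) * Poly_Mapping.lookup (smul c x) (h - g)) =
      smul c (Abs_poly_mapping (\<lambda>h. q powi bf g (h - g) * Poly_Mapping.lookup x (h - g))))"
    by (intro conjI allI poly_mapping_eqI; (simp only: *)?; (simp only: lookup_add lookup_smul)?;
        (simp only: *)?; simp add: algebra_simps)
qed

lemma lookup_mon:
  "Poly_Mapping.lookup (ap (mon g) p) h = q powi bf g (h - g) * Poly_Mapping.lookup p (h - g)"
proof -
  have "{h. q powi bf g (h - g) * Poly_Mapping.lookup p (h - g) \<noteq> 0} \<subseteq> (+) g ` Poly_Mapping.keys p"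
  proof
    fix h assume "h \<in> {h. q powi bf g (h - g) * Poly_Mapping.lookup p (h - g) \<noteq> 0}"
    then have "h - g \<in> Poly_Mapping.keys p" by (simp add: in_keys_iff)
    then show "h \<in> (+) g ` Poly_Mapping.keys p" by (intro image_eqI[of _ _ "h - g"]) auto
  qed
  then have "finite {h. q powi bf g (h - g) * Poly_Mapping.lookup p (h - g) \<noteq> 0}"
    by (rule finite_subset) simp
  then show ?thesis
    by (simp add: mon.rep_eq lookup_Abs_poly_mapping)
qed

lemma mon_zero: "mon 0 = 1"
  by (rule linop_eqI) (simp add: lookup_mon)

lemma mon_mult: "mon g * mon h = sc (q powi bf g h) * mon (g + h)"
proof (rule linop_eqI)
  fix p x
  have "bf g (x - g) = bf g h + bf g (x - (g + h))"
    using bf_add_right[of g h "x - (g + h)"] by (simp add: algebra_simps)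
  moreover have "bf (g + h) (x - (g + h)) = bf g (x - (g + h)) + bf h (x - (g + h))"
    by (rule bf_add_left)
  ultimately have "q powi bf g (x - g) * q powi bf h (x - (g + h)) =
      q powi bf g h * q powi bf (g + h) (x - (g + h))"
    by (simp add: power_int_add q_nonzero)
  then show "Poly_Mapping.lookup (ap (mon g * mon h) p) x =
      Poly_Mapping.lookup (ap (sc (q powi bf g h) * mon (g + h)) p) x"
    unfolding ap_simps lookup_mon lookup_smul diff_diff_eq by (simp only: mult.assoc[symmetric])
qed

lemma coef_mon: "coef (mon g) h = (if h = g then 1 else 0)"
  by (auto simp: coef_def lookup_mon lookup_one when_def)

text \<open>The span of the monomials. Only inside it do the numbers \<open>coef\<close> determine
  an operator.\<close>

inductive_set tor :: "('g, 'k) linop set"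
  where
    tor_zero: "0 \<in> tor"
  | tor_add_mon: "A \<in> tor \<Longrightarrow> sc c * mon g + A \<in> tor"

lemma tor_mon: "mon g \<in> tor"
  using tor_add_mon[OF tor_zero, of 1 g] by (simp add: sc_simps)

lemma tor_add: "A \<in> tor \<Longrightarrow> B \<in> tor \<Longrightarrow> A + B \<in> tor"
  by (induction rule: tor.induct) (auto simp: add.assoc intro: tor.intros)

lemma tor_sc_mult: "A \<in> tor \<Longrightarrow> sc c * A \<in> tor"
  by (induction rule: tor.induct)
    (auto simp: distrib_left simp flip: mult.assoc sc_simps(2) intro: tor.intros)

lemma tor_mon_mult: "A \<in> tor \<Longrightarrow> mon g * A \<in> tor"
proof (induction rule: tor.induct)
  case (tor_add_mon A c h)
  have "mon g * (sc c * mon h) = sc (c * q powi bf g h) * mon (g + h)"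
    by (simp only: mult.assoc[symmetric] sc_comm[of "mon g" c])
      (simp only: mult.assoc mon_mult sc_simps(2))
  then show ?case using tor_add_mon by (simp add: distrib_left tor.intros)
qed (simp add: tor_zero)

lemma tor_mult: "A \<in> tor \<Longrightarrow> B \<in> tor \<Longrightarrow> A * B \<in> tor"
  by (induction rule: tor.induct)
    (auto simp: distrib_right mult.assoc intro: tor_zero tor_add tor_sc_mult tor_mon_mult)

text \<open>An element of \<open>tor\<close> acts as the combination of monomials given by its
  coefficients. Evaluated at the basis vector 0 of a product this becomes the twisted convolution
  \<open>coef_mult\<close>.\<close>

lemma lookup_ap_tor:
  assumes "A \<in> tor"
  shows "Poly_Mapping.lookup (ap A p) x =
    (\<Sum>g\<in>supp A. coef A g * (q powi bf g (x - g) * Poly_Mapping.lookup p (x - g)))"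
  using assms
proof (induction rule: tor.induct)
  case tor_zero
  then show ?case by simp
next
  case (tor_add_mon A c g)
  define w where "w h = q powi bf h (x - h) * Poly_Mapping.lookup p (x - h)" for h
  let ?C = "sc c * mon g + A"
  define S where "S = insert g (supp A) \<union> supp ?C"
  have fin: "finite S" by (simp add: S_def)
  have ext: "(\<Sum>h\<in>supp B. coef B h * w h) = (\<Sum>h\<in>S. coef B h * w h)" if "supp B \<subseteq> S" for B
    by (rule sum.mono_neutral_left) (use fin that in \<open>auto simp: supp_def\<close>)
  have "(\<Sum>h\<in>supp ?C. coef ?C h * w h) = (\<Sum>h\<in>S. coef ?C h * w h)"
    by (rule ext) (auto simp: S_def)
  also have "\<dots> = (\<Sum>h\<in>S. (if h = g then c * w h else 0)) + (\<Sum>h\<in>S. coef A h * w h)"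
    unfolding sum.distrib[symmetric] by (rule sum.cong) (auto simp: coef_mon algebra_simps)
  also have "(\<Sum>h\<in>S. (if h = g then c * w h else 0)) = c * w g"
    using fin by (simp add: S_def)
  also have "(\<Sum>h\<in>S. coef A h * w h) = (\<Sum>h\<in>supp A. coef A h * w h)"
    by (rule ext[symmetric]) (auto simp: S_def)
  finally show ?case
    using tor_add_mon by (simp add: lookup_add lookup_mon w_def)
qed

lemma coef_mult:
  assumes "A \<in> tor"
  shows "coef (A * B) x = (\<Sum>g\<in>supp A. coef A g * (q powi bf g (x - g) * coef B (x - g)))"
  unfolding coef_def[of "A * B"] coef_def[of B] by (simp add: lookup_ap_tor[OF assms])

lemma supp_mult:
  assumes "A \<in> tor" "x \<in> supp (A * B)"
  obtains g h where "g \<in> supp A" "h \<in> supp B" "x = g + h"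
proof -
  have "(\<Sum>g\<in>supp A. coef A g * (q powi bf g (x - g) * coef B (x - g))) \<noteq> 0"
    using assms by (simp add: supp_def coef_mult)
  then obtain g where "g \<in> supp A" "coef A g * (q powi bf g (x - g) * coef B (x - g)) \<noteq> 0"
    by (rule sum.not_neutral_contains_not_neutral)
  then have "g \<in> supp A" "x - g \<in> supp B" "x = g + (x - g)" by (auto simp: supp_def)
  then show ?thesis by (rule that)
qed

lemma supp_add: "supp (A + B) \<subseteq> supp A \<union> supp B"
  by (auto simp: supp_def)

lemma supp_sc_mult: "supp (sc c * A) \<subseteq> supp A"
  by (auto simp: supp_def)

section \<open>Leading exponents in the quantum torus\<close>

definition below :: "('g, 'k) linop \<Rightarrow> 'g \<Rightarrow> bool"
  where "below A g \<longleftrightarrow> A \<in> tor \<and> (\<forall>h\<in>supp A. h < g)"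

definition leads :: "('g, 'k) linop \<Rightarrow> 'g \<Rightarrow> bool"
  where "leads A g \<longleftrightarrow> A \<in> tor \<and> coef A g \<noteq> 0 \<and> (\<forall>h\<in>supp A. h \<le> g)"

lemma below_zero [simp]: "below 0 g"
  by (simp add: below_def tor_zero supp_def)

lemma below_add: "below A g \<Longrightarrow> below B g \<Longrightarrow> below (A + B) g"
  unfolding below_def using supp_add[of A B] by (auto intro: tor_add)

lemma below_sum: "(\<And>i. i \<in> S \<Longrightarrow> below (A i) g) \<Longrightarrow> below (sum A S) g"
  by (induction S rule: infinite_finite_induct) (auto intro: below_add)

lemma below_sc_mult: "below A g \<Longrightarrow> below (sc c * A) g"
  unfolding below_def using supp_sc_mult[of c A] by (auto intro: tor_sc_mult)

lemma leads_below: "leads A g \<Longrightarrow> g < h \<Longrightarrow> below A h"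
  unfolding leads_def below_def by auto

lemma leads_mon: "leads (mon g) g"
  by (auto simp: leads_def tor_mon coef_mon supp_def)

lemma leads_one: "leads 1 0"
  using leads_mon[of 0] by (simp add: mon_zero)

lemma leads_sc_mult: "leads A g \<Longrightarrow> c \<noteq> 0 \<Longrightarrow> leads (sc c * A) g"
  unfolding leads_def using supp_sc_mult[of c A] by (auto intro: tor_sc_mult)

lemma leads_add_below: "leads A g \<Longrightarrow> below B g \<Longrightarrow> leads (A + B) g"
  unfolding leads_def below_def supp_def
  by (auto intro: tor_add) (metis add.right_neutral less_irrefl, metis add.left_neutral less_imp_le)

lemma leads_unique: "leads A g \<Longrightarrow> leads A h \<Longrightarrow> g = h"
  unfolding leads_def by (auto simp: supp_def intro: order_antisym)

lemma leads_nonzero: "leads A g \<Longrightarrow> A \<noteq> 0"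
  by (auto simp: leads_def)

text \<open>In an ordered group the sum of the two largest exponents arises from one pair only, and
  its coefficient is a product of nonzero factors because \<open>q\<close> is nonzero.\<close>

lemma leads_mult:
  assumes "leads A g" "leads B h"
  shows "leads (A * B) (g + h)"
proof -
  have A: "A \<in> tor" "coef A g \<noteq> 0" "\<forall>x\<in>supp A. x \<le> g"
    and B: "B \<in> tor" "coef B h \<noteq> 0" "\<forall>x\<in>supp B. x \<le> h"
    using assms by (auto simp: leads_def)
  have le: "x \<le> g + h" if x: "x \<in> supp (A * B)" for x
  proof -
    obtain u v where "u \<in> supp A" "v \<in> supp B" "x = u + v" using supp_mult[OF A(1) x] .
    then show ?thesis using A B by (simp add: add_mono)
  qed
  have zero: "coef A u * (q powi bf u (g + h - u) * coef B (g + h - u)) = 0"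
    if "u \<in> supp A" "u \<noteq> g" for u
  proof -
    have "u < g" using A that by (simp add: order.strict_iff_order)
    then have "\<not> g + h - u \<le> h" by (simp add: algebra_simps)
    then have "g + h - u \<notin> supp B" using B by blast
    then show ?thesis by (simp add: supp_def)
  qed
  have "g \<in> supp A" using A by (simp add: supp_def)
  then have "coef (A * B) (g + h) = coef A g * (q powi bf g h * coef B h)"
    unfolding coef_mult[OF A(1)]
    by (subst sum.remove[of _ g]) (auto intro!: sum.neutral zero)
  then show ?thesis using A B le by (simp add: leads_def tor_mult q_nonzero)
qed

end

section \<open>Representations by quantum oscillators\<close>

lemma mult_assoc_subst: "x * y = w \<Longrightarrow> x * (y * z) = w * (z :: 'r :: semigroup_mult)"
  by (simp add: mult.assoc[symmetric])

lemma comm_mult: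
  fixes x y z :: "'r :: semigroup_mult"
  assumes "x * z = z * x" "y * z = z * y"
  shows "(x * y) * z = z * (x * y)"
  by (metis assms mult.assoc)

lemma interchange:
  fixes a b c d :: "'r :: semigroup_mult"
  assumes "b * c = c * b"
  shows "(a * b) * (c * d) = (a * c) * (b * d)"
  by (metis assms mult.assoc)

text \<open>\<open>x\<close> and \<open>y\<close> have the shape of coproducts of Serre generators.
  The rules bring each monomial into the order scalars, \<open>a\<close>, \<open>k\<close>,
  \<open>b\<close> and replace one word of each Serre relation; the mixed terms then cancel by the
  q-commutation of \<open>k\<close> with \<open>a\<close>. The coefficient q + 1/q is split into
  \<open>Q\<close> and \<open>P\<close>, so that scalars reduce by \<open>Q * P = 1\<close>
  alone.\<close>

lemma serre_step:
  fixes a1 a2 b1 b2 k1 k2 Q P :: "'r :: ring_1"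
  assumes Sa: "a1 * (a1 * a2) + a2 * (a1 * a1) = Q * (a1 * (a2 * a1)) + P * (a1 * (a2 * a1))"
    and Sb: "b1 * (b1 * b2) + b2 * (b1 * b1) = Q * (b1 * (b2 * b1)) + P * (b1 * (b2 * b1))"
    and Q: "\<And>z. z * Q = Q * z" "\<And>z. z * P = P * z" and QP: "Q * P = 1"
    and k: "k1 * a1 = Q * (Q * (a1 * k1))" "k1 * a2 = P * (a2 * k1)" "k2 * a1 = P * (a1 * k2)"
      "k2 * k1 = k1 * k2"
    and b: "b1 * a1 = a1 * b1" "b1 * a2 = a2 * b1" "b2 * a1 = a1 * b2" "b2 * a2 = a2 * b2"
      "b1 * k1 = k1 * b1" "b1 * k2 = k2 * b1" "b2 * k1 = k1 * b2" "b2 * k2 = k2 * b2"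
  defines "x \<equiv> a1 + k1 * b1" and "y \<equiv> a2 + k2 * b2"
  shows "x * (x * y) + y * (x * x) = Q * (x * (y * x)) + P * (x * (y * x))"
proof -
  have PQ: "P * Q = 1" using Q(1)[of P] QP by simp
  note cQ = Q(1)[of a1] Q(1)[of a2] Q(1)[of b1] Q(1)[of b2] Q(1)[of k1] Q(1)[of k2]
    Q(2)[of a1] Q(2)[of a2] Q(2)[of b1] Q(2)[of b2] Q(2)[of k1] Q(2)[of k2]
  note rules = cQ cQ[THEN mult_assoc_subst] QP PQ QP[THEN mult_assoc_subst] PQ[THEN mult_assoc_subst]
    k k[THEN mult_assoc_subst] b b[THEN mult_assoc_subst]
  have Sa': "a1 * (a1 * a2) = Q * (a1 * (a2 * a1)) + P * (a1 * (a2 * a1)) - a2 * (a1 * a1)"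
    using Sa by (simp add: eq_diff_eq)
  have Sb': "b1 * (b1 * b2) = Q * (b1 * (b2 * b1)) + P * (b1 * (b2 * b1)) - b2 * (b1 * b1)"
    using Sb by (simp add: eq_diff_eq)
  show ?thesis
    unfolding x_def y_def
    by (simp add: distrib_left distrib_right mult.assoc rules Sa' Sb' left_diff_distrib right_diff_distrib)
qed

lemma far_step:
  fixes a1 a2 b1 b2 k1 k2 :: "'r :: ring_1"
  assumes "a1 * a2 = a2 * a1" "b1 * b2 = b2 * b1"
    and k: "k1 * a2 = a2 * k1" "k2 * a1 = a1 * k2" "k2 * k1 = k1 * k2"
    and b: "b1 * a2 = a2 * b1" "b2 * a1 = a1 * b2" "b1 * k2 = k2 * b1" "b2 * k1 = k1 * b2"
  shows "(a1 + k1 * b1) * (a2 + k2 * b2) = (a2 + k2 * b2) * (a1 + k1 * b1)"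
proof -
  note r = assms(1,2) k b
  note rules = r r[THEN mult_assoc_subst]
  show ?thesis by (simp add: distrib_left distrib_right mult.assoc rules add_ac)
qed

definition cartan :: "nat \<Rightarrow> nat \<Rightarrow> int"
  where "cartan i j = (if i = j then 2 else if \<bar>int i - int j\<bar> = 1 then -1 else 0)"

lemma cartan_sym: "cartan i j = cartan j i"
  by (auto simp: cartan_def abs_minus_commute)

text \<open>The field enters through a map into the centre of a ring type. The same results then
  serve the operators with \<open>sc\<close> and the free algebra with
  \<open>fa_const\<close>.\<close>

locale central_field =
  fixes sca :: "'k::field \<Rightarrow> 'r::ring_1" and q :: 'k
  assumes sca_add: "sca (c + d) = sca c + sca d" and sca_mult: "sca (c * d) = sca c * sca d"
    and sca_one: "sca 1 = 1" and sca_comm: "x * sca c = sca c * x" and q0: "q \<noteq> 0"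
begin

lemma sca_left: "x * (sca c * y) = sca c * (x * y)"
  by (simp only: mult.assoc[symmetric] sca_comm)

lemma sca_zero: "sca 0 = 0" using sca_add[of 0 0] by simp

lemma sca_uminus: "sca (- c) = - sca c"
  using sca_add[of c "- c"] by (simp add: sca_zero eq_neg_iff_add_eq_0 add.commute)

lemma sca_diff: "sca (c - d) = sca c - sca d"
  using sca_add[of c "- d"] by (simp add: sca_uminus)

abbreviation Q where "Q \<equiv> sca q"
abbreviation P where "P \<equiv> sca (inverse q)"

lemma QP: "Q * P = 1" "P * Q = 1"
  by (simp_all add: q0 sca_one flip: sca_mult)

definition serre :: "nat \<Rightarrow> (nat \<Rightarrow> 'r) \<Rightarrow> bool"
  where "serre n x \<longleftrightarrow> (\<forall>i\<in>{1..<n}. \<forall>j\<in>{1..<n}.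
    (\<bar>int i - int j\<bar> > 1 \<longrightarrow> x i * x j = x j * x i) \<and>
    (\<bar>int i - int j\<bar> = 1 \<longrightarrow> x i * (x i * x j) + x j * (x i * x i) =
        Q * (x i * (x j * x i)) + P * (x i * (x j * x i))))"

definition torus_acts :: "nat \<Rightarrow> (nat \<Rightarrow> 'r) \<Rightarrow> (nat \<Rightarrow> 'r) \<Rightarrow> bool"
  where "torus_acts n k a \<longleftrightarrow> (\<forall>i\<in>{1..<n}. \<forall>j\<in>{1..<n}.
    k i * k j = k j * k i \<and> k i * a j = sca (q powi cartan i j) * (a j * k i))"

definition commuting :: "'r set \<Rightarrow> 'r set \<Rightarrow> bool"
  where "commuting S T \<longleftrightarrow> (\<forall>x\<in>S. \<forall>y\<in>T. x * y = y * x)"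

lemma serre_coproduct:
  assumes a: "serre n a" and b: "serre n b" and k: "torus_acts n k a"
    and c: "commuting (range b) (range a \<union> range k)"
  shows "serre n (\<lambda>i. a i + k i * b i)"
  unfolding serre_def
proof (intro ballI conjI impI)
  fix i j assume ij: "i \<in> {1..<n}" "j \<in> {1..<n}"
  have k': "k i * k j = k j * k i" "k i * a j = sca (q powi cartan i j) * (a j * k i)"
    if "i \<in> {1..<n}" "j \<in> {1..<n}" for i j
    using k that by (auto simp: torus_acts_def)
  have c': "b i * a j = a j * b i" "b i * k j = k j * b i" for i j
    using c by (auto simp: commuting_def)
  {
    assume far: "\<bar>int i - int j\<bar> > 1"
    then have "cartan i j = 0" "cartan j i = 0" by (auto simp: cartan_def)
    then show "(a i + k i * b i) * (a j + k j * b j) = (a j + k j * b j) * (a i + k i * b i)"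
      using a b far ij k'[of i j] k'[of j i] c'
      by (intro far_step) (auto simp: serre_def sca_one)
  next
    assume near: "\<bar>int i - int j\<bar> = 1"
    then have car: "cartan i j = -1" "cartan j i = -1" "cartan i i = 2" by (auto simp: cartan_def)
    show "(a i + k i * b i) * ((a i + k i * b i) * (a j + k j * b j)) +
        (a j + k j * b j) * ((a i + k i * b i) * (a i + k i * b i)) =
      Q * ((a i + k i * b i) * ((a j + k j * b j) * (a i + k i * b i))) +
      P * ((a i + k i * b i) * ((a j + k j * b j) * (a i + k i * b i)))"
    proof (rule serre_step)
      show "z * Q = Q * z" "z * P = P * z" for z by (rule sca_comm)+
      show "k i * a i = Q * (Q * (a i * k i))"
        using k'(2)[OF ij(1,1)] car by (simp add: sca_mult power2_eq_square mult.assoc)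
      show "k i * a j = P * (a j * k i)" "k j * a i = P * (a i * k j)"
        using k'(2)[OF ij] k'(2)[OF ij(2,1)] car by (simp_all add: power_int_minus)
    qed (use a b near ij c' k'(1) QP in \<open>auto simp: serre_def\<close>)
  }
qed

end

section \<open>Tensor products of contracted representations\<close>

definition qexp :: "nat \<Rightarrow> nat \<Rightarrow> int"
  where "qexp j i = of_bool (i = j) - of_bool (i + 1 = j)"

text \<open>
  The parameters \<open>\<alpha>\<close> and \<open>\<beta>\<close> interpolate between the quantum group and its contractions; in a
  coproduct the inner parameters have to match and cancel.
\<close>

locale qrep = central_field sca q
  for sca :: "'k::field \<Rightarrow> 'r::ring_1" and q :: 'k +
  fixes n :: nat and \<alpha> \<beta> :: "nat \<Rightarrow> 'k" and e f K L :: "nat \<Rightarrow> 'r"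
  assumes KK: "\<lbrakk>i \<in> {1..n}; j \<in> {1..n}\<rbrakk> \<Longrightarrow> K i * K j = K j * K i"
    and KL: "j \<in> {1..n} \<Longrightarrow> K j * L j = 1" "j \<in> {1..n} \<Longrightarrow> L j * K j = 1"
    and Ke: "\<lbrakk>i \<in> {1..<n}; j \<in> {1..n}\<rbrakk> \<Longrightarrow> K j * e i = sca (q powi qexp j i) * (e i * K j)"
    and Kf: "\<lbrakk>i \<in> {1..<n}; j \<in> {1..n}\<rbrakk> \<Longrightarrow> K j * f i = sca (q powi (- qexp j i)) * (f i * K j)"
    and ef: "\<lbrakk>i \<in> {1..<n}; j \<in> {1..<n}\<rbrakk> \<Longrightarrow> e i * f j - f j * e i =
      (if i = j then sca (inverse (q - inverse q)) *
         (sca (\<alpha> i) * (K i * L (i + 1)) - sca (\<beta> i) * (L i * K (i + 1))) else 0)"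
    and serre_e: "serre n e" and serre_f: "serre n f"
begin

definition k :: "nat \<Rightarrow> 'r" where "k i = K i * L (i + 1)"
definition l :: "nat \<Rightarrow> 'r" where "l i = L i * K (i + 1)"

lemma inv_commute:
  assumes "x * y = sca c * (y * x)" "x * x' = 1" "x' * x = 1" "c \<noteq> 0"
  shows "x' * y = sca (inverse c) * (y * x')"
proof -
  have "y * x' = x' * (x * y) * x'" using assms(3) by (simp flip: mult.assoc)
  also have "\<dots> = sca c * (x' * y * (x * x'))"
    by (simp only: assms(1)) (metis mult.assoc sca_comm)
  finally have "y * x' = sca c * (x' * y)" using assms(2) by simp
  then have "sca (inverse c) * (y * x') = sca (inverse c * c) * (x' * y)"
    by (simp add: sca_mult mult.assoc)
  then show ?thesis using assms(4) by (simp add: sca_one)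
qed

lemma KL_comm:
  assumes "i \<in> {1..n}" "j \<in> {1..n}"
  shows "K i * L j = L j * K i" "L i * L j = L j * L i"
proof -
  have *: "L j * K i = sca (inverse 1) * (K i * L j)" if "i \<in> {1..n}" "j \<in> {1..n}" for i j
    using that by (intro inv_commute[of "K j"]) (auto simp: sca_one KK KL)
  show KL': "K i * L j = L j * K i" using *[OF assms] by (simp add: sca_one)
  have "L j * L i = sca (inverse 1) * (L i * L j)"
    using assms *[of j i] *[of i j]
    by (intro inv_commute[of "K j"]) (auto simp: sca_one KL)
  then show "L i * L j = L j * L i" by (simp add: sca_one)
qed

lemma powi_nz: "q powi z \<noteq> 0" using q0 by simp

lemma Le: "\<lbrakk>i \<in> {1..<n}; j \<in> {1..n}\<rbrakk> \<Longrightarrow> L j * e i = sca (q powi (- qexp j i)) * (e i * L j)"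
  using inv_commute[OF Ke KL powi_nz] by (simp add: power_int_minus)

lemma Lf: "\<lbrakk>i \<in> {1..<n}; j \<in> {1..n}\<rbrakk> \<Longrightarrow> L j * f i = sca (q powi qexp j i) * (f i * L j)"
  using inv_commute[OF Kf KL powi_nz] by (simp add: power_int_minus)

lemma cartan_qexp: "i \<in> {1..<n} \<Longrightarrow> qexp i j - qexp (i + 1) j = cartan i j"
  unfolding qexp_def cartan_def by auto

lemma scale_mult:
  assumes "x * y = sca c * (y * x)" "x' * y = sca c' * (y * x')"
  shows "(x * x') * y = sca (c * c') * (y * (x * x'))"
proof -
  have "(x * x') * y = x * (sca c' * (y * x'))" using assms(2) by (simp add: mult.assoc)
  also have "\<dots> = sca c' * ((x * y) * x')" by (metis mult.assoc sca_comm)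
  also have "\<dots> = sca (c' * c) * (y * (x * x'))" using assms(1) by (simp add: mult.assoc sca_mult)
  finally show ?thesis by (simp add: mult.commute)
qed

lemma k_acts: "i \<in> {1..<n} \<Longrightarrow> j \<in> {1..<n} \<Longrightarrow> k i * e j = sca (q powi cartan i j) * (e j * k i)"
  "i \<in> {1..<n} \<Longrightarrow> j \<in> {1..<n} \<Longrightarrow> k i * f j = sca (q powi (- cartan i j)) * (f j * k i)"
  "i \<in> {1..<n} \<Longrightarrow> j \<in> {1..<n} \<Longrightarrow> l i * e j = sca (q powi (- cartan i j)) * (e j * l i)"
  "i \<in> {1..<n} \<Longrightarrow> j \<in> {1..<n} \<Longrightarrow> l i * f j = sca (q powi cartan i j) * (f j * l i)"
proof -
  assume ij: "i \<in> {1..<n}" "j \<in> {1..<n}"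
  then have i': "i \<in> {1..n}" "i + 1 \<in> {1..n}" by auto
  have pw: "q powi a * q powi b = q powi (a + b)" for a b by (simp add: power_int_add q0)
  show "k i * e j = sca (q powi cartan i j) * (e j * k i)"
    using scale_mult[OF Ke[OF ij(2) i'(1)] Le[OF ij(2) i'(2)]] cartan_qexp[OF ij(1), of j]
    by (simp add: k_def pw)
  show "k i * f j = sca (q powi (- cartan i j)) * (f j * k i)"
    using scale_mult[OF Kf[OF ij(2) i'(1)] Lf[OF ij(2) i'(2)]] cartan_qexp[OF ij(1), of j, symmetric]
    by (simp add: k_def pw)
  show "l i * e j = sca (q powi (- cartan i j)) * (e j * l i)"
    using scale_mult[OF Le[OF ij(2) i'(1)] Ke[OF ij(2) i'(2)]] cartan_qexp[OF ij(1), of j, symmetric]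
    by (simp add: l_def pw)
  show "l i * f j = sca (q powi cartan i j) * (f j * l i)"
    using scale_mult[OF Lf[OF ij(2) i'(1)] Kf[OF ij(2) i'(2)]] cartan_qexp[OF ij(1), of j]
    by (simp add: l_def pw)
qed

lemma kl_comm: "i \<in> {1..<n} \<Longrightarrow> j \<in> {1..<n} \<Longrightarrow> k i * k j = k j * k i"
  "i \<in> {1..<n} \<Longrightarrow> j \<in> {1..<n} \<Longrightarrow> l i * l j = l j * l i"
proof -
  assume ij: "i \<in> {1..<n}" "j \<in> {1..<n}"
  then have i': "i \<in> {1..n}" "i + 1 \<in> {1..n}" "j \<in> {1..n}" "j + 1 \<in> {1..n}" by auto
  have c: "K a * L b = L b * K a" "L b * K a = K a * L b" "K a * K b = K b * K a"
    "L a * L b = L b * L a" if "a \<in> {1..n}" "b \<in> {1..n}" for a b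
    using KL_comm[OF that] KK[OF that] by simp_all
  show "k i * k j = k j * k i" "l i * l j = l j * l i"
    unfolding k_def l_def by (intro comm_mult comm_mult[symmetric] c i')+
qed

lemma torus_acts_ke: "torus_acts n k e" and torus_acts_lf: "torus_acts n l f"
  using k_acts kl_comm by (auto simp: torus_acts_def)

definition gens :: "'r set"
  where "gens = range e \<union> range f \<union> range K \<union> range L"

lemma gens_mem: "e i \<in> gens" "f i \<in> gens" "K i \<in> gens" "L i \<in> gens"
  by (auto simp: gens_def)

text \<open>The Chevalley involution. Exchanging \<open>K\<close> with its inverse swaps the two
  torus terms of the commutator, and with them their coefficients.\<close>

lemma opposite: "qrep sca q n \<beta> \<alpha> f e L K"
proof (unfold_locales, goal_cases)
  case (6 i j)
  have "f i * e j - e j * f i = - (e j * f i - f i * e j)" by simp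
  then show ?case using ef[OF 6(2,1)]
    by (auto simp: right_diff_distrib)
qed (use KL_comm KL Le Lf serre_e serre_f in \<open>auto\<close>)

end

text \<open>The commutator of the combined generators is [e1, f1] l2 + k1 [e2, f2]. Both summands
  contribute a term in k1 l2, with coefficients proportional to \<open>\<alpha>1\<close> and
  \<open>- \<beta>2\<close>, which is where \<open>match\<close> enters.\<close>

lemma qrep_coproduct:
  assumes R1: "qrep sca q n \<alpha>1 \<beta>1 e1 f1 K1 L1" and R2: "qrep sca q n \<alpha>2 \<beta>2 e2 f2 K2 L2"
    and comm: "central_field.commuting (qrep.gens e1 f1 K1 L1) (qrep.gens e2 f2 K2 L2)"
    and match: "\<And>i. i \<in> {1..<n} \<Longrightarrow> \<alpha>1 i = \<beta>2 i"
  shows "qrep sca q n \<alpha>2 \<beta>1 (\<lambda>i. e1 i + qrep.k K1 L1 i * e2 i)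
    (\<lambda>i. f1 i * qrep.l K2 L2 i + f2 i) (\<lambda>i. K1 i * K2 i) (\<lambda>i. L1 i * L2 i)"
proof -
  interpret R1: qrep sca q n \<alpha>1 \<beta>1 e1 f1 K1 L1 by fact
  interpret R2: qrep sca q n \<alpha>2 \<beta>2 e2 f2 K2 L2 by fact
  have c: "x * y = y * x" if "x \<in> R1.gens" "y \<in> R2.gens" for x y
    using comm that by (auto simp: R1.commuting_def)
  note c1 = c[OF R1.gens_mem(1)] c[OF R1.gens_mem(2)] c[OF R1.gens_mem(3)] c[OF R1.gens_mem(4)]
  have kc: "R1.k i * y = y * R1.k i" "R1.l i * y = y * R1.l i" if "y \<in> R2.gens" for i y
    unfolding R1.k_def R1.l_def by (intro comm_mult c1[OF that])+
  have kc2: "x * R2.k i = R2.k i * x" "x * R2.l i = R2.l i * x" if "x \<in> R1.gens" for i x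
    unfolding R2.k_def R2.l_def by (intro comm_mult[symmetric] c[OF that, symmetric] R2.gens_mem)+
  have kk: "R1.k i * R2.l j = R2.l j * R1.k i" "R1.l i * R2.l j = R2.l j * R1.l i" for i j
    unfolding R2.l_def by (intro comm_mult[symmetric] kc[symmetric] R2.gens_mem)+
  show ?thesis
  proof (unfold_locales, goal_cases)
    case (1 i j)
    have "K1 i * K2 i * (K1 j * K2 j) = K1 i * K1 j * (K2 i * K2 j)" for i j
      by (intro interchange c1(3)[symmetric] R2.gens_mem)
    then show ?case using 1 R1.KK R2.KK by simp
  next
    case (2 j)
    have "K1 j * K2 j * (L1 j * L2 j) = K1 j * L1 j * (K2 j * L2 j)"
      by (intro interchange c1(4)[symmetric] R2.gens_mem)
    then show ?case using 2 R1.KL R2.KL by simp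
  next
    case (3 j)
    have "L1 j * L2 j * (K1 j * K2 j) = L1 j * K1 j * (L2 j * K2 j)"
      by (intro interchange c1(3)[symmetric] R2.gens_mem)
    then show ?case using 3 R1.KL R2.KL by simp
  next
    case (4 i j)
    then have kK: "R1.k i * K1 j = K1 j * R1.k i"
      unfolding R1.k_def by (intro comm_mult R1.KK R1.KL_comm(1)[symmetric]) auto
    have "K1 j * K2 j * (e1 i) = sca (q powi qexp j i) * (e1 i * (K1 j * K2 j))"
    proof -
      have "K1 j * K2 j * e1 i = K1 j * e1 i * K2 j"
        using c1(1)[OF R2.gens_mem(3), of i j] by (simp add: mult.assoc)
      then show ?thesis using R1.Ke[OF 4] by (simp add: mult.assoc)
    qed
    moreover have "K1 j * K2 j * (R1.k i * e2 i) = sca (q powi qexp j i) * (R1.k i * e2 i * (K1 j * K2 j))"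
    proof -
      have "K1 j * K2 j * (R1.k i * e2 i) = K1 j * R1.k i * (K2 j * e2 i)"
        by (intro interchange kc(1)[symmetric] R2.gens_mem)
      also have "\<dots> = sca (q powi qexp j i) * (R1.k i * (K1 j * e2 i) * K2 j)"
        unfolding R2.Ke[OF 4] kK[symmetric] by (simp add: mult.assoc R1.sca_left[of "R1.k i"] R1.sca_left[of "K1 j"])
      also have "\<dots> = sca (q powi qexp j i) * (R1.k i * e2 i * (K1 j * K2 j))"
        using c1(3)[OF R2.gens_mem(1)] by (simp add: mult.assoc)
      finally show ?thesis .
    qed
    ultimately show ?case by (simp add: distrib_left distrib_right)
  next
    case (5 i j)
    then have kK: "R2.l i * K2 j = K2 j * R2.l i"
      unfolding R2.l_def by (intro comm_mult R2.KK R2.KL_comm(1)[symmetric]) auto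
    have "K1 j * K2 j * f2 i = sca (q powi (- qexp j i)) * (f2 i * (K1 j * K2 j))"
    proof -
      have "K1 j * K2 j * f2 i = sca (q powi (- qexp j i)) * (K1 j * f2 i * K2 j)"
        using R2.Kf[OF 5] by (simp add: mult.assoc R1.sca_left)
      then show ?thesis using c1(3)[OF R2.gens_mem(2)] by (simp add: mult.assoc)
    qed
    moreover have "K1 j * K2 j * (f1 i * R2.l i) = sca (q powi (- qexp j i)) * (f1 i * R2.l i * (K1 j * K2 j))"
    proof -
      have "K1 j * K2 j * (f1 i * R2.l i) = K1 j * f1 i * (K2 j * R2.l i)"
        by (intro interchange c1(2)[symmetric] R2.gens_mem)
      also have "\<dots> = sca (q powi (- qexp j i)) * (f1 i * (K1 j * R2.l i) * K2 j)"
        unfolding R1.Kf[OF 5] kK[symmetric] by (simp add: mult.assoc)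
      also have "\<dots> = sca (q powi (- qexp j i)) * (f1 i * R2.l i * (K1 j * K2 j))"
        using kc2(2)[OF R1.gens_mem(3)] by (simp add: mult.assoc)
      finally show ?thesis .
    qed
    ultimately show ?case by (simp add: distrib_left distrib_right)
  next
    case (6 i j)
    have e1f2: "e1 i * f2 j = f2 j * e1 i" using c1(1)[OF R2.gens_mem(2)] .
    have x1: "e1 i * (f1 j * R2.l j) - (f1 j * R2.l j) * e1 i = (e1 i * f1 j - f1 j * e1 i) * R2.l j"
      using kc2(2)[OF R1.gens_mem(1)] by (simp add: left_diff_distrib mult.assoc)
    have x2: "(R1.k i * e2 i) * f2 j - f2 j * (R1.k i * e2 i) = R1.k i * (e2 i * f2 j - f2 j * e2 i)"
      using kc(1)[OF R2.gens_mem(2)] by (simp add: right_diff_distrib flip: mult.assoc)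
    \<comment> \<open>On one side \<open>f1\<close> passes \<open>R1.k\<close>, on the other
      \<open>R2.l\<close> passes \<open>e2\<close>; both cost the same power of \<open>q\<close>
      because the Cartan matrix is symmetric.\<close>
    have x3: "(R1.k i * e2 i) * (f1 j * R2.l j) = (f1 j * R2.l j) * (R1.k i * e2 i)"
    proof -
      let ?s = "sca (q powi cartan i j)" and ?s' = "sca (q powi (- cartan i j))"
      have ss: "?s' * ?s = 1"
        by (simp add: R1.q0 power_int_minus R1.sca_one flip: R1.sca_mult)
      have "(R1.k i * e2 i) * (f1 j * R2.l j) = (R1.k i * f1 j) * (e2 i * R2.l j)"
        by (intro interchange c1(2)[symmetric] R2.gens_mem)
      also have "\<dots> = ?s' * (f1 j * (R1.k i * (e2 i * R2.l j)))"
        unfolding R1.k_acts(2)[OF 6] by (simp add: mult.assoc)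
      finally have lhs: "(R1.k i * e2 i) * (f1 j * R2.l j) = ?s' * (f1 j * (R1.k i * (e2 i * R2.l j)))" .
      have "(f1 j * R2.l j) * (R1.k i * e2 i) = f1 j * (R1.k i * (R2.l j * e2 i))"
        unfolding mult.assoc by (simp only: kk(1)[of i j] mult.assoc mult.assoc[of "R1.k i" "R2.l j", symmetric])
      also have "\<dots> = ?s' * (f1 j * (R1.k i * (e2 i * R2.l j)))"
        unfolding R2.k_acts(3)[OF 6(2,1)] by (simp add: cartan_sym[of j i] R1.sca_left)
      finally show ?thesis using lhs by simp
    qed
    have "(e1 i + R1.k i * e2 i) * (f1 j * R2.l j + f2 j) - (f1 j * R2.l j + f2 j) * (e1 i + R1.k i * e2 i)
        = (e1 i * f1 j - f1 j * e1 i) * R2.l j + R1.k i * (e2 i * f2 j - f2 j * e2 i)"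
      unfolding x1[symmetric] x2[symmetric] by (simp add: distrib_left distrib_right e1f2 x3)
    also have "\<dots> = (if i = j then sca (inverse (q - inverse q)) *
         (sca (\<alpha>2 i) * (K1 i * K2 i * (L1 (i + 1) * L2 (i + 1))) -
          sca (\<beta>1 i) * (L1 i * L2 i * (K1 (i + 1) * K2 (i + 1)))) else 0)"
    proof (cases "i = j")
      case True
      let ?z = "sca (inverse (q - inverse q))"
      have k12: "K1 i * K2 i * (L1 (i + 1) * L2 (i + 1)) = R1.k i * R2.k i"
        unfolding R1.k_def R2.k_def by (intro interchange c1(4)[symmetric] R2.gens_mem)
      have l12: "L1 i * L2 i * (K1 (i + 1) * K2 (i + 1)) = R1.l i * R2.l i"
        unfolding R1.l_def R2.l_def by (intro interchange c1(3)[symmetric] R2.gens_mem)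
      have "(e1 i * f1 i - f1 i * e1 i) * R2.l i + R1.k i * (e2 i * f2 i - f2 i * e2 i) =
        ?z * (sca (\<alpha>1 i) * (R1.k i * R2.l i) - sca (\<beta>1 i) * (R1.l i * R2.l i)) +
        R1.k i * (?z * (sca (\<alpha>2 i) * R2.k i - sca (\<beta>2 i) * R2.l i))"
      proof -
        have "e1 i * f1 i - f1 i * e1 i = ?z * (sca (\<alpha>1 i) * R1.k i - sca (\<beta>1 i) * R1.l i)"
          using R1.ef[OF 6(1,1)] by (simp add: R1.k_def R1.l_def)
        moreover have "e2 i * f2 i - f2 i * e2 i = ?z * (sca (\<alpha>2 i) * R2.k i - sca (\<beta>2 i) * R2.l i)"
          using R2.ef[OF 6(1,1)] by (simp add: R2.k_def R2.l_def)
        ultimately show ?thesis by (simp only: left_diff_distrib mult.assoc)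
      qed
      also have "R1.k i * (?z * (sca (\<alpha>2 i) * R2.k i - sca (\<beta>2 i) * R2.l i)) =
        ?z * (sca (\<alpha>2 i) * (R1.k i * R2.k i) - sca (\<beta>2 i) * (R1.k i * R2.l i))"
        by (simp only: R1.sca_left[of "R1.k i"] right_diff_distrib)
      finally show ?thesis
        unfolding k12 l12 using match[OF 6(1)] by (simp add: True[symmetric] right_diff_distrib)
    next
      case False
      then show ?thesis using R1.ef[OF 6] R2.ef[OF 6] by simp
    qed
    finally show ?case .
  next
    case 7
    have "R1.commuting (range e2) (range e1 \<union> range R1.k)"
      unfolding R1.commuting_def using c1(1) kc(1) R2.gens_mem by auto
    then show ?case
      using R1.serre_coproduct[OF R1.serre_e R2.serre_e R1.torus_acts_ke] by simp
  next
    case 8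
    have "R1.commuting (range f1) (range f2 \<union> range R2.l)"
      unfolding R1.commuting_def using c1(2) kc2(2) R1.gens_mem R2.gens_mem by auto
    \<comment> \<open>For \<open>f\<close> the twist comes from the second factor, so
      \<open>serre_coproduct\<close> is used with the factors interchanged.\<close>
    then have "R1.serre n (\<lambda>i. f2 i + R2.l i * f1 i)"
      using R1.serre_coproduct[OF R2.serre_f R1.serre_f R2.torus_acts_lf] by simp
    moreover have "f2 i + R2.l i * f1 i = f1 i * R2.l i + f2 i" for i
      using kc2(2)[OF R1.gens_mem(2)] by (simp add: add.commute)
    ultimately show ?case by simp
  qed
qed

section \<open>Root vectors and their coproducts\<close>

context central_field
begin

definition br :: "'r \<Rightarrow> 'r \<Rightarrow> 'r" where "br x y = x * y - P * (y * x)"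

text \<open>Root vectors as iterated q-commutators: \<open>rt x d i\<close> belongs to the sum of
  the simple roots \<open>i\<close> to \<open>i + d\<close>, so \<open>d\<close> is the height minus
  one.\<close>

fun rt :: "(nat \<Rightarrow> 'r) \<Rightarrow> nat \<Rightarrow> nat \<Rightarrow> 'r"
  where
    "rt x 0 i = x i"
  | "rt x (Suc d) i = br (x i) (rt x d (Suc i))"

fun kk :: "(nat \<Rightarrow> 'r) \<Rightarrow> nat \<Rightarrow> nat \<Rightarrow> 'r"
  where
    "kk k 0 i = k i"
  | "kk k (Suc d) i = k i * kk k d (Suc i)"

lemma br_add: "br (x + x') y = br x y + br x' y" "br x (y + y') = br x y + br x y'"
  by (simp_all add: br_def algebra_simps)

lemma br_sum: "br x (sum g S) = (\<Sum>s\<in>S. br x (g s))"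
  by (simp add: br_def sum_distrib_left sum_distrib_right sum_subtractf)

lemma br_sca: "br x (sca c * y) = sca c * br x y" "br (sca c * x) y = sca c * br x y"
  by (simp_all add: br_def right_diff_distrib sca_left[of x] sca_left[of y] mult.assoc
      sca_left[of P] sca_left[of "y" _ x])

lemma br_mult_comm: "z * x = x * z \<Longrightarrow> br x (y * z) = br x y * z"
  by (simp add: br_def left_diff_distrib mult.assoc)

lemma br_scaled: "x * y = P * (y * x) \<Longrightarrow> br x y = 0"
  by (simp add: br_def)

lemma scaled_mult:
  assumes "z * x = sca c * (x * z)" "z * y = sca c' * (y * z)"
  shows "z * (x * y) = sca (c * c') * (x * y * z)"
proof -
  have "z * (x * y) = sca c * (x * (z * y))" using assms(1) by (simp flip: mult.assoc)
  also have "\<dots> = sca c * (sca c' * (x * (y * z)))" by (simp only: assms(2) sca_left[of x])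
  finally show ?thesis by (simp add: sca_mult mult.assoc)
qed

lemma rt_scale:
  assumes "\<And>m. m \<in> {i..i + d} \<Longrightarrow> z * x m = sca (c m) * (x m * z)"
  shows "z * rt x d i = sca (\<Prod>m\<in>{i..i + d}. c m) * (rt x d i * z)"
  using assms
proof (induction d arbitrary: i)
  case (Suc d)
  define C where "C = (\<Prod>m\<in>{Suc i..Suc i + d}. c m)"
  have R: "z * rt x d (Suc i) = sca C * (rt x d (Suc i) * z)"
    unfolding C_def using Suc.prems by (intro Suc.IH) auto
  have x: "z * x i = sca (c i) * (x i * z)" using Suc.prems by auto
  have pr: "(\<Prod>m\<in>{i..i + Suc d}. c m) = c i * C"
    by (simp add: C_def prod.atLeast_Suc_atMost)
  have "P * (sca (c i * C) * y) = sca (c i * C) * (P * y)" for y by (rule sca_left)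
  then show ?case
    unfolding pr using scaled_mult[OF x R] scaled_mult[OF R x]
    by (simp add: br_def right_diff_distrib left_diff_distrib sca_left[of z] mult.assoc
        mult.commute[of C])
qed simp

lemma rt_comm:
  assumes "\<And>m. m \<in> {i..i + d} \<Longrightarrow> z * x m = x m * z"
  shows "z * rt x d i = rt x d i * z"
  using rt_scale[of i d z x "\<lambda>_. 1"] assms by (simp add: sca_one)

lemma kk_scale:
  assumes "\<And>m. m \<in> {i..i + d} \<Longrightarrow> k m * z = sca (c m) * (z * k m)"
  shows "kk k d i * z = sca (\<Prod>m\<in>{i..i + d}. c m) * (z * kk k d i)"
  using assms
proof (induction d arbitrary: i)
  case (Suc d)
  define C where "C = (\<Prod>m\<in>{Suc i..Suc i + d}. c m)"
  have R: "kk k d (Suc i) * z = sca C * (z * kk k d (Suc i))"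
    unfolding C_def using Suc.prems by (intro Suc.IH) auto
  have x: "k i * z = sca (c i) * (z * k i)" using Suc.prems by auto
  have pr: "(\<Prod>m\<in>{i..i + Suc d}. c m) = c i * C"
    by (simp add: C_def prod.atLeast_Suc_atMost)
  have "kk k (Suc d) i * z = k i * (sca C * (z * kk k d (Suc i)))"
    by (simp add: R mult.assoc)
  also have "\<dots> = sca C * (k i * z * kk k d (Suc i))"
    by (simp add: sca_left[of "k i"] mult.assoc)
  also have "\<dots> = sca (C * c i) * (z * kk k (Suc d) i)"
    unfolding x by (simp add: sca_mult mult.assoc)
  finally show ?case by (simp only: pr mult.commute)
qed simp

lemma kk_comm:
  assumes "\<And>m. m \<in> {i..i + d} \<Longrightarrow> k m * z = z * k m"
  shows "kk k d i * z = z * kk k d i"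
  using kk_scale[of i d k z "\<lambda>_. 1"] assms by (simp add: sca_one)

text \<open>Within the range only the neighbour \<open>Suc i\<close> of \<open>i\<close> has a
  nonzero Cartan entry, and it is -1.\<close>

lemma prod_cartan:
  "(\<Prod>m\<in>{Suc i..Suc i + d}. q powi cartan i m) = inverse q"
  "(\<Prod>m\<in>{Suc i..Suc i + d}. q powi cartan m i) = inverse q"
proof -
  have *: "(\<Prod>m\<in>{Suc i..Suc i + d}. q powi cartan i m) = inverse q"
  proof -
    have "(\<Prod>m\<in>{Suc i..Suc i + d}. q powi cartan i m) =
        q powi cartan i (Suc i) * (\<Prod>m\<in>{Suc (Suc i)..Suc i + d}. q powi cartan i m)"
      by (simp add: prod.atLeast_Suc_atMost)
    also have "(\<Prod>m\<in>{Suc (Suc i)..Suc i + d}. q powi cartan i m) = 1"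
      by (rule prod.neutral) (auto simp: cartan_def)
    also have "q powi cartan i (Suc i) = inverse q" by (simp add: cartan_def power_int_minus)
    finally show ?thesis by simp
  qed
  then show "(\<Prod>m\<in>{Suc i..Suc i + d}. q powi cartan i m) = inverse q" .
  show "(\<Prod>m\<in>{Suc i..Suc i + d}. q powi cartan m i) = inverse q"
    using * by (simp add: cartan_sym)
qed

text \<open>Induction by bracketing with one more generator on the left. Its summand
  \<open>k i * b i\<close> extends the pure \<open>b\<close> term and annihilates all terms with
  \<open>a\<close> factors, whereas \<open>a i\<close> extends these factors. New mixed terms come
  from \<open>a i\<close> and the pure \<open>b\<close> term \<open>Y\<close>: since
  \<open>Y * a i\<close> is 1/q times \<open>a i * Y\<close>, their bracket is 1 - q^-2 times the
  product.\<close>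

theorem rt_coproduct:
  assumes a: "serre n a" and b: "serre n b" and k: "torus_acts n k a"
    and c: "commuting (range b) (range a \<union> range k)"
    and i: "1 \<le> i" "i + d < n"
  shows "rt (\<lambda>i. a i + k i * b i) d i = rt a d i + kk k d i * rt b d i +
    (\<Sum>m<d. sca (1 - (inverse q)\<^sup>2) *
      (rt a m i * (kk k (d - Suc m) (Suc (i + m)) * rt b (d - Suc m) (Suc (i + m)))))"
  using i
proof (induction d arbitrary: i)
  case (Suc d)
  have cba: "b r * a s = a s * b r" "b r * k s = k s * b r" for r s
    using c by (auto simp: commuting_def)
  have far: "a r * a s = a s * a r" "b r * b s = b s * b r" "k r * a s = a s * k r"
    if "r \<in> {1..<n}" "s \<in> {1..<n}" "\<bar>int r - int s\<bar> > 1" for r s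
    using a b k that by (auto simp: serre_def torus_acts_def cartan_def sca_one)
  have kks: "k r * k s = k s * k r" if "r \<in> {1..<n}" "s \<in> {1..<n}" for r s
    using k that by (auto simp: torus_acts_def)
  have ka: "k r * a s = sca (q powi cartan r s) * (a s * k r)" if "r \<in> {1..<n}" "s \<in> {1..<n}" for r s
    using k that by (auto simp: torus_acts_def)
  let ?l = "sca (1 - (inverse q)\<^sup>2)"
  define Ra where "Ra = rt a d (Suc i)"
  define Y where "Y = kk k d (Suc i) * rt b d (Suc i)"
  define U where "U m = kk k (d - Suc m) (Suc (Suc i + m)) * rt b (d - Suc m) (Suc (Suc i + m))" for m
  define T where "T m = rt a m (Suc i) * U m" for m
  have IH: "rt (\<lambda>i. a i + k i * b i) d (Suc i) = Ra + Y + (\<Sum>m<d. ?l * T m)"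
    using Suc by (simp add: Ra_def Y_def U_def T_def)
  have bRa: "b i * rt a m (Suc i) = rt a m (Suc i) * b i" for m
    by (rule rt_comm) (rule cba)
  have kRa: "k i * rt a m (Suc i) = P * (rt a m (Suc i) * k i)" if "m \<le> d" for m
    using rt_scale[of "Suc i" m "k i" a "\<lambda>m. q powi cartan i m"] ka Suc.prems that prod_cartan(1)[of i m]
    by auto
  have kbRa: "(k i * b i) * rt a m (Suc i) = P * (rt a m (Suc i) * (k i * b i))" if "m \<le> d" for m
  proof -
    have "(k i * b i) * rt a m (Suc i) = (k i * rt a m (Suc i)) * b i" by (simp add: mult.assoc bRa)
    then show ?thesis by (simp add: kRa[OF that] mult.assoc)
  qed
  have 2: "br (k i * b i) Ra = 0"
    unfolding Ra_def by (intro br_scaled kbRa) simp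
  have aY: "Y * a i = P * (a i * Y)"
  proof -
    have "rt b d (Suc i) * a i = a i * rt b d (Suc i)" by (rule rt_comm[symmetric]) (rule cba(1)[symmetric])
    moreover have "kk k d (Suc i) * a i = P * (a i * kk k d (Suc i))"
      using kk_scale[of "Suc i" d k "a i" "\<lambda>m. q powi cartan m i"] ka Suc.prems prod_cartan(2)[of i d]
      by auto
    ultimately show ?thesis unfolding Y_def by (simp add: mult.assoc) (simp flip: mult.assoc)
  qed
  have 3: "br (a i) Y = ?l * (a i * Y)"
    by (simp add: br_def aY power2_eq_square sca_diff sca_one sca_mult left_diff_distrib mult.assoc)
  have 4: "br (k i * b i) Y = kk k (Suc d) i * rt b (Suc d) i"
  proof -
    have bk: "b i * kk k d (Suc i) = kk k d (Suc i) * b i"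
      by (rule kk_comm[symmetric]) (rule cba(2)[symmetric])
    have kRb: "k i * rt b d (Suc i) = rt b d (Suc i) * k i"
      by (rule rt_comm) (rule cba(2)[symmetric])
    have kkk: "kk k d (Suc i) * k i = k i * kk k d (Suc i)"
      by (rule kk_comm) (use Suc.prems kks in auto)
    have "(k i * b i) * Y = k i * kk k d (Suc i) * (b i * rt b d (Suc i))"
      unfolding Y_def by (rule interchange) (rule bk)
    moreover have "Y * (k i * b i) = k i * kk k d (Suc i) * (rt b d (Suc i) * b i)"
      unfolding Y_def kkk[symmetric] by (rule interchange) (rule kRb[symmetric])
    ultimately show ?thesis by (simp add: br_def right_diff_distrib sca_left mult.assoc
          sca_left[of "k i"] sca_left[of "kk k d (Suc i)"])
  qed
  have 5: "br (a i) (T m) = rt a (Suc m) i * U m" if "m < d" for m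
  proof -
    have "rt b (d - Suc m) (Suc (Suc i + m)) * a i = a i * rt b (d - Suc m) (Suc (Suc i + m))"
      by (rule rt_comm[symmetric]) (rule cba(1)[symmetric])
    moreover have "kk k (d - Suc m) (Suc (Suc i + m)) * a i = a i * kk k (d - Suc m) (Suc (Suc i + m))"
      by (rule kk_comm) (use that Suc.prems in \<open>auto intro!: far\<close>)
    ultimately have "U m * a i = a i * U m" unfolding U_def by (intro comm_mult)
    then show ?thesis unfolding T_def by (simp add: br_mult_comm)
  qed
  have 6: "br (k i * b i) (T m) = 0" if "m < d" for m
  proof -
    have "rt b (d - Suc m) (Suc (Suc i + m)) * k i = k i * rt b (d - Suc m) (Suc (Suc i + m))"
      by (rule rt_comm[symmetric]) (rule cba(2)[symmetric])
    moreover have "kk k (d - Suc m) (Suc (Suc i + m)) * k i = k i * kk k (d - Suc m) (Suc (Suc i + m))"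
      by (rule kk_comm) (use that Suc.prems in \<open>auto intro!: kks\<close>)
    moreover have "rt b (d - Suc m) (Suc (Suc i + m)) * b i = b i * rt b (d - Suc m) (Suc (Suc i + m))"
      by (rule rt_comm[symmetric]) (use that Suc.prems in \<open>auto intro!: far\<close>)
    moreover have "kk k (d - Suc m) (Suc (Suc i + m)) * b i = b i * kk k (d - Suc m) (Suc (Suc i + m))"
      by (rule kk_comm) (rule cba(2)[symmetric])
    ultimately have "U m * (k i * b i) = (k i * b i) * U m"
      unfolding U_def by (intro comm_mult comm_mult[symmetric])
    then show ?thesis
      unfolding T_def using kbRa[of m] that by (subst br_mult_comm) (auto simp: br_scaled)
  qed
  have "rt (\<lambda>i. a i + k i * b i) (Suc d) i = br (a i + k i * b i) (Ra + Y + (\<Sum>m<d. ?l * T m))"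
    by (simp only: rt.simps IH)
  also have "\<dots> = br (a i) Ra + br (k i * b i) Y + (br (a i) Y +
      (\<Sum>m<d. ?l * br (a i) (T m))) + (\<Sum>m<d. ?l * br (k i * b i) (T m))"
    by (simp add: br_add br_sum br_sca 2 sum.distrib distrib_left)
  also have "(\<Sum>m<d. ?l * br (k i * b i) (T m)) = 0" by (simp add: 6)
  \<comment> \<open>The bracket with \<open>Y\<close> becomes the summand \<open>m = 0\<close>, and
    the old mixed terms move up by one.\<close>
  also have "br (a i) Y + (\<Sum>m<d. ?l * br (a i) (T m)) =
      (\<Sum>m<Suc d. ?l * (rt a m i * (kk k (Suc d - Suc m) (Suc (i + m)) * rt b (Suc d - Suc m) (Suc (i + m)))))"
    unfolding sum.lessThan_Suc_shift by (simp add: 3[unfolded Y_def] 5 U_def Y_def del: rt.simps(2))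
  also have "br (a i) Ra = rt a (Suc d) i" by (simp add: Ra_def)
  finally show ?case by (simp only: 4 add_0_right)
qed simp

text \<open>Expanding the bracket shows that the Serre relations of a neighbouring pair are
  q-commutations of the two generators with their bracket.\<close>

lemma serre_from_br:
  assumes "x * br x y = Q * (br x y * x)" "br x y * y = Q * (y * br x y)"
  shows "x * (x * y) + y * (x * x) = Q * (x * (y * x)) + P * (x * (y * x))"
    "y * (y * x) + x * (y * y) = Q * (y * (x * y)) + P * (y * (x * y))"
proof -
  have r: "Q * (P * z) = z" "P * (Q * z) = z" for z
    by (simp_all add: QP flip: mult.assoc)
  have 1: "x * br x y = x * (x * y) - P * (x * (y * x))" "br x y * y = x * (y * y) - P * (y * (x * y))"
    by (simp_all add: br_def right_diff_distrib left_diff_distrib sca_left[of x] mult.assoc)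
  have 2: "Q * (br x y * x) = Q * (x * (y * x)) - y * (x * x)"
    "Q * (y * br x y) = Q * (y * (x * y)) - y * (y * x)"
    by (simp_all add: br_def right_diff_distrib left_diff_distrib sca_left[of y] mult.assoc r)
  show "x * (x * y) + y * (x * x) = Q * (x * (y * x)) + P * (x * (y * x))"
    using assms(1) unfolding 1 2 by (simp add: algebra_simps)
  show "y * (y * x) + x * (y * y) = Q * (y * (x * y)) + P * (y * (x * y))"
    using assms(2) unfolding 1 2 by (simp add: algebra_simps)
qed

end

text \<open>Model: \<open>A\<close> is multiplication by a variable, \<open>t\<close> the q-shift of
  that variable with inverse \<open>u\<close>, and \<open>D\<close> a combination of both shifts
  divided by the variable. Vanishing coefficients \<open>a\<close> or \<open>b\<close> give
  contractions of the q-oscillator algebra.\<close>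

locale oscillators = central_field sca q
  for sca :: "'k::field \<Rightarrow> 'r::ring_1" and q :: 'k +
  fixes A D t u :: "nat \<Rightarrow> 'r" and a b :: "nat \<Rightarrow> 'k"
  assumes AA: "A r * A s = A s * A r" and DD: "D r * D s = D s * D r"
    and AD: "r \<noteq> s \<Longrightarrow> A r * D s = D s * A r"
    and tt: "t r * t s = t s * t r" and tA: "r \<noteq> s \<Longrightarrow> t r * A s = A s * t r"
    and tD: "r \<noteq> s \<Longrightarrow> t r * D s = D s * t r"
    and tu: "t r * u r = 1" "u r * t r = 1"
    and tA': "t r * A r = Q * (A r * t r)" and tD': "t r * D r = P * (D r * t r)"
    and AD': "A r * D r = sca (a r) * t r + sca (b r) * u r"
    and DA': "D r * A r = sca (a r * q) * t r + sca (b r * inverse q) * u r"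
    and qq: "q - inverse q \<noteq> 0"
begin

definition oe :: "nat \<Rightarrow> 'r" where "oe i = A i * D (Suc i)"
definition of' :: "nat \<Rightarrow> 'r" where "of' i = A (Suc i) * D i"
text \<open>The commutator of \<open>oe i\<close> and \<open>of' i\<close> is minus (q - 1/q) times
  the wanted difference of torus terms, whereas the quantum group has the factor 1/(q -
  1/q).\<close>

definition sc0 :: 'k where "sc0 = - inverse ((q - inverse q)\<^sup>2)"

lemma exchange: "x \<noteq> w \<Longrightarrow> y \<noteq> z \<Longrightarrow> (A x * D y) * (A z * D w) = (A z * D w) * (A x * D y)"
  by (intro comm_mult comm_mult[symmetric] AA DD AD AD[symmetric]) auto

lemma DA_AD: "D r * A r - P * (A r * D r) = sca ((q - inverse q) * a r) * t r"
  by (simp add: AD' DA' distrib_left left_diff_distrib sca_mult sca_diff mult.assoc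
      mult.commute[of _ q] mult.commute[of _ "inverse q"])

text \<open>The bracket contracts the shared index \<open>y\<close>: by \<open>DA_AD\<close> the
  \<open>u\<close> terms cancel and a multiple of \<open>t y\<close> remains. \<open>Z\<close> holds
  the factors accumulated by earlier brackets.\<close>

lemma br_pair:
  assumes "x \<noteq> y" "y \<noteq> z" "x \<noteq> z"
    and Z: "Z * D y = D y * Z" "Z * A x = A x * Z"
  shows "br (A x * D y) (A y * (Z * D z)) = sca ((q - inverse q) * a y) * (A x * (t y * (Z * D z)))"
proof -
  have 1: "(A x * D y) * (A y * (Z * D z)) = A x * (D y * A y) * (Z * D z)"
    by (simp add: mult.assoc)
  have "(A y * (Z * D z)) * (A x * D y) = A y * (Z * (D z * A x) * D y)" by (simp add: mult.assoc)
  also have "\<dots> = A y * ((Z * A x) * (D z * D y))"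
    using AD[OF assms(3), symmetric] AD[OF assms(3), symmetric, THEN mult_assoc_subst]
    by (simp add: mult.assoc)
  also have "\<dots> = A y * (A x * Z * (D z * D y))" by (simp only: Z(2))
  also have "\<dots> = A y * A x * (Z * D y) * D z" using DD[of z y] by (simp add: mult.assoc)
  also have "\<dots> = A x * (A y * D y) * (Z * D z)" using Z(1) AA[of y x] by (simp add: mult.assoc[symmetric])
  finally have 2: "(A y * (Z * D z)) * (A x * D y) = A x * (A y * D y) * (Z * D z)" .
  have "br (A x * D y) (A y * (Z * D z)) = A x * (D y * A y - P * (A y * D y)) * (Z * D z)"
    unfolding br_def 1 2 by (simp add: left_diff_distrib right_diff_distrib sca_left[of "A x"] mult.assoc)
  also have "\<dots> = sca ((q - inverse q) * a y) * (A x * (t y * (Z * D z)))"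
    unfolding DA_AD by (simp add: sca_left[of "A x"] mult.assoc)
  finally show ?thesis .
qed

text \<open>By \<open>br_pair\<close> the bracket of the pair is a scalar times one product, which
  q-commutes with both factors. The indices are arbitrary but distinct because \<open>oe\<close>
  runs through them upwards and \<open>of'\<close> downwards.\<close>

lemma serre_triple:
  assumes "x \<noteq> y" "y \<noteq> z" "x \<noteq> z"
  defines "U \<equiv> A x * D y" and "Y \<equiv> A y * D z"
  shows "U * (U * Y) + Y * (U * U) = Q * (U * (Y * U)) + P * (U * (Y * U))"
    "Y * (Y * U) + U * (Y * Y) = Q * (Y * (U * Y)) + P * (Y * (U * Y))"
proof -
  let ?E = "A x * (t y * D z)" and ?c = "sca ((q - inverse q) * a y)"
  have br: "br U Y = ?c * ?E"
    using br_pair[OF assms(1-3), of 1] by (simp add: U_def Y_def)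
  have Dt: "D y * t y = Q * (t y * D y)"
  proof -
    have "Q * (t y * D y) = Q * (P * (D y * t y))" by (simp add: tD')
    then show ?thesis by (simp add: QP flip: mult.assoc)
  qed
  have 1: "U * ?E = Q * (?E * U)"
  proof -
    have "U * ?E = A x * (D y * A x) * (t y * D z)" by (simp add: U_def mult.assoc)
    also have "\<dots> = A x * A x * (D y * t y) * D z"
      using AD[OF assms(1), symmetric, THEN mult_assoc_subst] by (simp add: mult.assoc)
    also have "\<dots> = Q * (A x * A x * (t y * D y) * D z)"
      unfolding Dt by (simp add: sca_left[of "A x"] mult.assoc)
    also have "A x * A x * (t y * D y) * D z = A x * (A x * t y) * (D y * D z)" by (simp add: mult.assoc)
    also have "\<dots> = A x * (t y * A x) * (D z * D y)" using tA[of y x] assms(1) DD[of y z] by simp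
    also have "\<dots> = A x * t y * (A x * D z) * D y" by (simp add: mult.assoc)
    also have "\<dots> = A x * t y * (D z * A x) * D y" using AD[of x z] assms(3) by simp
    finally show ?thesis by (simp add: U_def mult.assoc)
  qed
  have 2: "?E * Y = Q * (Y * ?E)"
  proof -
    have "?E * Y = A x * t y * (D z * A y) * D z" by (simp add: Y_def mult.assoc)
    also have "\<dots> = A x * (t y * A y) * (D z * D z)" using AD[OF assms(2), symmetric, THEN mult_assoc_subst] by (simp add: mult.assoc)
    also have "\<dots> = Q * (A x * A y * t y * D z * D z)"
      unfolding tA' by (simp add: sca_left[of "A x"] mult.assoc)
    also have "A x * A y * t y * D z * D z = A y * A x * (t y * D z) * D z"
      using AA[of x y] by (simp add: mult.assoc)
    also have "\<dots> = A y * A x * (D z * t y) * D z" using tD[of y z] assms(2) by simp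
    also have "\<dots> = A y * (A x * D z) * (t y * D z)" by (simp add: mult.assoc)
    also have "\<dots> = A y * (D z * A x) * (t y * D z)" using AD[of x z] assms(3) by simp
    finally show ?thesis by (simp add: Y_def mult.assoc)
  qed
  have "U * br U Y = Q * (br U Y * U)" "br U Y * Y = Q * (Y * br U Y)"
    unfolding br using 1 2 by (simp_all add: sca_left[of U] sca_left[of Y] sca_left[of Q] mult.assoc)
  from serre_from_br[OF this]
  show "U * (U * Y) + Y * (U * U) = Q * (U * (Y * U)) + P * (U * (Y * U))"
    "Y * (Y * U) + U * (Y * Y) = Q * (Y * (U * Y)) + P * (Y * (U * Y))" .
qed

lemma serre_scale:
  assumes "serre n x" shows "serre n (\<lambda>i. sca c * x i)"
proof -
  have *: "sca c * x i * (sca c * x j) = sca c * (sca c * (x i * x j))" for i j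
    by (simp add: sca_left[of "x i"] mult.assoc)
  have **: "sca c * x r * (sca c * (sca c * y)) = sca c * (sca c * (sca c * (x r * y)))" for r y
    by (simp add: sca_left[of "x r"] mult.assoc)
  have ***: "Q * (sca c * y) = sca c * (Q * y)" "P * (sca c * y) = sca c * (P * y)" for y
    by (rule sca_left)+
  show ?thesis
    using assms unfolding serre_def * ** *** by (auto simp flip: distrib_left)
qed

lemma serre_oe: "serre n oe"
  unfolding serre_def
proof (intro ballI conjI impI)
  fix i j assume "\<bar>int i - int j\<bar> > 1"
  then show "oe i * oe j = oe j * oe i" unfolding oe_def by (intro exchange) auto
next
  fix i j assume "\<bar>int i - int j\<bar> = 1"
  then consider "j = Suc i" | "i = Suc j" by linarith
  then show "oe i * (oe i * oe j) + oe j * (oe i * oe i) =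
      Q * (oe i * (oe j * oe i)) + P * (oe i * (oe j * oe i))"
    unfolding oe_def using serre_triple[of i "Suc i" "Suc (Suc i)"] serre_triple[of j "Suc j" "Suc (Suc j)"]
    by cases simp_all
qed

lemma serre_of: "serre n of'"
  unfolding serre_def
proof (intro ballI conjI impI)
  fix i j assume "\<bar>int i - int j\<bar> > 1"
  then show "of' i * of' j = of' j * of' i" unfolding of'_def by (intro exchange) auto
next
  fix i j assume "\<bar>int i - int j\<bar> = 1"
  then consider "j = Suc i" | "i = Suc j" by linarith
  then show "of' i * (of' i * of' j) + of' j * (of' i * of' i) =
      Q * (of' i * (of' j * of' i)) + P * (of' i * (of' j * of' i))"
    unfolding of'_def using serre_triple[of "Suc (Suc i)" "Suc i" i] serre_triple[of "Suc (Suc j)" "Suc j" j]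
    by cases simp_all
qed

lemma t_scale: "t j * A i = sca (q powi of_bool (i = j)) * (A i * t j)"
  "t j * D i = sca (q powi (- of_bool (i = j))) * (D i * t j)"
  using tA[of j i] tD[of j i] tA'[of j] tD'[of j]
  by (auto simp: sca_one power_int_minus)

lemma t_scale_pair: "t j * (A i * D l) = sca (q powi (of_bool (i = j) - of_bool (l = j))) * (A i * D l * t j)"
  using scaled_mult[OF t_scale(1)[of j i] t_scale(2)[of j l]] q0
  by (simp add: power_int_add[symmetric])

text \<open>Each of the two torus terms is weighted by one product of oscillator coefficients at
  neighbouring indices. Setting a coefficient to zero removes torus terms selectively; this is the
  source of the contractions.\<close>

lemma qrep: "qrep sca q n (\<lambda>i. a i * b (Suc i)) (\<lambda>i. a (Suc i) * b i) oe (\<lambda>i. sca sc0 * of' i) t u"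
proof (unfold_locales, goal_cases)
  case (4 i j)
  then show ?case unfolding oe_def t_scale_pair by (simp add: qexp_def)
next
  case (5 i j)
  have "of_bool (Suc i = j) - of_bool (i = j) = - qexp j i" by (simp add: qexp_def)
  then show ?case
    unfolding of'_def using t_scale_pair[of j "Suc i" i]
    by (simp add: sca_left[of "t j"] mult.assoc sca_left[of "sca sc0"])
next
  case (6 i j)
  show ?case
  proof (cases "i = j")
    case False
    then have "oe i * of' j = of' j * oe i" unfolding oe_def of'_def by (intro exchange) auto
    then show ?thesis using False by (simp add: sca_left[of "oe i"] mult.assoc)
  next
    case True
    let ?j = "Suc i"
    have ut: "u x * t y = t y * u x" "u x * u y = u y * u x" if "x \<noteq> y" for x y
    proof -
      have ut: "u x * t y = t y * u x" for x y
      proof -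
        have "u x * t y = u x * (t y * t x) * u x" by (simp add: mult.assoc tu)
        also have "\<dots> = (u x * t x) * t y * u x" unfolding tt[of y x] by (simp add: mult.assoc)
        finally show ?thesis by (simp add: tu)
      qed
      then show "u x * t y = t y * u x" .
      have "u x * u y = u x * (u y * t x) * u x" by (simp add: mult.assoc tu)
      also have "\<dots> = (u x * t x) * u y * u x" unfolding ut[of y x] by (simp add: mult.assoc)
      finally show "u x * u y = u y * u x" by (simp add: tu)
    qed
    have "(A i * D ?j) * (A ?j * D i) = (D ?j * A ?j) * (A i * D i)"
    proof -
      have "(A i * D ?j) * (A ?j * D i) = A i * (D ?j * A ?j) * D i" by (simp add: mult.assoc)
      also have "A i * (D ?j * A ?j) = (D ?j * A ?j) * A i"
        by (intro comm_mult[symmetric] AA AD[symmetric]) simp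
      finally show ?thesis by (simp add: mult.assoc)
    qed
    moreover have "(A ?j * D i) * (A i * D ?j) = (A ?j * D ?j) * (D i * A i)"
    proof -
      have "(A ?j * D i) * (A i * D ?j) = A ?j * ((D i * A i) * D ?j)" by (simp add: mult.assoc)
      also have "(D i * A i) * D ?j = D ?j * (D i * A i)"
        by (intro comm_mult DD AD) simp
      finally show ?thesis by (simp add: mult.assoc)
    qed
    ultimately have "oe i * of' i - of' i * oe i =
        (sca (a ?j * q) * t ?j + sca (b ?j * inverse q) * u ?j) * (sca (a i) * t i + sca (b i) * u i) -
        (sca (a ?j) * t ?j + sca (b ?j) * u ?j) * (sca (a i * q) * t i + sca (b i * inverse q) * u i)"
      by (simp add: oe_def of'_def AD' DA')
    also have "\<dots> = sca (a ?j * q * b i - a ?j * (b i * inverse q)) * (t ?j * u i) +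
        sca (b ?j * inverse q * a i - b ?j * (a i * q)) * (u ?j * t i)"
    proof -
      have *: "(sca x * y) * (sca z * w) = sca (x * z) * (y * w)" for x y z w
        by (simp add: sca_left[of y] sca_mult mult.assoc)
      show ?thesis
        unfolding distrib_left distrib_right * by (simp add: sca_diff left_diff_distrib mult_ac)
    qed
    also have "\<dots> = sca ((q - inverse q) * (a ?j * b i)) * (u i * t ?j) -
        sca ((q - inverse q) * (a i * b ?j)) * (t i * u ?j)"
      using ut(1)[of i ?j] ut(1)[of ?j i] by (simp add: sca_diff left_diff_distrib algebra_simps)
    finally have c: "oe i * of' i - of' i * oe i = sca ((q - inverse q) * (a ?j * b i)) * (u i * t ?j) -
        sca ((q - inverse q) * (a i * b ?j)) * (t i * u ?j)" .
    have s: "sc0 * ((q - inverse q) * x) = - (inverse (q - inverse q) * x)" for x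
    proof -
      have "- inverse (w\<^sup>2) * (w * x) = - (inverse w * x)" if "w \<noteq> 0" for w :: 'k
        using that by (simp add: power2_eq_square)
      from this[OF qq] show ?thesis unfolding sc0_def .
    qed
    have "oe i * (sca sc0 * of' i) - sca sc0 * of' i * oe i = sca sc0 * (oe i * of' i - of' i * oe i)"
      by (simp add: sca_left[of "oe i"] right_diff_distrib mult.assoc)
    also have "\<dots> = sca (sc0 * ((q - inverse q) * (a ?j * b i))) * (u i * t ?j) -
        sca (sc0 * ((q - inverse q) * (a i * b ?j))) * (t i * u ?j)"
      unfolding c by (simp only: right_diff_distrib sca_mult mult.assoc)
    also have "\<dots> = sca (inverse (q - inverse q)) *
         (sca (a i * b ?j) * (t i * u ?j) - sca (a ?j * b i) * (u i * t ?j))"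
      unfolding s by (simp add: sca_uminus sca_mult right_diff_distrib mult.assoc)
    finally show ?thesis using True by simp
  qed
next
  case 7 show ?case by (rule serre_oe)
next
  case 8 show ?case by (rule serre_scale[OF serre_of])
qed (use tt tu in auto)

fun tprod :: "nat \<Rightarrow> nat \<Rightarrow> 'r"
  where
    "tprod 0 i = 1"
  | "tprod (Suc d) i = t (Suc i) * tprod d (Suc i)"

lemma tprod_comm:
  "r \<le> i \<Longrightarrow> tprod d i * D r = D r * tprod d i" "r \<le> i \<Longrightarrow> tprod d i * A r = A r * tprod d i"
  by (induction d arbitrary: i) (auto intro!: comm_mult tA tD)

text \<open>Each bracket contracts one inner index by \<open>br_pair\<close> and leaves its
  \<open>t\<close> and a factor \<open>(q - inverse q) * a m\<close>. So within one copy a root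
  vector is a single product.\<close>

lemma rt_oe: "rt oe d i = sca ((q - inverse q) ^ d * (\<Prod>m\<in>{Suc i..i + d}. a m)) *
    (A i * (tprod d i * D (Suc (i + d))))"
proof (induction d arbitrary: i)
  case 0
  show ?case by (simp add: oe_def sca_one)
next
  case (Suc d)
  have pr: "(\<Prod>m\<in>{Suc i..i + Suc d}. a m) = a (Suc i) * (\<Prod>m\<in>{Suc (Suc i)..Suc i + d}. a m)"
    by (simp add: prod.atLeast_Suc_atMost)
  let ?c = "(q - inverse q) ^ d * (\<Prod>m\<in>{Suc (Suc i)..Suc i + d}. a m)"
  have "br (oe i) (A (Suc i) * (tprod d (Suc i) * D (Suc (Suc i + d)))) =
      sca ((q - inverse q) * a (Suc i)) * (A i * (t (Suc i) * (tprod d (Suc i) * D (Suc (Suc i + d)))))"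
    unfolding oe_def
    by (rule br_pair) (auto intro: tprod_comm)
  then have "rt oe (Suc d) i = sca ?c * (sca ((q - inverse q) * a (Suc i)) *
      (A i * (t (Suc i) * (tprod d (Suc i) * D (Suc (Suc i + d))))))"
    by (simp add: Suc br_sca)
  also have "\<dots> = sca (?c * ((q - inverse q) * a (Suc i))) * (A i * (tprod (Suc d) i * D (Suc (i + Suc d))))"
    by (simp add: sca_mult mult.assoc)
  also have "?c * ((q - inverse q) * a (Suc i)) = (q - inverse q) ^ Suc d * (\<Prod>m\<in>{Suc i..i + Suc d}. a m)"
    unfolding pr by (simp add: mult_ac)
  finally show ?case .
qed

end

section \<open>A homomorphism into a quantum torus\<close>

type_synonym expo = "(nat \<times> nat \<times> nat \<times> nat) \<Rightarrow>\<^sub>0 int"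

text \<open>The least index at which two exponents differ decides, so coordinates with small indices
  dominate.\<close>

lemma expo_less:
  assumes "Poly_Mapping.lookup g p < Poly_Mapping.lookup h p"
    "\<And>p'. p' < p \<Longrightarrow> Poly_Mapping.lookup g p' = Poly_Mapping.lookup h p'"
  shows "g < (h :: expo)"
  using assms unfolding less_poly_mapping.rep_eq less_fun_def by blast

text \<open>This permits bringing the parameters into closed form after each coproduct.\<close>

lemma qrep_cong:
  assumes "qrep sca q n \<alpha> \<beta> e f K L" "\<And>i. i \<in> {1..<n} \<Longrightarrow> \<alpha> i = \<alpha>' i" "\<And>i. i \<in> {1..<n} \<Longrightarrow> \<beta> i = \<beta>' i"
  shows "qrep sca q n \<alpha>' \<beta>' e f K L"
proof -
  interpret qrep sca q n \<alpha> \<beta> e f K L by fact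
  show ?thesis
    by unfold_locales (use KK KL Ke Kf ef serre_e serre_f assms(2,3) in auto)
qed

text \<open>
  The coordinate \<open>(1, s, n - c, k)\<close> is the exponent of the variable \<open>x\<^sub>k\<close> of the \<open>c\<close>-th copy of the
  oscillator algebra on the side \<open>s\<close>, and \<open>(2, s, n - c, k)\<close> that of its shift operator. The
  lexicographic order looks at copies with larger \<open>c\<close> first. The coordinate \<open>(0, 0, 0, 0)\<close> dominates;
  it is a redundant degree that makes the two sides count with opposite signs.
\<close>

locale gl_torus =
  fixes n :: nat and q :: "'k::field"
  assumes q0': "q \<noteq> 0" and qq': "q - inverse q \<noteq> 0"
begin

text \<open>Shift exponents of the left argument are paired with variable exponents of the right
  one. Thus t x = q x t for a variable and its own shift, and all other pairs commute. The ranges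
  cover the sides, the copies and the variables.\<close>

definition bform :: "expo \<Rightarrow> expo \<Rightarrow> int"
  where "bform g h = (\<Sum>s<2. \<Sum>a\<le>n. \<Sum>k\<le>n.
    Poly_Mapping.lookup g (2, s, a, k) * Poly_Mapping.lookup h (1, s, a, k))"

lemma bform_add: "bform (g + g') h = bform g h + bform g' h" "bform g (h + h') = bform g h + bform g h'"
  unfolding bform_def
  by (simp_all only: sum.distrib[symmetric] lookup_add distrib_left distrib_right)

sublocale twisted_torus q bform
  by unfold_locales (rule q0' bform_add)+

sublocale central_field "sc :: 'k \<Rightarrow> (expo, 'k) linop" q
  by unfold_locales (rule sc_simps(1-3) sc_comm q0')+

text \<open>The entry at \<open>(0, 0, 0, 0)\<close> gives the variable \<open>k\<close> the degree
  \<open>- k\<close>. On either side every \<open>e i\<close> then has degree 1 and every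
  \<open>f i\<close> degree -1.\<close>

definition xv :: "nat \<Rightarrow> nat \<Rightarrow> nat \<Rightarrow> expo"
  where "xv s c k = Poly_Mapping.single (1, s, n - c, k) 1 - Poly_Mapping.single (0, 0, 0, 0) (int k)"

definition tv :: "nat \<Rightarrow> nat \<Rightarrow> nat \<Rightarrow> expo"
  where "tv s c k = Poly_Mapping.single (2, s, n - c, k) 1"

lemma lookup_xv: "Poly_Mapping.lookup (xv s c k) p =
    (if p = (1, s, n - c, k) then 1 else if p = (0, 0, 0, 0) then - int k else 0)"
  by (auto simp: xv_def lookup_minus lookup_single when_def)

lemma lookup_tv: "Poly_Mapping.lookup (tv s c k) p = (if p = (2, s, n - c, k) then 1 else 0)"
  by (auto simp: tv_def lookup_single when_def)

lemma bform_0: "(\<And>r. Poly_Mapping.lookup g (2, r) = 0 \<or> Poly_Mapping.lookup h (1, r) = 0) \<Longrightarrow> bform g h = 0"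
  unfolding bform_def by (intro sum.neutral ballI) (metis mult_eq_0_iff)

lemma bform_xv [simp]: "bform (xv s c k) h = 0" "bform (- xv s c k) h = 0"
  by (rule bform_0; simp add: lookup_xv)+

lemma bform_tv_tv [simp]: "bform (tv s c k) (tv s' c' k') = 0"
  by (rule bform_0) (simp add: lookup_tv)

lemma bform_tv_xv:
  assumes "s < 2" "c \<le> n" "c' \<le> n" "k \<le> n"
  shows "bform (tv s c k) (xv s' c' k') = of_bool (s = s' \<and> c = c' \<and> k = k')"
proof (cases "s = s' \<and> c = c' \<and> k = k'")
  case True
  have "bform (tv s c k) (xv s' c' k') = (\<Sum>r<2. \<Sum>a\<le>n. \<Sum>l\<le>n. if l = k then (if a = n - c then (if r = s then 1 else 0) else 0) else 0)"
    unfolding bform_def by (intro sum.cong refl) (use True in \<open>auto simp: lookup_xv lookup_tv\<close>)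
  also have "\<dots> = 1" using assms by simp
  finally show ?thesis using True by simp
next
  case False
  then have "bform (tv s c k) (xv s' c' k') = 0"
    using assms by (intro bform_0) (auto simp: lookup_tv lookup_xv)
  then show ?thesis using False by (simp only: of_bool_def if_False)
qed

lemma mon_commute: "bform g h = 0 \<Longrightarrow> bform h g = 0 \<Longrightarrow> mon g * mon h = mon h * mon g"
  by (simp add: mon_mult sca_one add.commute)

lemma mon_scale: "bform h g = 0 \<Longrightarrow> mon g * mon h = sc (q powi bform g h) * (mon h * mon g)"
  by (simp add: mon_mult sca_one add.commute)

lemma mon_inverse: "bform g g = 0 \<Longrightarrow> mon g * mon (- g) = 1" "bform g g = 0 \<Longrightarrow> mon (- g) * mon g = 1"
  by (simp_all add: mon_mult bf_minus sca_one mon_zero)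

section \<open>Commuting copies of the oscillator algebra\<close>

inductive_set alg :: "expo set \<Rightarrow> (expo, 'k) linop set" for G
  where
    alg_mon: "g \<in> G \<Longrightarrow> mon g \<in> alg G"
  | alg_zero: "0 \<in> alg G"
  | alg_one: "1 \<in> alg G"
  | alg_add: "A \<in> alg G \<Longrightarrow> B \<in> alg G \<Longrightarrow> A + B \<in> alg G"
  | alg_mult: "A \<in> alg G \<Longrightarrow> B \<in> alg G \<Longrightarrow> A * B \<in> alg G"
  | alg_sc: "A \<in> alg G \<Longrightarrow> sc c * A \<in> alg G"

lemma alg_mono: "G \<subseteq> H \<Longrightarrow> alg G \<subseteq> alg H"
proof
  fix A assume "A \<in> alg G" "G \<subseteq> H"
  then show "A \<in> alg H" by (induction rule: alg.induct) (auto intro: alg.intros)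
qed

lemma alg_commuting:
  assumes "\<And>g h. g \<in> G \<Longrightarrow> h \<in> H \<Longrightarrow> mon g * mon h = mon h * mon g"
  shows "commuting (alg G) (alg H)"
proof -
  have 1: "A * mon h = mon h * A" if "A \<in> alg G" "h \<in> H" for A h
    using that(1)
  proof (induction rule: alg.induct)
    case (alg_sc A c)
    then show ?case by (simp add: sca_left[of "mon h"] mult.assoc)
  qed (use assms that(2) comm_mult in \<open>auto simp: distrib_left distrib_right\<close>)
  have "A * B = B * A" if "A \<in> alg G" "B \<in> alg H" for A B
    using that(2)
  proof (induction rule: alg.induct)
    case (alg_mult B C)
    then show ?case by (metis comm_mult)
  next
    case (alg_sc B c)
    then show ?case by (simp add: sca_left[of A] mult.assoc)
  qed (use 1 that(1) in \<open>auto simp: distrib_left distrib_right\<close>)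
  then show ?thesis unfolding commuting_def by blast
qed

definition copy_expos :: "nat \<Rightarrow> nat set \<Rightarrow> expo set"
  where "copy_expos s C = {g. \<exists>c\<in>C. \<exists>k\<in>{1..n}. g \<in> {xv s c k, - xv s c k, tv s c k, - tv s c k}}"

text \<open>Exponents of different copies have at most the degree coordinate in common, and the
  degree does not enter \<open>bform\<close>.\<close>

lemma copies_commute:
  assumes "s < 2" "s' < 2" "C \<subseteq> {1..n}" "C' \<subseteq> {1..n}" "s \<noteq> s' \<or> C \<inter> C' = {}"
  shows "commuting (alg (copy_expos s C)) (alg (copy_expos s' C'))"
proof (rule alg_commuting)
  fix g h assume "g \<in> copy_expos s C" "h \<in> copy_expos s' C'"
  then obtain c k c' k' where *: "c \<in> C" "c' \<in> C'" "k \<in> {1..n}" "k' \<in> {1..n}"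
      "g \<in> {xv s c k, - xv s c k, tv s c k, - tv s c k}"
      "h \<in> {xv s' c' k', - xv s' c' k', tv s' c' k', - tv s' c' k'}"
    by (auto simp: copy_expos_def)
  have r: "c \<le> n" "c' \<le> n" "k \<le> n" "k' \<le> n" "\<not> (s = s' \<and> c = c' \<and> k = k')" "\<not> (s' = s \<and> c' = c \<and> k' = k)"
  proof -
    show "c \<le> n" "c' \<le> n" using subsetD[OF assms(3) *(1)] subsetD[OF assms(4) *(2)] by auto
    show "k \<le> n" "k' \<le> n" using *(3,4) by auto
    have "\<not> (s = s' \<and> c = c')" using assms(5) *(1,2) by blast
    then show "\<not> (s = s' \<and> c = c' \<and> k = k')" "\<not> (s' = s \<and> c' = c \<and> k' = k)" by auto
  qed
  have "bform (tv s c k) (xv s' c' k') = 0" "bform (tv s' c' k') (xv s c k) = 0"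
    using bform_tv_xv[OF assms(1) r(1,2,3), of s' k'] bform_tv_xv[OF assms(2) r(2,1,4), of s k] r(5,6)
    by (simp_all only: of_bool_def if_False)
  then show "mon g * mon h = mon h * mon g"
    using *(5,6) by (intro mon_commute) (auto simp: bf_minus)
qed

text \<open>Copy \<open>c\<close> uses the indices from \<open>c\<close> to \<open>n\<close>.
  Outside this range \<open>oA\<close> and \<open>oD\<close> vanish and the shifts are 1, which
  keeps the oscillator relations valid for all indices.\<close>

definition oA :: "nat \<Rightarrow> nat \<Rightarrow> nat \<Rightarrow> (expo, 'k) linop"
  where "oA s c k = (if c \<le> k \<and> k \<le> n then mon (xv s c k) else 0)"
definition ot :: "nat \<Rightarrow> nat \<Rightarrow> nat \<Rightarrow> (expo, 'k) linop"
  where "ot s c k = (if c \<le> k \<and> k \<le> n then mon (tv s c k) else 1)"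
definition ou :: "nat \<Rightarrow> nat \<Rightarrow> nat \<Rightarrow> (expo, 'k) linop"
  where "ou s c k = (if c \<le> k \<and> k \<le> n then mon (- tv s c k) else 1)"
definition oa :: "nat \<Rightarrow> nat \<Rightarrow> 'k" where "oa c k = of_bool (c \<le> k \<and> k \<le> n)"
text \<open>Strict at \<open>k = c\<close>, where \<open>oD\<close> thereby becomes a monomial. This
  missing coefficient is what makes the parameters of consecutive copies fit together in
  \<open>qrep_chain\<close>.\<close>

definition ob :: "nat \<Rightarrow> nat \<Rightarrow> 'k" where "ob c k = of_bool (c < k \<and> k \<le> n)"
definition oD :: "nat \<Rightarrow> nat \<Rightarrow> nat \<Rightarrow> (expo, 'k) linop"
  where "oD s c k = (if c \<le> k \<and> k \<le> n
    then mon (- xv s c k) * (sc (oa c k) * ot s c k + sc (ob c k) * ou s c k) else 0)"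

lemma osc_in_alg:
  assumes "c \<in> {1..n}"
  shows "oA s c k \<in> alg (copy_expos s {c})" "oD s c k \<in> alg (copy_expos s {c})"
    "ot s c k \<in> alg (copy_expos s {c})" "ou s c k \<in> alg (copy_expos s {c})"
proof -
  have "mon (xv s c k) \<in> alg (copy_expos s {c})" "mon (- xv s c k) \<in> alg (copy_expos s {c})"
    "mon (tv s c k) \<in> alg (copy_expos s {c})" "mon (- tv s c k) \<in> alg (copy_expos s {c})"
    if "c \<le> k \<and> k \<le> n"
    using that assms by (auto intro!: alg_mon simp: copy_expos_def)
  then show "oA s c k \<in> alg (copy_expos s {c})" "oD s c k \<in> alg (copy_expos s {c})"
    "ot s c k \<in> alg (copy_expos s {c})" "ou s c k \<in> alg (copy_expos s {c})"
    unfolding oA_def oD_def ot_def ou_def by (auto intro: alg.intros)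
qed

lemma oscillators_copy:
  assumes s: "s < 2" and c: "c \<in> {1..n}"
  shows "oscillators sc q (oA s c) (oD s c) (ot s c) (ou s c) (oa c) (ob c)"
proof -
  have bx: "bform (tv s c k) (xv s c l) = of_bool (k = l)" if "k \<le> n" for k l
    using bform_tv_xv[of s c c k s l] that s c by auto
  have xx: "mon g * mon h = mon h * mon g"
    if "g \<in> {xv s c k, - xv s c k}" "h \<in> {xv s c l, - xv s c l}" for g h k l
    using that by (intro mon_commute) auto
  have tt: "mon g * mon h = mon h * mon g"
    if "g \<in> {tv s c k, - tv s c k}" "h \<in> {tv s c l, - tv s c l}" for g h k l
    using that by (intro mon_commute) (auto simp: bf_minus)
  have tx: "mon g * mon h = mon h * mon g"
    if "g \<in> {tv s c k, - tv s c k}" "h \<in> {xv s c l, - xv s c l}" "k \<le> n" "k \<noteq> l" for g h k l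
    using that bx[of k l] by (intro mon_commute) (auto simp: bf_minus)
  have tx1: "mon (tv s c k) * mon (xv s c k) = sc q * (mon (xv s c k) * mon (tv s c k))"
    "mon (- tv s c k) * mon (xv s c k) = sc (inverse q) * (mon (xv s c k) * mon (- tv s c k))"
    "mon (tv s c k) * mon (- xv s c k) = sc (inverse q) * (mon (- xv s c k) * mon (tv s c k))"
    if "k \<le> n" for k
    using mon_scale[of "xv s c k" "tv s c k"] mon_scale[of "xv s c k" "- tv s c k"]
      mon_scale[of "- xv s c k" "tv s c k"] bx[OF that]
    by (auto simp: bf_minus power_int_minus)
  have inv: "mon (xv s c k) * mon (- xv s c k) = 1" "mon (- xv s c k) * mon (xv s c k) = 1"
    "mon (tv s c k) * mon (- tv s c k) = 1" "mon (- tv s c k) * mon (tv s c k) = 1" for k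
    by (simp_all add: mon_inverse)
  define R where "R = {k. c \<le> k \<and> k \<le> n}"
  \<comment> \<open>The shift part of \<open>oD\<close>. All commutations of \<open>oD\<close>
    reduce to those of the shifts and of the variable.\<close>
  define g where "g k = sc (oa c k) * ot s c k + sc (ob c k) * ou s c k" for k
  have D: "oD s c k = (if k \<in> R then mon (- xv s c k) * g k else 0)" for k
    by (simp add: oD_def g_def R_def)
  have A: "oA s c k = (if k \<in> R then mon (xv s c k) else 0)" for k by (simp add: oA_def R_def)
  have t: "ot s c k = (if k \<in> R then mon (tv s c k) else 1)"
    "ou s c k = (if k \<in> R then mon (- tv s c k) else 1)" for k by (simp_all add: ot_def ou_def R_def)
  have R: "k \<le> n" if "k \<in> R" for k using that by (simp add: R_def)
  have gcom: "g k * z = z * g k" if "ot s c k * z = z * ot s c k" "ou s c k * z = z * ou s c k" for k z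
    using that unfolding g_def by (simp add: distrib_left distrib_right mult.assoc sca_left[of z])
  have tcom: "ot s c k * ot s c l = ot s c l * ot s c k" "ou s c k * ot s c l = ot s c l * ou s c k"
    "ou s c k * ou s c l = ou s c l * ou s c k" for k l
    unfolding t using tt by auto
  have tcx: "ot s c k * mon (- xv s c l) = mon (- xv s c l) * ot s c k"
    "ou s c k * mon (- xv s c l) = mon (- xv s c l) * ou s c k"
    "ot s c k * mon (xv s c l) = mon (xv s c l) * ot s c k"
    "ou s c k * mon (xv s c l) = mon (xv s c l) * ou s c k" if "k \<noteq> l" for k l
    unfolding t using tx[OF _ _ R that] by auto
  have gt: "g k * ot s c l = ot s c l * g k" "g k * ou s c l = ou s c l * g k" for k l
    by (intro gcom tcom tcom(2)[symmetric])+
  have gg: "g k * g l = g l * g k" for k l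
    by (intro gcom gt[symmetric])
  have gx: "g k * mon (- xv s c l) = mon (- xv s c l) * g k" "g k * mon (xv s c l) = mon (xv s c l) * g k"
    if "k \<noteq> l" for k l
    by (intro gcom tcx that)+
  show ?thesis
  proof (unfold_locales, goal_cases)
    case (1 r s) then show ?case unfolding A using xx by auto
  next
    case (2 r s)
    show ?case
    proof (cases "r = s")
      case False
      then show ?thesis
        unfolding D by (auto intro!: comm_mult comm_mult[symmetric] gx gx[symmetric] gg intro: xx)
    qed simp
  next
    case (3 r s)
    then show ?case
      unfolding A D by (auto intro!: comm_mult[symmetric] gx[symmetric] gx intro: xx)
  next
    case (4 r s) show ?case by (rule tcom)
  next
    case (5 r s) then show ?case unfolding A by (auto intro: tcx)
  next
    case (6 r s) then show ?case unfolding D by (auto intro!: comm_mult[symmetric] tcx[symmetric] gt)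
  next
    case (7 r) show ?case unfolding t using inv by simp
  next
    case (8 r) show ?case unfolding t using inv by simp
  next
    case (9 r) then show ?case unfolding A t using tx1(1)[OF R] by simp
  next
    case (10 r)
    have "mon (tv s c r) * (mon (- xv s c r) * g r) = sc (inverse q) * (mon (- xv s c r) * (mon (tv s c r) * g r))"
      if "r \<in> R"
      using tx1(3)[OF R[OF that], THEN mult_assoc_subst] by (simp add: mult.assoc)
    moreover have "mon (tv s c r) * g r = g r * mon (tv s c r)" if "r \<in> R"
      using gt(1)[of r r] that by (simp add: t)
    ultimately show ?case unfolding D t by (simp add: mult.assoc)
  next
    case (11 r)
    show ?case
    proof (cases "r \<in> R")
      case True
      have "mon (xv s c r) * (mon (- xv s c r) * g r) = g r"
        using inv(1)[of r, THEN mult_assoc_subst] by simp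
      then show ?thesis using True unfolding A D by (simp add: g_def)
    qed (auto simp: A D R_def oa_def ob_def sca_zero)
  next
    case (12 r)
    show ?case
    proof (cases "r \<in> R")
      case True
      have c1: "mon (- xv s c r) * (mon (tv s c r) * mon (xv s c r)) = sc q * mon (tv s c r)"
        "mon (- xv s c r) * (mon (- tv s c r) * mon (xv s c r)) = sc (inverse q) * mon (- tv s c r)"
        using inv(2)[of r, THEN mult_assoc_subst] unfolding tx1(1,2)[OF R[OF True]]
        by (simp_all add: sca_left[of "mon (- xv s c r)"])
      have "(mon (- xv s c r) * g r) * mon (xv s c r) =
          sc (oa c r) * (mon (- xv s c r) * (mon (tv s c r) * mon (xv s c r))) +
          sc (ob c r) * (mon (- xv s c r) * (mon (- tv s c r) * mon (xv s c r)))"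
        using True unfolding g_def t
        by (simp add: distrib_left distrib_right mult.assoc sca_left[of "mon (- xv s c r)"])
      then show ?thesis using True unfolding A D by (simp only: c1 if_True t sca_mult mult.assoc)
    qed (auto simp: A D R_def oa_def ob_def sca_zero)
  next
    case 13 show ?case by (rule qq')
  qed
qed

end

section \<open>The iterated coproduct of the copies on one side\<close>

context gl_torus
begin

text \<open>Exponent of the image of \<open>K i\<close> in the product of the \<open>m\<close>
  copies with \<open>c > n - m\<close>. Copies are adjoined in the order \<open>n\<close>,
  \<open>n - 1\<close>, and so on down to 1.\<close>

definition kexp :: "nat \<Rightarrow> nat \<Rightarrow> nat \<Rightarrow> expo"
  where "kexp s m i = (\<Sum>c\<in>{n - m<..n}. if c \<le> i \<and> i \<le> n then tv s c i else 0)"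

lemma kexp_0: "kexp s 0 i = 0"
  by (simp add: kexp_def)

lemma kexp_Suc:
  assumes "m < n"
  shows "kexp s (Suc m) i = kexp s m i + (if n - m \<le> i \<and> i \<le> n then tv s (n - m) i else 0)"
proof -
  have "{n - Suc m<..n} = insert (n - m) {n - m<..n}" using assms by auto
  then show ?thesis by (simp add: kexp_def add.commute)
qed

lemma bform_0_left: "(\<And>r. Poly_Mapping.lookup h (1, r) = 0) \<Longrightarrow> bform g h = 0"
  by (rule bform_0) simp

lemma lookup_kexp: "fst p \<noteq> 2 \<Longrightarrow> Poly_Mapping.lookup (kexp s m i) p = 0"
  unfolding kexp_def lookup_sum by (rule sum.neutral) (auto simp: lookup_tv)

lemma bform_kexp [simp]: "bform g (kexp s m i) = 0" "bform g (- kexp s m i) = 0"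
  by (rule bform_0_left; simp add: lookup_kexp)+

definition cK :: "nat \<Rightarrow> nat \<Rightarrow> nat \<Rightarrow> (expo, 'k) linop" where "cK s m i = mon (kexp s m i)"
definition cL :: "nat \<Rightarrow> nat \<Rightarrow> nat \<Rightarrow> (expo, 'k) linop" where "cL s m i = mon (- kexp s m i)"

definition ce_copy :: "nat \<Rightarrow> nat \<Rightarrow> nat \<Rightarrow> (expo, 'k) linop"
  where "ce_copy s c i = oA s c i * oD s c (Suc i)"
definition cf_copy :: "nat \<Rightarrow> nat \<Rightarrow> nat \<Rightarrow> (expo, 'k) linop"
  where "cf_copy s c i = sc (- inverse ((q - inverse q)\<^sup>2)) * (oA s c (Suc i) * oD s c i)"

text \<open>The recursion is the coproduct of \<open>qrep_coproduct\<close>, with the new copy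
  \<open>n - m\<close> as second factor.\<close>

primrec ce :: "nat \<Rightarrow> nat \<Rightarrow> nat \<Rightarrow> (expo, 'k) linop"
  where
    "ce s 0 = (\<lambda>i. 0)"
  | "ce s (Suc m) = (\<lambda>i. ce s m i + cK s m i * cL s m (i + 1) * ce_copy s (n - m) i)"

primrec cf :: "nat \<Rightarrow> nat \<Rightarrow> nat \<Rightarrow> (expo, 'k) linop"
  where
    "cf s 0 = (\<lambda>i. 0)"
  | "cf s (Suc m) = (\<lambda>i. cf s m i * (ou s (n - m) i * ot s (n - m) (i + 1)) + cf_copy s (n - m) i)"

lemma cK_Suc:
  assumes "m < n"
  shows "cK s (Suc m) = (\<lambda>i. cK s m i * ot s (n - m) i)" "cL s (Suc m) = (\<lambda>i. cL s m i * ou s (n - m) i)"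
proof -
  have *: "bform g (tv s (n - m) i) = 0" "bform g (- tv s (n - m) i) = 0" for g i
    by (rule bform_0_left; simp add: lookup_tv)+
  show "cK s (Suc m) = (\<lambda>i. cK s m i * ot s (n - m) i)" "cL s (Suc m) = (\<lambda>i. cL s m i * ou s (n - m) i)"
    unfolding cK_def cL_def kexp_Suc[OF assms] ot_def ou_def
    by (auto simp: fun_eq_iff mon_mult * sca_one)
qed

lemma copy_in_alg:
  assumes "c \<in> {1..n}"
  shows "ce_copy s c i \<in> alg (copy_expos s {c})" "cf_copy s c i \<in> alg (copy_expos s {c})"
  unfolding ce_copy_def cf_copy_def by (intro alg_mult alg_sc osc_in_alg assms)+

lemma alg_Suc:
  assumes "m < n"
  shows "A \<in> alg (copy_expos s {n - m<..n}) \<Longrightarrow> A \<in> alg (copy_expos s {n - Suc m<..n})"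
    "A \<in> alg (copy_expos s {n - m}) \<Longrightarrow> A \<in> alg (copy_expos s {n - Suc m<..n})"
proof -
  have "copy_expos s {n - m<..n} \<subseteq> copy_expos s {n - Suc m<..n}"
    "copy_expos s {n - m} \<subseteq> copy_expos s {n - Suc m<..n}"
    using assms by (auto simp: copy_expos_def) force+
  then show "A \<in> alg (copy_expos s {n - m<..n}) \<Longrightarrow> A \<in> alg (copy_expos s {n - Suc m<..n})"
    "A \<in> alg (copy_expos s {n - m}) \<Longrightarrow> A \<in> alg (copy_expos s {n - Suc m<..n})"
    using alg_mono by blast+
qed

lemma chain_in_alg:
  assumes "m \<le> n"
  shows "ce s m i \<in> alg (copy_expos s {n - m<..n})" "cf s m i \<in> alg (copy_expos s {n - m<..n})"
    "cK s m i \<in> alg (copy_expos s {n - m<..n})" "cL s m i \<in> alg (copy_expos s {n - m<..n})"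
proof -
  have "(\<forall>i. ce s m i \<in> alg (copy_expos s {n - m<..n})) \<and> (\<forall>i. cf s m i \<in> alg (copy_expos s {n - m<..n})) \<and>
    (\<forall>i. cK s m i \<in> alg (copy_expos s {n - m<..n})) \<and> (\<forall>i. cL s m i \<in> alg (copy_expos s {n - m<..n}))"
    using assms
  proof (induction m)
    case 0
    then show ?case by (simp add: cK_def cL_def kexp_0 mon_zero alg_zero alg_one)
  next
    case (Suc m)
    then have m: "m < n" and c: "n - m \<in> {1..n}" by auto
    have IH: "ce s m i \<in> alg (copy_expos s {n - Suc m<..n})" "cf s m i \<in> alg (copy_expos s {n - Suc m<..n})"
      "cK s m i \<in> alg (copy_expos s {n - Suc m<..n})" "cL s m i \<in> alg (copy_expos s {n - Suc m<..n})" for i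
      using Suc m by (auto intro: alg_Suc(1))
    show ?case
      by (simp only: ce.simps cf.simps cK_Suc[OF m] simp_thms)
        (intro conjI allI alg_add alg_mult IH alg_Suc(2)[OF m] osc_in_alg copy_in_alg c)
  qed
  then show "ce s m i \<in> alg (copy_expos s {n - m<..n})" "cf s m i \<in> alg (copy_expos s {n - m<..n})"
    "cK s m i \<in> alg (copy_expos s {n - m<..n})" "cL s m i \<in> alg (copy_expos s {n - m<..n})"
    by blast+
qed

lemma qrep_copy:
  assumes "s < 2" "c \<in> {1..n}"
  shows "qrep sc q n (\<lambda>i. oa c i * ob c (Suc i)) (\<lambda>i. oa c (Suc i) * ob c i)
    (ce_copy s c) (cf_copy s c) (ot s c) (ou s c)"
proof -
  interpret O: oscillators sc q "oA s c" "oD s c" "ot s c" "ou s c" "oa c" "ob c"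
    using oscillators_copy[OF assms] .
  have "O.oe = ce_copy s c" "(\<lambda>i. sc O.sc0 * O.of' i) = cf_copy s c"
    by (simp_all add: fun_eq_iff O.oe_def O.of'_def O.sc0_def ce_copy_def cf_copy_def)
  then show ?thesis using O.qrep[of n] by simp
qed

lemma commuting_mono: "commuting S T \<Longrightarrow> S' \<subseteq> S \<Longrightarrow> T' \<subseteq> T \<Longrightarrow> commuting S' T'"
  unfolding commuting_def by blast

text \<open>For \<open>1 \<le> i < n\<close>, copy \<open>c\<close> has \<open>\<alpha>\<close>
  equal to 1 exactly if \<open>i \<ge> c\<close> and \<open>\<beta>\<close> equal to 1 exactly if
  \<open>i > c\<close>. The chain of the copies above \<open>c\<close> has \<open>\<alpha>\<close>
  equal to 1 exactly if \<open>i > c\<close>, which is the \<open>\<beta>\<close> of the next copy.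
  So the parameters telescope, and the second one stays zero.\<close>

lemma qrep_chain:
  assumes "s < 2" "m \<le> n"
  shows "qrep sc q n (\<lambda>i. of_bool (i > n - m)) (\<lambda>i. 0) (ce s m) (cf s m) (cK s m) (cL s m)"
  using assms(2)
proof (induction m)
  case 0
  show ?case
    by unfold_locales (auto simp: cK_def cL_def kexp_0 mon_zero serre_def sca_zero)
next
  case (Suc m)
  then have m: "m < n" and c: "n - m \<in> {1..n}" by auto
  interpret R1: qrep sc q n "\<lambda>i. of_bool (i > n - m)" "\<lambda>i. 0" "ce s m" "cf s m" "cK s m" "cL s m"
    using Suc by simp
  interpret R2: qrep sc q n "\<lambda>i. oa (n - m) i * ob (n - m) (Suc i)" "\<lambda>i. oa (n - m) (Suc i) * ob (n - m) i"
      "ce_copy s (n - m)" "cf_copy s (n - m)" "ot s (n - m)" "ou s (n - m)"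
    by (rule qrep_copy[OF assms(1) c])
  have "commuting (alg (copy_expos s {n - m<..n})) (alg (copy_expos s {n - m}))"
    using assms(1) c by (intro copies_commute) auto
  moreover have "R1.gens \<subseteq> alg (copy_expos s {n - m<..n})"
    unfolding R1.gens_def using chain_in_alg[of m s] m by auto
  moreover have "R2.gens \<subseteq> alg (copy_expos s {n - m})"
    unfolding R2.gens_def using osc_in_alg[OF c] copy_in_alg[OF c] by auto
  ultimately have comm: "commuting R1.gens R2.gens" by (rule commuting_mono)
  have "qrep sc q n (\<lambda>i. oa (n - m) i * ob (n - m) (Suc i)) (\<lambda>i. 0)
      (\<lambda>i. ce s m i + R1.k i * ce_copy s (n - m) i) (\<lambda>i. cf s m i * R2.l i + cf_copy s (n - m) i)
      (\<lambda>i. cK s m i * ot s (n - m) i) (\<lambda>i. cL s m i * ou s (n - m) i)"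
    using m by (intro qrep_coproduct[OF R1.qrep_axioms R2.qrep_axioms comm]) (auto simp: oa_def ob_def)
  then have "qrep sc q n (\<lambda>i. oa (n - m) i * ob (n - m) (Suc i)) (\<lambda>i. 0) (ce s (Suc m)) (cf s (Suc m))
      (cK s (Suc m)) (cL s (Suc m))"
    by (simp only: R1.k_def R2.l_def ce.simps cf.simps cK_Suc[OF m])
  then show ?case by (rule qrep_cong) (use m in \<open>auto simp: oa_def ob_def\<close>)
qed

section \<open>Leading exponents of root vectors on one side\<close>

definition cexp :: "nat \<Rightarrow> nat \<Rightarrow> nat \<Rightarrow> nat \<Rightarrow> expo"
  where "cexp s c d i = xv s c i - xv s c (Suc (i + d)) + (\<Sum>l\<in>{i<..Suc (i + d)}. tv s c l)"

lemma tv_pos: "- tv s c k < tv s c k"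
proof -
  have "(0 :: expo) < tv s c k"
    by (rule expo_less[of _ "(2, s, n - c, k)"]) (auto simp: lookup_tv)
  then show ?thesis by (meson neg_less_0_iff_less order.strict_trans)
qed

text \<open>By \<open>rt_oe\<close> only the last factor \<open>oD\<close> is not a monomial, and of
  its two terms the one with the positive shift is larger. The scalar in front is nonzero because
  \<open>oa\<close> is 1 on the whole range.\<close>

lemma leads_copy:
  assumes "s < 2" "c \<in> {1..n}" "c \<le> i" "i + d < n"
  shows "leads (rt (ce_copy s c) d i) (cexp s c d i)"
proof -
  interpret O: oscillators sc q "oA s c" "oD s c" "ot s c" "ou s c" "oa c" "ob c"
    using oscillators_copy[OF assms(1,2)] .
  have oe: "O.oe = ce_copy s c" by (simp add: fun_eq_iff O.oe_def ce_copy_def)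
  let ?j = "Suc (i + d)"
  have 1: "leads (O.tprod d i) (\<Sum>l\<in>{i<..i + d}. tv s c l)" using assms(3,4)
  proof (induction d arbitrary: i)
    case 0
    then show ?case using leads_one by simp
  next
    case (Suc d)
    have "{i<..i + Suc d} = insert (Suc i) {Suc i<..Suc i + d}" by auto
    then have e: "(\<Sum>l\<in>{i<..i + Suc d}. tv s c l) = tv s c (Suc i) + (\<Sum>l\<in>{Suc i<..Suc i + d}. tv s c l)"
      by simp
    have "leads (ot s c (Suc i)) (tv s c (Suc i))" using Suc.prems leads_mon by (simp add: ot_def)
    moreover have "leads (O.tprod d (Suc i)) (\<Sum>l\<in>{Suc i<..Suc i + d}. tv s c l)"
      using Suc.prems by (intro Suc.IH) auto
    ultimately show ?case unfolding e by (simp add: leads_mult)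
  qed
  have 2: "leads (oD s c ?j) (- xv s c ?j + tv s c ?j)"
  proof -
    have "leads (sc (oa c ?j) * ot s c ?j + sc (ob c ?j) * ou s c ?j) (tv s c ?j)"
    proof (rule leads_add_below)
      show "leads (sc (oa c ?j) * ot s c ?j) (tv s c ?j)"
        using assms by (simp add: oa_def ot_def leads_mon sca_one)
      show "below (sc (ob c ?j) * ou s c ?j) (tv s c ?j)"
        using assms leads_below[OF leads_mon tv_pos] by (intro below_sc_mult) (simp add: ou_def)
    qed
    then have "leads (mon (- xv s c ?j) * (sc (oa c ?j) * ot s c ?j + sc (ob c ?j) * ou s c ?j))
        (- xv s c ?j + tv s c ?j)"
      by (intro leads_mult leads_mon)
    then show ?thesis using assms by (simp add: oD_def)
  qed
  have 3: "leads (oA s c i) (xv s c i)" using assms leads_mon by (simp add: oA_def)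
  have "(q - inverse q) ^ d * (\<Prod>m\<in>{Suc i..i + d}. oa c m) \<noteq> 0"
    using qq' assms by (auto simp: oa_def)
  then have "leads (rt O.oe d i) (xv s c i + ((\<Sum>l\<in>{i<..i + d}. tv s c l) + (- xv s c ?j + tv s c ?j)))"
    unfolding O.rt_oe by (intro leads_sc_mult leads_mult 1 2 3)
  moreover have "{i<..?j} = insert ?j {i<..i + d}" by auto
  ultimately show ?thesis by (simp add: oe cexp_def algebra_simps)
qed

lemma rt_zero:
  assumes "x i = 0" shows "rt x d i = 0"
  by (cases d) (simp_all add: assms br_def)

lemma ce_copy_zero: "i < c \<Longrightarrow> ce_copy s c i = 0"
  by (simp add: ce_copy_def oA_def)

lemma ce_zero: "m \<le> n \<Longrightarrow> i \<le> n - m \<Longrightarrow> ce s m i = 0"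
  by (induction m) (auto simp: ce_copy_zero)

lemma kk_mon:
  assumes "\<And>i. k i = mon (h i - h (Suc i))" "\<And>i j. bform (h i) (h j) = 0"
  shows "kk k d i = mon (h i - h (Suc (i + d)))"
proof (induction d arbitrary: i)
  case (Suc d)
  have "bform (h i - h (Suc i)) (h (Suc i) - h (Suc (Suc i + d))) = 0"
    using bform_add bf_minus assms(2) by (simp add: diff_conv_add_uminus del: add_uminus_conv_diff)
  then show ?case using Suc assms(1) by (simp add: mon_mult sca_one)
qed (simp add: assms)

text \<open>The contribution of copy \<open>i\<close>, the one with the largest \<open>c\<close> in
  which \<open>ce_copy\<close> at \<open>i\<close> need not vanish, preceded by the torus factors of
  the \<open>n - i\<close> copies with larger \<open>c\<close>.\<close>

definition \<gamma> :: "nat \<Rightarrow> nat \<Rightarrow> nat \<Rightarrow> expo"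
  where "\<gamma> s d i = kexp s (n - i) i - kexp s (n - i) (Suc (i + d)) + cexp s i d i"

lemma lookup_cexp: "fst p \<noteq> 2 \<Longrightarrow> Poly_Mapping.lookup (cexp s c d i) p =
    Poly_Mapping.lookup (xv s c i) p - Poly_Mapping.lookup (xv s c (Suc (i + d))) p"
  unfolding cexp_def lookup_add lookup_minus lookup_sum by (auto simp: lookup_tv intro!: sum.neutral)

lemma lookup_gamma: "fst p \<noteq> 2 \<Longrightarrow> Poly_Mapping.lookup (\<gamma> s d i) p =
    Poly_Mapping.lookup (xv s i i) p - Poly_Mapping.lookup (xv s i (Suc (i + d))) p"
  unfolding \<gamma>_def lookup_add lookup_minus by (simp add: lookup_kexp lookup_cexp)

lemma fst_less: "(p' :: nat \<times> nat \<times> nat \<times> nat) < (1, r) \<Longrightarrow> fst p' \<noteq> 2"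
  by (cases p') auto

text \<open>Both exponents have the same degree. They first differ at variable \<open>i\<close> of
  copy \<open>i\<close>, where \<open>\<gamma>\<close> has entry 1 and a contribution of a copy with
  smaller \<open>c\<close> has entry 0; shift exponents come later in the order.\<close>

lemma gamma_greater1:
  assumes "c < i" "i \<le> n"
  shows "kexp s m i - kexp s m (Suc (i + d)) + cexp s c d i < \<gamma> s d i"
proof (rule expo_less[of _ "(1, s, n - i, i)"])
  have "n - i < n - c" using assms by auto
  then show "Poly_Mapping.lookup (kexp s m i - kexp s m (Suc (i + d)) + cexp s c d i) (1, s, n - i, i)
      < Poly_Mapping.lookup (\<gamma> s d i) (1, s, n - i, i)"
    by (simp add: lookup_gamma lookup_add lookup_minus lookup_cexp lookup_kexp lookup_xv)
  fix p' :: "nat \<times> nat \<times> nat \<times> nat" assume p': "p' < (1, s, n - i, i)"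
  have "fst p' \<noteq> 2" using fst_less[OF p'] .
  moreover have "p' \<noteq> (1, s, n - c, i)" "p' \<noteq> (1, s, n - c, Suc (i + d))"
    "p' \<noteq> (1, s, n - i, i)" "p' \<noteq> (1, s, n - i, Suc (i + d))"
    using p' \<open>n - i < n - c\<close> by auto
  ultimately show "Poly_Mapping.lookup (kexp s m i - kexp s m (Suc (i + d)) + cexp s c d i) p' =
      Poly_Mapping.lookup (\<gamma> s d i) p'"
    by (simp add: lookup_gamma lookup_add lookup_minus lookup_cexp lookup_kexp lookup_xv)
qed

text \<open>A mixed term breaks the root after \<open>r + 1\<close> simple roots. This leaves the
  entry -1 at variable \<open>i + r + 1\<close> of copy \<open>i\<close>, where
  \<open>\<gamma> s d i\<close> has entry 0, and all earlier entries agree.\<close>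

lemma gamma_greater2:
  assumes "c < i" "i \<le> n" "r < d"
  shows "\<gamma> s r i + (kexp s m (Suc (i + r)) - kexp s m (Suc (i + d)) +
    cexp s c (d - Suc r) (Suc (i + r))) < \<gamma> s d i"
proof (rule expo_less[of _ "(1, s, n - i, Suc (i + r))"])
  have nc: "n - i < n - c" using assms by auto
  have e: "Suc (i + r + (d - Suc r)) = i + d" using assms(3) by simp
  note lk = lookup_gamma lookup_add lookup_minus lookup_cexp lookup_kexp lookup_xv e
  show "Poly_Mapping.lookup (\<gamma> s r i + (kexp s m (Suc (i + r)) - kexp s m (Suc (i + d)) +
      cexp s c (d - Suc r) (Suc (i + r)))) (1, s, n - i, Suc (i + r))
      < Poly_Mapping.lookup (\<gamma> s d i) (1, s, n - i, Suc (i + r))"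
    using nc assms(3) by (simp add: lk)
  fix p' :: "nat \<times> nat \<times> nat \<times> nat" assume p': "p' < (1, s, n - i, Suc (i + r))"
  have "fst p' \<noteq> 2" using fst_less[OF p'] .
  moreover have "p' \<noteq> (1, s, n - c, Suc (i + r))" "p' \<noteq> (1, s, n - c, Suc (i + d))"
    "p' \<noteq> (1, s, n - i, Suc (i + r))" "p' \<noteq> (1, s, n - i, Suc (i + d))"
    using p' nc assms(3) by auto
  ultimately show "Poly_Mapping.lookup (\<gamma> s r i + (kexp s m (Suc (i + r)) - kexp s m (Suc (i + d)) +
      cexp s c (d - Suc r) (Suc (i + r)))) p' = Poly_Mapping.lookup (\<gamma> s d i) p'"
    by (simp add: lk)
qed

text \<open>Adjoining copy \<open>n - m\<close> creates the first nonzero term if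
  \<open>i = n - m\<close>. Otherwise it only adds terms that are smaller by
  \<open>gamma_greater1\<close> and \<open>gamma_greater2\<close>.\<close>

lemma leads_chain:
  assumes "s < 2" "m \<le> n" "1 \<le> i" "i + d < n" "i > n - m"
  shows "leads (rt (ce s m) d i) (\<gamma> s d i)"
  using assms(2-)
proof (induction m arbitrary: i d)
  case (Suc m)
  then have m: "m < n" and c: "n - m \<in> {1..n}" by auto
  interpret R1: qrep sc q n "\<lambda>i. of_bool (i > n - m)" "\<lambda>i. 0" "ce s m" "cf s m" "cK s m" "cL s m"
    using qrep_chain[OF assms(1)] m by simp
  interpret R2: qrep sc q n "\<lambda>i. oa (n - m) i * ob (n - m) (Suc i)" "\<lambda>i. oa (n - m) (Suc i) * ob (n - m) i"
      "ce_copy s (n - m)" "cf_copy s (n - m)" "ot s (n - m)" "ou s (n - m)"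
    by (rule qrep_copy[OF assms(1) c])
  have com: "commuting (alg (copy_expos s {n - m})) (alg (copy_expos s {n - m<..n}))"
    using assms(1) c by (intro copies_commute) auto
  have kalg: "R1.k i \<in> alg (copy_expos s {n - m<..n})" for i
    unfolding R1.k_def using chain_in_alg[of m s] m by (auto intro: alg_mult)
  have "commuting (range (ce_copy s (n - m))) (range (ce s m) \<union> range R1.k)"
    by (rule commuting_mono[OF com]) (use copy_in_alg[OF c] chain_in_alg[of m s] m kalg in auto)
  then have cop: "rt (\<lambda>i. ce s m i + R1.k i * ce_copy s (n - m) i) d i = rt (ce s m) d i +
      kk R1.k d i * rt (ce_copy s (n - m)) d i + (\<Sum>r<d. sc (1 - (inverse q)\<^sup>2) *
      (rt (ce s m) r i * (kk R1.k (d - Suc r) (Suc (i + r)) * rt (ce_copy s (n - m)) (d - Suc r) (Suc (i + r)))))"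
    using Suc.prems by (intro rt_coproduct[OF R1.serre_e R2.serre_e R1.torus_acts_ke])
  have "ce s (Suc m) = (\<lambda>i. ce s m i + R1.k i * ce_copy s (n - m) i)"
    by (simp add: R1.k_def)
  note cop = cop[folded this]
  have k_mon: "R1.k i = mon (kexp s m i - kexp s m (Suc i))" for i
    by (simp add: R1.k_def cK_def cL_def mon_mult sca_one)
  have kk: "kk R1.k d i = mon (kexp s m i - kexp s m (Suc (i + d)))" for d i
    by (rule kk_mon) (simp_all add: k_mon)
  show ?case
  proof (cases "i = n - m")
    case True
    have "rt (ce s m) r i = 0" for r using True m by (intro rt_zero ce_zero) auto
    then have "rt (ce s (Suc m)) d i = kk R1.k d i * rt (ce_copy s (n - m)) d i"
      unfolding cop by simp
    moreover have "leads (kk R1.k d i * rt (ce_copy s (n - m)) d i)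
        (kexp s m i - kexp s m (Suc (i + d)) + cexp s (n - m) d i)"
      unfolding kk using Suc.prems True c by (intro leads_mult leads_mon leads_copy[OF assms(1) c]) auto
    moreover have "m = n - i" "n - m = i" using True m by auto
    ultimately show ?thesis unfolding \<gamma>_def by metis
  next
    case False
    then have im: "n - m < i" using Suc.prems m by auto
    have cp: "leads (rt (ce_copy s (n - m)) d i) (cexp s (n - m) d i)" if "n - m < i" "i + d < n" for d i
      using that by (intro leads_copy[OF assms(1) c]) auto
    show ?thesis unfolding cop
    proof (intro leads_add_below below_sum)
      show "leads (rt (ce s m) d i) (\<gamma> s d i)" using Suc im by simp
      have "leads (kk R1.k d i * rt (ce_copy s (n - m)) d i)
          (kexp s m i - kexp s m (Suc (i + d)) + cexp s (n - m) d i)"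
        unfolding kk using Suc.prems im by (intro leads_mult leads_mon cp) auto
      then show "below (kk R1.k d i * rt (ce_copy s (n - m)) d i) (\<gamma> s d i)"
        by (rule leads_below) (use im Suc.prems in \<open>intro gamma_greater1; auto\<close>)
    next
      fix r assume r: "r \<in> {..<d}"
      have "leads (rt (ce s m) r i * (kk R1.k (d - Suc r) (Suc (i + r)) * rt (ce_copy s (n - m)) (d - Suc r) (Suc (i + r))))
          (\<gamma> s r i + (kexp s m (Suc (i + r)) - kexp s m (Suc (Suc (i + r) + (d - Suc r))) +
            cexp s (n - m) (d - Suc r) (Suc (i + r))))"
        unfolding kk using Suc r im by (intro leads_mult leads_mon cp) auto
      then have "leads (rt (ce s m) r i * (kk R1.k (d - Suc r) (Suc (i + r)) * rt (ce_copy s (n - m)) (d - Suc r) (Suc (i + r))))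
          (\<gamma> s r i + (kexp s m (Suc (i + r)) - kexp s m (Suc (i + d)) +
            cexp s (n - m) (d - Suc r) (Suc (i + r))))"
        using r by simp
      then show "below (sc (1 - (inverse q)\<^sup>2) * (rt (ce s m) r i * (kk R1.k (d - Suc r) (Suc (i + r)) *
          rt (ce_copy s (n - m)) (d - Suc r) (Suc (i + r))))) (\<gamma> s d i)"
        by (intro below_sc_mult, rule leads_below) (use im Suc.prems r in \<open>intro gamma_greater2; auto\<close>)
    qed
  qed
qed simp

end

section \<open>The grading and the combination of the two sides\<close>

context gl_torus
begin

definition deg :: "expo \<Rightarrow> int" where "deg g = Poly_Mapping.lookup g (0, 0, 0, 0)"

lemma deg_simps [simp]: "deg (g + h) = deg g + deg h" "deg (g - h) = deg g - deg h" "deg (- g) = - deg g"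
  "deg 0 = 0" "deg (xv s c k) = - int k" "deg (tv s c k) = 0" "deg (kexp s m i) = 0"
  by (simp_all add: deg_def lookup_add lookup_minus lookup_xv lookup_tv lookup_kexp)

lemma deg_gamma [simp]: "deg (\<gamma> s d i) = int d + 1"
  by (simp add: deg_def lookup_gamma lookup_xv)

lemma deg_less: "deg g < deg h \<Longrightarrow> g < h"
  unfolding deg_def by (rule expo_less[of _ "(0, 0, 0, 0)"]) auto

definition homog :: "(expo, 'k) linop \<Rightarrow> int \<Rightarrow> bool"
  where "homog A z \<longleftrightarrow> A \<in> tor \<and> (\<forall>h\<in>supp A. deg h = z)"

lemma homog_mon: "homog (mon g) (deg g)"
  by (auto simp: homog_def tor_mon supp_def coef_mon)

lemma homog_zero: "homog 0 z"
  by (simp add: homog_def tor_zero supp_def)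

lemma homog_one: "homog 1 0"
  using homog_mon[of 0] by (simp add: mon_zero)

lemma homog_add: "homog A z \<Longrightarrow> homog B z \<Longrightarrow> homog (A + B) z"
  unfolding homog_def using supp_add[of A B] by (auto intro: tor_add)

lemma homog_sc: "homog A z \<Longrightarrow> homog (sc c * A) z"
  unfolding homog_def using supp_sc_mult[of c A] by (auto intro: tor_sc_mult)

lemma homog_mult: "homog A z \<Longrightarrow> homog B w \<Longrightarrow> homog (A * B) (z + w)"
  unfolding homog_def
proof (intro conjI ballI)
  assume *: "A \<in> tor \<and> (\<forall>h\<in>supp A. deg h = z)" "B \<in> tor \<and> (\<forall>h\<in>supp B. deg h = w)"
  then show "A * B \<in> tor" by (simp add: tor_mult)
  fix x assume "x \<in> supp (A * B)"
  then obtain g h where "g \<in> supp A" "h \<in> supp B" "x = g + h" using * supp_mult by metis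
  then show "deg x = z + w" using * by simp
qed

lemma homog_br: "homog A z \<Longrightarrow> homog B w \<Longrightarrow> homog (br A B) (z + w)"
proof -
  assume *: "homog A z" "homog B w"
  have "homog (A * B + sc (- inverse q) * (B * A)) (z + w)"
    using homog_mult[OF *] homog_mult[OF *(2,1)] by (intro homog_add homog_sc) (simp_all add: add.commute)
  then show ?thesis by (simp add: br_def sca_uminus)
qed

lemma homog_rt: "(\<And>i. homog (x i) z) \<Longrightarrow> homog (rt x d i) ((int d + 1) * z)"
proof (induction d arbitrary: i)
  case (Suc d)
  then show ?case using homog_br[of "x i" z "rt x d (Suc i)" "(int d + 1) * z"]
    by (simp add: algebra_simps)
qed simp

lemma homog_osc: "homog (oA s c k) (- int k)" "homog (oD s c k) (int k)" "homog (ot s c k) 0" "homog (ou s c k) 0"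
proof -
  show t: "homog (ot s c k) 0" "homog (ou s c k) 0"
    using homog_mon[of "tv s c k"] homog_mon[of "- tv s c k"] by (auto simp: ot_def ou_def homog_one)
  show "homog (oA s c k) (- int k)" using homog_mon[of "xv s c k"] by (auto simp: oA_def homog_zero)
  have "homog (mon (- xv s c k) * (sc (oa c k) * ot s c k + sc (ob c k) * ou s c k)) (int k + 0)"
    using homog_mon[of "- xv s c k"] t by (intro homog_mult homog_add homog_sc) auto
  then show "homog (oD s c k) (int k)" by (auto simp: oD_def homog_zero)
qed

lemma homog_K: "homog (cK s m i) 0" "homog (cL s m i) 0"
  using homog_mon[of "kexp s m i"] homog_mon[of "- kexp s m i"] by (simp_all add: cK_def cL_def)

lemma homog_ce: "homog (ce s m i) 1"
proof (induction m)
  case (Suc m)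
  have "homog (cK s m i * cL s m (i + 1) * ce_copy s (n - m) i) (0 + 0 + (- int i + int (Suc i)))"
    unfolding ce_copy_def by (intro homog_mult homog_K homog_osc)
  then show ?case using Suc by (simp add: homog_add)
qed (simp add: homog_zero)

lemma homog_cf: "homog (cf s m i) (- 1)"
proof (induction m)
  case (Suc m)
  have "homog (cf s m i * (ou s (n - m) i * ot s (n - m) (i + 1))) (- 1 + (0 + 0))"
    by (intro homog_mult Suc homog_osc)
  moreover have "homog (cf_copy s (n - m) i) (- int (Suc i) + int i)"
    unfolding cf_copy_def by (intro homog_sc homog_mult homog_osc)
  ultimately show ?case by (simp add: homog_add)
qed (simp add: homog_zero)

lemma homog_below: "homog A z \<Longrightarrow> z < deg g \<Longrightarrow> below A g"
  unfolding homog_def below_def by (auto intro: deg_less)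

text \<open>
  Side 1 provides the leading terms of the \<open>e\<close>'s, and side 0, on which the roles of \<open>e\<close> and \<open>f\<close>
  are exchanged, those of the \<open>f\<close>'s.
\<close>

definition te :: "nat \<Rightarrow> (expo, 'k) linop"
  where "te i = cf 0 n i + cL 0 n i * cK 0 n (i + 1) * ce 1 n i"
definition tf :: "nat \<Rightarrow> (expo, 'k) linop"
  where "tf i = ce 0 n i * (cL 1 n i * cK 1 n (i + 1)) + cf 1 n i"
definition tK :: "nat \<Rightarrow> (expo, 'k) linop" where "tK i = cL 0 n i * cK 1 n i"
definition tL :: "nat \<Rightarrow> (expo, 'k) linop" where "tL i = cK 0 n i * cL 1 n i"

lemma side0: "qrep sc q n (\<lambda>i. 0) (\<lambda>i. of_bool (i > n - n)) (cf 0 n) (ce 0 n) (cL 0 n) (cK 0 n)"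
  by (rule qrep.opposite[OF qrep_chain]) auto

lemma side1: "qrep sc q n (\<lambda>i. of_bool (i > n - n)) (\<lambda>i. 0) (ce 1 n) (cf 1 n) (cK 1 n) (cL 1 n)"
  by (rule qrep_chain) auto

lemma sides_commute:
  "commuting (qrep.gens (cf 0 n) (ce 0 n) (cL 0 n) (cK 0 n)) (qrep.gens (ce 1 n) (cf 1 n) (cK 1 n) (cL 1 n))"
proof (rule commuting_mono)
  show "commuting (alg (copy_expos 0 {n - n<..n})) (alg (copy_expos 1 {n - n<..n}))"
    by (rule copies_commute) auto
  show "qrep.gens (cf 0 n) (ce 0 n) (cL 0 n) (cK 0 n) \<subseteq> alg (copy_expos 0 {n - n<..n})"
    unfolding qrep.gens_def[OF side0] using chain_in_alg[OF order.refl] by blast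
  show "qrep.gens (ce 1 n) (cf 1 n) (cK 1 n) (cL 1 n) \<subseteq> alg (copy_expos 1 {n - n<..n})"
    unfolding qrep.gens_def[OF side1] using chain_in_alg[OF order.refl] by blast
qed

text \<open>Side 0 enters in opposite form and supplies \<open>\<beta>\<close>, side 1 supplies
  \<open>\<alpha>\<close>, and the inner parameters are both zero. On the index range the outer ones
  are 1, so the uncontracted commutator relation holds.\<close>

lemma qrep_total: "qrep sc q n (\<lambda>i. 1) (\<lambda>i. 1) te tf tK tL"
proof -
  have "qrep sc q n (\<lambda>i. of_bool (i > n - n)) (\<lambda>i. of_bool (i > n - n))
      (\<lambda>i. cf 0 n i + qrep.k (cL 0 n) (cK 0 n) i * ce 1 n i)
      (\<lambda>i. ce 0 n i * qrep.l (cK 1 n) (cL 1 n) i + cf 1 n i)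
      (\<lambda>i. cL 0 n i * cK 1 n i) (\<lambda>i. cK 0 n i * cL 1 n i)"
    by (rule qrep_coproduct[OF side0 side1 sides_commute]) simp
  then have "qrep sc q n (\<lambda>i. of_bool (i > n - n)) (\<lambda>i. of_bool (i > n - n)) te tf tK tL"
    unfolding qrep.k_def[OF side0] qrep.l_def[OF side1] te_def[abs_def] tf_def[abs_def] tK_def[abs_def] tL_def[abs_def] .
  then show ?thesis by (rule qrep_cong) auto
qed

definition gE :: "nat \<Rightarrow> nat \<Rightarrow> expo"
  where "gE d i = - kexp 0 n i + kexp 0 n (Suc (i + d)) + \<gamma> 1 d i"
definition gF :: "nat \<Rightarrow> nat \<Rightarrow> expo"
  where "gF d i = - kexp 1 n i + kexp 1 n (Suc (i + d)) + \<gamma> 0 d i"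
definition gK :: "nat \<Rightarrow> expo"
  where "gK i = - kexp 0 n i + kexp 1 n i"

text \<open>In the coproduct formula the pure \<open>ce\<close> term has degree
  \<open>d + 1\<close>. Every other term contains a root vector in the \<open>x i\<close>, which
  have degree -1, and so has smaller degree; since the degree dominates the order, no finer
  comparison is required. The form with free \<open>s\<close> and \<open>s'\<close> serves both
  \<open>te\<close> and \<open>tf\<close>.\<close>

lemma leads_two_sides:
  assumes R1: "qrep sc q n \<alpha> \<beta> x x' (cL s n) (cK s n)" and R2: "qrep sc q n \<alpha>' \<beta>' (ce s' n) y' (cK s' n) (cL s' n)"
    and hx: "\<And>i. homog (x i) (- 1)" and s: "s' < 2"
    and comm: "commuting (range (ce s' n)) (range x \<union> range (qrep.k (cL s n) (cK s n)))"
    and i: "1 \<le> i" "i + d < n"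
  shows "leads (rt (\<lambda>i. x i + qrep.k (cL s n) (cK s n) i * ce s' n i) d i)
    (- kexp s n i + kexp s n (Suc (i + d)) + \<gamma> s' d i)"
proof -
  interpret R1: qrep sc q n \<alpha> \<beta> x x' "cL s n" "cK s n" by fact
  interpret R2: qrep sc q n \<alpha>' \<beta>' "ce s' n" y' "cK s' n" "cL s' n" by fact
  have kk: "kk R1.k d i = mon (- kexp s n i + kexp s n (Suc (i + d)))" for d i
  proof -
    have "kk R1.k d i = mon (- kexp s n i - - kexp s n (Suc (i + d)))"
      by (rule kk_mon) (simp_all add: R1.k_def cK_def cL_def mon_mult sca_one)
    then show ?thesis by simp
  qed
  have lead: "leads (rt (ce s' n) d i) (\<gamma> s' d i)" if "1 \<le> i" "i + d < n" for d i
    using that s by (intro leads_chain) auto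
  show ?thesis
    unfolding rt_coproduct[OF R1.serre_e R2.serre_e R1.torus_acts_ke comm i]
  proof (rule leads_add_below[OF _ below_sum])
    have "below (rt x d i) (- kexp s n i + kexp s n (Suc (i + d)) + \<gamma> s' d i)"
      by (rule homog_below[OF homog_rt[OF hx]]) simp
    moreover have "leads (kk R1.k d i * rt (ce s' n) d i) (- kexp s n i + kexp s n (Suc (i + d)) + \<gamma> s' d i)"
      unfolding kk using i by (intro leads_mult leads_mon lead)
    ultimately show "leads (rt x d i + kk R1.k d i * rt (ce s' n) d i)
        (- kexp s n i + kexp s n (Suc (i + d)) + \<gamma> s' d i)"
      by (metis add.commute leads_add_below)
  next
    fix r assume r: "r \<in> {..<d}"
    have "homog (rt x r i * (kk R1.k (d - Suc r) (Suc (i + r)) * rt (ce s' n) (d - Suc r) (Suc (i + r))))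
        ((int r + 1) * - 1 + (deg (- kexp s n (Suc (i + r)) + kexp s n (Suc (Suc (i + r) + (d - Suc r)))) + (int (d - Suc r) + 1) * 1))"
      unfolding kk by (intro homog_mult homog_mon homog_rt hx homog_ce)
    then show "below (sc (1 - (inverse q)\<^sup>2) * (rt x r i *
        (kk R1.k (d - Suc r) (Suc (i + r)) * rt (ce s' n) (d - Suc r) (Suc (i + r)))))
      (- kexp s n i + kexp s n (Suc (i + d)) + \<gamma> s' d i)"
      by (intro below_sc_mult, rule homog_below) (use r in auto)
  qed
qed

lemma leads_te:
  assumes "1 \<le> i" "i + d < n"
  shows "leads (rt te d i) (gE d i)"
proof -
  interpret S0: qrep sc q n "\<lambda>i. 0" "\<lambda>i. of_bool (i > n - n)" "cf 0 n" "ce 0 n" "cL 0 n" "cK 0 n" by (rule side0)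
  have k: "cL 0 n i * cK 0 n (Suc i) = S0.k i" for i by (simp add: S0.k_def)
  have "S0.k i * y = y * S0.k i" if "y \<in> range (ce 1 n)" for y i
  proof -
    have "y \<in> qrep.gens (ce 1 n) (cf 1 n) (cK 1 n) (cL 1 n)"
      using that unfolding qrep.gens_def[OF side1] by auto
    then show ?thesis
      unfolding S0.k_def using sides_commute S0.gens_mem by (intro comm_mult) (auto simp: commuting_def)
  qed
  moreover have "commuting (range (cf 0 n)) (range (ce 1 n))"
    by (rule commuting_mono[OF sides_commute]) (auto simp: S0.gens_def qrep.gens_def[OF side1] simp del: One_nat_def)
  ultimately have c: "commuting (range (ce 1 n)) (range (cf 0 n) \<union> range S0.k)"
    unfolding commuting_def by (auto simp del: One_nat_def)
  have "leads (rt (\<lambda>i. cf 0 n i + S0.k i * ce 1 n i) d i) (gE d i)"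
    unfolding gE_def by (rule leads_two_sides[OF side0 side1 homog_cf _ c assms]) simp
  moreover have "te = (\<lambda>i. cf 0 n i + S0.k i * ce 1 n i)" by (simp add: te_def fun_eq_iff k)
  ultimately show ?thesis by simp
qed

lemma leads_tf:
  assumes "1 \<le> i" "i + d < n"
  shows "leads (rt tf d i) (gF d i)"
proof -
  have side1': "qrep sc q n (\<lambda>i. 0) (\<lambda>i. of_bool (i > n - n)) (cf 1 n) (ce 1 n) (cL 1 n) (cK 1 n)"
    by (rule qrep.opposite[OF side1])
  have side0': "qrep sc q n (\<lambda>i. of_bool (i > n - n)) (\<lambda>i. 0) (ce 0 n) (cf 0 n) (cK 0 n) (cL 0 n)"
    by (rule qrep.opposite[OF side0])
  interpret S1: qrep sc q n "\<lambda>i. 0" "\<lambda>i. of_bool (i > n - n)" "cf 1 n" "ce 1 n" "cL 1 n" "cK 1 n" by (rule side1')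
  have comm: "x * y = y * x" if "x \<in> range (ce 0 n)" "y \<in> S1.gens" for x y
  proof -
    have "x \<in> qrep.gens (cf 0 n) (ce 0 n) (cL 0 n) (cK 0 n)"
      "y \<in> qrep.gens (ce 1 n) (cf 1 n) (cK 1 n) (cL 1 n)"
      using that unfolding qrep.gens_def[OF side0] qrep.gens_def[OF side1] S1.gens_def by auto
    then show ?thesis using sides_commute by (auto simp: commuting_def)
  qed
  have kc: "x * S1.k i = S1.k i * x" if "x \<in> range (ce 0 n)" for x i
    unfolding S1.k_def using comm[OF that] S1.gens_mem by (intro comm_mult[symmetric]) auto
  then have c: "commuting (range (ce 0 n)) (range (cf 1 n) \<union> range S1.k)"
    using comm S1.gens_mem unfolding commuting_def by blast
  have "leads (rt (\<lambda>i. cf 1 n i + S1.k i * ce 0 n i) d i) (gF d i)"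
    unfolding gF_def by (rule leads_two_sides[OF side1' side0' homog_cf _ c assms]) simp
  \<comment> \<open>The sides commute, so \<open>tf\<close> can also be read as a coproduct whose
    first factor is side 1.\<close>
  moreover have "tf = (\<lambda>i. cf 1 n i + S1.k i * ce 0 n i)"
  proof
    fix i
    have "tf i = ce 0 n i * S1.k i + cf 1 n i" unfolding tf_def S1.k_def by simp
    then show "tf i = cf 1 n i + S1.k i * ce 0 n i" using kc[of "ce 0 n i" i] by (simp add: add.commute)
  qed
  ultimately show ?thesis by simp
qed

lemma leads_tK: "leads (tK i) (gK i)" "leads (tL i) (- gK i)"
proof -
  have "leads (tL i) (kexp 0 n i + - kexp 1 n i)" "leads (tK i) (- kexp 0 n i + kexp 1 n i)"
    unfolding tL_def tK_def cK_def cL_def by (intro leads_mult leads_mon)+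
  then show "leads (tK i) (gK i)" "leads (tL i) (- gK i)" by (simp_all add: gK_def)
qed

lemma lookup_gE: "fst p \<noteq> 2 \<Longrightarrow> Poly_Mapping.lookup (gE d i) p =
    Poly_Mapping.lookup (xv 1 i i) p - Poly_Mapping.lookup (xv 1 i (Suc (i + d))) p"
  unfolding gE_def lookup_add by (simp add: lookup_kexp lookup_gamma)

lemma lookup_gF: "fst p \<noteq> 2 \<Longrightarrow> Poly_Mapping.lookup (gF d i) p =
    Poly_Mapping.lookup (xv 0 i i) p - Poly_Mapping.lookup (xv 0 i (Suc (i + d))) p"
  unfolding gF_def lookup_add by (simp add: lookup_kexp lookup_gamma)

lemma lookup_gK: "fst p \<noteq> 2 \<Longrightarrow> Poly_Mapping.lookup (gK i) p = 0"
  unfolding gK_def lookup_add by (simp add: lookup_kexp)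

text \<open>Copy 1 contains all variables, so its shift exponents on side 1 tell the torus
  generators apart.\<close>

lemma lookup_gK': "i \<in> {1..n} \<Longrightarrow> Poly_Mapping.lookup (gK i) (2, 1, n - 1, j) = of_bool (i = j)"
proof -
  assume i: "i \<in> {1..n}"
  have "Poly_Mapping.lookup (kexp 0 n i) (2, 1, n - 1, j) = 0"
    unfolding kexp_def lookup_sum by (rule sum.neutral) (auto simp: lookup_tv)
  moreover have "Poly_Mapping.lookup (kexp 1 n i) (2, 1, n - 1, j) = (\<Sum>c\<in>{0<..n}. if c = 1 then of_bool (i = j) else 0)"
    unfolding kexp_def lookup_sum using i by (intro sum.cong) (auto simp: lookup_tv)
  ultimately show ?thesis using i by (simp add: gK_def lookup_add lookup_minus del: One_nat_def)
qed

text \<open>Leading exponent of the root vector with index \<open>(i, j)\<close>; the diagonal indexes the torus.\<close>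

definition gen_exp :: "nat \<times> nat \<Rightarrow> expo"
  where "gen_exp = (\<lambda>(i, j). if i < j then gE (j - i - 1) i else if j < i then gF (i - j - 1) j else gK i)"

section \<open>Linear independence of the leading exponents\<close>

definition lincomb :: "(nat \<times> nat \<Rightarrow> int) \<Rightarrow> expo"
  where "lincomb a = (\<Sum>p\<in>{1..n} \<times> {1..n}. frag_cmul (a p) (gen_exp p))"

lemma lookup_lincomb: "Poly_Mapping.lookup (lincomb a) r =
    (\<Sum>p\<in>{1..n} \<times> {1..n}. a p * Poly_Mapping.lookup (gen_exp p) r)"
  by (simp add: lincomb_def lookup_sum)

text \<open>For \<open>i < j\<close> the exponent of variable \<open>j\<close> in copy
  \<open>i\<close> on side 1 is nonzero only for the generator indexed \<open>(i, j)\<close>, and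
  the one on side 0 only for \<open>(j, i)\<close>. Once the off-diagonal coefficients have been
  compared in this way, the shift exponents of copy 1 settle the diagonal.\<close>

lemma lincomb_inj:
  assumes ab: "lincomb a = lincomb b" and p: "p \<in> {1..n} \<times> {1..n}"
  shows "a p = b p"
proof -
  define c where "c p = a p - b p" for p
  have z: "(\<Sum>p\<in>{1..n} \<times> {1..n}. c p * Poly_Mapping.lookup (gen_exp p) r) = 0" for r
    using lookup_lincomb[of a r] lookup_lincomb[of b r] ab
    by (simp add: c_def left_diff_distrib sum_subtractf)
  have fin: "finite ({1..n} \<times> {1..n})" by simp
  have single: "c p0 = 0" if "p0 \<in> {1..n} \<times> {1..n}" "Poly_Mapping.lookup (gen_exp p0) r \<noteq> 0"
    "\<And>p. p \<in> {1..n} \<times> {1..n} \<Longrightarrow> p \<noteq> p0 \<Longrightarrow> c p * Poly_Mapping.lookup (gen_exp p) r = 0" for p0 r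
  proof -
    have "(\<Sum>p\<in>{1..n} \<times> {1..n}. c p * Poly_Mapping.lookup (gen_exp p) r) = c p0 * Poly_Mapping.lookup (gen_exp p0) r"
      using that(1,3) by (subst sum.remove[OF fin that(1)]) (auto intro!: sum.neutral)
    then show ?thesis using z[of r] that(2) by simp
  qed
  have up: "c (i, j) = 0" if "i \<in> {1..n}" "j \<in> {1..n}" "i < j" for i j
  proof (rule single[of _ "(1, 1, n - i, j)"])
    show "Poly_Mapping.lookup (gen_exp (i, j)) (1, 1, n - i, j) \<noteq> 0"
      using that by (simp add: gen_exp_def lookup_gE lookup_xv)
    fix p assume p: "p \<in> {1..n} \<times> {1..n}" "p \<noteq> (i, j)"
    obtain i' j' where p': "p = (i', j')" by (cases p)
    have e: "n - i' = n - i \<longleftrightarrow> i' = i" using p p' that by auto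
    have "Poly_Mapping.lookup (gen_exp p) (1, 1, n - i, j) = 0"
      using p p' that e by (auto simp: gen_exp_def lookup_gE lookup_gF lookup_gK lookup_xv)
    then show "c p * Poly_Mapping.lookup (gen_exp p) (1, 1, n - i, j) = 0" by simp
  qed (use that in auto)
  have low: "c (j, i) = 0" if "i \<in> {1..n}" "j \<in> {1..n}" "i < j" for i j
  proof (rule single[of _ "(1, 0, n - i, j)"])
    show "Poly_Mapping.lookup (gen_exp (j, i)) (1, 0, n - i, j) \<noteq> 0"
      using that by (simp add: gen_exp_def lookup_gF lookup_xv)
    fix p assume p: "p \<in> {1..n} \<times> {1..n}" "p \<noteq> (j, i)"
    obtain i' j' where p': "p = (i', j')" by (cases p)
    have e: "n - j' = n - i \<longleftrightarrow> j' = i" using p p' that by auto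
    have "Poly_Mapping.lookup (gen_exp p) (1, 0, n - i, j) = 0"
      using p p' that e by (auto simp: gen_exp_def lookup_gE lookup_gF lookup_gK lookup_xv)
    then show "c p * Poly_Mapping.lookup (gen_exp p) (1, 0, n - i, j) = 0" by simp
  qed (use that in auto)
  have off: "c (i, j) = 0" if "i \<in> {1..n}" "j \<in> {1..n}" "i \<noteq> j" for i j
    using up[of i j] low[of j i] that by (metis linorder_neqE_nat)
  have diag: "c (j, j) = 0" if "j \<in> {1..n}" for j
  proof (rule single[of _ "(2, 1, n - 1, j)"])
    show "Poly_Mapping.lookup (gen_exp (j, j)) (2, 1, n - 1, j) \<noteq> 0"
      using that by (simp only: gen_exp_def) (simp add: lookup_gK'[simplified])
    fix p assume p: "p \<in> {1..n} \<times> {1..n}" "p \<noteq> (j, j)"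
    obtain i' j' where p': "p = (i', j')" by (cases p)
    show "c p * Poly_Mapping.lookup (gen_exp p) (2, 1, n - 1, j) = 0"
    proof (cases "i' = j'")
      case True
      then have "Poly_Mapping.lookup (gen_exp p) (2, 1, n - 1, j) = 0"
        using p p' lookup_gK'[of i' j] by (simp add: gen_exp_def)
      then show ?thesis by simp
    next
      case False
      then show ?thesis using off p p' by auto
    qed
  qed (use that in auto)
  obtain i j where "p = (i, j)" by (cases p)
  then have "c p = 0" using off diag p by (cases "i = j") auto
  then show ?thesis by (simp add: c_def)
qed

end

section \<open>Root vectors modulo an ideal\<close>

text \<open>Congruence modulo a two-sided ideal of a ring type replaces equality in the quotient, so
  ring simplification applies to representatives. \<open>q_sum\<close> permits the division in
  \<open>middle_commutes\<close>.\<close>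

locale rel_ideal = central_field sca q
  for sca :: "'k::field \<Rightarrow> 'r::ring_1" and q :: 'k +
  fixes J :: "'r set"
  assumes J_zero: "0 \<in> J" and J_add: "\<lbrakk>a \<in> J; b \<in> J\<rbrakk> \<Longrightarrow> a + b \<in> J"
    and J_left: "a \<in> J \<Longrightarrow> x * a \<in> J" and J_right: "a \<in> J \<Longrightarrow> a * x \<in> J"
    and q_sum: "q + inverse q \<noteq> 0"
begin

lemma J_uminus: "a \<in> J \<Longrightarrow> - a \<in> J"
  using J_left[of a "-1"] by simp

lemma J_diff: "a \<in> J \<Longrightarrow> b \<in> J \<Longrightarrow> a - b \<in> J"
  using J_add[of a "- b"] J_uminus by simp

lemma J_sca_cancel: "c \<noteq> 0 \<Longrightarrow> sca c * a \<in> J \<Longrightarrow> a \<in> J"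
  using J_left[of "sca c * a" "sca (inverse c)"] by (simp add: sca_one flip: mult.assoc sca_mult)

definition eqv :: "'r \<Rightarrow> 'r \<Rightarrow> bool" (infix \<open>\<doteq>\<close> 50)
  where "x \<doteq> y \<longleftrightarrow> x - y \<in> J"

lemma eqv_refl [simp]: "x \<doteq> x"
  by (simp add: eqv_def J_zero)

lemma eqv_sym: "x \<doteq> y \<Longrightarrow> y \<doteq> x"
  using J_uminus[of "x - y"] by (simp add: eqv_def)

lemma eqv_trans [trans]: "x \<doteq> y \<Longrightarrow> y \<doteq> z \<Longrightarrow> x \<doteq> z"
  using J_add[of "x - y" "y - z"] by (simp add: eqv_def)

lemma eqv_eq_trans [trans]: "x \<doteq> y \<Longrightarrow> y = z \<Longrightarrow> x \<doteq> z" "x = y \<Longrightarrow> y \<doteq> z \<Longrightarrow> x \<doteq> z"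
  by simp_all

lemma eqv_add: "x \<doteq> y \<Longrightarrow> x' \<doteq> y' \<Longrightarrow> x + x' \<doteq> y + y'"
  using J_add[of "x - y" "x' - y'"] by (simp add: eqv_def algebra_simps)

lemma eqv_diff: "x \<doteq> y \<Longrightarrow> x' \<doteq> y' \<Longrightarrow> x - x' \<doteq> y - y'"
  using J_diff[of "x - y" "x' - y'"] by (simp add: eqv_def algebra_simps)

lemma eqv_left: "x \<doteq> y \<Longrightarrow> z * x \<doteq> z * y"
  using J_left[of "x - y" z] by (simp add: eqv_def right_diff_distrib)

lemma eqv_right: "x \<doteq> y \<Longrightarrow> x * z \<doteq> y * z"
  using J_right[of "x - y" z] by (simp add: eqv_def left_diff_distrib)

lemma eqv_scaled_mult:
  assumes "x * z \<doteq> sca c * (z * x)" "y * z \<doteq> sca d * (z * y)"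
  shows "(x * y) * z \<doteq> sca (c * d) * (z * (x * y))"
proof -
  have "(x * y) * z = x * (y * z)" by (simp add: mult.assoc)
  also have "\<dots> \<doteq> x * (sca d * (z * y))" using assms(2) by (rule eqv_left)
  also have "\<dots> = sca d * ((x * z) * y)" by (simp add: sca_left[of x] mult.assoc)
  also have "\<dots> \<doteq> sca d * (sca c * (z * x) * y)" using assms(1) by (intro eqv_left eqv_right)
  finally show ?thesis by (simp add: sca_mult mult.assoc mult.commute[of c])
qed

lemma eqv_scaled_br:
  assumes "x * z \<doteq> sca c * (z * x)" "y * z \<doteq> sca d * (z * y)"
  shows "br x y * z \<doteq> sca (c * d) * (z * br x y)"
proof -
  have "br x y * z = (x * y) * z - P * ((y * x) * z)" by (simp add: br_def left_diff_distrib mult.assoc)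
  also have "\<dots> \<doteq> sca (c * d) * (z * (x * y)) - P * (sca (d * c) * (z * (y * x)))"
    using eqv_scaled_mult[OF assms] eqv_scaled_mult[OF assms(2,1)] by (intro eqv_diff eqv_left)
  also have "\<dots> = sca (c * d) * (z * br x y)"
    by (simp add: br_def right_diff_distrib sca_left[of z] sca_left[of P] mult.commute[of d])
  finally show ?thesis .
qed

lemma eqv_comm_br:
  assumes "x * z \<doteq> z * x" "y * z \<doteq> z * y"
  shows "br x y * z \<doteq> z * br x y"
  using eqv_scaled_br[of x z 1 y 1] assms by (simp add: sca_one)

lemma eqv_scaled_br_right:
  assumes "z * x \<doteq> sca c * (x * z)" "z * y \<doteq> sca d * (y * z)"
  shows "z * br x y \<doteq> sca (c * d) * (br x y * z)"
proof -
  have m: "z * (x * y) \<doteq> sca (c * d) * ((x * y) * z)"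
    if "z * x \<doteq> sca c * (x * z)" "z * y \<doteq> sca d * (y * z)" for x y c d
  proof -
    have "z * (x * y) = (z * x) * y" by (simp add: mult.assoc)
    also have "\<dots> \<doteq> sca c * (x * z) * y" using that(1) by (rule eqv_right)
    also have "\<dots> = sca c * (x * (z * y))" by (simp add: mult.assoc)
    also have "\<dots> \<doteq> sca c * (x * (sca d * (y * z)))" using that(2) by (intro eqv_left)
    also have "\<dots> = sca (c * d) * ((x * y) * z)" by (simp add: sca_left[of x] sca_mult mult.assoc)
    finally show ?thesis .
  qed
  have "z * br x y = z * (x * y) - P * (z * (y * x))" by (simp add: br_def right_diff_distrib sca_left[of z])
  also have "\<dots> \<doteq> sca (c * d) * ((x * y) * z) - P * (sca (d * c) * ((y * x) * z))"
    using m[OF assms] m[OF assms(2,1)] by (intro eqv_diff eqv_left)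
  also have "\<dots> = sca (c * d) * (br x y * z)"
    by (simp add: br_def left_diff_distrib right_diff_distrib sca_left[of P] mult.commute[of d] mult.assoc)
  finally show ?thesis .
qed

text \<open>The difference of the two bracketings is 1/q times the commutator of \<open>b\<close>
  with \<open>a * c - c * a\<close>.\<close>

lemma br_assoc:
  assumes "a * c \<doteq> c * a"
  shows "br a (br b c) \<doteq> br (br a b) c"
proof -
  have "br a (br b c) - br (br a b) c = P * (b * (a * c - c * a)) - P * ((a * c - c * a) * b)"
    by (simp add: br_def left_diff_distrib right_diff_distrib sca_left[of a] sca_left[of b] sca_left[of c] mult.assoc)
  also have "\<dots> \<in> J" using assms unfolding eqv_def
    by (intro J_diff[OF J_left[OF J_left] J_left[OF J_right]])
  finally show ?thesis by (simp add: eqv_def)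
qed

text \<open>
  Computing \<open>b\<close> times the triple bracket via both bracketings gives two relations whose sum is
  \<open>q + q\<^sup>-\<^sup>1\<close> times the claim.
\<close>

lemma middle_commutes:
  assumes h1: "a * c \<doteq> c * a" and h2: "b * br b c \<doteq> Q * (br b c * b)"
    and h3: "br a b * b \<doteq> Q * (b * br a b)"
  shows "br a (br b c) * b \<doteq> b * br a (br b c)"
proof -
  define G where "G = br a b"
  define H where "H = br b c"
  define Z where "Z = br a H"
  define Z' where "Z' = br G c"
  have ZZ: "Z \<doteq> Z'" unfolding Z_def Z'_def G_def H_def using h1 by (rule br_assoc)
  have 1: "b * Z \<doteq> Q * (Q * (Z * b)) + Q * (H * G - G * H)"
  proof -
    note rules = QP QP[THEN mult_assoc_subst] sca_left[of a] sca_left[of b] sca_left[of H]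
    have "b * Z - (Q * (Q * (Z * b)) + Q * (H * G - G * H)) =
        Q * (a * (b * H - Q * (H * b))) - P * ((b * H - Q * (H * b)) * a)"
      unfolding Z_def G_def br_def by (simp add: left_diff_distrib right_diff_distrib mult.assoc rules)
    also have "\<dots> \<in> J" using h2 unfolding eqv_def H_def[symmetric]
      by (intro J_diff[OF J_left[OF J_left] J_left[OF J_right]])
    finally show ?thesis by (simp add: eqv_def)
  qed
  have 2: "b * Z' \<doteq> P * (P * (Z' * b)) + P * (G * H - H * G)"
  proof -
    note rules = QP QP[THEN mult_assoc_subst] sca_left[of c] sca_left[of b] sca_left[of G]
    have "b * Z' - (P * (P * (Z' * b)) + P * (G * H - H * G)) =
        P * (P * (P * (c * (G * b - Q * (b * G))))) - P * ((G * b - Q * (b * G)) * c)"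
      unfolding Z'_def H_def br_def by (simp add: left_diff_distrib right_diff_distrib mult.assoc rules)
    also have "\<dots> \<in> J" using h3 unfolding eqv_def G_def[symmetric]
      by (intro J_diff[OF J_left[OF J_left[OF J_left[OF J_left]]] J_left[OF J_right]])
    finally show ?thesis by (simp add: eqv_def)
  qed
  have 3: "b * Z \<doteq> P * (P * (Z * b)) + P * (G * H - H * G)"
  proof -
    have "b * Z \<doteq> b * Z'" using ZZ by (rule eqv_left)
    also note 2
    also have "P * (P * (Z' * b)) + P * (G * H - H * G) \<doteq> P * (P * (Z * b)) + P * (G * H - H * G)"
      using eqv_sym[OF ZZ] by (intro eqv_add eqv_left eqv_right) auto
    finally show ?thesis .
  qed
  \<comment> \<open>With the weights \<open>P\<close> and \<open>Q\<close> the commutators of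
    \<open>G\<close> and \<open>H\<close> in the two relations cancel.\<close>
  have "P * (b * Z) + Q * (b * Z) \<doteq>
      P * (Q * (Q * (Z * b)) + Q * (H * G - G * H)) + Q * (P * (P * (Z * b)) + P * (G * H - H * G))"
    using 1 3 by (intro eqv_add eqv_left)
  also have "\<dots> = P * (Z * b) + Q * (Z * b)"
    by (simp add: distrib_left right_diff_distrib QP QP[THEN mult_assoc_subst])
  finally have "sca (q + inverse q) * (b * Z - Z * b) \<in> J"
    unfolding eqv_def by (simp add: sca_add distrib_left distrib_right right_diff_distrib algebra_simps)
  then have "b * Z - Z * b \<in> J" using J_sca_cancel[OF q_sum] by blast
  then have "b * Z \<doteq> Z * b" by (simp add: eqv_def)
  then show ?thesis unfolding Z_def H_def by (rule eqv_sym)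
qed

section \<open>Commutation of root vectors with simple generators\<close>

definition serre_mod :: "nat \<Rightarrow> (nat \<Rightarrow> 'r) \<Rightarrow> bool"
  where "serre_mod n x \<longleftrightarrow> (\<forall>i\<in>{1..<n}. \<forall>j\<in>{1..<n}.
    (\<bar>int i - int j\<bar> > 1 \<longrightarrow> x i * x j \<doteq> x j * x i) \<and>
    (\<bar>int i - int j\<bar> = 1 \<longrightarrow> x i * (x i * x j) + x j * (x i * x i) \<doteq>
        Q * (x i * (x j * x i)) + P * (x i * (x j * x i))))"

context
  fixes n x assumes serre: "serre_mod n x"
begin

lemma sm_far: "\<lbrakk>i \<in> {1..<n}; j \<in> {1..<n}; i + 1 < j \<or> j + 1 < i\<rbrakk> \<Longrightarrow> x i * x j \<doteq> x j * x i"
  using serre unfolding serre_mod_def by auto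

text \<open>Converse of \<open>serre_from_br\<close>, modulo \<open>J\<close>.\<close>

lemma sm_near:
  assumes "1 \<le> i" "Suc i < n"
  shows "x i * br (x i) (x (Suc i)) \<doteq> Q * (br (x i) (x (Suc i)) * x i)"
    "br (x i) (x (Suc i)) * x (Suc i) \<doteq> Q * (x (Suc i) * br (x i) (x (Suc i)))"
proof -
  let ?a = "x i" and ?b = "x (Suc i)"
  have s: "?a * (?a * ?b) + ?b * (?a * ?a) \<doteq> Q * (?a * (?b * ?a)) + P * (?a * (?b * ?a))"
    "?b * (?b * ?a) + ?a * (?b * ?b) \<doteq> Q * (?b * (?a * ?b)) + P * (?b * (?a * ?b))"
    using serre assms unfolding serre_mod_def by auto
  note rules = QP QP[THEN mult_assoc_subst] sca_left[of ?a] sca_left[of ?b]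
  have "?a * br ?a ?b - Q * (br ?a ?b * ?a) =
      (?a * (?a * ?b) + ?b * (?a * ?a)) - (Q * (?a * (?b * ?a)) + P * (?a * (?b * ?a)))"
    by (simp add: br_def left_diff_distrib right_diff_distrib mult.assoc rules)
  then show "?a * br ?a ?b \<doteq> Q * (br ?a ?b * ?a)" using s(1) by (simp only: eqv_def)
  have "br ?a ?b * ?b - Q * (?b * br ?a ?b) =
      (?b * (?b * ?a) + ?a * (?b * ?b)) - (Q * (?b * (?a * ?b)) + P * (?b * (?a * ?b)))"
    by (simp add: br_def left_diff_distrib right_diff_distrib mult.assoc rules)
  then show "br ?a ?b * ?b \<doteq> Q * (?b * br ?a ?b)" using s(2) by (simp only: eqv_def)
qed

lemma rt_far:
  assumes "r \<in> {1..<n}" "1 \<le> i" "i + d < n" "r + 1 < i \<or> i + d + 1 < r"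
  shows "rt x d i * x r \<doteq> x r * rt x d i"
  using assms(2-)
proof (induction d arbitrary: i)
  case 0
  then show ?case using assms(1) by (auto intro: sm_far)
next
  case (Suc d)
  then show ?case unfolding rt.simps using assms(1) by (intro eqv_comm_br Suc.IH sm_far) auto
qed

text \<open>Rebracketing isolates the bracket of the first two generators. \<open>x i\<close>
  q-commutes with that bracket and commutes with the remaining factor.\<close>

lemma rt_first:
  assumes "1 \<le> i" "i + Suc d < n"
  shows "x i * rt x (Suc d) i \<doteq> Q * (rt x (Suc d) i * x i)"
proof (cases d)
  case 0
  then show ?thesis using sm_near(1)[of i] assms by simp
next
  case (Suc d')
  let ?G = "br (x i) (x (Suc i))" and ?c = "rt x d' (Suc (Suc i))"
  have c: "x i * ?c \<doteq> ?c * x i" using assms Suc by (intro eqv_sym[OF rt_far]) auto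
  have e: "rt x (Suc d) i \<doteq> br ?G ?c" using br_assoc[OF c, of "x (Suc i)"] Suc by simp
  have "x i * br ?G ?c \<doteq> sca (q * 1) * (br ?G ?c * x i)"
    using sm_near(1)[of i] assms c by (intro eqv_scaled_br_right) (auto simp: sca_one)
  then have "x i * br ?G ?c \<doteq> Q * (br ?G ?c * x i)" by simp
  then show ?thesis
    using eqv_trans[OF eqv_left[OF e] eqv_trans[OF _ eqv_left[OF eqv_right[OF eqv_sym[OF e]]]]] by blast
qed

text \<open>Generators further to the left commute with \<open>x r\<close> and are peeled off until
  \<open>r\<close> is the second index, where \<open>middle_commutes\<close> applies.\<close>

lemma rt_middle:
  assumes "1 \<le> i" "i + d < n" "i < r" "r < i + d"
  shows "rt x d i * x r \<doteq> x r * rt x d i"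
  using assms
proof (induction d arbitrary: i)
  case (Suc d)
  show ?case
  proof (cases "r = Suc i")
    case False
    then show ?thesis unfolding rt.simps using Suc.prems by (intro eqv_comm_br Suc.IH sm_far) auto
  next
    case True
    then obtain d' where d: "d = Suc d'" using Suc.prems by (cases d) auto
    have "x i * rt x d' (Suc (Suc i)) \<doteq> rt x d' (Suc (Suc i)) * x i"
      using Suc.prems d by (intro eqv_sym[OF rt_far]) auto
    moreover have "x (Suc i) * rt x d (Suc i) \<doteq> Q * (rt x d (Suc i) * x (Suc i))"
      unfolding d using Suc.prems d by (intro rt_first) auto
    moreover have "br (x i) (x (Suc i)) * x (Suc i) \<doteq> Q * (x (Suc i) * br (x i) (x (Suc i)))"
      using Suc.prems d by (intro sm_near) auto
    ultimately show ?thesis using middle_commutes True d by simp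
  qed
qed simp

lemma rt_last:
  assumes "1 \<le> i" "i + Suc d < n"
  shows "rt x (Suc d) i * x (i + Suc d) \<doteq> Q * (x (i + Suc d) * rt x (Suc d) i)"
  using assms
proof (induction d arbitrary: i)
  case 0
  then show ?case using sm_near(2)[of i] by simp
next
  case (Suc d)
  have "rt x (Suc d) (Suc i) * x (Suc i + Suc d) \<doteq> Q * (x (Suc i + Suc d) * rt x (Suc d) (Suc i))"
    using Suc.prems by (intro Suc.IH) auto
  moreover have "x i * x (Suc i + Suc d) \<doteq> sca 1 * (x (Suc i + Suc d) * x i)"
    using Suc.prems by (simp add: sca_one) (intro sm_far; auto)
  ultimately have "br (x i) (rt x (Suc d) (Suc i)) * x (Suc i + Suc d) \<doteq>
      sca (1 * q) * (x (Suc i + Suc d) * br (x i) (rt x (Suc d) (Suc i)))"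
    by (intro eqv_scaled_br)
  then show ?case by simp
qed

text \<open>Induction from the common end \<open>t\<close>: the longer root vector q-commutes with
  the generator \<open>t\<close> by \<open>rt_last\<close> and commutes with the inner generators by
  \<open>rt_middle\<close>, and the shorter root vector is bracketed from these.\<close>

lemma rt_column:
  assumes "1 \<le> i" "i < j" "j \<le> t" "t < n"
  shows "rt x (t - i) i * rt x (t - j) j \<doteq> Q * (rt x (t - j) j * rt x (t - i) i)"
  using assms(2,3)
proof (induction "t - j" arbitrary: j)
  case 0
  have "rt x (Suc (t - i - 1)) i * x (i + Suc (t - i - 1)) \<doteq> Q * (x (i + Suc (t - i - 1)) * rt x (Suc (t - i - 1)) i)"
    using assms 0 by (intro rt_last) auto
  moreover have e: "Suc (t - i - 1) = t - i" "i + (t - i) = t" and "j = t" using 0 by auto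
  ultimately show ?case by (simp only: e) simp
next
  case (Suc d)
  let ?E = "rt x (t - i) i"
  have d: "t - j = Suc d" "t - Suc j = d" using Suc by auto
  have "?E * rt x (t - Suc j) (Suc j) \<doteq> Q * (rt x (t - Suc j) (Suc j) * ?E)"
    using Suc by (intro Suc.hyps(1)) auto
  moreover have "?E * x j \<doteq> sca 1 * (x j * ?E)"
    using Suc.prems assms Suc.hyps(2) unfolding sca_one mult_1_left by (intro rt_middle) auto
  ultimately have "?E * br (x j) (rt x (t - Suc j) (Suc j)) \<doteq>
      sca (1 * q) * (br (x j) (rt x (t - Suc j) (Suc j)) * ?E)"
    by (intro eqv_scaled_br_right)
  then show ?case unfolding d by simp
qed

end

section \<open>Spanning sets modulo an ideal\<close>

text \<open>The sum of \<open>J\<close> and the linear span of \<open>S\<close>. Starting from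
  \<open>J\<close> makes congruent elements interchangeable.\<close>

inductive_set sp :: "'r set \<Rightarrow> 'r set" for S
  where
    sp_J: "a \<in> J \<Longrightarrow> a \<in> sp S"
  | sp_term: "x \<in> S \<Longrightarrow> p \<in> sp S \<Longrightarrow> sca c * x + p \<in> sp S"

lemma sp_zero: "0 \<in> sp S"
  by (rule sp_J[OF J_zero])

lemma sp_base: "x \<in> S \<Longrightarrow> x \<in> sp S"
  using sp_term[OF _ sp_zero, of x S 1] by (simp add: sca_one)

lemma sp_add: "p \<in> sp S \<Longrightarrow> r \<in> sp S \<Longrightarrow> p + r \<in> sp S"
proof (induction rule: sp.induct)
  case (sp_J a)
  from sp_J(2) show ?case
  proof (induction rule: sp.induct)
    case (sp_J b)
    then show ?case using \<open>a \<in> J\<close> by (intro sp.sp_J J_add)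
  next
    case (sp_term x p c)
    then show ?case by (metis add.left_commute sp.sp_term)
  qed
qed (simp add: add.assoc sp_term)

lemma sp_sca: "p \<in> sp S \<Longrightarrow> sca c * p \<in> sp S"
proof (induction rule: sp.induct)
  case (sp_term x p d)
  have "sca c * (sca d * x + p) = sca (c * d) * x + sca c * p"
    by (simp add: distrib_left sca_mult mult.assoc)
  then show ?case using sp_term sp.sp_term by metis
qed (intro sp_J J_left)

lemma sp_eqv: "p \<doteq> r \<Longrightarrow> r \<in> sp S \<Longrightarrow> p \<in> sp S"
  using sp_add[OF sp_J, of "p - r" r S] by (simp add: eqv_def)

lemma sp_diff: "p \<in> sp S \<Longrightarrow> r \<in> sp S \<Longrightarrow> p - r \<in> sp S"
  using sp_add[OF _ sp_sca, of p S r "-1"] by (simp add: sca_uminus sca_one)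

lemma sp_subset: "S \<subseteq> sp T \<Longrightarrow> p \<in> sp S \<Longrightarrow> p \<in> sp T"
  by (rotate_tac 1, induction rule: sp.induct) (auto intro: sp_J sp_add sp_sca)

lemma sp_mono: "S \<subseteq> T \<Longrightarrow> p \<in> sp S \<Longrightarrow> p \<in> sp T"
  using sp_subset[of S T p] sp_base by blast

lemma sp_mult_right: "(\<And>x. x \<in> S \<Longrightarrow> x * z \<in> sp T) \<Longrightarrow> p \<in> sp S \<Longrightarrow> p * z \<in> sp T"
  by (rotate_tac 1, induction rule: sp.induct)
    (auto simp: distrib_right mult.assoc intro: sp_J J_right sp_add sp_sca)

lemma sp_mult_left: "(\<And>x. x \<in> S \<Longrightarrow> z * x \<in> sp T) \<Longrightarrow> p \<in> sp S \<Longrightarrow> z * p \<in> sp T"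
  by (rotate_tac 1, induction rule: sp.induct)
    (auto simp: distrib_left sca_left[of z] intro: sp_J J_left sp_add sp_sca)

lemma sp_mult: "(\<And>x y. x \<in> S \<Longrightarrow> y \<in> T \<Longrightarrow> x * y \<in> sp V) \<Longrightarrow> p \<in> sp S \<Longrightarrow> r \<in> sp T \<Longrightarrow> p * r \<in> sp V"
  by (rule sp_mult_right[of S]) (rule sp_mult_left[of T], auto)

end

section \<open>Ordered monomials in root vectors of one sign\<close>

context rel_ideal
begin

text \<open>The scalar is left open because only spans matter. To reverse a relation,
  \<open>qcomm_sym_nz\<close> asks for an explicit nonzero scalar.\<close>

definition qcomm :: "'r \<Rightarrow> 'r \<Rightarrow> bool"
  where "qcomm x y \<longleftrightarrow> (\<exists>c. x * y \<doteq> sca c * (y * x))"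

lemma qcommI: "x * y \<doteq> sca c * (y * x) \<Longrightarrow> qcomm x y"
  by (auto simp: qcomm_def)

lemma qcomm_eqv: "x * y \<doteq> y * x \<Longrightarrow> qcomm x y"
  by (rule qcommI[of _ _ 1]) (simp add: sca_one)

lemma qcomm_sym_nz:
  assumes "x * y \<doteq> sca c * (y * x)" "c \<noteq> 0"
  shows "y * x \<doteq> sca (inverse c) * (x * y)"
proof -
  have "sca (inverse c) * (x * y) \<doteq> sca (inverse c) * (sca c * (y * x))" using assms(1) by (rule eqv_left)
  also have "\<dots> = y * x" using assms(2) by (simp add: sca_one flip: mult.assoc sca_mult)
  finally show ?thesis by (rule eqv_sym)
qed

lemma qcomm_mult_left: "qcomm x z \<Longrightarrow> qcomm y z \<Longrightarrow> qcomm (x * y) z"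
  unfolding qcomm_def using eqv_scaled_mult by blast

lemma qcomm_mult_right: "qcomm z x \<Longrightarrow> qcomm z y \<Longrightarrow> qcomm z (x * y)"
proof -
  assume "qcomm z x" "qcomm z y"
  then obtain c d where c: "z * x \<doteq> sca c * (x * z)" and d: "z * y \<doteq> sca d * (y * z)"
    by (auto simp: qcomm_def)
  have "z * (x * y) = (z * x) * y" by (simp add: mult.assoc)
  also have "\<dots> \<doteq> sca c * (x * z) * y" using c by (rule eqv_right)
  also have "\<dots> = sca c * (x * (z * y))" by (simp add: mult.assoc)
  also have "\<dots> \<doteq> sca c * (x * (sca d * (y * z)))" using d by (intro eqv_left)
  also have "\<dots> = sca (c * d) * (x * y * z)" by (simp add: sca_left[of x] sca_mult mult.assoc)
  finally show ?thesis by (rule qcommI)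
qed

lemma qcomm_one: "qcomm 1 z" "qcomm z 1"
  by (rule qcomm_eqv; simp)+

lemma qcomm_power: "qcomm z x \<Longrightarrow> qcomm z (x ^ k)"
  by (induction k) (auto intro: qcomm_one qcomm_mult_right)

lemma qcomm_prod_list_left: "(\<And>x. x \<in> set xs \<Longrightarrow> qcomm x z) \<Longrightarrow> qcomm (prod_list xs) z"
  by (induction xs) (auto intro: qcomm_one qcomm_mult_left)

text \<open>The factor \<open>g\<close> travels past the slots in front of \<open>p\<close> and is
  absorbed by slot \<open>p\<close>. Abstract slots cover both powers of root vectors and integer
  powers of torus generators.\<close>

lemma slot_insert:
  fixes S :: "'p \<Rightarrow> 'z \<Rightarrow> 'r"
  assumes "distinct ord" "p \<in> set ord" "\<And>p'. p' \<in> set ord \<Longrightarrow> p' \<noteq> p \<Longrightarrow> qcomm g (S p' (a p'))"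
    and g: "g * S p (a p) \<doteq> S p z"
  shows "\<exists>c. g * prod_list (map (\<lambda>p. S p (a p)) ord) \<doteq>
    sca c * prod_list (map (\<lambda>p'. S p' ((a(p := z)) p')) ord)"
  using assms(1-3)
proof (induction ord)
  case (Cons o' ord)
  show ?case
  proof (cases "o' = p")
    case True
    then have "map (\<lambda>p'. S p' ((a(p := z)) p')) ord = map (\<lambda>p. S p (a p)) ord"
      using Cons.prems(1) by (intro map_cong) auto
    then have m: "map (\<lambda>p'. S p' ((a(p := z)) p')) (o' # ord) = S p z # map (\<lambda>p. S p (a p)) ord"
      by (simp only: list.map True fun_upd_same)
    have "g * prod_list (map (\<lambda>p. S p (a p)) (o' # ord)) \<doteq>
        sca 1 * prod_list (map (\<lambda>p'. S p' ((a(p := z)) p')) (o' # ord))"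
      unfolding m using eqv_right[OF g, of "prod_list (map (\<lambda>p. S p (a p)) ord)"] True
      by (simp add: sca_one mult.assoc)
    then show ?thesis ..
  next
    case False
    then have "qcomm g (S o' (a o'))" using Cons.prems by auto
    then obtain d where d: "g * S o' (a o') \<doteq> sca d * (S o' (a o') * g)" by (auto simp: qcomm_def)
    have "\<exists>c. g * prod_list (map (\<lambda>p. S p (a p)) ord) \<doteq>
        sca c * prod_list (map (\<lambda>p'. S p' ((a(p := z)) p')) ord)"
      using Cons.prems False by (intro Cons.IH) auto
    then obtain c where c: "g * prod_list (map (\<lambda>p. S p (a p)) ord) \<doteq>
        sca c * prod_list (map (\<lambda>p'. S p' ((a(p := z)) p')) ord)" ..
    have "g * prod_list (map (\<lambda>p. S p (a p)) (o' # ord)) =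
        (g * S o' (a o')) * prod_list (map (\<lambda>p. S p (a p)) ord)" by (simp add: mult.assoc)
    also have "\<dots> \<doteq> sca d * (S o' (a o') * g) * prod_list (map (\<lambda>p. S p (a p)) ord)"
      using d by (rule eqv_right)
    also have "\<dots> = sca d * (S o' (a o') * (g * prod_list (map (\<lambda>p. S p (a p)) ord)))"
      by (simp add: mult.assoc)
    also have "\<dots> \<doteq> sca d * (S o' (a o') * (sca c * prod_list (map (\<lambda>p'. S p' ((a(p := z)) p')) ord)))"
      using c by (intro eqv_left)
    also have "\<dots> = sca (d * c) * prod_list (map (\<lambda>p'. S p' ((a(p := z)) p')) (o' # ord))"
      using False by (simp add: sca_left[of "S o' (a o')"] sca_mult mult.assoc)
    finally show ?thesis by blast
  qed
qed simp

text \<open>\<open>root x (i, j)\<close> is the root vector of the root \<open>\<epsilon>\<^sub>i - \<epsilon>\<^sub>j\<close> for \<open>i < j\<close>.\<close>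

definition root :: "(nat \<Rightarrow> 'r) \<Rightarrow> nat \<times> nat \<Rightarrow> 'r"
  where "root x p = rt x (snd p - fst p - 1) (fst p)"

definition col_monom :: "(nat \<Rightarrow> 'r) \<Rightarrow> nat \<Rightarrow> (nat \<times> nat \<Rightarrow> nat) \<Rightarrow> 'r"
  where "col_monom x r a = prod_list (map (\<lambda>j. root x (j, r) ^ a (j, r)) [1..<r])"

text \<open>Ordered by columns, a column being the roots with the same second index. Dropping the
  last column leaves the order for one index less, as the induction in
  \<open>root_monom_span\<close> needs.\<close>

definition root_order :: "nat \<Rightarrow> (nat \<times> nat) list"
  where "root_order n = concat (map (\<lambda>r. map (\<lambda>j. (j, r)) [1..<r]) [1..<Suc n])"

definition root_monom :: "(nat \<Rightarrow> 'r) \<Rightarrow> nat \<Rightarrow> (nat \<times> nat \<Rightarrow> nat) \<Rightarrow> 'r"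
  where "root_monom x n a = prod_list (map (\<lambda>p. root x p ^ a p) (root_order n))"

lemma root_order_Suc: "root_order (Suc n) = root_order n @ map (\<lambda>j. (j, Suc n)) [1..<Suc n]"
  by (simp add: root_order_def)

lemma set_root_order: "set (root_order n) = {(i, j). 1 \<le> i \<and> i < j \<and> j \<le> n}"
proof (induction n)
  case (Suc n)
  have "(i, j) \<in> set (root_order (Suc n)) \<longleftrightarrow> 1 \<le> i \<and> i < j \<and> j \<le> Suc n" for i j
    unfolding root_order_Suc set_append Un_iff Suc by (cases "j = Suc n") auto
  then show ?case by auto
qed (auto simp: root_order_def)

lemma distinct_root_order: "distinct (root_order n)"
proof (induction n)
  case (Suc n)
  then show ?case unfolding root_order_Suc
    by (auto simp: set_root_order distinct_map inj_on_def)
qed (simp add: root_order_def)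

lemma root_monom_Suc: "root_monom x (Suc n) a = root_monom x n a * col_monom x (Suc n) a"
  by (simp add: root_monom_def root_order_Suc col_monom_def comp_def)

context
  fixes n x assumes serre: "serre_mod n x"
begin

lemma column_qcomm:
  assumes "i \<in> {1..<r}" "j \<in> {1..<r}" "r \<le> n"
  shows "qcomm (root x (i, r)) (root x (j, r))"
proof -
  have *: "root x (i, r) * root x (j, r) \<doteq> Q * (root x (j, r) * root x (i, r))"
    if "i \<in> {1..<r}" "j \<in> {1..<r}" "i < j" for i j
  proof -
    have "rt x (r - 1 - i) i * rt x (r - 1 - j) j \<doteq> Q * (rt x (r - 1 - j) j * rt x (r - 1 - i) i)"
      using that assms(3) by (intro rt_column[OF serre]) auto
    moreover have "r - 1 - i = r - i - 1" "r - 1 - j = r - j - 1" by simp_all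
    ultimately show ?thesis by (simp only: root_def fst_conv snd_conv)
  qed
  consider "i = j" | "i < j" | "j < i" by linarith
  then show ?thesis
  proof cases
    case 1
    then show ?thesis by (auto intro: qcomm_eqv)
  next
    case 2
    then show ?thesis using *[of i j] assms by (auto intro: qcommI)
  next
    case 3
    then show ?thesis using qcomm_sym_nz[OF *[of j i] q0] assms by (auto intro: qcommI)
  qed
qed

text \<open>Root vectors of one column q-commute pairwise, so sorting costs only scalars, and each
  letter raises one exponent by one.\<close>

lemma column_sort:
  assumes "set v \<subseteq> {1..<r}" "r \<le> n"
  shows "prod_list (map (\<lambda>j. root x (j, r)) v) \<in> sp {col_monom x r a |a. \<forall>p. a p \<le> length v}"
  using assms(1)
proof (induction v)
  case Nil
  have "col_monom x r (\<lambda>_. 0) = 1"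
    unfolding col_monom_def by (simp add: map_replicate_const)
  then show ?case using sp_base[of "col_monom x r (\<lambda>_. 0)"] by (auto intro!: sp_base)
next
  case (Cons j v)
  have j: "j \<in> {1..<r}" using Cons.prems by auto
  have "root x (j, r) * prod_list (map (\<lambda>j. root x (j, r)) v) \<in> sp {col_monom x r a |a. \<forall>p. a p \<le> length (j # v)}"
  proof (rule sp_mult_left)
    show "prod_list (map (\<lambda>j. root x (j, r)) v) \<in> sp {col_monom x r a |a. \<forall>p. a p \<le> length v}"
      using Cons by auto
    fix y assume "y \<in> {col_monom x r a |a. \<forall>p. a p \<le> length v}"
    then obtain a where a: "y = col_monom x r a" "\<forall>p. a p \<le> length v" by auto
    let ?b = "\<lambda>i. a (i, r)"
    let ?a' = "a((j, r) := Suc (a (j, r)))"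
    have "\<exists>c. root x (j, r) * prod_list (map (\<lambda>i. root x (i, r) ^ ?b i) [1..<r]) \<doteq>
        sca c * prod_list (map (\<lambda>i. root x (i, r) ^ (?b(j := Suc (?b j))) i) [1..<r])"
      using j assms(2)
      by (intro slot_insert[where S = "\<lambda>i k. root x (i, r) ^ k"]) (auto intro!: qcomm_power column_qcomm)
    moreover have "col_monom x r ?a' = prod_list (map (\<lambda>i. root x (i, r) ^ (?b(j := Suc (?b j))) i) [1..<r])"
      unfolding col_monom_def by (intro arg_cong[of _ _ prod_list] map_cong) auto
    ultimately obtain c where c: "root x (j, r) * y \<doteq> sca c * col_monom x r ?a'"
      unfolding a(1) col_monom_def[of x r a] by auto
    have "\<forall>p. ?a' p \<le> length (j # v)" using a(2) by (auto simp: le_SucI)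
    then have "col_monom x r ?a' \<in> {col_monom x r a |a. \<forall>p. a p \<le> length (j # v)}" by blast
    then show "root x (j, r) * y \<in> sp {col_monom x r a |a. \<forall>p. a p \<le> length (j # v)}"
      by (intro sp_eqv[OF c] sp_sca sp_base)
  qed
  then show ?case by simp
qed

text \<open>\<open>x i\<close> q-commutes with all root vectors of the column except the one
  starting at \<open>i + 1\<close>. There the definition of the bracket yields a passing term and a
  term in which \<open>x i\<close> is absorbed and the letter becomes the root vector starting at
  \<open>i\<close>. Either way the number of column letters is unchanged, which is what the length
  bound needs.\<close>

lemma column_move:
  assumes "set v \<subseteq> {1..<r}" "r \<le> n" "1 \<le> i" "Suc i < r"
  shows "prod_list (map (\<lambda>j. root x (j, r)) v) * x i \<in>
    sp ({x i * prod_list (map (\<lambda>j. root x (j, r)) v') |v'. set v' \<subseteq> {1..<r} \<and> length v' = length v} \<union>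
      {prod_list (map (\<lambda>j. root x (j, r)) v') |v'. set v' \<subseteq> {1..<r} \<and> length v' = length v})"
    (is "_ \<in> sp (?A v \<union> ?B v)")
  using assms(1)
proof (induction v rule: rev_induct)
  case Nil
  have "x i \<in> ?A []" by auto
  then show ?case using sp_base[of "x i" "?A [] \<union> ?B []"] by simp
next
  case (snoc j v)
  define w where "w v = prod_list (map (\<lambda>j. root x (j, r)) v)" for v
  have j: "j \<in> {1..<r}" and v: "set v \<subseteq> {1..<r}" using snoc.prems by auto
  have ws: "w (v @ [j]) = w v * root x (j, r)" for v by (simp add: w_def)
  have IH: "w v * x i \<in> sp (?A v \<union> ?B v)" using snoc.IH[OF v] by (simp add: w_def)
  have IHj: "w v * x i * root x (j, r) \<in> sp (?A (v @ [j]) \<union> ?B (v @ [j]))"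
  proof (rule sp_mult_right[OF _ IH])
    fix y assume "y \<in> ?A v \<union> ?B v"
    then consider v' where "y = x i * w v'" "set v' \<subseteq> {1..<r}" "length v' = length v"
      | v' where "y = w v'" "set v' \<subseteq> {1..<r}" "length v' = length v"
      unfolding w_def by blast
    then show "y * root x (j, r) \<in> sp (?A (v @ [j]) \<union> ?B (v @ [j]))"
    proof cases
      case 1
      then have "y * root x (j, r) = x i * prod_list (map (\<lambda>j. root x (j, r)) (v' @ [j]))"
        by (simp add: w_def mult.assoc)
      moreover have "set (v' @ [j]) \<subseteq> {1..<r}" "length (v' @ [j]) = length (v @ [j])" using 1 j by auto
      ultimately show ?thesis by (intro sp_base) blast
    next
      case 2
      then have "y * root x (j, r) = prod_list (map (\<lambda>j. root x (j, r)) (v' @ [j]))" by (simp add: w_def)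
      moreover have "set (v' @ [j]) \<subseteq> {1..<r}" "length (v' @ [j]) = length (v @ [j])" using 2 j by auto
      ultimately show ?thesis by (intro sp_base) blast
    qed
  qed
  consider "j = Suc i" | "j \<noteq> Suc i" by blast
  then show ?case
  proof cases
    case 1
    have "root x (i, r) = br (x i) (root x (j, r))"
    proof -
      have "r - i - 1 = Suc (r - Suc i - 1)" using assms(4) by simp
      then show ?thesis using 1 by (simp add: root_def)
    qed
    then have "P * (root x (j, r) * x i) = x i * root x (j, r) - root x (i, r)" by (simp add: br_def)
    then have "Q * (P * (root x (j, r) * x i)) = Q * (x i * root x (j, r) - root x (i, r))" by simp
    then have e: "root x (j, r) * x i = Q * (x i * root x (j, r)) - Q * root x (i, r)"
      by (simp add: QP[THEN mult_assoc_subst] right_diff_distrib)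
    have "w (v @ [j]) * x i = w v * (root x (j, r) * x i)" by (simp add: w_def mult.assoc)
    also have "\<dots> = Q * (w v * x i * root x (j, r)) - Q * w (v @ [i])"
      unfolding e by (simp add: w_def right_diff_distrib sca_left[of "prod_list _"] mult.assoc)
    also have "\<dots> \<in> sp (?A (v @ [j]) \<union> ?B (v @ [j]))"
    proof (intro sp_diff sp_sca IHj)
      have "set (v @ [i]) \<subseteq> {1..<r}" "length (v @ [i]) = length (v @ [j])" using v assms by auto
      then show "w (v @ [i]) \<in> sp (?A (v @ [j]) \<union> ?B (v @ [j]))"
        unfolding w_def by (intro sp_base) blast
    qed
    finally show ?thesis by (simp add: w_def)
  next
    case 2
    have "\<exists>c. root x (j, r) * x i \<doteq> sca c * (x i * root x (j, r))"
    proof -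
      have rj: "root x (j, r) = rt x (r - j - 1) j" by (simp add: root_def)
      consider "i = j" | "j < i" | "Suc i < j" using 2 by linarith
      then show ?thesis
      proof cases
        case 1
        obtain d where d: "r - j - 1 = Suc d" using 1 assms(4) by (metis Suc_diff_Suc diff_diff_left plus_1_eq_Suc add.commute)
        have "x j * rt x (Suc d) j \<doteq> Q * (rt x (Suc d) j * x j)"
          using d assms 1 by (intro rt_first[OF serre]) auto
        from qcomm_sym_nz[OF this q0] show ?thesis using rj d 1 by auto
      next
        case 2
        have "rt x (r - j - 1) j * x i \<doteq> x i * rt x (r - j - 1) j"
          using 2 assms j by (intro rt_middle[OF serre]) auto
        then show ?thesis using rj by (metis mult_1_left sca_one)
      next
        case 3
        have "rt x (r - j - 1) j * x i \<doteq> x i * rt x (r - j - 1) j"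
          using 3 assms j by (intro rt_far[OF serre]) auto
        then show ?thesis using rj by (metis mult_1_left sca_one)
      qed
    qed
    then obtain c where c: "root x (j, r) * x i \<doteq> sca c * (x i * root x (j, r))" ..
    have "w (v @ [j]) * x i = w v * (root x (j, r) * x i)" by (simp add: w_def mult.assoc)
    also have "\<dots> \<doteq> w v * (sca c * (x i * root x (j, r)))" using c by (rule eqv_left)
    also have "\<dots> = sca c * (w v * x i * root x (j, r))" by (simp add: sca_left[of "w v"] mult.assoc)
    finally have "w (v @ [j]) * x i \<in> sp (?A (v @ [j]) \<union> ?B (v @ [j]))"
      by (rule sp_eqv) (intro sp_sca IHj)
    then show ?thesis by (simp add: w_def)
  qed
qed

text \<open>The generator \<open>r - 1\<close> is itself a root vector of column \<open>r\<close>;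
  every smaller generator moves to the left of the column letters or is absorbed by one of them. No
  step increases the total length.\<close>

lemma word_split:
  assumes "set u \<subseteq> {1..<r}" "1 \<le> r" "r \<le> n"
  shows "prod_list (map x u) \<in> sp {prod_list (map x u') * prod_list (map (\<lambda>j. root x (j, r)) v) |u' v.
    set u' \<subseteq> {1..<r - 1} \<and> set v \<subseteq> {1..<r} \<and> length u' + length v \<le> length u}"
    (is "_ \<in> sp (?S (length u))")
  using assms(1)
proof (induction u rule: rev_induct)
  case Nil
  have "1 \<in> ?S 0" by force
  then show ?case by (simp add: sp_base)
next
  case (snoc i u)
  define w where "w v = prod_list (map (\<lambda>j. root x (j, r)) v)" for v
  have i: "i \<in> {1..<r}" and u: "set u \<subseteq> {1..<r}" using snoc.prems by auto
  have S: "prod_list (map x u') * w v \<in> ?S m" if "set u' \<subseteq> {1..<r - 1}" "set v \<subseteq> {1..<r}"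
    "length u' + length v \<le> m" for u' v m
    using that unfolding w_def by blast
  have "prod_list (map x u) * x i \<in> sp (?S (length (u @ [i])))"
  proof (rule sp_mult_right[OF _ snoc.IH[OF u]])
    fix y assume "y \<in> ?S (length u)"
    then obtain u' v where y: "y = prod_list (map x u') * w v" "set u' \<subseteq> {1..<r - 1}" "set v \<subseteq> {1..<r}"
      "length u' + length v \<le> length u" unfolding w_def by blast
    show "y * x i \<in> sp (?S (length (u @ [i])))"
    proof (cases "i = r - 1")
      case True
      then have "x i = root x (i, r)" using i by (simp add: root_def)
      then have "y * x i = prod_list (map x u') * w (v @ [i])" using y by (simp add: w_def mult.assoc)
      moreover have "\<dots> \<in> ?S (length (u @ [i]))" by (rule S) (use y i in auto)
      ultimately show ?thesis by (simp add: sp_base)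
    next
      case False
      then have i': "1 \<le> i" "Suc i < r" using i by auto
      have "prod_list (map x u') * (w v * x i) \<in> sp (?S (length (u @ [i])))"
      proof (rule sp_mult_left[OF _ column_move[OF y(3) assms(3) i', folded w_def]])
        fix z assume "z \<in> {x i * w v' |v'. set v' \<subseteq> {1..<r} \<and> length v' = length v} \<union>
          {w v' |v'. set v' \<subseteq> {1..<r} \<and> length v' = length v}"
        then consider v' where "z = x i * w v'" "set v' \<subseteq> {1..<r}" "length v' = length v"
          | v' where "z = w v'" "set v' \<subseteq> {1..<r}" "length v' = length v" by blast
        then show "prod_list (map x u') * z \<in> sp (?S (length (u @ [i])))"
        proof cases
          case 1
          then have "prod_list (map x u') * z = prod_list (map x (u' @ [i])) * w v'" by (simp add: mult.assoc)
          moreover have "\<dots> \<in> ?S (length (u @ [i]))" by (rule S) (use y i' 1 in auto)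
          ultimately show ?thesis by (simp add: sp_base)
        next
          case 2
          then have "prod_list (map x u') * z \<in> ?S (length (u @ [i]))" by (simp only: 2) (rule S; use y 2 in auto)
          then show ?thesis by (rule sp_base)
        qed
      qed
      then show ?thesis using y by (simp add: mult.assoc)
    qed
  qed
  then show ?case by simp
qed

lemma root_monom_span:
  assumes "set u \<subseteq> {1..<r}" "r \<le> n"
  shows "prod_list (map x u) \<in> sp {root_monom x r a |a. \<forall>p. a p \<le> length u}"
  using assms
proof (induction r arbitrary: u)
  case 0
  then have "prod_list (map x u) = root_monom x 0 (\<lambda>_. 0)" by (simp add: root_monom_def root_order_def)
  then show ?case by (auto intro!: sp_base)
next
  case (Suc r)
  show ?case
  proof (rule sp_subset[OF _ word_split[OF Suc.prems(1)]])
    show "{prod_list (map x u') * prod_list (map (\<lambda>j. root x (j, Suc r)) v) |u' v.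
        set u' \<subseteq> {1..<Suc r - 1} \<and> set v \<subseteq> {1..<Suc r} \<and> length u' + length v \<le> length u}
      \<subseteq> sp {root_monom x (Suc r) a |a. \<forall>p. a p \<le> length u}"
    proof
      fix y assume "y \<in> {prod_list (map x u') * prod_list (map (\<lambda>j. root x (j, Suc r)) v) |u' v.
        set u' \<subseteq> {1..<Suc r - 1} \<and> set v \<subseteq> {1..<Suc r} \<and> length u' + length v \<le> length u}"
      then obtain u' v where y: "y = prod_list (map x u') * prod_list (map (\<lambda>j. root x (j, Suc r)) v)"
        "set u' \<subseteq> {1..<r}" "set v \<subseteq> {1..<Suc r}" "length u' + length v \<le> length u" by auto
      show "y \<in> sp {root_monom x (Suc r) a |a. \<forall>p. a p \<le> length u}" unfolding y(1)
      proof (rule sp_mult)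
        show "prod_list (map x u') \<in> sp {root_monom x r a |a. \<forall>p. a p \<le> length u'}"
          using Suc y by auto
        show "prod_list (map (\<lambda>j. root x (j, Suc r)) v) \<in> sp {col_monom x (Suc r) a |a. \<forall>p. a p \<le> length v}"
          using y Suc.prems by (intro column_sort)
        fix z z' assume "z \<in> {root_monom x r a |a. \<forall>p. a p \<le> length u'}"
          "z' \<in> {col_monom x (Suc r) a |a. \<forall>p. a p \<le> length v}"
        then obtain a b where ab: "z = root_monom x r a" "\<forall>p. a p \<le> length u'"
          "z' = col_monom x (Suc r) b" "\<forall>p. b p \<le> length v" by blast
        \<comment> \<open>The two monomials involve disjoint sets of indices, so their exponents
          merge into one function.\<close>
        let ?c = "\<lambda>p. if snd p = Suc r then b p else a p"
        have "root_monom x r ?c = root_monom x r a"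
          unfolding root_monom_def by (intro arg_cong[of _ _ prod_list] map_cong) (auto simp: set_root_order)
        moreover have "col_monom x (Suc r) ?c = col_monom x (Suc r) b"
          unfolding col_monom_def by simp
        ultimately have "z * z' = root_monom x (Suc r) ?c" by (simp add: ab root_monom_Suc)
        moreover have "?c p \<le> length u" for p
          using spec[OF ab(2), of p] spec[OF ab(4), of p] y(4) by auto
        ultimately show "z * z' \<in> sp {root_monom x (Suc r) a |a. \<forall>p. a p \<le> length u}"
          by (intro sp_base) blast
      qed
    qed
  qed (use Suc.prems in auto)
qed

end

end

section \<open>Ordered monomials span\<close>

lemma list_of_image: "set u \<subseteq> g ` A \<Longrightarrow> \<exists>u'. u = map g u' \<and> set u' \<subseteq> A"
proof (induction u)
  case (Cons x u)
  then obtain a u' where "x = g a" "a \<in> A" "u = map g u'" "set u' \<subseteq> A" by auto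
  then show ?case by (intro exI[of _ "a # u'"]) simp
qed simp

locale qgroup_mod = rel_ideal sca q J
  for sca :: "'k::field \<Rightarrow> 'r::ring_1" and q :: 'k and J +
  fixes n :: nat and e f K L :: "nat \<Rightarrow> 'r"
  assumes KKm: "\<lbrakk>i \<in> {1..n}; j \<in> {1..n}\<rbrakk> \<Longrightarrow> K i * K j \<doteq> K j * K i"
    and KLm: "j \<in> {1..n} \<Longrightarrow> K j * L j \<doteq> 1" "j \<in> {1..n} \<Longrightarrow> L j * K j \<doteq> 1"
    and Kem: "\<lbrakk>i \<in> {1..<n}; j \<in> {1..n}\<rbrakk> \<Longrightarrow> K j * e i * L j \<doteq> sca (q powi qexp j i) * e i"
    and Kfm: "\<lbrakk>i \<in> {1..<n}; j \<in> {1..n}\<rbrakk> \<Longrightarrow> K j * f i * L j \<doteq> sca (q powi (- qexp j i)) * f i"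
    and efm: "\<lbrakk>i \<in> {1..<n}; j \<in> {1..<n}\<rbrakk> \<Longrightarrow> e i * f j - f j * e i \<doteq>
      (if i = j then sca (inverse (q - inverse q)) * (K i * L (i + 1) - L i * K (i + 1)) else 0)"
    and serre_e: "serre_mod n e" and serre_f: "serre_mod n f"
begin

lemma inv_commute_mod:
  assumes "x * y \<doteq> sca c * (y * x)" "x * x' \<doteq> 1" "x' * x \<doteq> 1" "c \<noteq> 0"
  shows "x' * y \<doteq> sca (inverse c) * (y * x')"
proof -
  have "y * x' = 1 * y * x'" by simp
  also have "\<dots> \<doteq> (x' * x) * y * x'" using eqv_sym[OF assms(3)] by (intro eqv_right)
  also have "\<dots> = x' * (x * y) * x'" by (simp add: mult.assoc)
  also have "\<dots> \<doteq> x' * (sca c * (y * x)) * x'" using assms(1) by (intro eqv_left eqv_right)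
  also have "\<dots> = sca c * (x' * y * (x * x'))" by (simp add: sca_left[of x'] mult.assoc)
  also have "\<dots> \<doteq> sca c * (x' * y * 1)" using assms(2) by (intro eqv_left)
  finally have "sca (inverse c) * (y * x') \<doteq> sca (inverse c) * (sca c * (x' * y))"
    by (intro eqv_left) simp
  also have "\<dots> = x' * y" using assms(4) by (simp add: sca_one flip: mult.assoc sca_mult)
  finally show ?thesis by (rule eqv_sym)
qed

lemma K_scale:
  assumes "K j * y * L j \<doteq> sca c * y" "j \<in> {1..n}"
  shows "K j * y \<doteq> sca c * (y * K j)"
proof -
  have "K j * y = K j * y * 1" by simp
  also have "\<dots> \<doteq> K j * y * (L j * K j)" using eqv_sym[OF KLm(2)[OF assms(2)]] by (rule eqv_left)
  also have "\<dots> = (K j * y * L j) * K j" by (simp add: mult.assoc)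
  also have "\<dots> \<doteq> sca c * y * K j" using assms(1) by (rule eqv_right)
  finally show ?thesis by (simp add: mult.assoc)
qed

primrec val :: "uq_gen \<Rightarrow> 'r"
  where
    "val (Gen_e i) = e i"
  | "val (Gen_f i) = f i"
  | "val (Gen_K i) = K i"
  | "val (Gen_Kinv i) = L i"

definition Es where "Es = Gen_e ` {1..<n}"
definition Fs where "Fs = Gen_f ` {1..<n}"
definition Ks where "Ks = Gen_K ` {1..n} \<union> Gen_Kinv ` {1..n}"

definition pv :: "uq_gen list \<Rightarrow> 'r" where "pv w = prod_list (map val w)"

lemma pv_simps [simp]: "pv [] = 1" "pv (g # w) = val g * pv w" "pv (u @ v) = pv u * pv v"
  by (simp_all add: pv_def)

lemma powi_nz: "q powi z \<noteq> 0" using q0 by simp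

lemma KL_qcomm:
  assumes "i \<in> {1..n}" "j \<in> {1..n}"
  shows "qcomm (K i) (K j)" "qcomm (K i) (L j)" "qcomm (L i) (K j)" "qcomm (L i) (L j)"
proof -
  have 1: "L i * K j \<doteq> sca (inverse 1) * (K j * L i)" if "i \<in> {1..n}" "j \<in> {1..n}" for i j
    using that by (intro inv_commute_mod[of "K i"] KLm) (simp_all add: sca_one KKm)
  have 2: "K i * L j \<doteq> sca (inverse (inverse 1)) * (L j * K i)"
    using 1[OF assms(2,1)] by (rule qcomm_sym_nz) simp
  have 3: "L i * L j \<doteq> sca (inverse (inverse (inverse 1))) * (L j * L i)"
    using inv_commute_mod[OF 2 KLm[OF assms(1)]] by simp
  show "qcomm (K i) (K j)" "qcomm (K i) (L j)" "qcomm (L i) (K j)" "qcomm (L i) (L j)"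
    using KKm[OF assms] 1[OF assms] 2 3 by (auto intro: qcommI qcomm_eqv)
qed

lemma EK_qcomm:
  assumes "g \<in> Es" "h \<in> Ks"
  shows "qcomm (val g) (val h)"
proof -
  obtain i where i: "g = Gen_e i" "i \<in> {1..<n}" using assms(1) by (auto simp: Es_def)
  obtain j where j: "h = Gen_K j \<or> h = Gen_Kinv j" "j \<in> {1..n}" using assms(2) by (auto simp: Ks_def)
  have 1: "K j * e i \<doteq> sca (q powi qexp j i) * (e i * K j)" using K_scale[OF Kem[OF i(2) j(2)] j(2)] .
  have 2: "L j * e i \<doteq> sca (inverse (q powi qexp j i)) * (e i * L j)"
    by (rule inv_commute_mod[OF 1 KLm[OF j(2)] powi_nz])
  show ?thesis using qcomm_sym_nz[OF 1 powi_nz] qcomm_sym_nz[OF 2] powi_nz i j by (auto intro: qcommI)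
qed

lemma KF_qcomm:
  assumes "g \<in> Fs" "h \<in> Ks"
  shows "qcomm (val h) (val g)"
proof -
  obtain i where i: "g = Gen_f i" "i \<in> {1..<n}" using assms(1) by (auto simp: Fs_def)
  obtain j where j: "h = Gen_K j \<or> h = Gen_Kinv j" "j \<in> {1..n}" using assms(2) by (auto simp: Ks_def)
  have 1: "K j * f i \<doteq> sca (q powi (- qexp j i)) * (f i * K j)" using K_scale[OF Kfm[OF i(2) j(2)] j(2)] .
  have 2: "L j * f i \<doteq> sca (inverse (q powi (- qexp j i))) * (f i * L j)"
    by (rule inv_commute_mod[OF 1 KLm[OF j(2)] powi_nz])
  show ?thesis using 1 2 i j by (auto intro: qcommI)
qed

lemma qcomm_pv_left: "(\<And>g. g \<in> set w \<Longrightarrow> qcomm (val g) z) \<Longrightarrow> qcomm (pv w) z"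
  unfolding pv_def by (rule qcomm_prod_list_left) auto

text \<open>A commutator replaces one \<open>e\<close> and the \<open>f\<close> by two torus
  letters, which move to the left of the remaining \<open>e\<close> letters at the cost of scalars.
  So no term is longer than the original word, whose length is
  \<open>Suc (length u)\<close>.\<close>

lemma e_word_f:
  assumes "set u \<subseteq> Es" "g \<in> Fs"
  shows "pv u * val g \<in> sp (insert (val g * pv u)
    {pv k * pv u' |k u'. set k \<subseteq> Ks \<and> set u' \<subseteq> Es \<and> length k + length u' \<le> Suc (length u)})"
    (is "_ \<in> sp (insert _ (?A (length u)))")
  using assms(1)
proof (induction u rule: rev_induct)
  case Nil
  show ?case by (rule sp_base) simp
next
  case (snoc h u)
  obtain j where j: "g = Gen_f j" "j \<in> {1..<n}" using assms(2) by (auto simp: Fs_def)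
  obtain i where i: "h = Gen_e i" "i \<in> {1..<n}" using snoc.prems by (auto simp: Es_def)
  have u: "set u \<subseteq> Es" and h: "h \<in> Es" using snoc.prems by auto
  have A: "pv k * pv u' \<in> ?A m" if "set k \<subseteq> Ks" "set u' \<subseteq> Es" "length k + length u' \<le> Suc m" for k u' m
    using that by blast
  let ?T = "insert (val g * pv (u @ [h])) (?A (length (u @ [h])))"
  have 1: "pv u * val g * val h \<in> sp ?T"
  proof (rule sp_mult_right[OF _ snoc.IH[OF u]])
    fix y assume "y \<in> insert (val g * pv u) (?A (length u))"
    then consider "y = val g * pv u" | k u' where "y = pv k * pv u'" "set k \<subseteq> Ks" "set u' \<subseteq> Es"
      "length k + length u' \<le> Suc (length u)" by blast
    then show "y * val h \<in> sp ?T"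
    proof cases
      case 1
      then have "y * val h = val g * pv (u @ [h])" by (simp add: mult.assoc)
      then show ?thesis by (intro sp_base) simp
    next
      case 2
      then have "y * val h = pv k * pv (u' @ [h])" by (simp add: mult.assoc)
      moreover have "pv k * pv (u' @ [h]) \<in> ?A (length (u @ [h]))" by (rule A) (use 2 h in auto)
      ultimately show ?thesis by (intro sp_base) simp
    qed
  qed
  have KL: "pv u * (val a * val b) \<in> sp ?T" if "a \<in> Ks" "b \<in> Ks" for a b
  proof -
    have "qcomm (pv u) (val a * val b)"
      using that u by (intro qcomm_mult_right qcomm_pv_left EK_qcomm) auto
    then obtain c where c: "pv u * (val a * val b) \<doteq> sca c * (val a * val b * pv u)" by (auto simp: qcomm_def)
    have "pv [a, b] * pv u \<in> ?A (length (u @ [h]))" by (rule A) (use that u in auto)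
    then have "val a * val b * pv u \<in> sp ?T" by (intro sp_base) simp
    then show ?thesis by (intro sp_eqv[OF c] sp_sca)
  qed
  have "e i * f j \<doteq> f j * e i + (if i = j then sca (inverse (q - inverse q)) * (K i * L (i + 1) - L i * K (i + 1)) else 0)"
    using efm[OF i(2) j(2)] unfolding eqv_def by (simp add: algebra_simps)
  then have c: "val h * val g \<doteq> val g * val h + (if i = j then sca (inverse (q - inverse q)) *
      (val (Gen_K i) * val (Gen_Kinv (i + 1)) - val (Gen_Kinv i) * val (Gen_K (i + 1))) else 0)"
    unfolding i(1) j(1) val.simps .
  have "pv (u @ [h]) * val g = pv u * (val h * val g)" by (simp add: mult.assoc)
  also have "\<dots> \<doteq> pv u * (val g * val h + (if i = j then sca (inverse (q - inverse q)) *
      (val (Gen_K i) * val (Gen_Kinv (i + 1)) - val (Gen_Kinv i) * val (Gen_K (i + 1))) else 0))"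
    using c by (rule eqv_left)
  also have "\<dots> = pv u * val g * val h + (if i = j then sca (inverse (q - inverse q)) *
      (pv u * (val (Gen_K i) * val (Gen_Kinv (i + 1))) - pv u * (val (Gen_Kinv i) * val (Gen_K (i + 1)))) else 0)"
    by (simp add: distrib_left right_diff_distrib sca_left[of "pv u"] mult.assoc)
  finally show ?case
  proof (rule sp_eqv)
    have Kmem: "Gen_K i \<in> Ks" "Gen_Kinv (i + 1) \<in> Ks" "Gen_Kinv i \<in> Ks" "Gen_K (i + 1) \<in> Ks"
      using i(2) by (auto simp: Ks_def)
    show "pv u * val g * val h + (if i = j then sca (inverse (q - inverse q)) *
      (pv u * (val (Gen_K i) * val (Gen_Kinv (i + 1))) - pv u * (val (Gen_Kinv i) * val (Gen_K (i + 1)))) else 0)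
      \<in> sp ?T"
    proof (cases "i = j")
      case True
      then show ?thesis
        unfolding if_P[OF True] by (intro sp_add 1 sp_sca sp_diff KL Kmem)
    next
      case False
      then show ?thesis using 1 by simp
    qed
  qed
qed

text \<open>Letters are appended on the right and moved into the order \<open>f\<close>, torus,
  \<open>e\<close>. Only an \<open>f\<close> passing \<open>e\<close> letters produces additional
  terms, and \<open>e_word_f\<close> controls their length.\<close>

lemma triangular:
  assumes "set w \<subseteq> Es \<union> Fs \<union> Ks"
  shows "pv w \<in> sp {pv v * pv k * pv u |v k u. set v \<subseteq> Fs \<and> set k \<subseteq> Ks \<and> set u \<subseteq> Es \<and>
    length v + length k + length u \<le> length w}"
    (is "_ \<in> sp (?T (length w))")
  using assms
proof (induction w rule: rev_induct)
  case Nil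
  have "pv [] * pv [] * pv [] \<in> ?T (length [])"
    by (intro CollectI exI conjI) auto
  then show ?case by (intro sp_base) simp
next
  case (snoc g w)
  have T: "pv v * pv k * pv u \<in> ?T m"
    if "set v \<subseteq> Fs" "set k \<subseteq> Ks" "set u \<subseteq> Es" "length v + length k + length u \<le> m" for v k u m
    using that by blast
  have w: "set w \<subseteq> Es \<union> Fs \<union> Ks" using snoc.prems by auto
  have "pv w * val g \<in> sp (?T (length (w @ [g])))"
  proof (rule sp_mult_right[OF _ snoc.IH[OF w]])
    fix y assume "y \<in> ?T (length w)"
    then obtain v k u where y: "y = pv v * pv k * pv u" "set v \<subseteq> Fs" "set k \<subseteq> Ks" "set u \<subseteq> Es"
      "length v + length k + length u \<le> length w" by blast
    consider "g \<in> Es" | "g \<in> Ks" | "g \<in> Fs" using snoc.prems by auto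
    then show "y * val g \<in> sp (?T (length (w @ [g])))"
    proof cases
      case 1
      then have "y * val g = pv v * pv k * pv (u @ [g])" by (simp add: y mult.assoc)
      moreover have "pv v * pv k * pv (u @ [g]) \<in> ?T (length (w @ [g]))" by (rule T) (use y 1 in auto)
      ultimately show ?thesis by (intro sp_base) simp
    next
      case 2
      have "qcomm (pv u) (val g)" using y 2 by (intro qcomm_pv_left EK_qcomm) auto
      then obtain c where c: "pv u * val g \<doteq> sca c * (val g * pv u)" by (auto simp: qcomm_def)
      have "y * val g = pv v * pv k * (pv u * val g)" by (simp add: y mult.assoc)
      also have "\<dots> \<doteq> pv v * pv k * (sca c * (val g * pv u))" using c by (rule eqv_left)
      also have "\<dots> = sca c * (pv v * pv (k @ [g]) * pv u)" by (simp add: sca_left[of "pv v"] sca_left[of "pv k"] mult.assoc)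
      finally have "y * val g \<doteq> sca c * (pv v * pv (k @ [g]) * pv u)" .
      moreover have "pv v * pv (k @ [g]) * pv u \<in> ?T (length (w @ [g]))" by (rule T) (use y 2 in auto)
      ultimately show ?thesis by (rule sp_eqv[OF _ sp_sca[OF sp_base]])
    next
      case 3
      have "pv v * pv k * (pv u * val g) \<in> sp (?T (length (w @ [g])))"
      proof (rule sp_mult_left[OF _ e_word_f[OF y(4) 3]])
        fix z assume "z \<in> insert (val g * pv u)
          {pv k * pv u' |k u'. set k \<subseteq> Ks \<and> set u' \<subseteq> Es \<and> length k + length u' \<le> Suc (length u)}"
        then consider "z = val g * pv u" | k' u' where "z = pv k' * pv u'" "set k' \<subseteq> Ks" "set u' \<subseteq> Es"
          "length k' + length u' \<le> Suc (length u)" by blast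
        then show "pv v * pv k * z \<in> sp (?T (length (w @ [g])))"
        proof cases
          case 1
          have "qcomm (pv k) (val g)" using y 3 by (intro qcomm_pv_left KF_qcomm) auto
          then obtain c where c: "pv k * val g \<doteq> sca c * (val g * pv k)" by (auto simp: qcomm_def)
          have "pv v * pv k * z = pv v * (pv k * val g) * pv u" by (simp add: 1 mult.assoc)
          also have "\<dots> \<doteq> pv v * (sca c * (val g * pv k)) * pv u" using c by (intro eqv_left eqv_right)
          also have "\<dots> = sca c * (pv (v @ [g]) * pv k * pv u)" by (simp add: sca_left[of "pv v"] mult.assoc)
          finally have "pv v * pv k * z \<doteq> sca c * (pv (v @ [g]) * pv k * pv u)" .
          moreover have "pv (v @ [g]) * pv k * pv u \<in> ?T (length (w @ [g]))" by (rule T) (use y 3 in auto)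
          ultimately show ?thesis by (rule sp_eqv[OF _ sp_sca[OF sp_base]])
        next
          case 2
          then have "pv v * pv k * z = pv v * pv (k @ k') * pv u'" by (simp add: mult.assoc)
          moreover have "pv v * pv (k @ k') * pv u' \<in> ?T (length (w @ [g]))" by (rule T) (use y 2 in auto)
          ultimately show ?thesis by (intro sp_base) simp
        qed
      qed
      then show ?thesis by (simp add: y mult.assoc)
    qed
  qed
  then show ?case by simp
qed

section \<open>PBW monomials\<close>

definition slot :: "nat \<times> nat \<Rightarrow> int \<Rightarrow> 'r"
  where "slot = (\<lambda>(i, j) z. if i < j then root e (i, j) ^ nat z
    else if j < i then root f (j, i) ^ nat z
    else if z \<ge> 0 then K i ^ nat z else L i ^ nat (- z))"

text \<open>The swap is there because \<open>slot\<close> places the \<open>f\<close> root vectors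
  below the diagonal, while \<open>root_order\<close> lists indices above it.\<close>

definition pbw_order :: "(nat \<times> nat) list"
  where "pbw_order = map prod.swap (root_order n) @ map (\<lambda>j. (j, j)) [1..<Suc n] @ root_order n"

definition pbw :: "(nat \<times> nat \<Rightarrow> int) \<Rightarrow> 'r"
  where "pbw a = prod_list (map (\<lambda>p. slot p (a p)) pbw_order)"

text \<open>Only the torus, on the diagonal, admits negative exponents. Entries outside the index
  square are normalized to zero later, in \<open>exps\<close>.\<close>

definition pbw_exps :: "nat \<Rightarrow> (nat \<times> nat \<Rightarrow> int) set"
  where "pbw_exps m = {a. \<forall>i j. \<bar>a (i, j)\<bar> \<le> int m \<and> (i \<noteq> j \<longrightarrow> a (i, j) \<ge> 0)}"

lemma set_pbw_order: "set pbw_order = {1..n} \<times> {1..n}"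
proof -
  have "(i, j) \<in> set pbw_order \<longleftrightarrow> i \<in> {1..n} \<and> j \<in> {1..n}" for i j
    unfolding pbw_order_def by (cases i j rule: linorder_cases) (auto simp: set_root_order image_iff)
  then show ?thesis by auto
qed

lemma distinct_pbw_order: "distinct pbw_order"
  unfolding pbw_order_def
  by (auto simp: distinct_map distinct_root_order inj_on_def set_root_order)

text \<open>Modulo \<open>J\<close> a torus letter raises or lowers one exponent by one, so the
  exponents are bounded by the word length.\<close>

lemma K_word_sort:
  assumes "set w \<subseteq> Ks"
  shows "pv w \<in> sp {prod_list (map (\<lambda>j. slot (j, j) (a j)) [1..<Suc n]) |a. \<forall>j. \<bar>a j\<bar> \<le> int (length w)}"
    (is "_ \<in> sp (?T (length w))")
  using assms
proof (induction w)
  case Nil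
  have "prod_list (map (\<lambda>j. slot (j, j) ((\<lambda>_. 0) j)) [1..<Suc n]) \<in> ?T (length [])"
    by (intro CollectI exI conjI refl) auto
  moreover have "prod_list (map (\<lambda>j. slot (j, j) ((\<lambda>_. 0) j)) [1..<Suc n]) = 1"
    by (simp add: slot_def map_replicate_const del: upt_Suc)
  ultimately show ?case by (intro sp_base) simp
next
  case (Cons g w)
  obtain j where j: "g = Gen_K j \<or> g = Gen_Kinv j" "j \<in> {1..n}" using Cons.prems by (auto simp: Ks_def)
  have "val g * pv w \<in> sp (?T (length (g # w)))"
  proof (rule sp_mult_left[OF _ Cons.IH])
    fix y assume "y \<in> ?T (length w)"
    then obtain a where a: "y = prod_list (map (\<lambda>j. slot (j, j) (a j)) [1..<Suc n])"
      "\<forall>j. \<bar>a j\<bar> \<le> int (length w)" by blast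
    have "\<exists>z. val g * slot (j, j) (a j) \<doteq> slot (j, j) z \<and> \<bar>z\<bar> \<le> \<bar>a j\<bar> + 1"
    proof -
      \<comment> \<open>A letter that meets a positive power of its inverse cancels one
        factor.\<close>
      have pw: "x * y ^ nat z \<doteq> y ^ nat (z - 1)" if "x * y \<doteq> 1" "z > 0" for x y :: 'r and z :: int
      proof -
        have "nat z = Suc (nat (z - 1))" using that(2) by simp
        then have "x * y ^ nat z = (x * y) * y ^ nat (z - 1)" by (simp add: mult.assoc)
        also have "\<dots> \<doteq> 1 * y ^ nat (z - 1)" using that(1) by (rule eqv_right)
        finally show ?thesis by simp
      qed
      have sc: "x * x ^ nat z = x ^ nat (z + 1)" if "z \<ge> 0" for x :: 'r and z :: int
        using that by (simp add: nat_add_distrib)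
      consider "g = Gen_K j" "a j \<ge> 0" | "g = Gen_K j" "a j < 0" | "g = Gen_Kinv j" "a j > 0"
        | "g = Gen_Kinv j" "a j \<le> 0" using j(1) by linarith
      then show ?thesis
      proof cases
        case 1
        then have "val g * slot (j, j) (a j) = slot (j, j) (a j + 1)" by (simp add: slot_def sc)
        then show ?thesis by (intro exI[of _ "a j + 1"]) auto
      next
        case 2
        have "K j * L j ^ nat (- a j) \<doteq> L j ^ nat (- a j - 1)" using 2 j by (intro pw KLm) auto
        moreover have "slot (j, j) (a j + 1) = L j ^ nat (- a j - 1)"
          using 2 by (cases "a j = -1") (auto simp: slot_def)
        ultimately show ?thesis using 2 by (intro exI[of _ "a j + 1"]) (auto simp: slot_def)
      next
        case 3
        have "L j * K j ^ nat (a j) \<doteq> K j ^ nat (a j - 1)" using 3 j by (intro pw KLm) auto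
        then show ?thesis using 3 by (intro exI[of _ "a j - 1"]) (auto simp: slot_def)
      next
        case 4
        then have "val g * slot (j, j) (a j) = slot (j, j) (a j - 1)"
          using sc[of "- a j" "L j"] by (cases "a j = 0") (auto simp: slot_def)
        then show ?thesis using 4 by (intro exI[of _ "a j - 1"]) auto
      qed
    qed
    then obtain z where z: "val g * slot (j, j) (a j) \<doteq> slot (j, j) z" "\<bar>z\<bar> \<le> \<bar>a j\<bar> + 1" by blast
    have "\<exists>c. val g * prod_list (map (\<lambda>j. slot (j, j) (a j)) [1..<Suc n]) \<doteq>
        sca c * prod_list (map (\<lambda>i. slot (i, i) ((a(j := z)) i)) [1..<Suc n])"
    proof (rule slot_insert[where S = "\<lambda>j. slot (j, j)" and p = j and a = a and z = z, OF _ _ _ z(1)])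
      fix p assume "p \<in> set [1..<Suc n]" "p \<noteq> j"
      then have p: "p \<in> {1..n}" by auto
      show "qcomm (val g) (slot (p, p) (a p))"
        unfolding slot_def using j KL_qcomm[OF j(2) p] by (auto intro!: qcomm_power)
    qed (use j in auto)
    then obtain c where c: "val g * y \<doteq> sca c * prod_list (map (\<lambda>i. slot (i, i) ((a(j := z)) i)) [1..<Suc n])"
      unfolding a(1) by blast
    have "\<forall>i. \<bar>(a(j := z)) i\<bar> \<le> int (length (g # w))"
    proof
      fix i show "\<bar>(a(j := z)) i\<bar> \<le> int (length (g # w))"
        using spec[OF a(2), of i] spec[OF a(2), of j] z(2) by auto
    qed
    then have "prod_list (map (\<lambda>i. slot (i, i) ((a(j := z)) i)) [1..<Suc n]) \<in> ?T (length (g # w))" by blast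
    then show "val g * y \<in> sp (?T (length (g # w)))" by (intro sp_eqv[OF c] sp_sca sp_base)
  qed (use Cons.prems in auto)
  then show ?case by simp
qed

lemma simple_words:
  assumes "set u \<subseteq> Es" "set v \<subseteq> Fs"
  shows "pv u \<in> sp {root_monom e n a |a. \<forall>p. a p \<le> length u}"
    "pv v \<in> sp {root_monom f n a |a. \<forall>p. a p \<le> length v}"
proof -
  obtain u' where u': "u = map Gen_e u'" "set u' \<subseteq> {1..<n}"
    using list_of_image[OF assms(1)[unfolded Es_def]] by blast
  obtain v' where v': "v = map Gen_f v'" "set v' \<subseteq> {1..<n}"
    using list_of_image[OF assms(2)[unfolded Fs_def]] by blast
  show "pv u \<in> sp {root_monom e n a |a. \<forall>p. a p \<le> length u}"
    using root_monom_span[OF serre_e u'(2) order.refl] by (simp add: u' pv_def comp_def)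
  show "pv v \<in> sp {root_monom f n a |a. \<forall>p. a p \<le> length v}"
    using root_monom_span[OF serre_f v'(2) order.refl] by (simp add: v' pv_def comp_def)
qed

text \<open>After the triangular decomposition each of the three blocks is sorted separately. No
  block is longer than the word, which bounds all exponents.\<close>

theorem pbw_span:
  assumes "set w \<subseteq> Es \<union> Fs \<union> Ks"
  shows "pv w \<in> sp (pbw ` pbw_exps (length w))"
proof (rule sp_subset[OF _ triangular[OF assms]], rule subsetI)
  fix y assume "y \<in> {pv v * pv k * pv u |v k u. set v \<subseteq> Fs \<and> set k \<subseteq> Ks \<and> set u \<subseteq> Es \<and>
    length v + length k + length u \<le> length w}"
  then obtain v k u where y: "y = pv v * pv k * pv u" "set v \<subseteq> Fs" "set k \<subseteq> Ks" "set u \<subseteq> Es"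
    "length v + length k + length u \<le> length w" by blast
  let ?A = "{root_monom f n a |a. \<forall>p. a p \<le> length v}"
  let ?B = "{prod_list (map (\<lambda>j. slot (j, j) (a j)) [1..<Suc n]) |a. \<forall>j. \<bar>a j\<bar> \<le> int (length k)}"
  let ?C = "{root_monom e n a |a. \<forall>p. a p \<le> length u}"
  have "pv v * pv k \<in> sp {x * x' |x x'. x \<in> ?A \<and> x' \<in> ?B}"
    by (rule sp_mult[OF _ simple_words(2)[OF y(4,2)] K_word_sort[OF y(3)]]) (rule sp_base, blast)
  then show "y \<in> sp (pbw ` pbw_exps (length w))"
    unfolding y(1)
  proof (rule sp_mult[OF _ _ simple_words(1)[OF y(4,2)], rotated])
    fix x x' assume "x \<in> {x * x' |x x'. x \<in> ?A \<and> x' \<in> ?B}" "x' \<in> ?C"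
    then obtain a b c where x: "x = root_monom f n a * prod_list (map (\<lambda>j. slot (j, j) (b j)) [1..<Suc n])"
      "x' = root_monom e n c"
      and bd: "\<forall>p. a p \<le> length v" "\<forall>j. \<bar>b j\<bar> \<le> int (length k)" "\<forall>p. c p \<le> length u" by blast
    define z where "z = (\<lambda>(i, j). if i < j then int (c (i, j)) else if j < i then int (a (j, i)) else b i)"
    have "z \<in> pbw_exps (length w)"
      unfolding pbw_exps_def
    proof (intro CollectI allI conjI impI)
      fix i j
      show "\<bar>z (i, j)\<bar> \<le> int (length w)"
        using spec[OF bd(1), of "(j, i)"] spec[OF bd(2), of i] spec[OF bd(3), of "(i, j)"] y(5)
        by (auto simp: z_def)
      show "z (i, j) \<ge> 0" if "i \<noteq> j" using that by (auto simp: z_def)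
    qed
    moreover have "x * x' = pbw z"
    proof -
      have "map (\<lambda>p. slot p (z p)) (map prod.swap (root_order n)) = map (\<lambda>p. root f p ^ a p) (root_order n)"
        unfolding map_map by (intro map_cong) (auto simp: set_root_order slot_def z_def)
      moreover have "map (\<lambda>p. slot p (z p)) (root_order n) = map (\<lambda>p. root e p ^ c p) (root_order n)"
        by (intro map_cong) (auto simp: set_root_order slot_def z_def)
      moreover have "map (\<lambda>p. slot p (z p)) (map (\<lambda>j. (j, j)) [1..<Suc n]) = map (\<lambda>j. slot (j, j) (b j)) [1..<Suc n]"
        unfolding map_map by (intro map_cong) (auto simp: z_def)
      ultimately show ?thesis
        unfolding pbw_def pbw_order_def x root_monom_def map_append prod_list.append by (simp only: mult.assoc)
    qed
    ultimately show "x * x' \<in> sp (pbw ` pbw_exps (length w))" by (intro sp_base) blast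
  qed
qed

end

section \<open>Evaluation of noncommutative polynomials\<close>

lemma poly_mapping_sum_single:
  "(p :: 'a \<Rightarrow>\<^sub>0 'b::comm_monoid_add) = (\<Sum>w\<in>Poly_Mapping.keys p. Poly_Mapping.single w (Poly_Mapping.lookup p w))"
proof (rule poly_mapping_eqI)
  fix k
  have "(\<Sum>w\<in>Poly_Mapping.keys p. Poly_Mapping.lookup (Poly_Mapping.single w (Poly_Mapping.lookup p w)) k)
      = (\<Sum>w\<in>Poly_Mapping.keys p. if w = k then Poly_Mapping.lookup p w else 0)"
    by (intro sum.cong) (auto simp: lookup_single when_def)
  also have "\<dots> = Poly_Mapping.lookup p k" by (auto simp: in_keys_iff)
  finally show "Poly_Mapping.lookup p k =
      Poly_Mapping.lookup (\<Sum>w\<in>Poly_Mapping.keys p. Poly_Mapping.single w (Poly_Mapping.lookup p w)) k"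
    by (simp add: lookup_sum)
qed

lemma poly_mapping_induct_single:
  assumes "P 0" "\<And>w c p. P p \<Longrightarrow> P (Poly_Mapping.single w c + p)"
  shows "P (p :: 'a \<Rightarrow>\<^sub>0 'b::comm_monoid_add)"
proof -
  have "P (\<Sum>w\<in>S. Poly_Mapping.single w (f w))" if "finite S" for S and f :: "'a \<Rightarrow> 'b"
    using that by (induction S rule: finite_induct) (auto intro: assms)
  from this[of "Poly_Mapping.keys p" "Poly_Mapping.lookup p"] show ?thesis
    using poly_mapping_sum_single[of p] by simp
qed

context central_field
begin

text \<open>The homomorphism given by the universal property of the free algebra.\<close>

definition ev :: "('g \<Rightarrow> 'r) \<Rightarrow> ('g free_monoid \<Rightarrow>\<^sub>0 'k) \<Rightarrow> 'r"
  where "ev v p = (\<Sum>w\<in>Poly_Mapping.keys p. sca (Poly_Mapping.lookup p w) * prod_list (map v (letters w)))"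

lemma ev_superset:
  assumes "finite S" "Poly_Mapping.keys p \<subseteq> S"
  shows "ev v p = (\<Sum>w\<in>S. sca (Poly_Mapping.lookup p w) * prod_list (map v (letters w)))"
  unfolding ev_def using assms
  by (intro sum.mono_neutral_left) (auto simp: in_keys_iff sca_zero)

lemma ev_add: "ev v (p + r) = ev v p + ev v r"
proof -
  let ?S = "Poly_Mapping.keys p \<union> Poly_Mapping.keys r"
  have "Poly_Mapping.keys (p + r) \<subseteq> ?S" by (rule Poly_Mapping.keys_add)
  then have "ev v (p + r) = (\<Sum>w\<in>?S. sca (Poly_Mapping.lookup (p + r) w) * prod_list (map v (letters w)))"
    by (intro ev_superset) auto
  also have "\<dots> = ev v p + ev v r"
    by (simp add: ev_superset[of ?S p] ev_superset[of ?S r] lookup_add sca_add distrib_right sum.distrib)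
  finally show ?thesis .
qed

lemma ev_zero [simp]: "ev v 0 = 0"
  by (simp add: ev_def)

lemma ev_uminus: "ev v (- p) = - ev v p"
  using ev_add[of v p "- p"] by (simp add: eq_neg_iff_add_eq_0 add.commute)

lemma ev_diff: "ev v (p - r) = ev v p - ev v r"
  using ev_add[of v p "- r"] by (simp add: ev_uminus)

lemma ev_single: "ev v (Poly_Mapping.single w c) = sca c * prod_list (map v (letters w))"
  by (cases "c = 0") (auto simp: ev_def sca_zero)

lemma ev_sum: "ev v (sum h S) = (\<Sum>s\<in>S. ev v (h s))"
  by (induction S rule: infinite_finite_induct) (auto simp: ev_add)

lemma ev_mult: "ev v (p * r) = ev v p * ev v r"
proof (induction p rule: poly_mapping_induct_single)
  case (2 w c p)
  have "ev v (Poly_Mapping.single w c * r) = ev v (Poly_Mapping.single w c) * ev v r"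
  proof (induction r rule: poly_mapping_induct_single)
    case (2 u d r)
    have "ev v (Poly_Mapping.single w c * Poly_Mapping.single u d) =
        ev v (Poly_Mapping.single w c) * ev v (Poly_Mapping.single u d)"
      by (simp add: mult_single ev_single plus_free_monoid_def sca_mult mult.assoc
          sca_left[of "prod_list (map v (letters w))"])
    then show ?case using 2 by (simp add: distrib_left ev_add)
  qed simp
  then show ?case using 2 by (simp add: distrib_right ev_add)
qed simp

lemma ev_const: "ev v (fa_const c) = sca c"
  by (simp add: fa_const_def ev_single zero_free_monoid_def)

lemma ev_var: "ev v (fa_var x) = v x"
  by (simp add: fa_var_def ev_single sca_one)

lemma ev_one: "ev v 1 = 1"
  using ev_const[of v 1] by (simp add: fa_const_def sca_one)

lemma ev_prod_list: "ev v (prod_list ps) = prod_list (map (ev v) ps)"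
  by (induction ps) (auto simp: ev_one ev_mult)

end

lemma fa_const_central: "central_field (fa_const :: 'k::field \<Rightarrow> 'g free_monoid \<Rightarrow>\<^sub>0 'k) q" if "q \<noteq> 0"
proof
  show "fa_const (c + d) = fa_const c + fa_const d" for c d :: 'k by (simp add: fa_const_def single_add)
  show "fa_const (c * d) = fa_const c * (fa_const d :: 'g free_monoid \<Rightarrow>\<^sub>0 'k)" for c d :: 'k
    by (simp add: fa_const_def mult_single)
  show "fa_const 1 = (1 :: 'g free_monoid \<Rightarrow>\<^sub>0 'k)" by (simp add: fa_const_def)
  show "x * fa_const c = fa_const c * x" for x :: "'g free_monoid \<Rightarrow>\<^sub>0 'k" and c
    by (induction x rule: poly_mapping_induct_single)
      (auto simp: fa_const_def mult_single distrib_left distrib_right mult.commute)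
  show "q \<noteq> 0" by fact
qed

lemma prod_list_fa_var: "prod_list (map fa_var xs) = Poly_Mapping.single (Free_Monoid xs) (1 :: 'k::field)"
proof (induction xs)
  case Nil
  then show ?case by (simp flip: zero_free_monoid_def)
next
  case (Cons x xs)
  then show ?case by (simp add: fa_var_def mult_single plus_free_monoid_def)
qed

lemma single_word: "Poly_Mapping.single w c = fa_const c * prod_list (map fa_var (letters w))"
  by (simp add: prod_list_fa_var fa_const_def mult_single)

text \<open>
  Setting the variables outside \<open>G\<close> to zero retracts the monoid ring onto \<open>free_algebra G\<close>. This
  turns the relator ideal into an ideal of the whole type, so that no carriers are needed when
  computing modulo the relations.
\<close>

locale presentation =
  fixes G :: "'g set" and S :: "('g free_monoid \<Rightarrow>\<^sub>0 'k::field) set" and q :: 'k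
  assumes S_closed: "S \<subseteq> carrier (free_algebra G)" and q_nz: "q \<noteq> 0"
begin

sublocale fa: central_field "fa_const :: 'k \<Rightarrow> 'g free_monoid \<Rightarrow>\<^sub>0 'k" q
  by (rule fa_const_central[OF q_nz])

abbreviation A :: "('g free_monoid \<Rightarrow>\<^sub>0 'k) ring" where "A \<equiv> free_algebra G"
abbreviation I where "I \<equiv> relator_ideal G S"
abbreviation U where "U \<equiv> presented_algebra G S"

lemma A_simps: "carrier A = free_algebra_set G" "x \<otimes>\<^bsub>A\<^esub> y = x * y" "x \<oplus>\<^bsub>A\<^esub> y = x + y"
  "\<zero>\<^bsub>A\<^esub> = 0" "\<one>\<^bsub>A\<^esub> = 1"
  by (simp_all add: free_algebra_def ring_of_type_algebra_def)

sublocale I: ideal I A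
  unfolding relator_ideal_def by (rule ring.genideal_ideal[OF ring_free_algebra S_closed])

definition \<rho> :: "('g free_monoid \<Rightarrow>\<^sub>0 'k) \<Rightarrow> ('g free_monoid \<Rightarrow>\<^sub>0 'k)"
  where "\<rho> = fa.ev (\<lambda>x. if x \<in> G then fa_var x else 0)"

lemma \<rho>_simps: "\<rho> (p + r) = \<rho> p + \<rho> r" "\<rho> (p - r) = \<rho> p - \<rho> r" "\<rho> (p * r) = \<rho> p * \<rho> r" "\<rho> 0 = 0" "\<rho> 1 = 1"
  "\<rho> (fa_const c) = fa_const c"
  unfolding \<rho>_def by (simp_all add: fa.ev_add fa.ev_diff fa.ev_mult fa.ev_one fa.ev_const)

lemma \<rho>_word: "\<rho> (Poly_Mapping.single w c) = (if set (letters w) \<subseteq> G then Poly_Mapping.single w c else 0)"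
proof -
  have "prod_list (map (\<lambda>x. if x \<in> G then fa_var x else 0) xs) =
      (if set xs \<subseteq> G then prod_list (map fa_var xs) else (0 :: 'g free_monoid \<Rightarrow>\<^sub>0 'k))" for xs
    by (induction xs) auto
  then show ?thesis unfolding \<rho>_def fa.ev_single by (simp add: single_word[of w c])
qed

lemma \<rho>_closed: "\<rho> p \<in> free_algebra_set G"
proof (induction p rule: poly_mapping_induct_single)
  case (2 w c p)
  have "Poly_Mapping.single w c \<in> free_algebra_set G" if "set (letters w) \<subseteq> G"
    using that by (auto simp: free_algebra_set_def)
  then show ?case using 2 by (auto simp: \<rho>_simps \<rho>_word fa_closed fa_plus_closed)
qed (simp add: \<rho>_simps fa_closed)

lemma \<rho>_id: "p \<in> free_algebra_set G \<Longrightarrow> \<rho> p = p"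
proof -
  assume p: "p \<in> free_algebra_set G"
  have "\<rho> p = \<rho> (\<Sum>w\<in>Poly_Mapping.keys p. Poly_Mapping.single w (Poly_Mapping.lookup p w))"
    using poly_mapping_sum_single[of p] by simp
  also have "\<dots> = (\<Sum>w\<in>Poly_Mapping.keys p. \<rho> (Poly_Mapping.single w (Poly_Mapping.lookup p w)))"
    unfolding \<rho>_def by (rule fa.ev_sum)
  also have "\<dots> = (\<Sum>w\<in>Poly_Mapping.keys p. Poly_Mapping.single w (Poly_Mapping.lookup p w))"
    using p by (intro sum.cong) (auto simp: \<rho>_word free_algebra_set_def)
  also have "\<dots> = p" using poly_mapping_sum_single[of p] by simp
  finally show ?thesis .
qed

text \<open>Besides the relator ideal it contains every word with a letter outside
  \<open>G\<close>.\<close>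

definition J :: "('g free_monoid \<Rightarrow>\<^sub>0 'k) set"
  where "J = {p. \<rho> p \<in> I}"

lemma J_ideal: "0 \<in> J" "a \<in> J \<Longrightarrow> b \<in> J \<Longrightarrow> a + b \<in> J" "a \<in> J \<Longrightarrow> x * a \<in> J" "a \<in> J \<Longrightarrow> a * x \<in> J"
  using additive_subgroup.zero_closed[OF I.is_additive_subgroup]
    additive_subgroup.a_closed[OF I.is_additive_subgroup, of "\<rho> a" "\<rho> b"] I.I_l_closed[of "\<rho> a" "\<rho> x"] I.I_r_closed[of "\<rho> a" "\<rho> x"] \<rho>_closed
  by (auto simp: J_def \<rho>_simps A_simps)

lemma S_in_J: "S \<subseteq> J"
proof
  fix s assume s: "s \<in> S"
  then have "s \<in> I" unfolding relator_ideal_def using ring.genideal_self[OF ring_free_algebra S_closed] by blast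
  moreover have "\<rho> s = s" using s S_closed by (intro \<rho>_id) (auto simp: A_simps)
  ultimately show "s \<in> J" by (simp add: J_def)
qed

lemma missing_letter: "\<not> set (letters w) \<subseteq> G \<Longrightarrow> Poly_Mapping.single w c \<in> J"
  using J_ideal(1) by (simp add: J_def \<rho>_word \<rho>_simps)

definition cls :: "('g free_monoid \<Rightarrow>\<^sub>0 'k) \<Rightarrow> ('g free_monoid \<Rightarrow>\<^sub>0 'k) set"
  where "cls p = I +>\<^bsub>A\<^esub> \<rho> p"

lemma U_ring: "ring U"
  unfolding presented_algebra_def by (rule I.quotient_is_ring)

lemma cls_hom: "cls (p + r) = cls p \<oplus>\<^bsub>U\<^esub> cls r" "cls (p * r) = cls p \<otimes>\<^bsub>U\<^esub> cls r" "cls 1 = \<one>\<^bsub>U\<^esub>"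
  "cls p \<in> carrier U"
proof -
  note h = I.rcos_ring_hom
  have c: "\<rho> p \<in> carrier A" for p by (simp add: A_simps \<rho>_closed)
  show "cls (p + r) = cls p \<oplus>\<^bsub>U\<^esub> cls r"
    using ring_hom_add[OF h c c] by (simp add: cls_def presented_algebra_def \<rho>_simps A_simps)
  show "cls (p * r) = cls p \<otimes>\<^bsub>U\<^esub> cls r"
    using ring_hom_mult[OF h c c] by (simp add: cls_def presented_algebra_def \<rho>_simps A_simps)
  show "cls 1 = \<one>\<^bsub>U\<^esub>"
    using ring_hom_one[OF h] by (simp add: cls_def presented_algebra_def \<rho>_simps A_simps)
  show "cls p \<in> carrier U"
    using ring_hom_closed[OF h c] by (simp add: cls_def presented_algebra_def)
qed

lemma cls_surj: "u \<in> carrier U \<Longrightarrow> \<exists>p. u = cls p"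
proof -
  assume "u \<in> carrier U"
  then obtain p where "p \<in> carrier A" "u = I +>\<^bsub>A\<^esub> p"
    by (auto simp: presented_algebra_def FactRing_def A_RCOSETS_def')
  then show ?thesis using \<rho>_id[of p] by (auto simp: cls_def A_simps intro!: exI[of _ p])
qed

lemma cls_zero_iff: "cls p = \<zero>\<^bsub>U\<^esub> \<longleftrightarrow> p \<in> J"
proof -
  have c: "\<rho> p \<in> carrier A" by (simp add: A_simps \<rho>_closed)
  have z: "\<zero>\<^bsub>U\<^esub> = I" by (simp add: presented_algebra_def FactRing_def)
  have "I +>\<^bsub>A\<^esub> \<rho> p = I \<longleftrightarrow> \<rho> p \<in> I"
    using I.a_rcos_const[of "\<rho> p"] I.a_rcos_self[OF c] by auto
  then show ?thesis by (simp add: cls_def z J_def)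
qed

lemma cls_minus: "\<ominus>\<^bsub>U\<^esub> cls p = cls (- p)"
proof -
  interpret ring U by (rule U_ring)
  have "cls (- p) \<oplus>\<^bsub>U\<^esub> cls p = \<zero>\<^bsub>U\<^esub>"
    unfolding cls_hom(1)[symmetric] cls_zero_iff by (simp add: J_ideal)
  then show ?thesis using minus_equality cls_hom(4) by blast
qed

lemma cls_diff: "cls (p - r) = cls p \<ominus>\<^bsub>U\<^esub> cls r"
  using cls_hom(1)[of p "- r"] by (simp add: a_minus_def cls_minus)

lemma cls_eq_iff: "cls p = cls r \<longleftrightarrow> p - r \<in> J"
proof -
  interpret ring U by (rule U_ring)
  show ?thesis
    unfolding cls_zero_iff[symmetric] cls_diff using cls_hom(4) by (metis r_right_minus_eq)
qed

lemma scalars_eq: "presented_scalars G S = range (\<lambda>c. cls (fa_const c))"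
  by (simp add: presented_scalars_def cls_def \<rho>_simps)

lemma cls_const_central: "cls (fa_const c) \<otimes>\<^bsub>U\<^esub> cls p = cls p \<otimes>\<^bsub>U\<^esub> cls (fa_const c)"
  by (simp only: cls_hom(2)[symmetric] fa.sca_comm)

text \<open>The quotient has to be nonzero for this; for the enveloping algebra that follows from
  the image of 1 in the torus.\<close>

lemma scalars_subfield:
  assumes "1 \<notin> J"
  shows "subfield (presented_scalars G S) U"
proof -
  interpret ring U by (rule U_ring)
  have ne: "\<one>\<^bsub>U\<^esub> \<noteq> \<zero>\<^bsub>U\<^esub>" using assms cls_zero_iff[of 1] by (simp add: cls_hom)
  have inv: "cls (fa_const c) \<otimes>\<^bsub>U\<^esub> cls (fa_const (inverse c)) = \<one>\<^bsub>U\<^esub>" if "c \<noteq> 0" for c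
    using that by (simp add: fa.sca_one flip: cls_hom fa.sca_mult)
  show ?thesis
  proof (rule subfieldI)
    show "subcring (presented_scalars G S) U"
    proof (rule subcringI[OF subringI])
      show "presented_scalars G S \<subseteq> carrier U" using cls_hom(4) by (auto simp: scalars_eq)
      show "\<one>\<^bsub>U\<^esub> \<in> presented_scalars G S"
        unfolding scalars_eq cls_hom(3)[symmetric] by (metis fa.sca_one rangeI)
      show "\<ominus>\<^bsub>U\<^esub> h \<in> presented_scalars G S" if "h \<in> presented_scalars G S" for h
        using that unfolding scalars_eq by (auto simp: cls_minus simp flip: fa.sca_uminus)
      show "h1 \<otimes>\<^bsub>U\<^esub> h2 \<in> presented_scalars G S"
        if "h1 \<in> presented_scalars G S" "h2 \<in> presented_scalars G S" for h1 h2
        using that unfolding scalars_eq by (auto simp flip: cls_hom fa.sca_mult)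
      show "h1 \<oplus>\<^bsub>U\<^esub> h2 \<in> presented_scalars G S"
        if "h1 \<in> presented_scalars G S" "h2 \<in> presented_scalars G S" for h1 h2
        using that unfolding scalars_eq by (auto simp flip: cls_hom fa.sca_add)
      show "h1 \<otimes>\<^bsub>U\<^esub> h2 = h2 \<otimes>\<^bsub>U\<^esub> h1"
        if "h1 \<in> presented_scalars G S" "h2 \<in> presented_scalars G S" for h1 h2
      proof -
        from that obtain c d where "h1 = cls (fa_const c)" "h2 = cls (fa_const d)" by (auto simp: scalars_eq)
        then show ?thesis using cls_const_central[of c "fa_const d"] by simp
      qed
    qed
    show "Units (U\<lparr>carrier := presented_scalars G S\<rparr>) = presented_scalars G S - {\<zero>\<^bsub>U\<^esub>}"
    proof (intro equalityI subsetI)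
      fix x assume "x \<in> Units (U\<lparr>carrier := presented_scalars G S\<rparr>)"
      then obtain y where x: "x \<in> presented_scalars G S" "y \<in> presented_scalars G S" "x \<otimes>\<^bsub>U\<^esub> y = \<one>\<^bsub>U\<^esub>"
        by (auto simp: Units_def)
      have "y \<in> carrier U" using x(2) cls_hom(4) by (auto simp: scalars_eq)
      then have "\<zero>\<^bsub>U\<^esub> \<otimes>\<^bsub>U\<^esub> y = \<zero>\<^bsub>U\<^esub>" by (rule l_null)
      then have "x \<noteq> \<zero>\<^bsub>U\<^esub>" using x(3) ne by metis
      then show "x \<in> presented_scalars G S - {\<zero>\<^bsub>U\<^esub>}" using x by simp
    next
      fix x assume x: "x \<in> presented_scalars G S - {\<zero>\<^bsub>U\<^esub>}"
      then obtain c where c: "x = cls (fa_const c)" by (auto simp: scalars_eq)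
      have "c \<noteq> 0"
      proof
        assume "c = 0"
        then have "x = \<zero>\<^bsub>U\<^esub>" unfolding c cls_zero_iff by (simp add: fa.sca_zero J_ideal)
        then show False using x by simp
      qed
      let ?y = "cls (fa_const (inverse c))"
      have y: "?y \<in> presented_scalars G S" by (simp add: scalars_eq)
      have "x \<otimes>\<^bsub>U\<^esub> ?y = \<one>\<^bsub>U\<^esub>" "?y \<otimes>\<^bsub>U\<^esub> x = \<one>\<^bsub>U\<^esub>"
        unfolding c using inv[OF \<open>c \<noteq> 0\<close>] cls_const_central[of "inverse c" "fa_const c"] by simp_all
      then show "x \<in> Units (U\<lparr>carrier := presented_scalars G S\<rparr>)"
        using x y unfolding Units_def by auto
    qed
  qed
qed

text \<open>The kernel of the evaluation on the carrier is an ideal containing the relators, hence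
  the relator ideal. Since \<open>v\<close> vanishes outside \<open>G\<close>, evaluation is
  invariant under \<open>\<rho>\<close>, which extends the conclusion to \<open>J\<close>.\<close>

lemma ev_vanishes:
  assumes "central_field sca q" and v: "\<And>x. x \<notin> G \<Longrightarrow> v x = 0"
    and S: "\<And>s. s \<in> S \<Longrightarrow> central_field.ev sca v s = (0 :: 'r :: ring_1)" and p: "p \<in> J"
  shows "central_field.ev sca v p = 0"
proof -
  interpret C: central_field sca q by fact
  have "C.ev v (\<rho> r) = C.ev v r" for r
  proof (induction r rule: poly_mapping_induct_single)
    case (2 w c r)
    have "prod_list (map v xs) = 0" if "\<not> set xs \<subseteq> G" for xs
      using that
    proof (induction xs)
      case (Cons x xs)
      then show ?case using v[of x] by (cases "x \<in> G") auto
    qed simp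
    then show ?case using 2 by (auto simp: \<rho>_simps \<rho>_word C.ev_add C.ev_single)
  qed (simp add: \<rho>_simps)
  moreover have "I \<subseteq> {r \<in> carrier A. C.ev v r = 0}"
    unfolding relator_ideal_def
  proof (rule ring.genideal_minimal[OF ring_free_algebra])
    show "ideal {r \<in> carrier A. C.ev v r = 0} A"
    proof (rule idealI[OF ring_free_algebra])
      show "subgroup {r \<in> carrier A. C.ev v r = 0} (add_monoid A)"
      proof (rule I.add.subgroupI)
        show "{r \<in> carrier A. C.ev v r = 0} \<noteq> {}" using fa_closed(2)[of G] by (auto simp: A_simps)
      next
        fix a assume a: "a \<in> {r \<in> carrier A. C.ev v r = 0}"
        have minus: "- a \<in> carrier A"
          using a fa_minus_closed[OF fa_closed(2), of a G] by (simp add: A_simps)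
        have "\<ominus>\<^bsub>A\<^esub> a = - a"
        proof (rule I.minus_equality)
          show "- a \<oplus>\<^bsub>A\<^esub> a = \<zero>\<^bsub>A\<^esub>" by (simp add: A_simps)
          show "a \<in> carrier A" "- a \<in> carrier A" using a minus by auto
        qed
        then show "\<ominus>\<^bsub>A\<^esub> a \<in> {r \<in> carrier A. C.ev v r = 0}"
          using a minus by (simp add: C.ev_uminus)
      qed (auto simp: A_simps C.ev_add fa_plus_closed)
    qed (auto simp: A_simps C.ev_mult fa_times_closed)
    show "S \<subseteq> {r \<in> carrier A. C.ev v r = 0}" using S_closed S by auto
  qed
  ultimately show ?thesis using p by (auto simp: J_def)
qed

end

section \<open>The quantized enveloping algebra\<close>

lemma (in central_field) rt_cong:
  assumes "\<And>m. m \<in> {i..i + d} \<Longrightarrow> x m = y m"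
  shows "rt x d i = rt y d i"
  using assms
proof (induction d arbitrary: i)
  case (Suc d)
  have "rt x d (Suc i) = rt y d (Suc i)" using Suc.prems by (intro Suc.IH) auto
  then show ?case using Suc.prems[of i] by simp
qed simp

lemma (in twisted_torus) leads_prod_list:
  "(\<And>p. p \<in> set ps \<Longrightarrow> leads (X' p) (g p)) \<Longrightarrow> leads (prod_list (map X' ps)) (sum_list (map g ps))"
  by (induction ps) (auto intro: leads_one leads_mult)

locale gl_algebra = gl_torus n q
  for n :: nat and q :: "'k::field" +
  assumes q_sum': "q + inverse q \<noteq> 0" and n_pos: "n \<ge> 1"
begin

sublocale presentation "uq_gens n" "uq_relators n q" q
  by unfold_locales (use uq_relators_closed q0' in auto)

section \<open>The relations modulo \<open>J\<close> and the homomorphism to the torus\<close>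

lemma rel_J: "rel_ideal fa_const q J"
  by unfold_locales (use J_ideal q_sum' in auto)

lemma relator_in_J: "r \<in> uq_relators n q \<Longrightarrow> r \<in> J"
  using S_in_J by blast

lemma weight_eq: "uq_weight = qexp"
  by (intro ext) (simp add: uq_weight_def qexp_def)

lemma serre_relators_mod:
  assumes "serre_relators n q x \<subseteq> J"
  shows "rel_ideal.serre_mod fa_const q J n x"
  unfolding rel_ideal.serre_mod_def[OF rel_J] rel_ideal.eqv_def[OF rel_J]
proof (intro ballI conjI impI)
  fix i j assume ij: "i \<in> {1..<n}" "j \<in> {1..<n}"
  show "x i * x j - x j * x i \<in> J" if "1 < \<bar>int i - int j\<bar>"
    using assms ij that unfolding serre_relators_def by blast
  assume "\<bar>int i - int j\<bar> = 1"
  then have "(x i)\<^sup>2 * x j - fa_const (q + inverse q) * x i * x j * x i + x j * (x i)\<^sup>2 \<in> J"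
    using assms ij unfolding serre_relators_def by blast
  moreover have "(x i)\<^sup>2 * x j - fa_const (q + inverse q) * x i * x j * x i + x j * (x i)\<^sup>2 =
      x i * (x i * x j) + x j * (x i * x i) - (fa_const q * (x i * (x j * x i)) + fa_const (inverse q) * (x i * (x j * x i)))"
    by (simp add: power2_eq_square fa.sca_add distrib_right mult.assoc algebra_simps)
  ultimately show "x i * (x i * x j) + x j * (x i * x i) -
      (fa_const q * (x i * (x j * x i)) + fa_const (inverse q) * (x i * (x j * x i))) \<in> J" by metis
qed

sublocale M: qgroup_mod fa_const q J n uq_e uq_f uq_K uq_Kinv
proof (intro qgroup_mod.intro qgroup_mod_axioms.intro rel_J, unfold rel_ideal.eqv_def[OF rel_J])
  fix i j
  show "uq_K i * uq_K j - uq_K j * uq_K i \<in> J" if "i \<in> {1..n}" "j \<in> {1..n}"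
    by (rule relator_in_J) (use that in \<open>unfold uq_relators_def uq_torus_relators_def, blast\<close>)
  show "uq_K j * uq_Kinv j - 1 \<in> J" if "j \<in> {1..n}"
    by (rule relator_in_J) (use that in \<open>unfold uq_relators_def uq_torus_relators_def, blast\<close>)
  show "uq_Kinv j * uq_K j - 1 \<in> J" if "j \<in> {1..n}"
    by (rule relator_in_J) (use that in \<open>unfold uq_relators_def uq_torus_relators_def, blast\<close>)
  show "uq_K j * uq_e i * uq_Kinv j - fa_const (q powi qexp j i) * uq_e i \<in> J"
    if "i \<in> {1..<n}" "j \<in> {1..n}"
    by (rule relator_in_J) (use that in \<open>unfold uq_relators_def uq_weight_relators_def weight_eq, blast\<close>)
  show "uq_K j * uq_f i * uq_Kinv j - fa_const (q powi - qexp j i) * uq_f i \<in> J"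
    if "i \<in> {1..<n}" "j \<in> {1..n}"
    by (rule relator_in_J) (use that in \<open>unfold uq_relators_def uq_weight_relators_def weight_eq, blast\<close>)
  show "uq_e i * uq_f j - uq_f j * uq_e i -
      (if i = j then fa_const (inverse (q - inverse q)) * (uq_K i * uq_Kinv (i + 1) - uq_Kinv i * uq_K (i + 1))
       else 0) \<in> J" if "i \<in> {1..<n}" "j \<in> {1..<n}"
    by (rule relator_in_J) (use that in \<open>unfold uq_relators_def uq_commutator_relators_def, blast\<close>)
  show "rel_ideal.serre_mod fa_const q J n uq_e" "rel_ideal.serre_mod fa_const q J n uq_f"
    by (rule serre_relators_mod; use S_in_J in \<open>unfold uq_relators_def, blast\<close>)+
qed

text \<open>Zero outside the generating set, as \<open>ev_vanishes\<close> requires.\<close>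

definition gen_img :: "uq_gen \<Rightarrow> (expo, 'k) linop"
  where "gen_img x = (if x \<in> uq_gens n then
    (case x of Gen_e i \<Rightarrow> te i | Gen_f i \<Rightarrow> tf i | Gen_K i \<Rightarrow> tK i | Gen_Kinv i \<Rightarrow> tL i) else 0)"

definition \<Phi> :: "'k uq_free \<Rightarrow> (expo, 'k) linop" where "\<Phi> = ev gen_img"

lemma \<Phi>_gen:
  "i \<in> {1..<n} \<Longrightarrow> \<Phi> (uq_e i) = te i" "i \<in> {1..<n} \<Longrightarrow> \<Phi> (uq_f i) = tf i"
  "i \<in> {1..n} \<Longrightarrow> \<Phi> (uq_K i) = tK i" "i \<in> {1..n} \<Longrightarrow> \<Phi> (uq_Kinv i) = tL i"
  by (auto simp: \<Phi>_def ev_var gen_img_def uq_gens_def)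

lemma \<Phi>_simps: "\<Phi> (p + r) = \<Phi> p + \<Phi> r" "\<Phi> (p - r) = \<Phi> p - \<Phi> r" "\<Phi> (p * r) = \<Phi> p * \<Phi> r"
  "\<Phi> 0 = 0" "\<Phi> 1 = 1" "\<Phi> (fa_const c) = sc c" "\<Phi> (sum h S) = (\<Sum>s\<in>S. \<Phi> (h s))"
  "\<Phi> (prod_list ps) = prod_list (map \<Phi> ps)" "\<Phi> (p ^ k) = \<Phi> p ^ k"
proof -
  show "\<Phi> (p + r) = \<Phi> p + \<Phi> r" "\<Phi> (p - r) = \<Phi> p - \<Phi> r" "\<Phi> (p * r) = \<Phi> p * \<Phi> r"
    "\<Phi> 0 = 0" "\<Phi> 1 = 1" "\<Phi> (fa_const c) = sc c" "\<Phi> (sum h S) = (\<Sum>s\<in>S. \<Phi> (h s))"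
    "\<Phi> (prod_list ps) = prod_list (map \<Phi> ps)"
    unfolding \<Phi>_def by (simp_all add: ev_add ev_diff ev_mult ev_one ev_const ev_sum ev_prod_list)
  show "\<Phi> (p ^ k) = \<Phi> p ^ k"
    by (induction k) (simp_all add: \<Phi>_def ev_mult ev_one)
qed

lemma \<Phi>_serre:
  assumes "serre n y" "\<And>i. i \<in> {1..<n} \<Longrightarrow> \<Phi> (x i) = y i" "r \<in> serre_relators n q x"
  shows "\<Phi> r = 0"
proof -
  from assms(3) consider i j where "r = x i * x j - x j * x i" "i \<in> {1..<n}" "j \<in> {1..<n}" "\<bar>int i - int j\<bar> > 1"
    | i j where "r = (x i)\<^sup>2 * x j - fa_const (q + inverse q) * x i * x j * x i + x j * (x i)\<^sup>2"
        "i \<in> {1..<n}" "j \<in> {1..<n}" "\<bar>int i - int j\<bar> = 1"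
    unfolding serre_relators_def by blast
  then show ?thesis
  proof cases
    case 1
    then have "y i * y j = y j * y i" using assms(1) unfolding serre_def by blast
    then show ?thesis using 1 by (simp add: \<Phi>_simps assms(2))
  next
    case 2
    have "y i * (y i * y j) + y j * (y i * y i) = sc q * (y i * (y j * y i)) + sc (inverse q) * (y i * (y j * y i))"
      using 2 assms(1) unfolding serre_def by blast
    moreover have "\<Phi> r = y i * y i * y j - sc (q + inverse q) * y i * y j * y i + y j * (y i * y i)"
      unfolding 2(1) by (simp only: \<Phi>_simps power2_eq_square assms(2)[OF 2(2)] assms(2)[OF 2(3)])
    then have "\<Phi> r = y i * (y i * y j) + y j * (y i * y i) -
        (sc q * (y i * (y j * y i)) + sc (inverse q) * (y i * (y j * y i)))"
      by (simp add: sc_simps distrib_right mult.assoc algebra_simps)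
    ultimately show ?thesis by (simp only: diff_self)
  qed
qed

lemma \<Phi>_relators:
  assumes "r \<in> uq_relators n q"
  shows "\<Phi> r = 0"
proof -
  interpret T: qrep sc q n "\<lambda>i. 1" "\<lambda>i. 1" te tf tK tL by (rule qrep_total)
  \<comment> \<open>The weight relators are in conjugated form, the representation has the relations
    as q-commutations.\<close>
  have KeL: "tK j * y * tL j = sc c * y" if "tK j * y = sc c * (y * tK j)" "j \<in> {1..n}" for j y c
    using that T.KL(1)[OF that(2)] by (simp add: mult.assoc)
  consider "r \<in> uq_torus_relators n" | "r \<in> uq_weight_relators n q" | "r \<in> uq_commutator_relators n q"
    | "r \<in> serre_relators n q uq_e" | "r \<in> serre_relators n q uq_f"
    using assms unfolding uq_relators_def by blast
  then show ?thesis
  proof cases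
    case 1
    then consider i j where "r = uq_K i * uq_K j - uq_K j * uq_K i" "i \<in> {1..n}" "j \<in> {1..n}"
      | j where "r = uq_K j * uq_Kinv j - 1" "j \<in> {1..n}" | j where "r = uq_Kinv j * uq_K j - 1" "j \<in> {1..n}"
      unfolding uq_torus_relators_def by blast
    then show ?thesis
    proof cases
      case 1
      then show ?thesis using T.KK[of i j] by (simp only: \<Phi>_simps \<Phi>_gen) simp
    next
      case 2
      then show ?thesis using T.KL[of j] by (simp only: \<Phi>_simps \<Phi>_gen) simp
    next
      case 3
      then show ?thesis using T.KL[of j] by (simp only: \<Phi>_simps \<Phi>_gen) simp
    qed
  next
    case 2
    then consider i j where "r = uq_K j * uq_e i * uq_Kinv j - fa_const (q powi uq_weight j i) * uq_e i"
        "i \<in> {1..<n}" "j \<in> {1..n}"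
      | i j where "r = uq_K j * uq_f i * uq_Kinv j - fa_const (q powi - uq_weight j i) * uq_f i"
        "i \<in> {1..<n}" "j \<in> {1..n}"
      unfolding uq_weight_relators_def by blast
    then show ?thesis
    proof cases
      case 1
      then show ?thesis using KeL[OF T.Ke[OF 1(2,3)] 1(3)] by (simp only: \<Phi>_simps \<Phi>_gen weight_eq) simp
    next
      case 2
      then show ?thesis using KeL[OF T.Kf[OF 2(2,3)] 2(3)] by (simp only: \<Phi>_simps \<Phi>_gen weight_eq) simp
    qed
  next
    case 3
    then obtain i j where r: "r = uq_e i * uq_f j - uq_f j * uq_e i -
       (if i = j then fa_const (inverse (q - inverse q)) * (uq_K i * uq_Kinv (i + 1) - uq_Kinv i * uq_K (i + 1))
        else 0)" and ij: "i \<in> {1..<n}" "j \<in> {1..<n}"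
      unfolding uq_commutator_relators_def by blast
    have i': "i \<in> {1..n}" "i + 1 \<in> {1..n}" using ij by auto
    have t: "te i * tf j - tf j * te i =
        (if i = j then sc (inverse (q - inverse q)) * (tK i * tL (i + 1) - tL i * tK (i + 1)) else 0)"
      using T.ef[OF ij] unfolding sca_one mult_1_left .
    show ?thesis
    proof (cases "i = j")
      case True
      then have ji: "j = i" by simp
      show ?thesis
        using t unfolding r ji
        by (simp only: \<Phi>_simps \<Phi>_gen(1,2)[OF ij(1)] \<Phi>_gen(3,4)[OF i'(1)] \<Phi>_gen(3,4)[OF i'(2)] refl if_True diff_self)
    next
      case False
      then show ?thesis
        using t unfolding r if_not_P[OF False] by (simp only: \<Phi>_simps \<Phi>_gen(1,2)[OF ij(1)] \<Phi>_gen(1,2)[OF ij(2)]) simp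
    qed
  next
    case 4
    show ?thesis by (rule \<Phi>_serre[OF T.serre_e _ 4]) (simp add: \<Phi>_gen)
  next
    case 5
    show ?thesis by (rule \<Phi>_serre[OF T.serre_f _ 5]) (simp add: \<Phi>_gen)
  qed
qed

lemma \<Phi>_J: "p \<in> J \<Longrightarrow> \<Phi> p = 0"
  unfolding \<Phi>_def
  by (rule ev_vanishes[OF central_field_axioms])
    (use \<Phi>_relators in \<open>auto simp: gen_img_def \<Phi>_def\<close>)

lemma \<Phi>_root:
  assumes "1 \<le> i" "i < j" "j \<le> n"
  shows "leads (\<Phi> (M.root uq_e (i, j))) (gen_exp (i, j))" "leads (\<Phi> (M.root uq_f (i, j))) (gen_exp (j, i))"
proof -
  have \<Phi>rt: "\<Phi> (fa.rt x d i) = rt (\<lambda>m. \<Phi> (x m)) d i" for x d i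
    by (induction d arbitrary: i) (simp_all add: fa.br_def br_def \<Phi>_simps)
  have r: "i + (j - i - 1) < n" using assms by simp
  have "rt (\<lambda>m. \<Phi> (uq_e m)) (j - i - 1) i = rt te (j - i - 1) i"
    "rt (\<lambda>m. \<Phi> (uq_f m)) (j - i - 1) i = rt tf (j - i - 1) i"
    by (intro rt_cong \<Phi>_gen; use assms r in auto)+
  then show "leads (\<Phi> (M.root uq_e (i, j))) (gen_exp (i, j))" "leads (\<Phi> (M.root uq_f (i, j))) (gen_exp (j, i))"
    using leads_te[OF assms(1) r] leads_tf[OF assms(1) r] assms
    by (simp_all add: M.root_def \<Phi>rt gen_exp_def)
qed

lemma leads_power: "leads Y g \<Longrightarrow> leads (Y ^ k) (frag_cmul (int k) g)"
proof (induction k)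
  case 0
  then show ?case using leads_one by simp
next
  case (Suc k)
  have "frag_cmul (int (Suc k)) g = g + frag_cmul (int k) g"
    by (rule poly_mapping_eqI) (simp add: lookup_add distrib_right)
  then show ?case using leads_mult[OF Suc.prems Suc.IH[OF Suc.prems]] by simp
qed

lemma leads_slot:
  assumes "p \<in> {1..n} \<times> {1..n}" "fst p \<noteq> snd p \<Longrightarrow> z \<ge> 0"
  shows "leads (\<Phi> (M.slot p z)) (frag_cmul z (gen_exp p))"
proof -
  obtain i j where p: "p = (i, j)" by (cases p)
  have ij: "i \<in> {1..n}" "j \<in> {1..n}" using assms p by auto
  consider "i < j" | "j < i" | "i = j" "z \<ge> 0" | "i = j" "z < 0" by linarith
  then show ?thesis
  proof cases
    case 1
    then show ?thesis using leads_power[OF \<Phi>_root(1)[of i j], of "nat z"] ij assms p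
      by (simp add: M.slot_def \<Phi>_simps)
  next
    case 2
    then show ?thesis using leads_power[OF \<Phi>_root(2)[of j i], of "nat z"] ij assms p
      by (simp add: M.slot_def \<Phi>_simps)
  next
    case 3
    then show ?thesis using leads_power[OF leads_tK(1)[of i], of "nat z"] ij p
      by (simp add: M.slot_def \<Phi>_simps \<Phi>_gen gen_exp_def)
  next
    case 4
    have "frag_cmul (- z) (- gK i) = frag_cmul z (gK i)" by (rule poly_mapping_eqI) simp
    then show ?thesis using 4 leads_power[OF leads_tK(2)[of i], of "nat (- z)"] ij p
      by (simp add: M.slot_def \<Phi>_simps \<Phi>_gen gen_exp_def)
  qed
qed

abbreviation idx where "idx \<equiv> {1..n} \<times> {1..n}"

lemma leads_pbw:
  assumes "a \<in> M.pbw_exps m"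
  shows "leads (\<Phi> (M.pbw a)) (lincomb a)"
proof -
  have "leads (prod_list (map (\<lambda>p. \<Phi> (M.slot p (a p))) M.pbw_order))
      (sum_list (map (\<lambda>p. frag_cmul (a p) (gen_exp p)) M.pbw_order))"
    using assms M.set_pbw_order
    by (intro leads_prod_list leads_slot) (auto simp: M.pbw_exps_def)
  moreover have "sum_list (map (\<lambda>p. frag_cmul (a p) (gen_exp p)) M.pbw_order) = lincomb a"
    unfolding lincomb_def M.set_pbw_order[symmetric]
    by (rule sum_list_distinct_conv_sum_set[OF M.distinct_pbw_order])
  ultimately show ?thesis by (simp add: M.pbw_def \<Phi>_simps comp_def)
qed

definition exps :: "nat \<Rightarrow> (nat \<times> nat \<Rightarrow> int) set"
  where "exps m = {a \<in> M.pbw_exps m. \<forall>p. p \<notin> idx \<longrightarrow> a p = 0}"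

text \<open>The ordered product visits only indices in \<open>idx\<close>, so the other exponents
  may be reset to zero. Exponent functions thus normalized are determined by
  \<open>lincomb\<close>.\<close>

lemma pbw_exps_image: "M.pbw ` M.pbw_exps m \<subseteq> M.pbw ` exps m"
proof
  fix y assume "y \<in> M.pbw ` M.pbw_exps m"
  then obtain a where a: "a \<in> M.pbw_exps m" "y = M.pbw a" by auto
  let ?b = "\<lambda>p. if p \<in> idx then a p else 0"
  have b: "?b \<in> exps m" using a(1) by (auto simp: exps_def M.pbw_exps_def)
  have e: "M.pbw ?b = M.pbw a"
    unfolding M.pbw_def by (intro arg_cong[of _ _ prod_list] map_cong) (auto simp: M.set_pbw_order)
  show "y \<in> M.pbw ` exps m" unfolding a(2) e[symmetric] using b by (rule imageI)
qed

text \<open>Collecting repeated monomials gives a combination indexed by a set of exponent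
  functions, so that no leading exponent is counted twice.\<close>

lemma span_combination:
  assumes "p \<in> M.sp (M.pbw ` E)"
  shows "\<exists>B c. finite B \<and> B \<subseteq> E \<and> p - (\<Sum>a\<in>B. fa_const (c a) * M.pbw a) \<in> J"
  using assms
proof (induction rule: M.sp.induct)
  case (sp_J a)
  then have "finite {} \<and> {} \<subseteq> E \<and> a - (\<Sum>a\<in>{}. fa_const (0 :: 'k) * M.pbw a) \<in> J" by simp
  then show ?case by fast
next
  case (sp_term x p d)
  then obtain b where b: "b \<in> E" "x = M.pbw b" by auto
  obtain B c where B: "finite B" "B \<subseteq> E" "p - (\<Sum>a\<in>B. fa_const (c a) * M.pbw a) \<in> J" using sp_term by blast
  let ?c = "\<lambda>a. (if a \<in> B then c a else 0) + (if a = b then d else 0)"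
  have "(\<Sum>a\<in>insert b B. fa_const (?c a) * M.pbw a) =
      (\<Sum>a\<in>insert b B. fa_const (if a \<in> B then c a else 0) * M.pbw a) +
      (\<Sum>a\<in>insert b B. fa_const (if a = b then d else 0) * M.pbw a)"
    by (simp only: fa.sca_add distrib_right sum.distrib)
  also have "(\<Sum>a\<in>insert b B. fa_const (if a \<in> B then c a else 0) * M.pbw a) = (\<Sum>a\<in>B. fa_const (c a) * M.pbw a)"
    using B(1) by (intro sum.mono_neutral_cong_right) (auto simp: fa.sca_zero)
  also have "(\<Sum>a\<in>insert b B. fa_const (if a = b then d else 0) * M.pbw a) = (\<Sum>a\<in>{b}. fa_const d * M.pbw a)"
    using B(1) by (intro sum.mono_neutral_cong_right) (auto simp: fa.sca_zero)
  finally have "fa_const d * x + p - (\<Sum>a\<in>insert b B. fa_const (?c a) * M.pbw a) =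
      p - (\<Sum>a\<in>B. fa_const (c a) * M.pbw a)"
    unfolding b(2) by (simp only: diff_diff_eq[symmetric] add.commute[of _ p] add_diff_cancel_left) (simp add: algebra_simps)
  then have "finite (insert b B) \<and> insert b B \<subseteq> E \<and>
      fa_const d * x + p - (\<Sum>a\<in>insert b B. fa_const (?c a) * M.pbw a) \<in> J"
    using B b(1) by (simp only:) simp
  then show ?case by (intro exI)
qed

lemma word_span:
  assumes "length (letters w) \<le> m"
  shows "Poly_Mapping.single w c \<in> M.sp (M.pbw ` exps m)"
proof (cases "set (letters w) \<subseteq> uq_gens n")
  case False
  then show ?thesis by (intro M.sp_J missing_letter)
next
  case True
  have "M.val = fa_var"
  proof
    fix x show "M.val x = fa_var x" by (cases x) simp_all
  qed
  then have "Poly_Mapping.single w c = fa_const c * M.pv (letters w)"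
    by (simp add: M.pv_def single_word[of w c])
  moreover have "M.pv (letters w) \<in> M.sp (M.pbw ` M.pbw_exps (length (letters w)))"
    using True by (intro M.pbw_span) (simp add: uq_gens_def M.Es_def M.Fs_def M.Ks_def Un_ac)
  moreover have "M.pbw_exps (length (letters w)) \<subseteq> M.pbw_exps m"
    unfolding M.pbw_exps_def
  proof (rule subsetI, unfold mem_Collect_eq)
    fix a assume a: "\<forall>i j. \<bar>a (i, j)\<bar> \<le> int (length (letters w)) \<and> (i \<noteq> j \<longrightarrow> 0 \<le> a (i, j))"
    have "\<bar>a (i, j)\<bar> \<le> int m" for i j
      using spec[OF spec[OF a, of i], of j] of_nat_mono[OF assms, where 'a = int] by (elim conjE) (rule order_trans)
    then show "\<forall>i j. \<bar>a (i, j)\<bar> \<le> int m \<and> (i \<noteq> j \<longrightarrow> 0 \<le> a (i, j))" using a by blast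
  qed
  then have "M.pbw ` M.pbw_exps (length (letters w)) \<subseteq> M.pbw ` exps m"
    using pbw_exps_image[of m] by blast
  ultimately show ?thesis by (simp only:) (intro M.sp_sca, rule M.sp_mono)
qed

section \<open>Leading exponents of classes and the valuation\<close>

definition bounded :: "nat \<Rightarrow> 'k uq_free set"
  where "bounded m = {p. \<forall>w\<in>Poly_Mapping.keys p. length (letters w) \<le> m}"

lemma bounded_span:
  assumes "p \<in> bounded m"
  shows "p \<in> M.sp (M.pbw ` exps m)"
proof -
  have "(\<Sum>w\<in>S. Poly_Mapping.single w (h w)) \<in> M.sp (M.pbw ` exps m)"
    if "finite S" "\<forall>w\<in>S. length (letters w) \<le> m" for S h
    using that by (induction S rule: finite_induct) (auto intro: M.sp_zero M.sp_add word_span)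
  from this[of "Poly_Mapping.keys p" "Poly_Mapping.lookup p"] show ?thesis
    using assms by (simp add: bounded_def flip: poly_mapping_sum_single)
qed

lemma lincomb_inj_exps: "inj_on lincomb {a. \<forall>p. p \<notin> idx \<longrightarrow> a p = 0}"
proof (rule inj_onI, rule ext)
  fix a b p assume ab: "a \<in> {a. \<forall>p. p \<notin> idx \<longrightarrow> a p = 0}" "b \<in> {a. \<forall>p. p \<notin> idx \<longrightarrow> a p = 0}" "lincomb a = lincomb b"
  show "a p = b p"
  proof (cases "p \<in> idx")
    case True
    then show ?thesis by (rule lincomb_inj[OF ab(3)])
  next
    case False
    then show ?thesis using ab(1,2) unfolding mem_Collect_eq by metis
  qed
qed

text \<open>The monomials of a combination have pairwise different leading exponents, so the largest
  one with nonzero coefficient cannot cancel. This gives at once the injectivity of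
  \<open>\<Phi>\<close> modulo \<open>J\<close> and, because the exponents are at most
  \<open>m\<close>, the box bound for the filtration.\<close>

lemma leads_bounded:
  assumes "p \<in> bounded m" "p \<notin> J"
  shows "\<exists>a\<in>exps m. leads (\<Phi> p) (lincomb a)"
proof -
  obtain B c where B: "finite B" "B \<subseteq> exps m" "p - (\<Sum>a\<in>B. fa_const (c a) * M.pbw a) \<in> J"
    using span_combination[OF bounded_span[OF assms(1)]] by blast
  have \<Phi>p: "\<Phi> p = (\<Sum>a\<in>B. sc (c a) * \<Phi> (M.pbw a))"
    using \<Phi>_J[OF B(3)] by (simp add: \<Phi>_simps)
  define B' where "B' = {a \<in> B. c a \<noteq> 0}"
  have fB': "finite B'" "B' \<subseteq> exps m" using B by (auto simp: B'_def)
  have sumB': "(\<Sum>a\<in>B. sc (c a) * \<Phi> (M.pbw a)) = (\<Sum>a\<in>B'. sc (c a) * \<Phi> (M.pbw a))"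
    unfolding B'_def using B(1) by (intro sum.mono_neutral_right) (auto simp: sca_zero)
  have "B' \<noteq> {}"
  proof
    assume "B' = {}"
    then have "c a = 0" if "a \<in> B" for a using that by (auto simp: B'_def)
    then have "(\<Sum>a\<in>B. fa_const (c a) * M.pbw a) = 0" by (intro sum.neutral) (simp add: fa.sca_zero)
    then show False using B(3) assms(2) by simp
  qed
  then have "Max (lincomb ` B') \<in> lincomb ` B'" using fB' by simp
  then obtain b where b: "b \<in> B'" "lincomb b = Max (lincomb ` B')" by (metis imageE)
  have lead: "leads (\<Phi> (M.pbw a)) (lincomb a)" if "a \<in> B'" for a
    using that fB'(2) leads_pbw by (auto simp: exps_def)
  have less: "lincomb a < lincomb b" if "a \<in> B' - {b}" for a
  proof -
    have "lincomb a \<le> lincomb b" unfolding b(2) using that fB' by simp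
    moreover have "lincomb a \<noteq> lincomb b"
      using that b(1) fB'(2) inj_onD[OF lincomb_inj_exps, of a b] by (auto simp: exps_def)
    ultimately show ?thesis by simp
  qed
  have "leads (sc (c b) * \<Phi> (M.pbw b) + (\<Sum>a\<in>B' - {b}. sc (c a) * \<Phi> (M.pbw a))) (lincomb b)"
  proof (rule leads_add_below)
    show "leads (sc (c b) * \<Phi> (M.pbw b)) (lincomb b)"
      using b(1) lead by (intro leads_sc_mult) (auto simp: B'_def)
    show "below (\<Sum>a\<in>B' - {b}. sc (c a) * \<Phi> (M.pbw a)) (lincomb b)"
      by (intro below_sum below_sc_mult leads_below[OF lead less]) auto
  qed
  then have "leads (\<Phi> p) (lincomb b)"
    unfolding \<Phi>p sumB' using sum.remove[OF fB'(1) b(1), of "\<lambda>a. sc (c a) * \<Phi> (M.pbw a)"] by simp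
  then show ?thesis using b(1) fB'(2) by blast
qed

lemma bounded_exists: "\<exists>m. p \<in> bounded m"
proof -
  have "\<forall>w\<in>Poly_Mapping.keys p. length (letters w) \<le> Max ((\<lambda>w. length (letters w)) ` Poly_Mapping.keys p)"
    by simp
  then show ?thesis unfolding bounded_def by blast
qed

lemma leads_not_J: "p \<notin> J \<Longrightarrow> \<exists>g. leads (\<Phi> p) g"
  using bounded_exists leads_bounded by metis

lemma leads_imp_not_J: "leads (\<Phi> p) g \<Longrightarrow> p \<notin> J"
  using \<Phi>_J leads_nonzero by blast

text \<open>Independent of the representative because congruent polynomials have the same image
  under \<open>\<Phi>\<close>. On the zero class the choice is arbitrary.\<close>

definition \<nu> :: "'k uq_free set \<Rightarrow> expo"
  where "\<nu> u = (SOME g. \<exists>p. cls p = u \<and> leads (\<Phi> p) g)"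

lemma \<nu>_cls:
  assumes "leads (\<Phi> p) g"
  shows "\<nu> (cls p) = g"
  unfolding \<nu>_def
proof (rule some_equality)
  show "\<exists>r. cls r = cls p \<and> leads (\<Phi> r) g" using assms by blast
  fix h assume "\<exists>r. cls r = cls p \<and> leads (\<Phi> r) h"
  then obtain r where r: "cls r = cls p" "leads (\<Phi> r) h" by blast
  have "\<Phi> (r - p) = 0" using r(1) \<Phi>_J unfolding cls_eq_iff by blast
  then have "\<Phi> r = \<Phi> p" by (simp add: \<Phi>_simps)
  then show "h = g" using r(2) assms leads_unique by metis
qed

lemma nonzero_cls:
  assumes "u \<in> carrier U - {\<zero>\<^bsub>U\<^esub>}"
  obtains p g where "u = cls p" "p \<notin> J" "leads (\<Phi> p) g" "\<nu> u = g"
proof -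
  obtain p where p: "u = cls p" using cls_surj assms by blast
  then have "p \<notin> J" using assms cls_zero_iff by blast
  then obtain g where "leads (\<Phi> p) g" using leads_not_J by blast
  then show ?thesis using that p \<open>p \<notin> J\<close> \<nu>_cls by blast
qed

abbreviation scalars where "scalars \<equiv> presented_scalars (uq_gens n) (uq_relators n q)"

lemma one_not_J: "1 \<notin> J"
  by (rule leads_imp_not_J[of _ 0]) (simp only: \<Phi>_simps leads_one)

lemma const_not_J: "fa_const c \<in> J \<longleftrightarrow> c = 0"
  using leads_imp_not_J[of "fa_const c"] leads_sc_mult[OF leads_one, of c] J_ideal(1)
  by (auto simp: \<Phi>_simps fa.sca_zero)

lemma valuation: "valuation_algebra U scalars \<nu>"
proof (intro valuation_algebra.intro valuation_algebra_axioms.intro)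
  show "ring U" by (rule U_ring)
  interpret ring U by (rule U_ring)
  show "subfield scalars U" by (rule scalars_subfield[OF one_not_J])
  show "k \<otimes>\<^bsub>U\<^esub> x = x \<otimes>\<^bsub>U\<^esub> k" if "k \<in> scalars" "x \<in> carrier U" for k x
    using that cls_surj[of x] cls_const_central by (auto simp: scalars_eq)
next
  fix x y assume x: "x \<in> carrier U - {\<zero>\<^bsub>U\<^esub>}" and y: "y \<in> carrier U - {\<zero>\<^bsub>U\<^esub>}"
  obtain p g where p: "x = cls p" "p \<notin> J" "leads (\<Phi> p) g" "\<nu> x = g" by (rule nonzero_cls[OF x])
  obtain r h where r: "y = cls r" "r \<notin> J" "leads (\<Phi> r) h" "\<nu> y = h" by (rule nonzero_cls[OF y])
  have m: "leads (\<Phi> (p * r)) (g + h)" using leads_mult[OF p(3) r(3)] by (simp add: \<Phi>_simps)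
  have xy: "x \<otimes>\<^bsub>U\<^esub> y = cls (p * r)" by (simp add: p r cls_hom)
  show "x \<otimes>\<^bsub>U\<^esub> y \<noteq> \<zero>\<^bsub>U\<^esub>" unfolding xy cls_zero_iff by (rule leads_imp_not_J[OF m])
  show "\<nu> (x \<otimes>\<^bsub>U\<^esub> y) = \<nu> x + \<nu> y" unfolding xy using \<nu>_cls[OF m] p r by simp
  show "\<nu> (x \<oplus>\<^bsub>U\<^esub> y) \<le> max (\<nu> x) (\<nu> y)" if "x \<oplus>\<^bsub>U\<^esub> y \<noteq> \<zero>\<^bsub>U\<^esub>"
  proof -
    have s: "x \<oplus>\<^bsub>U\<^esub> y = cls (p + r)" by (simp add: p r cls_hom)
    then have "p + r \<notin> J" using that cls_zero_iff by simp
    then obtain k where k: "leads (\<Phi> (p + r)) k" using leads_not_J by blast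
    then have "k \<in> supp (\<Phi> p + \<Phi> r)" by (simp add: leads_def supp_def \<Phi>_simps)
    then have "k \<in> supp (\<Phi> p) \<union> supp (\<Phi> r)" using supp_add by blast
    then have "k \<le> max g h" using p(3) r(3) unfolding leads_def by (auto simp: le_max_iff_disj)
    then show ?thesis unfolding s using \<nu>_cls[OF k] p r by simp
  qed
  show "\<exists>k\<in>scalars. x \<ominus>\<^bsub>U\<^esub> k \<otimes>\<^bsub>U\<^esub> y = \<zero>\<^bsub>U\<^esub> \<or> \<nu> (x \<ominus>\<^bsub>U\<^esub> k \<otimes>\<^bsub>U\<^esub> y) < \<nu> y" if "\<nu> x = \<nu> y"
  proof -
    have gh: "g = h" using that p r by simp
    \<comment> \<open>The quotient of the leading coefficients, so that the top terms
      cancel.\<close>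
    define c where "c = coef (\<Phi> p) g / coef (\<Phi> r) g"
    have s: "x \<ominus>\<^bsub>U\<^esub> cls (fa_const c) \<otimes>\<^bsub>U\<^esub> y = cls (p - fa_const c * r)" by (simp add: p r cls_hom cls_diff)
    have "\<nu> (cls (p - fa_const c * r)) < g" if nJ: "p - fa_const c * r \<notin> J"
    proof -
      obtain k where k: "leads (\<Phi> (p - fa_const c * r)) k" using leads_not_J[OF nJ] by blast
      have e: "coef (\<Phi> (p - fa_const c * r)) l = coef (\<Phi> p) l - c * coef (\<Phi> r) l" for l
        by (simp add: \<Phi>_simps)
      have "coef (\<Phi> r) g \<noteq> 0" using r(3) gh by (simp add: leads_def)
      then have "coef (\<Phi> (p - fa_const c * r)) g = 0" unfolding e by (simp add: c_def)
      then have "k \<noteq> g" using k by (auto simp: leads_def)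
      moreover have "k \<le> g"
      proof -
        have "coef (\<Phi> p) k \<noteq> 0 \<or> coef (\<Phi> r) k \<noteq> 0" using k e[of k] by (auto simp: leads_def)
        then show ?thesis using p(3) r(3) gh unfolding leads_def supp_def by auto
      qed
      ultimately show ?thesis using \<nu>_cls[OF k] by simp
    qed
    then have "x \<ominus>\<^bsub>U\<^esub> cls (fa_const c) \<otimes>\<^bsub>U\<^esub> y = \<zero>\<^bsub>U\<^esub> \<or> \<nu> (x \<ominus>\<^bsub>U\<^esub> cls (fa_const c) \<otimes>\<^bsub>U\<^esub> y) < \<nu> y"
      unfolding s cls_zero_iff using r(4) gh by auto
    then show ?thesis unfolding scalars_eq by blast
  qed
next
  fix k x assume k: "k \<in> scalars - {\<zero>\<^bsub>U\<^esub>}" and x: "x \<in> carrier U - {\<zero>\<^bsub>U\<^esub>}"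
  obtain p g where p: "x = cls p" "p \<notin> J" "leads (\<Phi> p) g" "\<nu> x = g" by (rule nonzero_cls[OF x])
  obtain c where c: "k = cls (fa_const c)" using k unfolding scalars_eq by blast
  then have "fa_const c \<notin> J" using k cls_zero_iff by blast
  then have c0: "c \<noteq> 0" using const_not_J by blast
  have "leads (\<Phi> (fa_const c * p)) g" using leads_sc_mult[OF p(3) c0] by (simp add: \<Phi>_simps)
  from \<nu>_cls[OF this] show "\<nu> (k \<otimes>\<^bsub>U\<^esub> x) = \<nu> x" using p c by (simp add: cls_hom)
qed

text \<open>Inverse of \<open>lincomb\<close> on functions supported in \<open>idx\<close>; all
  values of \<open>\<nu>\<close> on nonzero classes are such combinations.\<close>

definition coord :: "expo \<Rightarrow> nat \<times> nat \<Rightarrow> int"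
  where "coord = the_inv_into {a. \<forall>p. p \<notin> idx \<longrightarrow> a p = 0} lincomb"

lemma coord_lincomb: "\<forall>p. p \<notin> idx \<longrightarrow> a p = 0 \<Longrightarrow> coord (lincomb a) = a"
  unfolding coord_def by (rule the_inv_into_f_f[OF lincomb_inj_exps]) simp

lemma slot_one:
  assumes "p \<in> idx"
  shows "leads (\<Phi> (M.slot p 1)) (gen_exp p)"
  using leads_slot[of p 1] assms by simp

lemma lincomb_upd:
  assumes "p \<in> idx"
  shows "gen_exp p + lincomb a = lincomb (a(p := a p + 1))"
proof -
  have fin: "finite idx" by simp
  have "(\<Sum>r\<in>idx - {p}. frag_cmul ((a(p := a p + 1)) r) (gen_exp r)) = (\<Sum>r\<in>idx - {p}. frag_cmul (a r) (gen_exp r))"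
    by (intro sum.cong) auto
  moreover have "frag_cmul (a p + 1) (gen_exp p) = gen_exp p + frag_cmul (a p) (gen_exp p)"
    by (rule poly_mapping_eqI) (simp add: lookup_add distrib_right)
  ultimately show ?thesis
    unfolding lincomb_def sum.remove[OF fin assms] by (simp add: add.assoc)
qed

text \<open>The distinguished elements are the root vectors and the \<open>K j\<close>, that is
  every slot with exponent 1; their leading exponents are the lattice basis. The filtration is by
  word length and its coordinate bound is \<open>leads_bounded\<close>.\<close>

lemma filtered: "filtered_valuation_algebra U scalars \<nu> (\<lambda>m. cls ` bounded m) idx coord
  (\<lambda>p. cls (M.slot p 1)) (cls ` fa_var ` uq_gens n)"
proof -
  interpret V: valuation_algebra U scalars \<nu> by (rule valuation)
  have vals: "\<exists>a\<in>exps m. g = lincomb a" if g: "g \<in> V.vals (cls ` bounded m)" for g m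
  proof -
    obtain p where p: "p \<in> bounded m" "cls p \<noteq> \<zero>\<^bsub>U\<^esub>" "g = \<nu> (cls p)" using g unfolding V.vals_def by blast
    then have "p \<notin> J" using cls_zero_iff by simp
    from leads_bounded[OF p(1) this] show ?thesis using p(3) \<nu>_cls by blast
  qed
  have exhaust: "\<exists>m. u \<in> cls ` bounded m" if "u \<in> carrier U" for u
    using cls_surj[OF that] bounded_exists by (metis imageI)
  have vals': "\<exists>m. \<exists>a\<in>exps m. g = lincomb a" if g: "g \<in> V.vals (carrier U)" for g
  proof -
    obtain u where u: "u \<in> carrier U" "u \<noteq> \<zero>\<^bsub>U\<^esub>" "g = \<nu> u" using g unfolding V.vals_def by blast
    obtain m where "u \<in> cls ` bounded m" using exhaust[OF u(1)] by blast
    then have "g \<in> V.vals (cls ` bounded m)" using u by (auto simp: V.vals_def)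
    then show ?thesis using vals by blast
  qed
  have bounded_simps: "0 \<in> bounded m" "p \<in> bounded m \<Longrightarrow> r \<in> bounded m \<Longrightarrow> p + r \<in> bounded m"
    "p \<in> bounded l \<Longrightarrow> r \<in> bounded m \<Longrightarrow> p * r \<in> bounded (l + m)" "fa_const c \<in> bounded m" for p r l m c
  proof -
    show "0 \<in> bounded m" by (simp add: bounded_def)
    show "p + r \<in> bounded m" if "p \<in> bounded m" "r \<in> bounded m"
      using that Poly_Mapping.keys_add[of p r] unfolding bounded_def by blast
    show "fa_const c \<in> bounded m" by (simp add: bounded_def fa_const_def zero_free_monoid_def)
    show "p * r \<in> bounded (l + m)" if "p \<in> bounded l" "r \<in> bounded m"
      unfolding bounded_def
    proof (intro CollectI ballI)
      fix w assume "w \<in> Poly_Mapping.keys (p * r)"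
      then obtain u v where "u \<in> Poly_Mapping.keys p" "v \<in> Poly_Mapping.keys r" "w = u + v"
        using Poly_Mapping.keys_mult[of p r] by blast
      then show "length (letters w) \<le> l + m"
        using that by (auto simp: bounded_def plus_free_monoid_def intro: add_mono)
    qed
  qed
  show ?thesis
  proof (intro filtered_valuation_algebra.intro valuation filtered_valuation_algebra_axioms.intro)
    fix m
    show "subalgebra scalars (cls ` bounded m) U"
    proof (rule V.subalgebraI)
      show "cls ` bounded m \<subseteq> carrier U" using cls_hom(4) by blast
      show "\<zero>\<^bsub>U\<^esub> \<in> cls ` bounded m" using cls_zero_iff[of 0] J_ideal(1) bounded_simps(1) by (metis imageI)
      show "x \<oplus>\<^bsub>U\<^esub> y \<in> cls ` bounded m" if "x \<in> cls ` bounded m" "y \<in> cls ` bounded m" for x y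
        using that bounded_simps(2) by (auto simp flip: cls_hom)
      show "k \<otimes>\<^bsub>U\<^esub> x \<in> cls ` bounded m" if "k \<in> scalars" "x \<in> cls ` bounded m" for k x
        using that bounded_simps(3)[OF bounded_simps(4)[of _ 0], of _ m] by (auto simp: scalars_eq simp flip: cls_hom)
    qed
    show "a \<otimes>\<^bsub>U\<^esub> b \<in> cls ` bounded (l + m)" if "a \<in> cls ` bounded l" "b \<in> cls ` bounded m" for a b l
      using that bounded_simps(3) by (auto simp flip: cls_hom)
    show "cls ` bounded l \<subseteq> cls ` bounded m" if "l \<le> m" for l
      using that by (intro image_mono) (force simp: bounded_def)
    show "scalars \<subseteq> cls ` bounded 0" using bounded_simps(4) by (auto simp: scalars_eq)
    show "\<bar>coord g i\<bar> \<le> int m" if g: "g \<in> V.vals (cls ` bounded m)" "i \<in> idx" for g i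
    proof -
      obtain a where a: "a \<in> exps m" "g = lincomb a" using vals[OF g(1)] by blast
      then have "coord g = a" using coord_lincomb unfolding exps_def by blast
      then show ?thesis using a(1) by (cases i) (simp add: exps_def M.pbw_exps_def)
    qed
  next
    show "\<exists>m. a \<in> cls ` bounded m" if "a \<in> carrier U" for a using exhaust[OF that] .
    show "finite idx" "idx \<noteq> {}" using n_pos by auto
    show "cls (M.slot i 1) \<in> carrier U - {\<zero>\<^bsub>U\<^esub>}" if "i \<in> idx" for i
      using leads_imp_not_J[OF slot_one[OF that]] cls_hom(4) cls_zero_iff by auto
    show "inj_on coord (V.vals (carrier U))"
    proof (rule inj_onI)
      fix g h assume "g \<in> V.vals (carrier U)" "h \<in> V.vals (carrier U)" "coord g = coord h"
      then show "g = h" using vals'[of g] vals'[of h] coord_lincomb by (auto simp: exps_def)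
    qed
    show "coord g i = 0" if g: "g \<in> V.vals (carrier U)" "i \<notin> idx" for g i
    proof -
      obtain m a where a: "a \<in> exps m" "g = lincomb a" using vals'[OF g(1)] by blast
      then have "coord g = a" using coord_lincomb unfolding exps_def by blast
      then show ?thesis using a(1) g(2) unfolding exps_def by blast
    qed
    show "coord (\<nu> (cls (M.slot i 1)) + g) = (coord g)(i := coord g i + 1)"
      if g: "g \<in> V.vals (carrier U)" "i \<in> idx" for g i
    proof -
      obtain m a where a: "a \<in> exps m" "g = lincomb a" using vals'[OF g(1)] by blast
      then have z: "\<forall>p. p \<notin> idx \<longrightarrow> a p = 0" by (simp add: exps_def)
      have "\<nu> (cls (M.slot i 1)) + g = lincomb (a(i := a i + 1))"
        using \<nu>_cls[OF slot_one[OF g(2)]] lincomb_upd[OF g(2)] a(2) by simp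
      moreover have "coord (lincomb (a(i := a i + 1))) = a(i := a i + 1)"
        using z g(2) by (intro coord_lincomb) auto
      ultimately show ?thesis using coord_lincomb[OF z] a(2) by simp
    qed
    show "finite (cls ` fa_var ` uq_gens n)" by (simp add: uq_gens_def)
    show "cls ` fa_var ` uq_gens n \<subseteq> carrier U" using cls_hom(4) by blast
    show "generate_ring U (scalars \<union> cls ` fa_var ` uq_gens n) = carrier U"
    proof
      let ?H = "scalars \<union> cls ` fa_var ` uq_gens n"
      show "generate_ring U ?H \<subseteq> carrier U"
        using cls_hom(4) by (intro V.generate_ring_incl) (auto simp: scalars_eq)
      have const: "cls (fa_const c) \<in> generate_ring U ?H" for c
        by (rule generate_ring.incl) (simp add: scalars_eq)
      have var: "cls (fa_var x) \<in> generate_ring U ?H" for x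
      proof (cases "x \<in> uq_gens n")
        case True
        then show ?thesis by (intro generate_ring.incl) simp
      next
        case False
        then have "fa_var x \<in> J" unfolding fa_var_def by (intro missing_letter) simp
        then show ?thesis using cls_zero_iff V.zero_in_generate by metis
      qed
      have words: "cls (prod_list (map fa_var xs)) \<in> generate_ring U ?H" for xs
      proof (induction xs)
        case Nil
        then show ?case using generate_ring.one by (simp add: cls_hom)
      next
        case (Cons x xs)
        then show ?case using var by (simp add: cls_hom generate_ring.eng_mult)
      qed
      have "cls p \<in> generate_ring U ?H" for p
      proof (induction p rule: poly_mapping_induct_single)
        case 1
        then show ?case using cls_zero_iff[of 0] J_ideal(1) V.zero_in_generate by metis
      next
        case (2 w c p)
        have "cls (Poly_Mapping.single w c) \<in> generate_ring U ?H"
          unfolding single_word[of w c] cls_hom(2) by (intro generate_ring.eng_mult const words)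
        then show ?case unfolding cls_hom(1) using 2 by (intro generate_ring.eng_add)
      qed
      then show "carrier U \<subseteq> generate_ring U ?H" using cls_surj by blast
    qed
  qed
qed

end

theorem theorem5p17:
  fixes n :: nat
    and q :: "'k :: {alg_closed_field, field_char_0}"
  assumes "n \<ge> 1"
    and "q \<noteq> 0"
    and "\<forall>m::nat. m \<ge> 1 \<longrightarrow> q ^ m \<noteq> 1"
  shows "ring.LD_stable (Uq_gl n q) (Uq_gl_scalars n q) \<and>
    ring.GK (Uq_gl n q) (Uq_gl_scalars n q) = ereal (real (n\<^sup>2))"
proof -
  \<comment> \<open>\<open>q - inverse q\<close> is the denominator in the commutator relation, and
    \<open>q + inverse q\<close> has to be cancelled in \<open>middle_commutes\<close>.\<close>
  have "q - inverse q \<noteq> 0"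
  proof
    assume "q - inverse q = 0"
    then have "q ^ 2 = 1" using assms(2) by (simp add: field_simps power2_eq_square)
    then show False using assms(3) by auto
  qed
  moreover have "q + inverse q \<noteq> 0"
  proof
    assume "q + inverse q = 0"
    then have "q ^ 2 = - 1" using assms(2) by (simp add: field_simps power2_eq_square eq_neg_iff_add_eq_0)
    then have "(q ^ 2) ^ 2 = 1" by simp
    then have "q ^ 4 = 1" by (simp flip: power_mult)
    then show False using assms(3) by auto
  qed
  ultimately interpret gl_algebra n q
    using assms by unfold_locales auto
  interpret filtered_valuation_algebra U scalars \<nu> "\<lambda>m. cls ` bounded m" idx coord
    "\<lambda>p. cls (M.slot p 1)" "cls ` fa_var ` uq_gens n"
    by (rule filtered)
  \<comment> \<open>The lattice basis is indexed by an \<open>n\<close> by \<open>n\<close> square,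
    whose cardinality is the dimension.\<close>
  show ?thesis
    using LD_stable_GK by (simp add: Uq_gl_def Uq_gl_scalars_def power2_eq_square)
qed

end
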